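(* Let $A$ be the preprojective algebra of a connected finite graph $\Delta$ distinct from $\mathrm{A}_1$ and $\mathrm{A}_2$, over a field $\mathbb{F}$, and let $K(A)$ be the Koszul bimodule complex of $A$. Then the $A$-bimodule $\mathrm{HK}^p(A,A^e)$ is isomorphic to the $A$-bimodule $H_{2-p}(K(A))$ for $0\leq p\leq 2$. In particular: (i) The $A$-bimodule $\mathrm{HK}^2(A,A^e)$ is isomorphic to the $A$-bimodule $A$. (ii) $\mathrm{HK}^1(A,A^e)=0$. (iii) The $A$-bimodule $\mathrm{HK}^0(A,A^e)$ is isomorphic to the $A$-bimodule $H_2(K(A))$, which is always non-zero when $\Delta$ is Dynkin of type $\mathrm{ADE}$.
   Context: Preprojective algebra. $\Delta$ is a connected graph with finite vertex and edge sets (loops and multiple edges allowed, no labels). $\mathrm{A}_1$ is one vertex without edge; $\mathrm{A}_2$ is two vertices joined by one edge. Let $Q$ be a quiver with underlying graph $\Delta$; $\mathfrak{s},\mathfrak{t}$ denote source and target. For each $a\in Q_1$ add an arrow $a^*$ with $\mathfrak{s}(a^* )=\mathfrak{t}(a)$, $\mathfrak{t}(a^* )=\mathfrak{s}(a)$, giving the double quiver $\overline{Q}$ with $\overline{Q}_0=Q_0$, $\overline{Q}_1=Q_1\sqcup Q_1^*$; $(-)^*$ is regarded as an involution of $\overline{Q}_1$. Put $\varepsilon(a)=1$ if $a\in Q_1$ and $\varepsilon(a)=-1$ if $a\in Q_1^*$. Paths are written from right to left. Let $k=\mathbb{F}Q_0$ with orthogonal idempotents $e_i$ ($i\in Q_0$),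 $V=\mathbb{F}\overline{Q}_1$ (a $k$-bimodule with $e_jae_i=a$ if $i=\mathfrak{s}(a)$, $j=\mathfrak{t}(a)$, and $0$ otherwise), so that $T_k(V)\cong\mathbb{F}\overline{Q}$. Let $R\subseteq V\otimes_kV$ be spanned by $\sigma_i=\sum_{a\in\overline{Q}_1,\ \mathfrak{t}(a)=i}\varepsilon(a)aa^*$, $i\in Q_0$. Then $A=T_k(V)/(R)$. Koszul complex and cohomology. $\otimes=\otimes_{\mathbb{F}}$, $A^e=A\otimes A^{op}$, $k^e=k\otimes k$. Put $W_0=k$, $W_1=V$, $W_p=\bigcap_{i+2+j=p}V^{\otimes_k i}\otimes_kR\otimes_kV^{\otimes_k j}$ for $p\geq2$; elements of $W_p$ are written $x_1\ldots x_p$ (a sum is understood). $K(A)$ is the complex of $A$-bimodules $K(A)_p=A\otimes_kW_p\otimes_kA$ with $d(a\otimes_k x_1\ldots x_p\otimes_k a')=ax_1\otimes_k x_2\ldots x_p\otimes_k a'+(-1)^pa\otimes_k x_1\ldots x_{p-1}\otimes_k x_pa'$. For an $A$-bimodule $M$, $\mathrm{HK}^\bullet(A,M)=H^\bullet(\mathrm{Hom}_{A^e}(K(A),M))\cong H^\bullet(\mathrm{Hom}_{k^e}(W_\bullet,M),b_K)$ where, for $f:W_p\to M$, $b_K(f)(x_1\ldots x_{p+1})=f(x_1\ldots x_p)x_{p+1}-(-1)^px_1f(x_2\ldots x_{p+1})$. Bimodule structure. In $\mathrm{HK}^p(A,A^e)$ the coefficients $A^e$ are viewed as a left $A^e$-module,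 i.e. as $A\otimes A$ with the outer $A$-bimodule structure $a\cdot(\alpha\otimes\beta)\cdot b=a\alpha\otimes\beta b$. The right $A^e$-module structure of $A^e$, $(\alpha\otimes\beta).(a\otimes b)=\alpha a\otimes b\beta$ (inner structure), commutes with the outer one and, acting on values of cochains, makes $\mathrm{HK}^p(A,A^e)$ a right $A^e$-module, i.e. an $A$-bimodule. *)

theory Defs
  imports "HOL-Algebra.Algebra" "HOL-Algebra.Free_Abelian_Groups" "Graph_Theory.Arc_Walk"
begin

section \<open>Graphs\<close>

text \<open>Loops and multiple edges are allowed; an edge with a single end is a loop.\<close>

record ('v, 'e) mgraph =
  vertices :: "'v set"
  edges :: "'e set"
  ends :: "'e \<Rightarrow> 'v set"

definition finite_graph :: "('v, 'e) mgraph \<Rightarrow> bool" where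
  "finite_graph \<Delta> \<longleftrightarrow> finite (vertices \<Delta>) \<and> finite (edges \<Delta>) \<and>
     (\<forall>e\<in>edges \<Delta>. ends \<Delta> e \<subseteq> vertices \<Delta> \<and> card (ends \<Delta> e) \<in> {1, 2})"

definition adjacency :: "('v, 'e) mgraph \<Rightarrow> ('v \<times> 'v) set" where
  "adjacency \<Delta> = {(u, v). \<exists>e\<in>edges \<Delta>. ends \<Delta> e = {u, v}}"

definition connected_graph :: "('v, 'e) mgraph \<Rightarrow> bool" where
  "connected_graph \<Delta> \<longleftrightarrow> vertices \<Delta> \<noteq> {} \<and>
     (\<forall>u\<in>vertices \<Delta>. \<forall>v\<in>vertices \<Delta>. (u, v) \<in> (adjacency \<Delta>)\<^sup>*)"

definition graph_iso :: "('v, 'e) mgraph \<Rightarrow> ('w, 'd) mgraph \<Rightarrow> bool" where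
  "graph_iso \<Delta> \<Gamma> \<longleftrightarrow> (\<exists>f g. bij_betw f (vertices \<Delta>) (vertices \<Gamma>) \<and>
     bij_betw g (edges \<Delta>) (edges \<Gamma>) \<and> (\<forall>e\<in>edges \<Delta>. ends \<Gamma> (g e) = f ` ends \<Delta> e))"

definition simple_graph :: "nat \<Rightarrow> nat set set \<Rightarrow> (nat, nat set) mgraph" where
  "simple_graph n E = \<lparr>vertices = {..<n}, edges = E, ends = id\<rparr>"

definition chain :: "nat \<Rightarrow> nat set set" where
  "chain n = {{i, Suc i} | i. Suc i < n}"

definition type_A :: "nat \<Rightarrow> (nat, nat set) mgraph" where
  "type_A n = simple_graph n (chain n)"

text \<open>In types D and E the vertices \<open>0, \<dots>, n - 2\<close> form a chain, and the last vertex
  \<open>n - 1\<close> is attached to the branching vertex.\<close>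

definition type_D :: "nat \<Rightarrow> (nat, nat set) mgraph" where
  "type_D n = simple_graph n (insert {n - 3, n - 1} (chain (n - 1)))"

definition type_E :: "nat \<Rightarrow> (nat, nat set) mgraph" where
  "type_E n = simple_graph n (insert {2, n - 1} (chain (n - 1)))"

definition dynkin_ADE :: "('v, 'e) mgraph \<Rightarrow> bool" where
  "dynkin_ADE \<Delta> \<longleftrightarrow> (\<exists>n\<ge>1. graph_iso \<Delta> (type_A n)) \<or> (\<exists>n\<ge>4. graph_iso \<Delta> (type_D n)) \<or>
     (\<exists>n\<in>{6, 7, 8}. graph_iso \<Delta> (type_E n))"

definition has_underlying_graph :: "('v, 'e) pre_digraph \<Rightarrow> ('v, 'e) mgraph \<Rightarrow> bool" where
  "has_underlying_graph Q \<Delta> \<longleftrightarrow> wf_digraph Q \<and> verts Q = vertices \<Delta> \<and> arcs Q = edges \<Delta> \<and>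
     (\<forall>a\<in>arcs Q. ends \<Delta> a = {tail Q a, head Q a})"


section \<open>Bimodules\<close>

text \<open>As for the library record \<^type>\<open>module\<close>, the fields \<open>mult\<close> and \<open>one\<close> of a bimodule
  carry no meaning; \<open>smult\<close> is the left action.\<close>

record ('l, 'm, 'r) bimodule = "('l, 'm) module" +
  ract :: "'m \<Rightarrow> 'r \<Rightarrow> 'm"

text \<open>A ring as a bimodule, where scalars act by multiplication through two maps into it.\<close>

definition ring_bimodule ::
  "('l \<Rightarrow> 'm) \<Rightarrow> ('r \<Rightarrow> 'm) \<Rightarrow> ('m, 'z) ring_scheme \<Rightarrow> ('l, 'm, 'r) bimodule" where
  "ring_bimodule \<phi> \<psi> A = \<lparr>carrier = carrier A, monoid.mult = undefined, monoid.one = undefined,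
     ring.zero = \<zero>\<^bsub>A\<^esub>, ring.add = ring.add A, smult = (\<lambda>l m. \<phi> l \<otimes>\<^bsub>A\<^esub> m), ract = (\<lambda>m r. m \<otimes>\<^bsub>A\<^esub> \<psi> r)\<rparr>"

abbreviation regular_bimodule :: "('m, 'z) ring_scheme \<Rightarrow> ('m, 'm, 'm) bimodule" where
  "regular_bimodule \<equiv> ring_bimodule id id"

definition additive_maps ::
  "('l, 'm, 'r) bimodule \<Rightarrow> ('l', 'n, 'r') bimodule \<Rightarrow> ('m \<Rightarrow> 'n) set" where
  "additive_maps M N = {f \<in> carrier M \<rightarrow>\<^sub>E carrier N.
     \<forall>x\<in>carrier M. \<forall>y\<in>carrier M. f (x \<oplus>\<^bsub>M\<^esub> y) = f x \<oplus>\<^bsub>N\<^esub> f y}"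

definition bimodule_homs :: "('a, 'z) ring_scheme \<Rightarrow> ('a, 'm, 'a) bimodule \<Rightarrow>
    ('a, 'n, 'a) bimodule \<Rightarrow> ('m \<Rightarrow> 'n) set" where
  "bimodule_homs A M N = {f \<in> additive_maps M N. \<forall>a\<in>carrier A. \<forall>x\<in>carrier M.
     f (a \<odot>\<^bsub>M\<^esub> x) = a \<odot>\<^bsub>N\<^esub> f x \<and> f (ract M x a) = ract N (f x) a}"

definition bimodule_iso :: "('a, 'z) ring_scheme \<Rightarrow> ('a, 'm, 'a) bimodule \<Rightarrow>
    ('a, 'n, 'a) bimodule \<Rightarrow> bool" where
  "bimodule_iso A M N \<longleftrightarrow> (\<exists>f\<in>bimodule_homs A M N. bij_betw f (carrier M) (carrier N))"

text \<open>The subquotient \<open>Z / B\<close> of \<open>M\<close>, for subbimodules \<open>B \<subseteq> Z\<close> of \<open>M\<close>.\<close>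

definition subquotient ::
  "('l, 'm, 'r) bimodule \<Rightarrow> 'm set \<Rightarrow> 'm set \<Rightarrow> ('l, 'm set, 'r) bimodule" where
  "subquotient M Z B = \<lparr>carrier = {B +>\<^bsub>M\<^esub> z | z. z \<in> Z}, monoid.mult = undefined, monoid.one = undefined,
     ring.zero = B, ring.add = set_add M,
     smult = (\<lambda>l S. \<Union>x\<in>S. B +>\<^bsub>M\<^esub> (l \<odot>\<^bsub>M\<^esub> x)),
     ract = (\<lambda>S r. \<Union>x\<in>S. B +>\<^bsub>M\<^esub> (ract M x r))\<rparr>"


section \<open>Tensor products\<close>

text \<open>For a ring with carrier \<open>B\<close>, acting on the right of \<open>M\<close> and on the left of \<open>N\<close>, the
  tensor product of \<open>M\<close> and \<open>N\<close> over \<open>B\<close> is the free abelian group on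
  \<open>carrier M \<times> carrier N\<close> modulo the subgroup generated by the usual relations.\<close>

definition tensor_rels :: "'b set \<Rightarrow> ('l, 'm, 'b) bimodule \<Rightarrow> ('b, 'n, 'r) bimodule \<Rightarrow>
    ('m \<times> 'n \<Rightarrow>\<^sub>0 int) set" where
  "tensor_rels B M N =
     {frag_of (x \<oplus>\<^bsub>M\<^esub> x', y) - frag_of (x, y) - frag_of (x', y) | x x' y.
        x \<in> carrier M \<and> x' \<in> carrier M \<and> y \<in> carrier N} \<union>
     {frag_of (x, y \<oplus>\<^bsub>N\<^esub> y') - frag_of (x, y) - frag_of (x, y') | x y y'.
        x \<in> carrier M \<and> y \<in> carrier N \<and> y' \<in> carrier N} \<union>
     {frag_of (ract M x b, y) - frag_of (x, b \<odot>\<^bsub>N\<^esub> y) | x b y.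
        x \<in> carrier M \<and> b \<in> B \<and> y \<in> carrier N}"

abbreviation tensor_free :: "('l, 'm, 'b) bimodule \<Rightarrow> ('b, 'n, 'r) bimodule \<Rightarrow>
    ('m \<times> 'n \<Rightarrow>\<^sub>0 int) monoid" where
  "tensor_free M N \<equiv> free_Abelian_group (carrier M \<times> carrier N)"

definition tensor_null :: "'b set \<Rightarrow> ('l, 'm, 'b) bimodule \<Rightarrow> ('b, 'n, 'r) bimodule \<Rightarrow>
    ('m \<times> 'n \<Rightarrow>\<^sub>0 int) set" where
  "tensor_null B M N = generate (tensor_free M N) (tensor_rels B M N)"

definition tensor_class :: "'b set \<Rightarrow> ('l, 'm, 'b) bimodule \<Rightarrow> ('b, 'n, 'r) bimodule \<Rightarrow>
    ('m \<times> 'n \<Rightarrow>\<^sub>0 int) \<Rightarrow> ('m \<times> 'n \<Rightarrow>\<^sub>0 int) set" where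
  "tensor_class B M N c = tensor_null B M N #>\<^bsub>tensor_free M N\<^esub> c"

definition pure_tensor :: "'b set \<Rightarrow> ('l, 'm, 'b) bimodule \<Rightarrow> ('b, 'n, 'r) bimodule \<Rightarrow>
    'm \<Rightarrow> 'n \<Rightarrow> ('m \<times> 'n \<Rightarrow>\<^sub>0 int) set" where
  "pure_tensor B M N x y = tensor_class B M N (frag_of (x, y))"

text \<open>The additive endomorphism \<open>x \<otimes> y \<mapsto> \<phi> x \<otimes> \<psi> y\<close> of the tensor product.\<close>

definition tensor_map :: "'b set \<Rightarrow> ('l, 'm, 'b) bimodule \<Rightarrow> ('b, 'n, 'r) bimodule \<Rightarrow>
    ('m \<Rightarrow> 'm) \<Rightarrow> ('n \<Rightarrow> 'n) \<Rightarrow> ('m \<times> 'n \<Rightarrow>\<^sub>0 int) set \<Rightarrow> ('m \<times> 'n \<Rightarrow>\<^sub>0 int) set" where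
  "tensor_map B M N \<phi> \<psi> S =
     (\<Union>c\<in>S. tensor_class B M N (frag_extend (\<lambda>(x, y). frag_of (\<phi> x, \<psi> y)) c))"

definition tensor :: "'b set \<Rightarrow> ('l, 'm, 'b) bimodule \<Rightarrow> ('b, 'n, 'r) bimodule \<Rightarrow>
    ('l, ('m \<times> 'n \<Rightarrow>\<^sub>0 int) set, 'r) bimodule" where
  "tensor B M N = (let G = tensor_free M N Mod tensor_null B M N in
     \<lparr>carrier = carrier G, monoid.mult = undefined, monoid.one = undefined,
      ring.zero = \<one>\<^bsub>G\<^esub>, ring.add = monoid.mult G,
      smult = (\<lambda>l. tensor_map B M N (\<lambda>x. l \<odot>\<^bsub>M\<^esub> x) id),
      ract = (\<lambda>S r. tensor_map B M N id (\<lambda>y. ract N y r) S)\<rparr>)"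


section \<open>The path algebra of the double quiver\<close>

text \<open>\<open>Inl a\<close> is the arrow \<open>a\<close> of \<open>Q\<close> and \<open>Inr a\<close> is the added arrow \<open>a\<^sup>*\<close>.\<close>

definition double_quiver :: "('v, 'e) pre_digraph \<Rightarrow> ('v, 'e + 'e) pre_digraph" where
  "double_quiver Q = \<lparr>verts = verts Q, arcs = arcs Q <+> arcs Q,
     tail = case_sum (tail Q) (head Q), head = case_sum (head Q) (tail Q)\<rparr>"

fun star :: "'e + 'e \<Rightarrow> 'e + 'e" where
  "star (Inl a) = Inr a"
| "star (Inr a) = Inl a"

fun eps :: "'e + 'e \<Rightarrow> 'f::field" where
  "eps (Inl a) = 1"
| "eps (Inr a) = - 1"

text \<open>The triple \<open>(j, p, i)\<close> is the path from \<open>i\<close> to \<open>j\<close> with arrows \<open>p\<close>, listed from right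
  to left: the first arrow to be traversed is the last element of \<open>p\<close>. In particular
  \<open>(i, [], i)\<close> is the trivial path at \<open>i\<close>.\<close>

type_synonym ('v, 'e) path = "'v \<times> ('e + 'e) list \<times> 'v"

type_synonym ('v, 'e, 'f) pelt = "('v, 'e) path \<Rightarrow>\<^sub>0 'f"

definition paths :: "('v, 'e) pre_digraph \<Rightarrow> ('v, 'e) path set" where
  "paths Q = {(j, p, i). pre_digraph.awalk (double_quiver Q) i (rev p) j}"

fun path_length :: "('v, 'e) path \<Rightarrow> nat" where
  "path_length (j, p, i) = length p"

fun path_mult :: "('v, 'e) path \<Rightarrow> ('v, 'e) path \<Rightarrow> ('v, 'e, 'f::field) pelt" where
  "path_mult (l, q, k) (j, p, i) = (if k = j then Poly_Mapping.single (l, q @ p, i) 1 else 0)"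

definition pscale :: "'f::field \<Rightarrow> ('v, 'e, 'f) pelt \<Rightarrow> ('v, 'e, 'f) pelt" where
  "pscale c = Poly_Mapping.map (\<lambda>x. c * x)"

definition idem :: "'v \<Rightarrow> ('v, 'e, 'f::field) pelt" where
  "idem i = Poly_Mapping.single (i, [], i) 1"

definition arrow :: "('v, 'e) pre_digraph \<Rightarrow> 'e + 'e \<Rightarrow> ('v, 'e, 'f::field) pelt" where
  "arrow Q a = Poly_Mapping.single (head (double_quiver Q) a, [a], tail (double_quiver Q) a) 1"

text \<open>The field is passed to the definitions as a type, in the form \<open>F :: 'f itself\<close>.\<close>

definition path_algebra ::
  "'f::field itself \<Rightarrow> ('v, 'e) pre_digraph \<Rightarrow> ('v, 'e, 'f) pelt ring" where
  "path_algebra F Q = \<lparr>carrier = {f. Poly_Mapping.keys f \<subseteq> paths Q},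
     monoid.mult = (\<lambda>f g. \<Sum>q\<in>Poly_Mapping.keys f. \<Sum>p\<in>Poly_Mapping.keys g.
       pscale (Poly_Mapping.lookup f q * Poly_Mapping.lookup g p) (path_mult q p)),
     monoid.one = (\<Sum>i\<in>verts Q. idem i), ring.zero = 0, ring.add = (+)\<rparr>"

text \<open>Through the identification of the tensor algebra \<open>T\<^sub>k(V)\<close> with the path algebra,
  the tensor power \<open>V\<^sup>p\<close> over \<open>k\<close> is spanned by the paths of length \<open>p\<close>. Thus \<open>V\<^sup>0 = k\<close>.\<close>

definition tensor_power ::
  "'f::field itself \<Rightarrow> ('v, 'e) pre_digraph \<Rightarrow> nat \<Rightarrow> ('v, 'e, 'f) pelt set" where
  "tensor_power F Q p = {f \<in> carrier (path_algebra F Q).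
     \<forall>r\<in>Poly_Mapping.keys f. path_length r = p}"

abbreviation vertex_ring ::
  "'f::field itself \<Rightarrow> ('v, 'e) pre_digraph \<Rightarrow> ('v, 'e, 'f) pelt set" where
  "vertex_ring F Q \<equiv> tensor_power F Q 0"

definition sigma :: "'f::field itself \<Rightarrow> ('v, 'e) pre_digraph \<Rightarrow> 'v \<Rightarrow> ('v, 'e, 'f) pelt" where
  "sigma F Q i = (\<Sum>a | a \<in> arcs (double_quiver Q) \<and> head (double_quiver Q) a = i.
     pscale (eps a) (arrow Q a \<otimes>\<^bsub>path_algebra F Q\<^esub> arrow Q (star a)))"

definition relations ::
  "'f::field itself \<Rightarrow> ('v, 'e) pre_digraph \<Rightarrow> ('v, 'e, 'f) pelt set" where
  "relations F Q = Modules.module.span pscale (sigma F Q ` verts Q)"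


section \<open>The preprojective algebra\<close>

definition rel_ideal ::
  "'f::field itself \<Rightarrow> ('v, 'e) pre_digraph \<Rightarrow> ('v, 'e, 'f) pelt set" where
  "rel_ideal F Q = genideal (path_algebra F Q) (relations F Q)"

type_synonym ('v, 'e, 'f) palg = "('v, 'e, 'f) pelt set"

definition preprojective ::
  "'f::field itself \<Rightarrow> ('v, 'e) pre_digraph \<Rightarrow> ('v, 'e, 'f) palg ring" where
  "preprojective F Q = path_algebra F Q Quot rel_ideal F Q"

definition proj ::
  "'f::field itself \<Rightarrow> ('v, 'e) pre_digraph \<Rightarrow> ('v, 'e, 'f) pelt \<Rightarrow> ('v, 'e, 'f) palg" where
  "proj F Q x = rel_ideal F Q +>\<^bsub>path_algebra F Q\<^esub> x"

definition field_map ::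
  "'f::field itself \<Rightarrow> ('v, 'e) pre_digraph \<Rightarrow> 'f \<Rightarrow> ('v, 'e, 'f) palg" where
  "field_map F Q c = proj F Q (pscale c \<one>\<^bsub>path_algebra F Q\<^esub>)"


section \<open>The Koszul bimodule complex\<close>

definition W :: "'f::field itself \<Rightarrow> ('v, 'e) pre_digraph \<Rightarrow> nat \<Rightarrow> ('v, 'e, 'f) pelt set" where
  "W F Q p = (if p < 2 then tensor_power F Q p
     else \<Inter>(i, j)\<in>{(i, j). i + 2 + j = p}. Modules.module.span pscale
       {v \<otimes>\<^bsub>path_algebra F Q\<^esub> r \<otimes>\<^bsub>path_algebra F Q\<^esub> w | v r w.
          v \<in> tensor_power F Q i \<and> r \<in> relations F Q \<and> w \<in> tensor_power F Q j})"

definition W_bimodule :: "'f::field itself \<Rightarrow> ('v, 'e) pre_digraph \<Rightarrow> nat \<Rightarrow>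
    (('v, 'e, 'f) pelt, ('v, 'e, 'f) pelt, ('v, 'e, 'f) pelt) bimodule" where
  "W_bimodule F Q p = (regular_bimodule (path_algebra F Q))\<lparr>carrier := W F Q p\<rparr>"

type_synonym ('v, 'e, 'f) AW = "(('v, 'e, 'f) palg \<times> ('v, 'e, 'f) pelt \<Rightarrow>\<^sub>0 int) set"

type_synonym ('v, 'e, 'f) AWA = "(('v, 'e, 'f) AW \<times> ('v, 'e, 'f) palg \<Rightarrow>\<^sub>0 int) set"

definition AW :: "'f::field itself \<Rightarrow> ('v, 'e) pre_digraph \<Rightarrow> nat \<Rightarrow>
    (('v, 'e, 'f) palg, ('v, 'e, 'f) AW, ('v, 'e, 'f) pelt) bimodule" where
  "AW F Q p = tensor (vertex_ring F Q)
     (ring_bimodule id (proj F Q) (preprojective F Q)) (W_bimodule F Q p)"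

definition koszul :: "'f::field itself \<Rightarrow> ('v, 'e) pre_digraph \<Rightarrow> nat \<Rightarrow>
    (('v, 'e, 'f) palg, ('v, 'e, 'f) AWA, ('v, 'e, 'f) palg) bimodule" where
  "koszul F Q p = tensor (vertex_ring F Q)
     (AW F Q p) (ring_bimodule (proj F Q) id (preprojective F Q))"

definition ktensor :: "'f::field itself \<Rightarrow> ('v, 'e) pre_digraph \<Rightarrow> nat \<Rightarrow>
    ('v, 'e, 'f) palg \<Rightarrow> ('v, 'e, 'f) pelt \<Rightarrow> ('v, 'e, 'f) palg \<Rightarrow> ('v, 'e, 'f) AWA" where
  "ktensor F Q p a w a' = pure_tensor (vertex_ring F Q)
     (AW F Q p) (ring_bimodule (proj F Q) id (preprojective F Q))
     (pure_tensor (vertex_ring F Q)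
        (ring_bimodule id (proj F Q) (preprojective F Q)) (W_bimodule F Q p) a w) a'"

text \<open>The differential \<open>d : K(A)\<^sub>p \<rightarrow> K(A)\<^sub>p\<^sub>-\<^sub>1\<close>. The notation \<open>x\<^sub>1 \<dots> x\<^sub>p\<close> (a sum being understood)
  for an element \<open>w\<close> of \<open>W\<^sub>p\<close>, with \<open>x\<^sub>1\<close> resp. \<open>x\<^sub>p\<close> in \<open>V\<close>, stands for the two ways of writing
  \<open>w = \<Sum>\<^sub>x x u\<^sub>x = \<Sum>\<^sub>x v\<^sub>x x\<close> with \<open>x\<close> running over the arrows and \<open>u\<^sub>x, v\<^sub>x\<close> in \<open>W\<^sub>p\<^sub>-\<^sub>1\<close>; these exist because
  \<open>W\<^sub>p\<close> is contained in \<open>V W\<^sub>p\<^sub>-\<^sub>1\<close> and in \<open>W\<^sub>p\<^sub>-\<^sub>1 V\<close>, and the result does not depend on the choice.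
  In degree \<open>0\<close> the differential is the zero map.\<close>

definition koszul_diff :: "'f::field itself \<Rightarrow> ('v, 'e) pre_digraph \<Rightarrow> nat \<Rightarrow>
    ('v, 'e, 'f) AWA \<Rightarrow> ('v, 'e, 'f) AWA" where
  "koszul_diff F Q p =
    (if p = 0 then (\<lambda>x\<in>carrier (koszul F Q 0). \<zero>\<^bsub>koszul F Q 0\<^esub>)
     else (THE d. d \<in> additive_maps (koszul F Q p) (koszul F Q (p - 1)) \<and>
       (\<forall>a\<in>carrier (preprojective F Q). \<forall>a'\<in>carrier (preprojective F Q). \<forall>w\<in>W F Q p. \<forall>u v.
          (\<forall>x\<in>arcs (double_quiver Q). u x \<in> W F Q (p - 1) \<and> v x \<in> W F Q (p - 1)) \<longrightarrow>
          w = (\<Sum>x\<in>arcs (double_quiver Q). arrow Q x \<otimes>\<^bsub>path_algebra F Q\<^esub> u x) \<longrightarrow>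
          w = (\<Sum>x\<in>arcs (double_quiver Q). v x \<otimes>\<^bsub>path_algebra F Q\<^esub> arrow Q x) \<longrightarrow>
          (let l = (\<Oplus>\<^bsub>koszul F Q (p - 1)\<^esub>x\<in>arcs (double_quiver Q).
                 ktensor F Q (p - 1) (a \<otimes>\<^bsub>preprojective F Q\<^esub> proj F Q (arrow Q x)) (u x) a');
               r = (\<Oplus>\<^bsub>koszul F Q (p - 1)\<^esub>x\<in>arcs (double_quiver Q).
                 ktensor F Q (p - 1) a (v x) (proj F Q (arrow Q x) \<otimes>\<^bsub>preprojective F Q\<^esub> a'))
           in d (ktensor F Q p a w a') =
             (if even p then l \<oplus>\<^bsub>koszul F Q (p - 1)\<^esub> r else l \<ominus>\<^bsub>koszul F Q (p - 1)\<^esub> r)))))"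

definition koszul_homology :: "'f::field itself \<Rightarrow> ('v, 'e) pre_digraph \<Rightarrow> nat \<Rightarrow>
    (('v, 'e, 'f) palg, ('v, 'e, 'f) AWA set, ('v, 'e, 'f) palg) bimodule" where
  "koszul_homology F Q p = subquotient (koszul F Q p)
     {x \<in> carrier (koszul F Q p). koszul_diff F Q p x = \<zero>\<^bsub>koszul F Q (p - 1)\<^esub>}
     (koszul_diff F Q (Suc p) ` carrier (koszul F Q (Suc p)))"


section \<open>Koszul cohomology with coefficients in the enveloping algebra\<close>

type_synonym ('v, 'e, 'f) env = "(('v, 'e, 'f) palg \<times> ('v, 'e, 'f) palg \<Rightarrow>\<^sub>0 int) set"

text \<open>The outer structure \<open>a (\<alpha> \<otimes> \<beta>) b = a \<alpha> \<otimes> \<beta> b\<close> on the tensor square of \<open>A\<close> over the field.\<close>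

definition env_outer :: "'f::field itself \<Rightarrow> ('v, 'e) pre_digraph \<Rightarrow>
    (('v, 'e, 'f) palg, ('v, 'e, 'f) env, ('v, 'e, 'f) palg) bimodule" where
  "env_outer F Q = tensor (UNIV :: 'f set)
     (ring_bimodule id (field_map F Q) (preprojective F Q))
     (ring_bimodule (field_map F Q) id (preprojective F Q))"

text \<open>The inner structure \<open>(\<alpha> \<otimes> \<beta>) . (a \<otimes> b) = \<alpha> a \<otimes> b \<beta>\<close> is a right module structure over the
  enveloping algebra; as a bimodule structure, it reads \<open>b (\<alpha> \<otimes> \<beta>) a = \<alpha> a \<otimes> b \<beta>\<close>.\<close>

definition env_inner :: "'f::field itself \<Rightarrow> ('v, 'e) pre_digraph \<Rightarrow>
    (('v, 'e, 'f) palg, ('v, 'e, 'f) env, ('v, 'e, 'f) palg) bimodule" where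
  "env_inner F Q =
    (let A = preprojective F Q;
         t = tensor_map (UNIV :: 'f set)
           (ring_bimodule id (field_map F Q) A) (ring_bimodule (field_map F Q) id A)
     in (env_outer F Q)\<lparr>smult := (\<lambda>b. t id (\<lambda>\<beta>. b \<otimes>\<^bsub>A\<^esub> \<beta>)),
                        ract := (\<lambda>x a. t (\<lambda>\<alpha>. \<alpha> \<otimes>\<^bsub>A\<^esub> a) id x)\<rparr>)"

text \<open>Cochains are bimodule homomorphisms for the outer structure, and form a bimodule through the
  inner structure.\<close>

definition koszul_cochains :: "'f::field itself \<Rightarrow> ('v, 'e) pre_digraph \<Rightarrow> nat \<Rightarrow>
    (('v, 'e, 'f) palg, ('v, 'e, 'f) AWA \<Rightarrow> ('v, 'e, 'f) env, ('v, 'e, 'f) palg) bimodule" where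
  "koszul_cochains F Q p =
    (let K = carrier (koszul F Q p); E = env_inner F Q
     in \<lparr>carrier = bimodule_homs (preprojective F Q) (koszul F Q p) (env_outer F Q),
         monoid.mult = undefined, monoid.one = undefined,
         ring.zero = (\<lambda>x\<in>K. \<zero>\<^bsub>E\<^esub>), ring.add = (\<lambda>f g. \<lambda>x\<in>K. f x \<oplus>\<^bsub>E\<^esub> g x),
         smult = (\<lambda>b f. \<lambda>x\<in>K. b \<odot>\<^bsub>E\<^esub> f x), ract = (\<lambda>f a. \<lambda>x\<in>K. ract E (f x) a)\<rparr>)"

text \<open>The differential is \<open>f \<mapsto> - (-1)\<^sup>p f \<circ> d\<close> on cochains of degree \<open>p\<close>; this sign yields the formula
  \<open>f(x\<^sub>1 \<dots> x\<^sub>p) x\<^sub>p\<^sub>+\<^sub>1 - (-1)\<^sup>p x\<^sub>1 f(x\<^sub>2 \<dots> x\<^sub>p\<^sub>+\<^sub>1)\<close> on restrictions to \<open>W\<^sub>p\<^sub>+\<^sub>1\<close>.\<close>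

definition koszul_codiff :: "'f::field itself \<Rightarrow> ('v, 'e) pre_digraph \<Rightarrow> nat \<Rightarrow>
    (('v, 'e, 'f) AWA \<Rightarrow> ('v, 'e, 'f) env) \<Rightarrow> (('v, 'e, 'f) AWA \<Rightarrow> ('v, 'e, 'f) env)" where
  "koszul_codiff F Q p f = (\<lambda>x\<in>carrier (koszul F Q (Suc p)).
     if even p then \<ominus>\<^bsub>env_outer F Q\<^esub> f (koszul_diff F Q (Suc p) x)
     else f (koszul_diff F Q (Suc p) x))"

definition koszul_coboundaries :: "'f::field itself \<Rightarrow> ('v, 'e) pre_digraph \<Rightarrow> nat \<Rightarrow>
    (('v, 'e, 'f) AWA \<Rightarrow> ('v, 'e, 'f) env) set" where
  "koszul_coboundaries F Q p = (if p = 0 then {\<zero>\<^bsub>koszul_cochains F Q 0\<^esub>}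
     else koszul_codiff F Q (p - 1) ` carrier (koszul_cochains F Q (p - 1)))"

definition HK :: "'f::field itself \<Rightarrow> ('v, 'e) pre_digraph \<Rightarrow> nat \<Rightarrow>
    (('v, 'e, 'f) palg, (('v, 'e, 'f) AWA \<Rightarrow> ('v, 'e, 'f) env) set, ('v, 'e, 'f) palg) bimodule"
  where
  "HK F Q p = subquotient (koszul_cochains F Q p)
     {f \<in> carrier (koszul_cochains F Q p). koszul_codiff F Q p f = \<zero>\<^bsub>koszul_cochains F Q (Suc p)\<^esub>}
     (koszul_coboundaries F Q p)"

end

theory Submission
  imports Defs "HOL-Library.Function_Algebras"
begin

text \<open>A bimodule homomorphism from \<open>K(A)\<^sub>p\<close> to \<open>A \<otimes> A\<close> is determined by its values on a basis of
  \<open>W\<^sub>p\<close>. The bases \<open>e\<^sub>i\<close> of \<open>W\<^sub>0\<close> and \<open>\<sigma>\<^sub>i\<close> of \<open>W\<^sub>2\<close> are dual to each other, and the basis of arrows \<open>x\<close> of \<open>W\<^sub>1\<close>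
  is dual to the basis \<open>\<epsilon>(x) x\<^sup>*\<close>; swapping the two factors of \<open>A \<otimes> A\<close> thus identifies the cochains of
  degree \<open>p\<close> with \<open>K(A)\<^sub>2\<^sub>-\<^sub>p\<close>, compatibly with the differentials. Since the graph is neither \<open>A\<^sub>1\<close> nor \<open>A\<^sub>2\<close>,
  \<open>W\<^sub>3 = 0\<close>, and so \<open>HK\<^sup>p(A, A\<^sup>e)\<close> is \<open>H\<^sub>2\<^sub>-\<^sub>p(K(A))\<close>.

  The universal derivation \<open>D\<close> of the path algebra with values in \<open>K(A)\<^sub>1\<close> satisfies
  \<open>d (D t) = t \<otimes> 1 - 1 \<otimes> t\<close> and maps the ideal of relations into \<open>d (K(A)\<^sub>2)\<close>. Hence \<open>H\<^sub>0 = A\<close>, and composing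
  \<open>D\<close> with a linear section of the projection onto \<open>A\<close> contracts \<open>K(A)\<^sub>1\<close> modulo \<open>d (K(A)\<^sub>2)\<close>, so that \<open>H\<^sub>1 = 0\<close>.

  Let \<open>a \<noteq> 0\<close> in \<open>A e\<^sub>j\<close> be annihilated by right multiplication with all arrows. Then the boundary of
  \<open>a \<otimes> \<sigma>\<^sub>j \<otimes> 1\<close> is a combination of right multiples by arrows, and can be corrected to zero within
  \<open>K(A)\<^sub>2 V\<close>, which gives a nonzero cycle. Without such \<open>a\<close>, one has
  \<open>dim A\<^sub>n e\<^sub>j + dim A\<^sub>n\<^sub>+\<^sub>2 e\<^sub>j \<le> \<Sum> dim A\<^sub>n\<^sub>+\<^sub>1 e\<^sub>i\<close>, the sum being over the neighbours \<open>i\<close> of \<open>j\<close>. On a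
  Dynkin graph there are positive weights \<open>v\<close> with \<open>\<Sum> v\<^sub>i < 2 v\<^sub>j\<close>; the weighted dimensions then form a strictly concave
  sequence, whence \<open>A\<^sub>n = 0\<close> for large \<open>n\<close>. But the last nonzero \<open>A\<^sub>n\<close> consists of such elements \<open>a\<close>.\<close>

section \<open>Tensor products of bimodules\<close>

text \<open>Tensor products are cosets of free abelian groups and the differential is a definite
  description: no map out of \<open>K(A)\<^sub>p\<close> is available until a universal property
  provides it, and identities are then checked on tensors \<open>a \<otimes> w \<otimes> b\<close>.
  The duality rests on \<open>\<epsilon>(star x) = - \<epsilon>(x)\<close>. The two halves of
  \<open>d\<close> are subtracted in degree 1 and added in degree 2; exchanging \<open>x\<close>
  with \<open>star x\<close> accounts for exactly this sign. An isolated vertex has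
  \<open>\<sigma>\<^sub>i = 0\<close> and hence no dual to \<open>e\<^sub>i\<close>, which rules out
  A1. For A2, \<open>V R\<close> and \<open>R V\<close> have a nonzero intersection, so
  \<open>W\<^sub>3\<close> survives. A merely linear section of the projection onto \<open>A\<close>
  would not give a well-defined map on the tensor square of \<open>A\<close> over \<open>k\<close>;
  it has to commute with the idempotents on the right. The correction of a cycle uses the map
  \<open>z \<mapsto> z - h (d z)\<close>, with \<open>h\<close> the homotopy: it is right linear,
  has boundaries as values and fixes cycles, so it treats the boundary of
  \<open>a \<otimes> \<sigma>\<^sub>j \<otimes> 1\<close> arrow by arrow. The augmentation of the
  right factor kills the correction but not \<open>a\<close>.\<close>

locale bimod = abelian_group M
  for L :: "'l set" and M :: "('l, 'm, 'r) bimodule" (structure) and R :: "'r set" +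
  assumes lact_closed: "\<lbrakk>l \<in> L; x \<in> carrier M\<rbrakk> \<Longrightarrow> l \<odot> x \<in> carrier M"
    and ract_closed: "\<lbrakk>r \<in> R; x \<in> carrier M\<rbrakk> \<Longrightarrow> ract M x r \<in> carrier M"
    and lact_add: "\<lbrakk>l \<in> L; x \<in> carrier M; y \<in> carrier M\<rbrakk> \<Longrightarrow> l \<odot> (x \<oplus> y) = l \<odot> x \<oplus> l \<odot> y"
    and ract_add: "\<lbrakk>r \<in> R; x \<in> carrier M; y \<in> carrier M\<rbrakk> \<Longrightarrow>
      ract M (x \<oplus> y) r = ract M x r \<oplus> ract M y r"
    and lact_ract: "\<lbrakk>l \<in> L; r \<in> R; x \<in> carrier M\<rbrakk> \<Longrightarrow> ract M (l \<odot> x) r = l \<odot> ract M x r"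

section \<open>Additive maps between abelian groups\<close>

lemma (in abelian_group) minus_to_eq:
  assumes "a \<in> carrier G" "b \<in> carrier G" "a \<ominus> b = \<zero>"
  shows "a = b"
proof -
  have "(a \<oplus> \<ominus> b) \<oplus> b = b" using assms by (simp add: a_minus_def)
  then show ?thesis using assms(1,2) by (simp add: a_assoc l_neg)
qed

lemma (in abelian_group) add_diff_diff:
  "\<lbrakk>a \<in> carrier G; b \<in> carrier G\<rbrakk> \<Longrightarrow> (a \<oplus> b) \<ominus> a \<ominus> b = \<zero>"
  by (simp add: a_minus_def a_assoc a_lcomm[of b] r_neg r_neg1)

lemma additive_zero:
  assumes "abelian_group M" "abelian_group N" "f \<in> carrier M \<rightarrow> carrier N"
    "\<And>x y. \<lbrakk>x \<in> carrier M; y \<in> carrier M\<rbrakk> \<Longrightarrow> f (x \<oplus>\<^bsub>M\<^esub> y) = f x \<oplus>\<^bsub>N\<^esub> f y"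
  shows "f \<zero>\<^bsub>M\<^esub> = \<zero>\<^bsub>N\<^esub>"
proof -
  interpret M: abelian_group M by fact
  interpret N: abelian_group N by fact
  have c: "f \<zero>\<^bsub>M\<^esub> \<in> carrier N" using assms(3) by auto
  have "f \<zero>\<^bsub>M\<^esub> \<oplus>\<^bsub>N\<^esub> f \<zero>\<^bsub>M\<^esub> = f \<zero>\<^bsub>M\<^esub> \<oplus>\<^bsub>N\<^esub> \<zero>\<^bsub>N\<^esub>"
    using assms(4)[of "\<zero>\<^bsub>M\<^esub>" "\<zero>\<^bsub>M\<^esub>"] c by simp
  from N.add.l_cancel[OF this c N.zero_closed c] show ?thesis .
qed

lemma additive_minus:
  assumes "abelian_group M" "abelian_group N" "f \<in> carrier M \<rightarrow> carrier N"
    "\<And>x y. \<lbrakk>x \<in> carrier M; y \<in> carrier M\<rbrakk> \<Longrightarrow> f (x \<oplus>\<^bsub>M\<^esub> y) = f x \<oplus>\<^bsub>N\<^esub> f y" "x \<in> carrier M"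
  shows "f (\<ominus>\<^bsub>M\<^esub> x) = \<ominus>\<^bsub>N\<^esub> f x"
proof -
  interpret M: abelian_group M by fact
  interpret N: abelian_group N by fact
  have c: "f x \<in> carrier N" "f (\<ominus>\<^bsub>M\<^esub> x) \<in> carrier N" using assms(3,5) by auto
  have "f (\<ominus>\<^bsub>M\<^esub> x) \<oplus>\<^bsub>N\<^esub> f x = \<zero>\<^bsub>N\<^esub>"
    using assms(4)[of "\<ominus>\<^bsub>M\<^esub> x" x] assms(5) additive_zero[OF assms(1-4)] by (simp add: M.l_neg)
  then show ?thesis using c by (simp add: N.minus_equality)
qed

lemma additive_finsum:
  assumes "abelian_group M" "abelian_group N" "f \<in> carrier M \<rightarrow> carrier N"
    "\<And>x y. \<lbrakk>x \<in> carrier M; y \<in> carrier M\<rbrakk> \<Longrightarrow> f (x \<oplus>\<^bsub>M\<^esub> y) = f x \<oplus>\<^bsub>N\<^esub> f y"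
    "finite S" "\<And>s. s \<in> S \<Longrightarrow> g s \<in> carrier M"
  shows "f (\<Oplus>\<^bsub>M\<^esub>s\<in>S. g s) = (\<Oplus>\<^bsub>N\<^esub>s\<in>S. f (g s))"
proof -
  interpret M: abelian_group M by fact
  interpret N: abelian_group N by fact
  show ?thesis using assms(5,6)
  proof (induction S rule: finite_induct)
    case empty
    then show ?case using additive_zero[OF assms(1-4)] by simp
  next
    case (insert s S)
    have "f (\<Oplus>\<^bsub>M\<^esub>s\<in>insert s S. g s) = f (g s \<oplus>\<^bsub>M\<^esub> (\<Oplus>\<^bsub>M\<^esub>s\<in>S. g s))"
      using insert by (subst M.finsum_insert) auto
    also have "\<dots> = f (g s) \<oplus>\<^bsub>N\<^esub> (\<Oplus>\<^bsub>N\<^esub>s\<in>S. f (g s))"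
      using insert assms(4) by (subst assms(4)) auto
    also have "\<dots> = (\<Oplus>\<^bsub>N\<^esub>s\<in>insert s S. f (g s))"
      using insert assms(3) by (subst N.finsum_insert) (auto simp: Pi_iff)
    finally show ?case .
  qed
qed

section \<open>The tensor product of two bimodules and its universal property\<close>

locale tensor_pair = M: bimod L M B + N: bimod B N R
  for L :: "'l set" and M :: "('l, 'm, 'b) bimodule" and B :: "'b set"
    and N :: "('b, 'n, 'r) bimodule" and R :: "'r set"
begin

abbreviation "G \<equiv> tensor_free M N"
abbreviation "U \<equiv> tensor_null B M N"
abbreviation "cls \<equiv> tensor_class B M N"
abbreviation "TP \<equiv> tensor B M N"
abbreviation "pt \<equiv> pure_tensor B M N"

lemma rels_closed: "tensor_rels B M N \<subseteq> carrier G"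
  unfolding tensor_rels_def
  by (auto simp: keys_frag_of M.ract_closed N.lact_closed dest!: subsetD[OF keys_diff])

lemma rels_memI:
  "\<lbrakk>x \<in> carrier M; x' \<in> carrier M; y \<in> carrier N\<rbrakk> \<Longrightarrow>
    frag_of (x \<oplus>\<^bsub>M\<^esub> x', y) - frag_of (x, y) - frag_of (x', y) \<in> tensor_rels B M N"
  "\<lbrakk>x \<in> carrier M; y \<in> carrier N; y' \<in> carrier N\<rbrakk> \<Longrightarrow>
    frag_of (x, y \<oplus>\<^bsub>N\<^esub> y') - frag_of (x, y) - frag_of (x, y') \<in> tensor_rels B M N"
  "\<lbrakk>x \<in> carrier M; b \<in> B; y \<in> carrier N\<rbrakk> \<Longrightarrow>
    frag_of (ract M x b, y) - frag_of (x, b \<odot>\<^bsub>N\<^esub> y) \<in> tensor_rels B M N"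
  unfolding tensor_rels_def by blast+

lemma rels_cases [consumes 1, case_names left right balanced]:
  assumes "r \<in> tensor_rels B M N"
  obtains x x' y where "x \<in> carrier M" "x' \<in> carrier M" "y \<in> carrier N"
      "r = frag_of (x \<oplus>\<^bsub>M\<^esub> x', y) - frag_of (x, y) - frag_of (x', y)"
    | x y y' where "x \<in> carrier M" "y \<in> carrier N" "y' \<in> carrier N"
      "r = frag_of (x, y \<oplus>\<^bsub>N\<^esub> y') - frag_of (x, y) - frag_of (x, y')"
    | x b y where "x \<in> carrier M" "b \<in> B" "y \<in> carrier N"
      "r = frag_of (ract M x b, y) - frag_of (x, b \<odot>\<^bsub>N\<^esub> y)"
  using assms unfolding tensor_rels_def
  by (elim UnE CollectE exE conjE) (erule (3) that)+

lemma subgroup_null: "subgroup U G"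
  unfolding tensor_null_def by (rule group.generate_is_subgroup[OF _ rels_closed]) simp

lemma normal_null: "U \<lhd> G"
  by (rule comm_group.subgroup_imp_normal[OF abelian_free_Abelian_group subgroup_null])

lemma comm_group_quotient: "comm_group (G Mod U)"
  by (rule comm_group.abelian_FactGroup[OF abelian_free_Abelian_group subgroup_null])

lemma cls_eqI:
  assumes "c \<in> carrier G" "d \<in> carrier G" "c - d \<in> U"
  shows "cls c = cls d"
proof -
  have "c = (c - d) \<otimes>\<^bsub>G\<^esub> d" by simp
  then have "c \<in> U #>\<^bsub>G\<^esub> d" unfolding r_coset_def using assms(3) by blast
  then show ?thesis unfolding tensor_class_def
    using group.repr_independence[OF group_free_Abelian_group _ assms(2) subgroup_null] by blast
qed

lemma cls_self: "c \<in> carrier G \<Longrightarrow> c \<in> cls c"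
  unfolding tensor_class_def
  by (rule group.rcos_self[OF group_free_Abelian_group _ subgroup_null])

lemma in_clsD:
  assumes "d \<in> cls c" "c \<in> carrier G"
  shows "d \<in> carrier G" "d - c \<in> U"
proof -
  obtain u where u: "u \<in> U" "d = u + c" using assms unfolding tensor_class_def r_coset_def by auto
  show "d - c \<in> U" using u by simp
  have "u \<in> carrier G" using u subgroup.subset[OF subgroup_null] by blast
  then show "d \<in> carrier G" using u assms(2)
    by (metis group.subgroup_self group_free_Abelian_group mult_free_Abelian_group subgroup.m_closed)
qed

lemma carrier_TP: "carrier TP = cls ` carrier G"
  unfolding tensor_def Let_def by (auto simp: FactGroup_def RCOSETS_def tensor_class_def)

lemma TP_sel: "ring.add TP = monoid.mult (G Mod U)" "ring.zero TP = monoid.one (G Mod U)" "carrier TP = carrier (G Mod U)"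
  unfolding tensor_def Let_def by simp_all

lemma cls_add: "\<lbrakk>c \<in> carrier G; d \<in> carrier G\<rbrakk> \<Longrightarrow> cls c \<oplus>\<^bsub>TP\<^esub> cls d = cls (c + d)"
  unfolding TP_sel tensor_class_def FactGroup_def
  using normal.rcos_sum[OF normal_null] by simp

lemma cls_zero: "\<zero>\<^bsub>TP\<^esub> = cls 0"
  unfolding TP_sel tensor_class_def FactGroup_def
  using group.coset_mult_one[OF group_free_Abelian_group, of U] subgroup.subset[OF subgroup_null] by simp

lemma abelian_group_tensor: "abelian_group TP"
proof -
  interpret q: comm_group "G Mod U" by (rule comm_group_quotient)
  show ?thesis
  proof (rule abelian_groupI)
    fix x assume "x \<in> carrier TP"
    then show "\<exists>y\<in>carrier TP. y \<oplus>\<^bsub>TP\<^esub> x = \<zero>\<^bsub>TP\<^esub>"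
      unfolding TP_sel using q.l_inv q.inv_closed by blast
  qed (unfold TP_sel, (rule q.m_closed q.one_closed q.m_assoc q.m_comm q.l_one; assumption?)+)
qed

sublocale T: abelian_group TP by (rule abelian_group_tensor)

lemma pure_closed: "\<lbrakk>x \<in> carrier M; y \<in> carrier N\<rbrakk> \<Longrightarrow> pt x y \<in> carrier TP"
  unfolding pure_tensor_def carrier_TP by auto

lemma rel_in_null: "r \<in> tensor_rels B M N \<Longrightarrow> r \<in> U"
  unfolding tensor_null_def by (rule generate.incl)

lemma keys_plus_subset: "\<lbrakk>Poly_Mapping.keys c \<subseteq> S; Poly_Mapping.keys d \<subseteq> S\<rbrakk> \<Longrightarrow> Poly_Mapping.keys (c + d) \<subseteq> S"
  by (meson Un_least keys_add subset_trans)

lemma pure_add_left: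
  assumes "x \<in> carrier M" "x' \<in> carrier M" "y \<in> carrier N"
  shows "pt (x \<oplus>\<^bsub>M\<^esub> x') y = pt x y \<oplus>\<^bsub>TP\<^esub> pt x' y"
proof -
  have "frag_of (x \<oplus>\<^bsub>M\<^esub> x', y) - (frag_of (x, y) + frag_of (x', y)) \<in> U"
    by (rule rel_in_null) (use assms in \<open>auto simp: tensor_rels_def diff_diff_add[symmetric]\<close>)
  then show ?thesis using assms
    by (simp add: pure_tensor_def cls_add cls_eqI keys_plus_subset keys_frag_of)
qed

lemma pure_add_right:
  assumes "x \<in> carrier M" "y \<in> carrier N" "y' \<in> carrier N"
  shows "pt x (y \<oplus>\<^bsub>N\<^esub> y') = pt x y \<oplus>\<^bsub>TP\<^esub> pt x y'"
proof -
  have "frag_of (x, y \<oplus>\<^bsub>N\<^esub> y') - (frag_of (x, y) + frag_of (x, y')) \<in> U"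
    by (rule rel_in_null) (use assms in \<open>auto simp: tensor_rels_def diff_diff_add[symmetric]\<close>)
  then show ?thesis using assms
    by (simp add: pure_tensor_def cls_add cls_eqI keys_plus_subset keys_frag_of)
qed

lemma pure_balanced:
  assumes "x \<in> carrier M" "b \<in> B" "y \<in> carrier N"
  shows "pt (ract M x b) y = pt x (b \<odot>\<^bsub>N\<^esub> y)"
  unfolding pure_tensor_def
  by (rule cls_eqI) (use assms in \<open>auto simp: tensor_rels_def M.ract_closed N.lact_closed intro!: rel_in_null\<close>)

lemma pure_zero_left: "y \<in> carrier N \<Longrightarrow> pt \<zero>\<^bsub>M\<^esub> y = \<zero>\<^bsub>TP\<^esub>"
  by (rule additive_zero[OF M.abelian_group_axioms T.abelian_group_axioms])
     (auto simp: pure_closed pure_add_left)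

text \<open>Sums of pure tensors suffice because the negative of \<open>x \<otimes> y\<close> is the
  pure tensor of \<open>\<ominus> x\<close> and \<open>y\<close>. The induction on the free group
  passes through differences, so the property is carried along for a class and its negative
  together.\<close>

lemma tensor_induct [consumes 1, case_names pure add]:
  assumes S: "S \<in> carrier TP"
    and pure: "\<And>x y. \<lbrakk>x \<in> carrier M; y \<in> carrier N\<rbrakk> \<Longrightarrow> P (pt x y)"
    and add: "\<And>u v. \<lbrakk>u \<in> carrier TP; v \<in> carrier TP; P u; P v\<rbrakk> \<Longrightarrow> P (u \<oplus>\<^bsub>TP\<^esub> v)"
  shows "P S"
proof -
  obtain c where c: "S = cls c" "c \<in> carrier G" using S carrier_TP by auto
  have neg: "cls (- c) = \<ominus>\<^bsub>TP\<^esub> cls c" if "c \<in> carrier G" for c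
  proof -
    have "cls (- c) \<oplus>\<^bsub>TP\<^esub> cls c = \<zero>\<^bsub>TP\<^esub>" using that by (subst cls_add) (auto simp: cls_zero)
    then show ?thesis using that by (intro T.minus_equality[symmetric]) (auto simp: carrier_TP)
  qed
  have "P (cls c) \<and> P (cls (- c))"
  proof (rule free_Abelian_group_induct[of c "carrier M \<times> carrier N"])
    show "Poly_Mapping.keys c \<subseteq> carrier M \<times> carrier N" using c by simp
    show "P (cls 0) \<and> P (cls (- 0))"
      using pure[OF M.zero_closed N.zero_closed] by (simp add: pure_zero_left cls_zero)
  next
    fix x y :: "'m \<times> 'n \<Rightarrow>\<^sub>0 int"
    assume k: "Poly_Mapping.keys x \<subseteq> carrier M \<times> carrier N" "Poly_Mapping.keys y \<subseteq> carrier M \<times> carrier N"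
    assume "P (cls x) \<and> P (cls (- x))" "P (cls y) \<and> P (cls (- y))"
    then have "P (cls x \<oplus>\<^bsub>TP\<^esub> cls (- y))" "P (cls y \<oplus>\<^bsub>TP\<^esub> cls (- x))"
      using k by (auto intro!: add simp: carrier_TP)
    then show "P (cls (x - y)) \<and> P (cls (- (x - y)))" using k by (simp add: cls_add)
  next
    fix a assume a: "a \<in> carrier M \<times> carrier N"
    obtain x y where xy: "a = (x, y)" by force
    have "P (pt x y)" "P (pt (\<ominus>\<^bsub>M\<^esub> x) y)" using a xy by (auto intro!: pure)
    moreover have "pt (\<ominus>\<^bsub>M\<^esub> x) y = \<ominus>\<^bsub>TP\<^esub> pt x y"
      by (rule additive_minus[OF M.abelian_group_axioms T.abelian_group_axioms])
         (use a xy in \<open>auto simp: pure_closed pure_add_left\<close>)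
    moreover have "\<ominus>\<^bsub>TP\<^esub> pt x y = cls (- frag_of a)"
      using a xy by (simp add: neg pure_tensor_def keys_frag_of)
    ultimately show "P (cls (frag_of a)) \<and> P (cls (- frag_of a))"
      by (simp add: pure_tensor_def xy)
  qed
  then show ?thesis using c by simp
qed

text \<open>The extension to the free abelian group kills the three kinds of relations, hence the
  subgroup they generate, and is therefore constant on cosets.\<close>

lemma tensor_lift:
  fixes H :: "('h, 'z) ring_scheme"
  assumes H: "abelian_group H"
    and cl: "\<And>x y. \<lbrakk>x \<in> carrier M; y \<in> carrier N\<rbrakk> \<Longrightarrow> \<phi> x y \<in> carrier H"
    and al: "\<And>x x' y. \<lbrakk>x \<in> carrier M; x' \<in> carrier M; y \<in> carrier N\<rbrakk> \<Longrightarrow>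
      \<phi> (x \<oplus>\<^bsub>M\<^esub> x') y = \<phi> x y \<oplus>\<^bsub>H\<^esub> \<phi> x' y"
    and ar: "\<And>x y y'. \<lbrakk>x \<in> carrier M; y \<in> carrier N; y' \<in> carrier N\<rbrakk> \<Longrightarrow>
      \<phi> x (y \<oplus>\<^bsub>N\<^esub> y') = \<phi> x y \<oplus>\<^bsub>H\<^esub> \<phi> x y'"
    and ba: "\<And>x b y. \<lbrakk>x \<in> carrier M; b \<in> B; y \<in> carrier N\<rbrakk> \<Longrightarrow> \<phi> (ract M x b) y = \<phi> x (b \<odot>\<^bsub>N\<^esub> y)"
  obtains h where "h \<in> carrier TP \<rightarrow> carrier H"
    "\<And>u v. \<lbrakk>u \<in> carrier TP; v \<in> carrier TP\<rbrakk> \<Longrightarrow> h (u \<oplus>\<^bsub>TP\<^esub> v) = h u \<oplus>\<^bsub>H\<^esub> h v"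
    "\<And>x y. \<lbrakk>x \<in> carrier M; y \<in> carrier N\<rbrakk> \<Longrightarrow> h (pt x y) = \<phi> x y"
proof -
  interpret H: abelian_group H by fact
  have im: "(\<lambda>(x, y). \<phi> x y) ` (carrier M \<times> carrier N) \<subseteq> carrier (add_monoid H)"
    using cl by auto
  obtain g where g: "g \<in> hom G (add_monoid H)"
    and gf: "\<And>x. x \<in> carrier M \<times> carrier N \<Longrightarrow> g (frag_of x) = (case x of (x, y) \<Rightarrow> \<phi> x y)"
    using comm_group.free_Abelian_group_universal[OF H.a_comm_group im] by blast
  have g_cl: "g c \<in> carrier H" if "c \<in> carrier G" for c using hom_in_carrier[OF g that] by simp
  have g_add: "g (c + d) = g c \<oplus>\<^bsub>H\<^esub> g d" if "c \<in> carrier G" "d \<in> carrier G" for c d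
    using hom_mult[OF g that] by simp
  interpret gh: group_hom G "add_monoid H" g
    by (simp add: group_hom_def group_hom_axioms_def H.add.group_axioms g)
  have g_diff: "g (c - d) = g c \<ominus>\<^bsub>H\<^esub> g d" if "c \<in> carrier G" "d \<in> carrier G" for c d
  proof -
    have "Poly_Mapping.keys (c - d) \<subseteq> carrier M \<times> carrier N"
      using that by (intro subset_trans[OF keys_diff]) simp
    then have cd: "c - d \<in> carrier G" by simp
    have "g c = g (c - d) \<oplus>\<^bsub>H\<^esub> g d" using g_add[OF cd that(2)] by simp
    then show ?thesis using g_cl[OF cd] g_cl[OF that(2)] by (simp add: a_minus_def H.a_assoc H.r_neg)
  qed
  have ker: "tensor_rels B M N \<subseteq> kernel G (add_monoid H) g"
  proof
    fix r assume r: "r \<in> tensor_rels B M N"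
    then have rG: "r \<in> carrier G" using rels_closed by blast
    have k: "Poly_Mapping.keys (frag_of a - frag_of b) \<subseteq> carrier M \<times> carrier N"
      if "a \<in> carrier M \<times> carrier N" "b \<in> carrier M \<times> carrier N" for a b
      using that by (intro subset_trans[OF keys_diff]) (auto simp: keys_frag_of)
    from r have "g r = \<zero>\<^bsub>H\<^esub>"
    proof (cases rule: rels_cases)
      case l: (left x x' y)
      then have "g r = (\<phi> x y \<oplus>\<^bsub>H\<^esub> \<phi> x' y) \<ominus>\<^bsub>H\<^esub> \<phi> x y \<ominus>\<^bsub>H\<^esub> \<phi> x' y"
        by (simp add: g_diff gf al k)
      then show ?thesis using cl[OF l(1,3)] cl[OF l(2,3)] by (simp add: H.add_diff_diff)
    next
      case r: (right x y y')
      then have "g r = (\<phi> x y \<oplus>\<^bsub>H\<^esub> \<phi> x y') \<ominus>\<^bsub>H\<^esub> \<phi> x y \<ominus>\<^bsub>H\<^esub> \<phi> x y'"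
        by (simp add: g_diff gf ar k)
      then show ?thesis using cl[OF r(1,2)] cl[OF r(1,3)] by (simp add: H.add_diff_diff)
    next
      case b: (balanced x b y)
      then show ?thesis using cl[OF b(1) N.lact_closed[OF b(2,3)]]
        by (simp add: g_diff gf ba M.ract_closed N.lact_closed H.r_neg a_minus_def)
    qed
    then show "r \<in> kernel G (add_monoid H) g" using rG by (simp add: kernel_def)
  qed
  have "U \<subseteq> kernel G (add_monoid H) g"
    unfolding tensor_null_def
    by (rule group.generate_subgroup_incl[OF group_free_Abelian_group ker gh.subgroup_kernel])
  then have gU: "g u = \<zero>\<^bsub>H\<^esub>" if "u \<in> U" for u using that by (auto simp: kernel_def)
  \<comment> \<open>Any representative of the coset will do, since \<open>g\<close> vanishes on
    \<open>U\<close>.\<close>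
  define h where "h S = g (SOME c. c \<in> S)" for S
  have h_cls: "h (cls c) = g c" if "c \<in> carrier G" for c
  proof -
    define d where "d = (SOME d. d \<in> cls c)"
    have "d \<in> cls c" unfolding d_def using cls_self[OF that] by (rule someI)
    then have d: "d \<in> carrier G" "d - c \<in> U" using in_clsD that by blast+
    then have "g d \<ominus>\<^bsub>H\<^esub> g c = \<zero>\<^bsub>H\<^esub>" using gU g_diff that by metis
    then have "g d = g c" by (rule H.minus_to_eq[OF g_cl[OF d(1)] g_cl[OF that]])
    then show ?thesis by (simp only: h_def d_def)
  qed
  show thesis
  proof (rule that[of h])
    show "h \<in> carrier TP \<rightarrow> carrier H" by (auto simp: carrier_TP h_cls g_cl)
    fix u v assume "u \<in> carrier TP" "v \<in> carrier TP"
    then obtain c d where "u = cls c" "v = cls d" "c \<in> carrier G" "d \<in> carrier G"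
      by (auto simp: carrier_TP)
    then show "h (u \<oplus>\<^bsub>TP\<^esub> v) = h u \<oplus>\<^bsub>H\<^esub> h v"
      by (simp add: cls_add h_cls g_add keys_plus_subset)
  next
    fix x y assume "x \<in> carrier M" "y \<in> carrier N"
    then show "h (pt x y) = \<phi> x y" by (simp add: pure_tensor_def h_cls gf keys_frag_of)
  qed
qed

text \<open>The operator is a union over all representatives of a class, so everything hinges on
  these giving one and the same class. They do because the substitution sends each defining relation
  to a defining relation of the same kind.\<close>

lemma tensor_map:
  assumes \<phi>: "\<phi> \<in> carrier M \<rightarrow> carrier M"
    "\<And>x y. \<lbrakk>x \<in> carrier M; y \<in> carrier M\<rbrakk> \<Longrightarrow> \<phi> (x \<oplus>\<^bsub>M\<^esub> y) = \<phi> x \<oplus>\<^bsub>M\<^esub> \<phi> y"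
    "\<And>x b. \<lbrakk>x \<in> carrier M; b \<in> B\<rbrakk> \<Longrightarrow> \<phi> (ract M x b) = ract M (\<phi> x) b"
    and \<psi>: "\<psi> \<in> carrier N \<rightarrow> carrier N"
    "\<And>x y. \<lbrakk>x \<in> carrier N; y \<in> carrier N\<rbrakk> \<Longrightarrow> \<psi> (x \<oplus>\<^bsub>N\<^esub> y) = \<psi> x \<oplus>\<^bsub>N\<^esub> \<psi> y"
    "\<And>y b. \<lbrakk>y \<in> carrier N; b \<in> B\<rbrakk> \<Longrightarrow> \<psi> (b \<odot>\<^bsub>N\<^esub> y) = b \<odot>\<^bsub>N\<^esub> \<psi> y"
  shows "tensor_map B M N \<phi> \<psi> \<in> carrier TP \<rightarrow> carrier TP"
    and "\<lbrakk>u \<in> carrier TP; v \<in> carrier TP\<rbrakk> \<Longrightarrow> tensor_map B M N \<phi> \<psi> (u \<oplus>\<^bsub>TP\<^esub> v) =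
      tensor_map B M N \<phi> \<psi> u \<oplus>\<^bsub>TP\<^esub> tensor_map B M N \<phi> \<psi> v"
    and "\<lbrakk>x \<in> carrier M; y \<in> carrier N\<rbrakk> \<Longrightarrow> tensor_map B M N \<phi> \<psi> (pt x y) = pt (\<phi> x) (\<psi> y)"
proof -
  define E where "E = frag_extend (\<lambda>(x, y). frag_of (\<phi> x, \<psi> y))"
  have E_cl: "E c \<in> carrier G" if "c \<in> carrier G" for c
  proof -
    have "(\<Union>x\<in>Poly_Mapping.keys c. Poly_Mapping.keys (case x of (x, y) \<Rightarrow> frag_of (\<phi> x, \<psi> y))) \<subseteq> carrier M \<times> carrier N"
      using that \<phi>(1) \<psi>(1) by (auto simp: keys_frag_of Pi_iff split: prod.splits)
    then show ?thesis using subset_trans[OF keys_frag_extend] by (simp add: E_def)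
  qed
  have E_add: "E (c + d) = E c + E d" and E_diff: "E (c - d) = E c - E d" for c d
    by (simp_all add: E_def frag_extend_add frag_extend_diff)
  have E_of: "E (frag_of (x, y)) = frag_of (\<phi> x, \<psi> y)" for x y by (simp add: E_def)
  have E_rel: "E r \<in> tensor_rels B M N" if "r \<in> tensor_rels B M N" for r
  proof -
    show ?thesis using that
    proof (cases rule: rels_cases)
      case (left x x' y)
      then have "E r = frag_of (\<phi> x \<oplus>\<^bsub>M\<^esub> \<phi> x', \<psi> y) - frag_of (\<phi> x, \<psi> y) - frag_of (\<phi> x', \<psi> y)"
        by (simp only: E_diff E_of \<phi>(2))
      then show ?thesis using left \<phi>(1) \<psi>(1) by (simp only: funcset_mem rels_memI)
    next
      case (right x y y')
      then have "E r = frag_of (\<phi> x, \<psi> y \<oplus>\<^bsub>N\<^esub> \<psi> y') - frag_of (\<phi> x, \<psi> y) - frag_of (\<phi> x, \<psi> y')"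
        by (simp only: E_diff E_of \<psi>(2))
      then show ?thesis using right \<phi>(1) \<psi>(1) by (simp only: funcset_mem rels_memI)
    next
      case (balanced x b y)
      then have "E r = frag_of (ract M (\<phi> x) b, \<psi> y) - frag_of (\<phi> x, b \<odot>\<^bsub>N\<^esub> \<psi> y)"
        by (simp only: E_diff E_of \<phi>(3) \<psi>(3))
      then show ?thesis using balanced \<phi>(1) \<psi>(1) by (simp only: funcset_mem rels_memI)
    qed
  qed
  have EU: "E u \<in> U" if "u \<in> U" for u
    using that unfolding tensor_null_def
  proof (induction rule: generate.induct)
    case one then show ?case using generate.one[of G] by (simp add: E_def)
  next
    case (incl h) then show ?case by (intro generate.incl E_rel)
  next
    case (inv h)
    have "inv\<^bsub>G\<^esub> h = - h" "inv\<^bsub>G\<^esub> (E h) = - E h"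
      using subsetD[OF rels_closed inv] subsetD[OF rels_closed E_rel[OF inv]]
      by (simp_all only: carrier_free_Abelian_group_iff inv_free_Abelian_group)
    moreover have "E (- h) = - E h" by (simp add: E_def frag_extend_minus)
    ultimately show ?case using generate.inv[OF E_rel[OF inv], of G] by simp
  next
    case (eng h1 h2)
    show ?case using generate.eng[OF eng.IH] by (simp only: mult_free_Abelian_group E_add)
  qed
  have t_cls: "tensor_map B M N \<phi> \<psi> (cls c) = cls (E c)" if "c \<in> carrier G" for c
  proof -
    have "cls (E d) = cls (E c)" if "d \<in> cls c" for d
      using in_clsD[OF that \<open>c \<in> carrier G\<close>] \<open>c \<in> carrier G\<close> E_cl EU
      by (intro cls_eqI) (auto simp: E_diff[symmetric])
    then show ?thesis unfolding tensor_map_def E_def[symmetric] using cls_self[OF that] by blast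
  qed
  show "tensor_map B M N \<phi> \<psi> \<in> carrier TP \<rightarrow> carrier TP"
    using E_cl by (auto simp: carrier_TP t_cls)
  show "tensor_map B M N \<phi> \<psi> (u \<oplus>\<^bsub>TP\<^esub> v) =
      tensor_map B M N \<phi> \<psi> u \<oplus>\<^bsub>TP\<^esub> tensor_map B M N \<phi> \<psi> v"
    if uv: "u \<in> carrier TP" "v \<in> carrier TP"
  proof -
    obtain c d where "u = cls c" "v = cls d" "c \<in> carrier G" "d \<in> carrier G"
      using uv unfolding carrier_TP by blast
    moreover from this have "c + d \<in> carrier G" by (simp add: keys_plus_subset)
    ultimately show ?thesis using E_cl by (simp add: cls_add t_cls E_add)
  qed
  show "tensor_map B M N \<phi> \<psi> (pt x y) = pt (\<phi> x) (\<psi> y)" if "x \<in> carrier M" "y \<in> carrier N"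
    using that by (simp add: pure_tensor_def t_cls E_of keys_frag_of)
qed

lemma lact_tensor:
  assumes "l \<in> L"
  shows "smult TP l \<in> carrier TP \<rightarrow> carrier TP"
    and "\<lbrakk>u \<in> carrier TP; v \<in> carrier TP\<rbrakk> \<Longrightarrow> l \<odot>\<^bsub>TP\<^esub> (u \<oplus>\<^bsub>TP\<^esub> v) = l \<odot>\<^bsub>TP\<^esub> u \<oplus>\<^bsub>TP\<^esub> l \<odot>\<^bsub>TP\<^esub> v"
    and "\<lbrakk>x \<in> carrier M; y \<in> carrier N\<rbrakk> \<Longrightarrow> l \<odot>\<^bsub>TP\<^esub> pt x y = pt (l \<odot>\<^bsub>M\<^esub> x) y"
proof -
  have e: "smult TP l = tensor_map B M N (\<lambda>x. l \<odot>\<^bsub>M\<^esub> x) id"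
    by (simp add: tensor_def Let_def)
  note t = tensor_map[of "\<lambda>x. l \<odot>\<^bsub>M\<^esub> x" id]
  show "smult TP l \<in> carrier TP \<rightarrow> carrier TP" unfolding e
    by (rule t) (use assms in \<open>auto simp: M.lact_closed M.lact_add M.lact_ract\<close>)
  show "l \<odot>\<^bsub>TP\<^esub> (u \<oplus>\<^bsub>TP\<^esub> v) = l \<odot>\<^bsub>TP\<^esub> u \<oplus>\<^bsub>TP\<^esub> l \<odot>\<^bsub>TP\<^esub> v" if "u \<in> carrier TP" "v \<in> carrier TP" unfolding e
    by (rule t) (use that assms in \<open>auto simp: M.lact_closed M.lact_add M.lact_ract\<close>)
  show "l \<odot>\<^bsub>TP\<^esub> pt x y = pt (l \<odot>\<^bsub>M\<^esub> x) y" if "x \<in> carrier M" "y \<in> carrier N" unfolding e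
    by (subst t) (use that assms in \<open>auto simp: M.lact_closed M.lact_add M.lact_ract\<close>)
qed

lemma ract_tensor:
  assumes "r \<in> R"
  shows "(\<lambda>u. ract TP u r) \<in> carrier TP \<rightarrow> carrier TP"
    and "\<lbrakk>u \<in> carrier TP; v \<in> carrier TP\<rbrakk> \<Longrightarrow> ract TP (u \<oplus>\<^bsub>TP\<^esub> v) r = ract TP u r \<oplus>\<^bsub>TP\<^esub> ract TP v r"
    and "\<lbrakk>x \<in> carrier M; y \<in> carrier N\<rbrakk> \<Longrightarrow> ract TP (pt x y) r = pt x (ract N y r)"
proof -
  have e: "ract TP u r = tensor_map B M N id (\<lambda>y. ract N y r) u" for u
    by (simp add: tensor_def Let_def)
  note t = tensor_map[of id "\<lambda>y. ract N y r"]
  show "(\<lambda>u. ract TP u r) \<in> carrier TP \<rightarrow> carrier TP" unfolding e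
    by (rule t) (use assms in \<open>auto simp: N.ract_closed N.ract_add N.lact_ract\<close>)
  show "ract TP (u \<oplus>\<^bsub>TP\<^esub> v) r = ract TP u r \<oplus>\<^bsub>TP\<^esub> ract TP v r" if "u \<in> carrier TP" "v \<in> carrier TP" unfolding e
    by (rule t) (use that assms in \<open>auto simp: N.ract_closed N.ract_add N.lact_ract\<close>)
  show "ract TP (pt x y) r = pt x (ract N y r)" if "x \<in> carrier M" "y \<in> carrier N" unfolding e
    by (subst t) (use that assms in \<open>auto simp: N.ract_closed N.ract_add N.lact_ract\<close>)
qed

lemma bimod_tensor: "bimod L TP R"
proof
  fix l r x assume l: "l \<in> L" and r: "r \<in> R" and x: "x \<in> carrier TP"
  note lt = lact_tensor[OF l] and rt = ract_tensor[OF r]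
  show "ract TP (l \<odot>\<^bsub>TP\<^esub> x) r = l \<odot>\<^bsub>TP\<^esub> ract TP x r" using x
  proof (induction rule: tensor_induct)
    case (pure x y)
    then show ?case using l r by (simp add: lt rt M.lact_closed N.ract_closed)
  next
    case (add u v)
    moreover have "l \<odot>\<^bsub>TP\<^esub> u \<in> carrier TP" "l \<odot>\<^bsub>TP\<^esub> v \<in> carrier TP" "ract TP u r \<in> carrier TP" "ract TP v r \<in> carrier TP"
      using add lt(1) rt(1) by auto
    ultimately show ?case by (simp add: lt rt)
  qed
next
  fix l x assume "l \<in> L" "x \<in> carrier TP"
  then show "l \<odot>\<^bsub>TP\<^esub> x \<in> carrier TP" by (rule funcset_mem[OF lact_tensor(1)])
next
  fix r x assume "r \<in> R" "x \<in> carrier TP"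
  then show "ract TP x r \<in> carrier TP" using ract_tensor(1) by blast
qed (rule lact_tensor(2) ract_tensor(2); assumption)+

end

section \<open>The path algebra and its quotient by the relations\<close>

lemma lookup_pscale: "Poly_Mapping.lookup (pscale c f) k = c * Poly_Mapping.lookup f k"
  by (simp add: pscale_def Poly_Mapping.map.rep_eq when_def)

interpretation pv: vector_space "pscale :: 'f::field \<Rightarrow> ('v, 'e, 'f) pelt \<Rightarrow> ('v, 'e, 'f) pelt"
  by unfold_locales
     (auto intro!: poly_mapping_eqI simp: lookup_pscale lookup_add algebra_simps)

lemma pscale_single: "pscale c (Poly_Mapping.single k d) = Poly_Mapping.single k (c * d)"
  by (simp add: pscale_def)

lemma keys_pscale: "Poly_Mapping.keys (pscale c f) \<subseteq> Poly_Mapping.keys f"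
  by (auto simp: in_keys_iff lookup_pscale)

lemma poly_mapping_sum_single:
  "f = (\<Sum>k\<in>Poly_Mapping.keys f. Poly_Mapping.single k (Poly_Mapping.lookup f k))"
proof (rule poly_mapping_eqI)
  fix k
  show "Poly_Mapping.lookup f k =
    Poly_Mapping.lookup (\<Sum>k\<in>Poly_Mapping.keys f. Poly_Mapping.single k (Poly_Mapping.lookup f k)) k"
    by (cases "k \<in> Poly_Mapping.keys f")
       (auto simp: lookup_sum lookup_single when_def in_keys_iff sum.delta)
qed

lemma poly_mapping_induct [consumes 1, case_names single add]:
  fixes f :: "'k \<Rightarrow>\<^sub>0 'f::comm_monoid_add"
  assumes "Poly_Mapping.keys f \<subseteq> S" and "P 0"
    and "\<And>k c. k \<in> S \<Longrightarrow> P (Poly_Mapping.single k c)"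
    and "\<And>a b. \<lbrakk>Poly_Mapping.keys a \<subseteq> S; Poly_Mapping.keys b \<subseteq> S; P a; P b\<rbrakk> \<Longrightarrow> P (a + b)"
  shows "P f"
proof -
  have "Poly_Mapping.keys (\<Sum>k\<in>K. Poly_Mapping.single k (g k)) \<subseteq> S \<and> P (\<Sum>k\<in>K. Poly_Mapping.single k (g k))"
    if "finite K" "K \<subseteq> S" for K and g :: "'k \<Rightarrow> 'f"
    using that
  proof (induction K rule: finite_induct)
    case empty then show ?case using assms(2) by simp
  next
    case (insert k K)
    have "Poly_Mapping.keys (Poly_Mapping.single k (g k)) \<subseteq> S" using insert by auto
    moreover have "Poly_Mapping.keys (Poly_Mapping.single k (g k) + (\<Sum>k\<in>K. Poly_Mapping.single k (g k))) \<subseteq> S"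
      using insert calculation by (intro subset_trans[OF keys_add] Un_least) auto
    ultimately show ?case using insert assms(3,4) by simp
  qed
  from this[OF finite_keys assms(1)] poly_mapping_sum_single[of f] show ?thesis by metis
qed

text \<open>The product of the path algebra, detached from \<open>F\<close> and \<open>Q\<close>: it
  is defined for all triples, so bilinearity and associativity hold without any carrier
  condition.\<close>

definition pmul :: "('v, 'e, 'f::field) pelt \<Rightarrow> ('v, 'e, 'f) pelt \<Rightarrow> ('v, 'e, 'f) pelt" where
  "pmul f g = (\<Sum>q\<in>Poly_Mapping.keys f. \<Sum>p\<in>Poly_Mapping.keys g.
     pscale (Poly_Mapping.lookup f q * Poly_Mapping.lookup g p) (path_mult q p))"

text \<open>Once all supports are replaced by a common finite superset, bilinearity can be verified
  term by term.\<close>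

lemma pmul_eq:
  assumes "finite A" "Poly_Mapping.keys f \<subseteq> A" "finite B" "Poly_Mapping.keys g \<subseteq> B"
  shows "pmul f g = (\<Sum>q\<in>A. \<Sum>p\<in>B.
     pscale (Poly_Mapping.lookup f q * Poly_Mapping.lookup g p) (path_mult q p))"
proof -
  have "pmul f g = (\<Sum>q\<in>Poly_Mapping.keys f. \<Sum>p\<in>B.
     pscale (Poly_Mapping.lookup f q * Poly_Mapping.lookup g p) (path_mult q p))"
    unfolding pmul_def
    by (rule sum.cong[OF refl]) (rule sum.mono_neutral_left, use assms in \<open>auto simp: in_keys_iff\<close>)
  also have "\<dots> = (\<Sum>q\<in>A. \<Sum>p\<in>B.
     pscale (Poly_Mapping.lookup f q * Poly_Mapping.lookup g p) (path_mult q p))"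
    by (rule sum.mono_neutral_left) (use assms in \<open>auto simp: in_keys_iff\<close>)
  finally show ?thesis .
qed

lemma pmul_add_left: "pmul (f + f') g = pmul f g + pmul f' g"
proof -
  let ?A = "Poly_Mapping.keys f \<union> Poly_Mapping.keys f'" and ?B = "Poly_Mapping.keys g"
  have f: "finite ?A" "finite ?B" by simp_all
  show ?thesis
    by (subst (1 2 3) pmul_eq[of ?A _ ?B]) (use keys_add[of f f'] in
      \<open>auto simp: lookup_add distrib_right pv.scale_left_distrib sum.distrib\<close>)
qed

lemma pmul_add_right: "pmul f (g + g') = pmul f g + pmul f g'"
proof -
  let ?A = "Poly_Mapping.keys f" and ?B = "Poly_Mapping.keys g \<union> Poly_Mapping.keys g'"
  show ?thesis
    by (subst (1 2 3) pmul_eq[of ?A _ ?B]) (use keys_add[of g g'] in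
      \<open>auto simp: lookup_add distrib_left pv.scale_left_distrib sum.distrib\<close>)
qed

lemma pmul_zero [simp]: "pmul 0 g = 0" "pmul f 0 = 0"
  by (simp_all add: pmul_def)

lemma pmul_pscale_left: "pmul (pscale c f) g = pscale c (pmul f g)"
  by (subst (1 2) pmul_eq[of "Poly_Mapping.keys f" _ "Poly_Mapping.keys g"])
     (auto simp: keys_pscale lookup_pscale pv.scale_sum_right mult.assoc)

lemma pmul_pscale_right: "pmul f (pscale c g) = pscale c (pmul f g)"
  by (subst (1 2) pmul_eq[of "Poly_Mapping.keys f" _ "Poly_Mapping.keys g"])
     (auto simp: keys_pscale lookup_pscale pv.scale_sum_right mult.assoc mult.left_commute)

lemma pmul_sum_left: "pmul (\<Sum>i\<in>I. f i) g = (\<Sum>i\<in>I. pmul (f i) g)"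
  by (induction I rule: infinite_finite_induct) (auto simp: pmul_add_left)

lemma pmul_sum_right: "pmul g (\<Sum>i\<in>I. f i) = (\<Sum>i\<in>I. pmul g (f i))"
  by (induction I rule: infinite_finite_induct) (auto simp: pmul_add_right)

lemma pmul_minus_left: "pmul (- f) g = - pmul f g"
  by (metis add_eq_0_iff pmul_add_left pmul_zero(1) add.right_inverse)

lemma pmul_diff_left: "pmul (f - f') g = pmul f g - pmul f' g"
  by (simp only: diff_conv_add_uminus pmul_add_left pmul_minus_left)

lemma pmul_single:
  "pmul (Poly_Mapping.single (l, q, k) c) (Poly_Mapping.single (j, p, i) d) =
    (if k = j then Poly_Mapping.single (l, q @ p, i) (c * d) else 0)"
  by (subst pmul_eq[of "{(l, q, k)}" _ "{(j, p, i)}"]) (auto simp: pscale_single)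

lemma pmul_assoc: "pmul (pmul f g) h = pmul f (pmul g h)"
proof -
  have 1: "pmul (pmul (Poly_Mapping.single x a) (Poly_Mapping.single y b)) (Poly_Mapping.single z c) =
    pmul (Poly_Mapping.single x a) (pmul (Poly_Mapping.single y b) (Poly_Mapping.single z c))" for x y z a b c
    by (cases x; cases y; cases z) (simp add: pmul_single mult.assoc)
  have 2: "pmul (pmul (Poly_Mapping.single x a) (Poly_Mapping.single y b)) h =
    pmul (Poly_Mapping.single x a) (pmul (Poly_Mapping.single y b) h)" for x y a b
    by (rule poly_mapping_induct[of h UNIV]) (auto simp: 1 pmul_add_right)
  have 3: "pmul (pmul (Poly_Mapping.single x a) g) h =
    pmul (Poly_Mapping.single x a) (pmul g h)" for x a
    by (rule poly_mapping_induct[of g UNIV]) (auto simp: 2 pmul_add_right pmul_add_left)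
  show ?thesis
    by (rule poly_mapping_induct[of f UNIV]) (auto simp: 3 pmul_add_left)
qed

lemma path_algebra_sel [simp]:
  "monoid.mult (path_algebra F Q) = pmul" "ring.add (path_algebra F Q) = (+)"
  "ring.zero (path_algebra F Q) = 0" "monoid.one (path_algebra F Q) = (\<Sum>i\<in>verts Q. idem i)"
  unfolding path_algebra_def pmul_def by (auto intro!: ext)

lemma double_quiver_sel [simp]:
  "verts (double_quiver Q) = verts Q"
  unfolding double_quiver_def by simp_all

lemma star_star [simp]: "star (star x) = x" by (cases x) auto
lemma star_neq [simp]: "star x \<noteq> x" "x \<noteq> star x" by (cases x; simp)+
lemma star_eq_iff [simp]: "star x = star y \<longleftrightarrow> x = y" by (metis star_star)
lemma star_arcs [simp]: "star x \<in> arcs (double_quiver Q) \<longleftrightarrow> x \<in> arcs (double_quiver Q)"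
  by (cases x) (auto simp: double_quiver_def)
lemma eps_star [simp]: "eps (star x) = - eps x" by (cases x) auto
lemma eps_neq_0 [simp]: "(eps x :: 'f::field) \<noteq> 0" by (cases x) auto
lemma eps_mult_eps [simp]: "(eps x :: 'f::field) * eps x = 1" by (cases x) auto
lemma head_star [simp]: "head (double_quiver Q) (star x) = tail (double_quiver Q) x"
  by (cases x) (auto simp: double_quiver_def)
lemma tail_star [simp]: "tail (double_quiver Q) (star x) = head (double_quiver Q) x"
  by (cases x) (auto simp: double_quiver_def)

lemma idem_mult_single [simp]:
  "pmul (idem i) (Poly_Mapping.single (l, p, k) c) = (if i = l then Poly_Mapping.single (l, p, k) c else 0)"
  "pmul (Poly_Mapping.single (l, p, k) c) (idem i) = (if k = i then Poly_Mapping.single (l, p, k) c else 0)"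
  by (auto simp: idem_def pmul_single)

lemma arrow_idem [simp]:
  "pmul (idem i) (arrow Q x) = (if i = head (double_quiver Q) x then arrow Q x else 0)"
  "pmul (arrow Q x) (idem i) = (if tail (double_quiver Q) x = i then arrow Q x else 0)"
  by (auto simp: arrow_def)

lemma idem_idem [simp]: "pmul (idem i) (idem j) = (if i = j then idem i else 0)"
  by (simp add: idem_def pmul_single)

lemma arrow_mult_single:
  "pmul (arrow Q x) (Poly_Mapping.single (l, p, k) c) =
    (if tail (double_quiver Q) x = l then Poly_Mapping.single (head (double_quiver Q) x, x # p, k) c else 0)"
  "pmul (Poly_Mapping.single (l, p, k) c) (arrow Q x) =
    (if k = head (double_quiver Q) x then Poly_Mapping.single (l, p @ [x], tail (double_quiver Q) x) c else 0)"
  by (auto simp: arrow_def pmul_single)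

section \<open>The path algebra of the double quiver of a finite quiver\<close>

locale fin_quiver =
  fixes F :: "'f::field itself" and Q :: "('v, 'e) pre_digraph"
  assumes wfQ: "wf_digraph Q" and finite_verts: "finite (verts Q)" and finite_arcs: "finite (arcs Q)"
begin

abbreviation "T \<equiv> path_algebra F Q"
abbreviation "QA \<equiv> arcs (double_quiver Q)"
abbreviation "tgt \<equiv> head (double_quiver Q)"
abbreviation "src \<equiv> tail (double_quiver Q)"
abbreviation ar :: "'e + 'e \<Rightarrow> ('v, 'e, 'f) pelt" where "ar \<equiv> arrow Q"
abbreviation ei :: "'v \<Rightarrow> ('v, 'e, 'f) pelt" where "ei \<equiv> idem"
abbreviation "sg \<equiv> sigma F Q"
abbreviation "RI \<equiv> rel_ideal F Q"
abbreviation "A \<equiv> preprojective F Q"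
abbreviation "pr \<equiv> proj F Q"
abbreviation "phi \<equiv> field_map F Q"

lemma wf_double: "wf_digraph (double_quiver Q)"
  using wfQ by (auto simp: wf_digraph_def double_quiver_def)

lemma finite_QA [simp]: "finite QA"
  using finite_arcs by (simp add: double_quiver_def finite_Plus)

lemma tgt_src_verts [simp]: "x \<in> QA \<Longrightarrow> tgt x \<in> verts Q" "x \<in> QA \<Longrightarrow> src x \<in> verts Q"
  using wf_double unfolding wf_digraph_def by simp_all

lemma path_Nil: "(j, [], i) \<in> paths Q \<longleftrightarrow> i = j \<and> i \<in> verts Q"
  using wf_digraph.awalk_Nil_iff[OF wf_double] by (auto simp: paths_def)

lemma path_append: "(l, q @ p, i) \<in> paths Q \<longleftrightarrow> (\<exists>k. (l, q, k) \<in> paths Q \<and> (k, p, i) \<in> paths Q)"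
proof -
  have *: "pre_digraph.awlast (double_quiver Q) i (rev p) = k"
    if "pre_digraph.awalk (double_quiver Q) i (rev p) k" for k
    using wf_digraph.awlast_of_awalk[OF wf_double that] by (simp add: NOMATCH_def)
  show ?thesis
    unfolding paths_def mem_Collect_eq prod.case rev_append wf_digraph.awalk_append_iff[OF wf_double]
    by (metis *)
qed

lemma path_single: "(l, [x], i) \<in> paths Q \<longleftrightarrow> x \<in> QA \<and> l = tgt x \<and> i = src x"
  by (cases "x \<in> QA") (auto simp: paths_def wf_digraph.awalk_Cons_iff[OF wf_double] wf_digraph.awalk_Nil_iff[OF wf_double])

lemma path_Cons: "(l, x # p, i) \<in> paths Q \<longleftrightarrow> x \<in> QA \<and> l = tgt x \<and> (src x, p, i) \<in> paths Q"
  using path_append[of l "[x]" p i] by (auto simp: path_single)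

lemma path_ends: "(l, p, i) \<in> paths Q \<Longrightarrow> l \<in> verts Q \<and> i \<in> verts Q"
  unfolding paths_def using wf_digraph.awalk_last_in_verts[OF wf_double] wf_digraph.awalk_hd_in_verts[OF wf_double]
  by fastforce

definition "TC = {f :: ('v, 'e, 'f) pelt. Poly_Mapping.keys f \<subseteq> paths Q}"

lemma carrier_T [simp]: "carrier T = TC" by (simp add: path_algebra_def TC_def)

lemma TC_iff: "f \<in> TC \<longleftrightarrow> Poly_Mapping.keys f \<subseteq> paths Q" by (simp add: TC_def)

lemma TC_induct [consumes 1, case_names zero single add]:
  assumes "f \<in> TC" "P 0" "\<And>k c. k \<in> paths Q \<Longrightarrow> P (Poly_Mapping.single k c)"
    "\<And>a b. \<lbrakk>a \<in> TC; b \<in> TC; P a; P b\<rbrakk> \<Longrightarrow> P (a + b)"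
  shows "P f"
  by (rule poly_mapping_induct[of f "paths Q"]) (use assms in \<open>auto simp: TC_iff\<close>)

lemma TC_subspace: "pv.subspace TC"
  by (rule pv.subspaceI) (auto simp: TC_iff dest!: subsetD[OF keys_add] subsetD[OF keys_pscale])

lemma TC_closed:
  "f \<in> TC \<Longrightarrow> g \<in> TC \<Longrightarrow> f + g \<in> TC" "f \<in> TC \<Longrightarrow> pscale c f \<in> TC"
  "f \<in> TC \<Longrightarrow> g \<in> TC \<Longrightarrow> f - g \<in> TC" "0 \<in> TC"  "f \<in> TC \<Longrightarrow> - f \<in> TC"
  by (rule pv.subspace_add[OF TC_subspace] pv.subspace_scale[OF TC_subspace] pv.subspace_diff[OF TC_subspace]
    pv.subspace_0[OF TC_subspace] pv.subspace_neg[OF TC_subspace]; assumption?)+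

lemma TC_sum: "(\<And>i. i \<in> S \<Longrightarrow> f i \<in> TC) \<Longrightarrow> (\<Sum>i\<in>S. f i) \<in> TC"
  by (rule pv.subspace_sum[OF TC_subspace])

lemma single_TC: "k \<in> paths Q \<Longrightarrow> Poly_Mapping.single k c \<in> TC" by (simp add: TC_iff)

lemma pmul_TC: assumes "f \<in> TC" "g \<in> TC" shows "pmul f g \<in> TC"
proof -
  have "path_mult q p \<in> TC" if "q \<in> paths Q" "p \<in> paths Q" for q p
    using that by (cases q; cases p) (auto simp: TC_closed path_append intro!: single_TC)
  then show ?thesis unfolding pmul_def using assms
    by (intro TC_sum TC_closed(2)) (meson TC_iff subsetD)
qed

lemma ei_TC: "i \<in> verts Q \<Longrightarrow> ei i \<in> TC" unfolding idem_def by (rule single_TC) (simp add: path_Nil)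
lemma ar_TC: "x \<in> QA \<Longrightarrow> ar x \<in> TC" unfolding arrow_def by (rule single_TC) (simp add: path_single)

abbreviation "eone \<equiv> (\<Sum>i\<in>verts Q. ei i)"

lemma eone_TC: "eone \<in> TC" by (rule TC_sum) (rule ei_TC)

lemma eone_left: "f \<in> TC \<Longrightarrow> pmul eone f = f"
proof (induction rule: TC_induct)
  case (single k c)
  then have "k \<in> paths Q" .
  moreover obtain l p i where k: "k = (l, p, i)" by (cases k)
  ultimately have "l \<in> verts Q" using path_ends by blast
  then show ?case
    using finite_verts by (simp add: k pmul_sum_left)
qed (auto simp: pmul_add_right)

lemma eone_right: "f \<in> TC \<Longrightarrow> pmul f eone = f"
proof (induction rule: TC_induct)
  case (single k c)
  then have "k \<in> paths Q" .
  moreover obtain l p i where k: "k = (l, p, i)" by (cases k)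
  ultimately have "i \<in> verts Q" using path_ends by blast
  then show ?case
    using finite_verts by (simp add: k pmul_sum_right)
qed (auto simp: pmul_add_left)

lemma ring_T: "ring T"
proof (rule ringI)
  show "abelian_group T"
  proof (rule abelian_groupI)
    fix x assume "x \<in> carrier T"
    then show "\<exists>y\<in>carrier T. y \<oplus>\<^bsub>T\<^esub> x = \<zero>\<^bsub>T\<^esub>" by (intro bexI[of _ "- x"]) (auto simp: TC_closed)
  qed (use TC_closed in \<open>auto simp: add_ac\<close>)
  show "monoid T"
    by (rule monoidI) (use pmul_TC eone_TC eone_left eone_right in \<open>auto simp: pmul_assoc\<close>)
qed (auto simp: pmul_add_left pmul_add_right)

lemma sg_eq: "sg i = (\<Sum>x | x \<in> QA \<and> tgt x = i. pscale (eps x) (pmul (ar x) (ar (star x))))"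
  by (simp add: sigma_def)

lemma sg_TC: "sg i \<in> TC"
  unfolding sg_eq by (rule TC_sum, rule TC_closed, rule pmul_TC; rule ar_TC; simp)

lemma ei_sg: "pmul (ei j) (sg i) = (if i = j then sg i else 0)"
  unfolding sg_eq pmul_sum_right pmul_pscale_right pmul_assoc[symmetric]
  by (auto intro!: sum.cong sum.neutral)

lemma sg_ei: "pmul (sg i) (ei j) = (if i = j then sg i else 0)"
  unfolding sg_eq pmul_sum_left pmul_pscale_left pmul_assoc
  by (auto intro!: sum.cong sum.neutral)

text \<open>\<open>genideal\<close> is an intersection of ideals and gives no access to single
  elements. These products turn out to span the ideal, which provides an induction principle for
  it.\<close>

definition sandwich :: "('v, 'e, 'f) pelt set" where
  "sandwich = {pmul (pmul (Poly_Mapping.single p 1) (sg i)) (Poly_Mapping.single q 1) | p i q.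
     p \<in> paths Q \<and> i \<in> verts Q \<and> q \<in> paths Q}"

lemma sandwichI: "\<lbrakk>p \<in> paths Q; i \<in> verts Q; q \<in> paths Q\<rbrakk> \<Longrightarrow>
    pmul (pmul (Poly_Mapping.single p 1) (sg i)) (Poly_Mapping.single q 1) \<in> sandwich"
  unfolding sandwich_def by blast

lemma sandwich_TC: "sandwich \<subseteq> TC"
  unfolding sandwich_def using pmul_TC sg_TC single_TC by blast

lemma span_TC: "pv.span sandwich \<subseteq> TC"
  by (rule pv.span_minimal[OF sandwich_TC TC_subspace])

lemma single_scale: "Poly_Mapping.single k (c::'f) = pscale c (Poly_Mapping.single k 1)"
  by (simp add: pscale_single)

lemma path_mult_single:
  assumes "k \<in> paths Q" "l \<in> paths Q"
  shows "pmul (Poly_Mapping.single k 1) (Poly_Mapping.single l (1::'f)) = 0 \<or>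
    (\<exists>m\<in>paths Q. pmul (Poly_Mapping.single k 1) (Poly_Mapping.single l (1::'f)) = Poly_Mapping.single m 1)"
proof -
  obtain a p b c q d where k: "k = (a, p, b)" and l: "l = (c, q, d)" by (cases k; cases l)
  show ?thesis
  proof (cases "b = c")
    case True
    then have "(a, p @ q, d) \<in> paths Q" using assms k l path_append by blast
    then show ?thesis using True k l by (auto simp: pmul_single)
  qed (simp add: k l pmul_single)
qed

lemma span_left:
  assumes "f \<in> TC" "u \<in> pv.span sandwich" shows "pmul f u \<in> pv.span sandwich"
proof -
  have "pmul (Poly_Mapping.single k c) u \<in> pv.span sandwich" if k: "k \<in> paths Q" for k c
    using assms(2)
  proof (induction rule: pv.span_induct_alt)
    case base then show ?case by (simp add: pv.span_zero)
  next
    case (step d x y)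
    obtain p i q where x: "x = pmul (pmul (Poly_Mapping.single p 1) (sg i)) (Poly_Mapping.single q 1)"
      "p \<in> paths Q" "i \<in> verts Q" "q \<in> paths Q" using step(1) unfolding sandwich_def by blast
    have e: "pmul (Poly_Mapping.single k 1) x =
      pmul (pmul (pmul (Poly_Mapping.single k 1) (Poly_Mapping.single p 1)) (sg i)) (Poly_Mapping.single q 1)"
      by (simp add: x pmul_assoc)
    have "pmul (Poly_Mapping.single k 1) x \<in> pv.span sandwich"
      using path_mult_single[OF k x(2)]
    proof
      assume "\<exists>m\<in>paths Q. pmul (Poly_Mapping.single k 1) (Poly_Mapping.single p (1::'f)) = Poly_Mapping.single m 1"
      then show ?thesis unfolding e using x by (auto intro!: pv.span_base sandwichI)
    qed (simp add: e pv.span_zero)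
    then have "pmul (Poly_Mapping.single k c) x \<in> pv.span sandwich"
      by (subst single_scale) (simp add: pmul_pscale_left pv.span_scale)
    then show ?case using step by (simp add: pmul_add_right pmul_pscale_right pv.span_add pv.span_scale)
  qed
  note * = this
  show ?thesis
    using assms(1) by (induction f rule: TC_induct) (auto simp: * pmul_add_left pv.span_zero pv.span_add)
qed

lemma span_right:
  assumes "f \<in> TC" "u \<in> pv.span sandwich" shows "pmul u f \<in> pv.span sandwich"
proof -
  have "pmul u (Poly_Mapping.single k c) \<in> pv.span sandwich" if k: "k \<in> paths Q" for k c
    using assms(2)
  proof (induction rule: pv.span_induct_alt)
    case base then show ?case by (simp add: pv.span_zero)
  next
    case (step d x y)
    obtain p i q where x: "x = pmul (pmul (Poly_Mapping.single p 1) (sg i)) (Poly_Mapping.single q 1)"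
      "p \<in> paths Q" "i \<in> verts Q" "q \<in> paths Q" using step(1) unfolding sandwich_def by blast
    have e: "pmul x (Poly_Mapping.single k 1) =
      pmul (pmul (Poly_Mapping.single p 1) (sg i)) (pmul (Poly_Mapping.single q 1) (Poly_Mapping.single k 1))"
      by (simp add: x pmul_assoc)
    have "pmul x (Poly_Mapping.single k 1) \<in> pv.span sandwich"
      using path_mult_single[OF x(4) k]
    proof
      assume "\<exists>m\<in>paths Q. pmul (Poly_Mapping.single q 1) (Poly_Mapping.single k (1::'f)) = Poly_Mapping.single m 1"
      then show ?thesis unfolding e using x by (auto intro!: pv.span_base sandwichI)
    qed (simp add: e pv.span_zero)
    then have "pmul x (Poly_Mapping.single k c) \<in> pv.span sandwich"
      by (subst single_scale) (simp add: pmul_pscale_right pv.span_scale)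
    then show ?case using step by (simp add: pmul_add_left pmul_pscale_left pv.span_add pv.span_scale)
  qed
  note * = this
  show ?thesis
    using assms(1) by (induction f rule: TC_induct) (auto simp: * pmul_add_right pv.span_zero pv.span_add)
qed

lemma ideal_span: "ideal (pv.span sandwich) T"
proof (rule idealI[OF ring_T])
  interpret T: ring T by (rule ring_T)
  show "subgroup (pv.span sandwich) (add_monoid T)"
  proof (rule group.subgroupI[OF T.add.group_axioms])
    fix a assume a: "a \<in> pv.span sandwich"
    then have "a \<in> carrier T" "- a \<in> carrier T" using span_TC TC_closed(5) by auto
    then have "inv\<^bsub>add_monoid T\<^esub> a = - a" using T.minus_equality[of "- a" a] by (simp add: a_inv_def)
    then show "inv\<^bsub>add_monoid T\<^esub> a \<in> pv.span sandwich" using a by (simp add: pv.span_neg)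
  qed (use span_TC in \<open>auto simp: pv.span_add intro: pv.span_zero\<close>)
qed (use span_left span_right in auto)

lemma relations_eq: "relations F Q = pv.span (sg ` verts Q)"
  by (simp add: relations_def)

lemma relations_TC: "relations F Q \<subseteq> TC"
  unfolding relations_eq by (rule pv.span_minimal[OF _ TC_subspace]) (use sg_TC in blast)

lemma ideal_I: "ideal RI T"
  unfolding rel_ideal_def by (rule ring.genideal_ideal[OF ring_T]) (use relations_TC in auto)

text \<open>The span is an ideal that contains every
  \<open>\<sigma>\<^sub>i = e\<^sub>i \<sigma>\<^sub>i e\<^sub>i\<close>. Conversely an ideal is a
  linear subspace, because a scalar acts as multiplication by that multiple of the unit
  element.\<close>

lemma I_eq: "RI = pv.span sandwich"
proof
  have "sg i \<in> pv.span sandwich" if i: "i \<in> verts Q" for i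
  proof -
    have "pmul (pmul (Poly_Mapping.single (i, [], i) 1) (sg i)) (Poly_Mapping.single (i, [], i) 1) = sg i"
      using ei_sg[of i i] sg_ei[of i i] by (simp add: idem_def)
    then show ?thesis using i sandwichI[of "(i, [], i)" i "(i, [], i)"] by (auto simp: path_Nil intro: pv.span_base)
  qed
  then have "relations F Q \<subseteq> pv.span sandwich"
    unfolding relations_eq by (intro pv.span_minimal) auto
  then show "RI \<subseteq> pv.span sandwich" unfolding rel_ideal_def
    by (rule ring.genideal_minimal[OF ring_T ideal_span])
  interpret I: ideal RI T by (rule ideal_I)
  have I_TC: "RI \<subseteq> TC" using I.Icarr by auto
  have r: "relations F Q \<subseteq> RI" unfolding rel_ideal_def
    by (rule ring.genideal_self[OF ring_T]) (use relations_TC in auto)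
  have sc: "pscale c u \<in> RI" if "u \<in> RI" for c u
  proof -
    have "pmul (pscale c eone) u \<in> RI" using I.I_l_closed[OF that, of "pscale c eone"] TC_closed(2)[OF eone_TC] by simp
    moreover have "u \<in> TC" using that I_TC by blast
    ultimately show ?thesis by (simp only: pmul_pscale_left eone_left)
  qed
  have "sandwich \<subseteq> RI"
  proof
    fix x assume "x \<in> sandwich"
    then obtain p i q where x: "x = pmul (pmul (Poly_Mapping.single p 1) (sg i)) (Poly_Mapping.single q 1)"
      "p \<in> paths Q" "i \<in> verts Q" "q \<in> paths Q" unfolding sandwich_def by blast
    have "sg i \<in> RI" using r x(3) pv.span_base[of "sg i" "sg ` verts Q"] unfolding relations_eq by blast
    then have "pmul (Poly_Mapping.single p 1) (sg i) \<in> RI"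
      using I.I_l_closed[of "sg i" "Poly_Mapping.single p 1"] single_TC x(2) by simp
    then show "x \<in> RI" using I.I_r_closed[of _ "Poly_Mapping.single q 1"] single_TC x(1,4) by simp
  qed
  moreover have "pv.subspace RI"
    by (rule pv.subspaceI) (use additive_subgroup.a_closed[OF I.additive_subgroup_axioms]
      additive_subgroup.zero_closed[OF I.additive_subgroup_axioms] sc in simp_all)
  ultimately show "pv.span sandwich \<subseteq> RI" by (rule pv.span_minimal)
qed

lemma I_TC: "RI \<subseteq> TC" using span_TC I_eq by simp

lemma I_subspace: "pv.subspace RI" by (simp add: I_eq)

lemma I_left: "f \<in> TC \<Longrightarrow> u \<in> RI \<Longrightarrow> pmul f u \<in> RI" using span_left by (simp add: I_eq)
lemma I_right: "f \<in> TC \<Longrightarrow> u \<in> RI \<Longrightarrow> pmul u f \<in> RI" using span_right by (simp add: I_eq)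

lemma sg_I: "i \<in> verts Q \<Longrightarrow> sg i \<in> RI"
  using ring.genideal_self[OF ring_T, of "relations F Q"] relations_TC pv.span_base[of "sg i" "sg ` verts Q"]
  unfolding rel_ideal_def relations_eq by auto

section \<open>The quotient algebra \<open>A\<close> and its scalars\<close>

sublocale A: ring A
  unfolding preprojective_def by (rule ideal.quotient_is_ring[OF ideal_I])

lemma proj_hom: "pr \<in> ring_hom T A"
  unfolding preprojective_def proj_def using ideal.rcos_ring_hom[OF ideal_I] by simp

lemma proj_closed: "t \<in> TC \<Longrightarrow> pr t \<in> carrier A"
  using ring_hom_closed[OF proj_hom, of t] by simp

lemma proj_mult: "s \<in> TC \<Longrightarrow> t \<in> TC \<Longrightarrow> pr (pmul s t) = pr s \<otimes>\<^bsub>A\<^esub> pr t"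
  using ring_hom_mult[OF proj_hom, of s t] by simp

lemma proj_add: "s \<in> TC \<Longrightarrow> t \<in> TC \<Longrightarrow> pr (s + t) = pr s \<oplus>\<^bsub>A\<^esub> pr t"
  using ring_hom_add[OF proj_hom, of s t] by simp

lemma proj_one: "pr eone = \<one>\<^bsub>A\<^esub>"
  using ring_hom_one[OF proj_hom] by simp

lemma proj_surj: "a \<in> carrier A \<Longrightarrow> \<exists>t\<in>TC. a = pr t"
  unfolding preprojective_def FactRing_def A_RCOSETS_def RCOSETS_def proj_def a_r_coset_def by auto

lemma proj_eq_iff:
  assumes "s \<in> TC" "t \<in> TC" shows "pr s = pr t \<longleftrightarrow> s - t \<in> RI"
proof -
  interpret T: ring T by (rule ring_T)
  have "s \<ominus>\<^bsub>T\<^esub> t = s - t"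
  proof -
    have "\<ominus>\<^bsub>T\<^esub> t = - t" using assms(2) TC_closed(5) by (intro T.minus_equality) auto
    then show ?thesis by (simp add: a_minus_def)
  qed
  then show ?thesis unfolding proj_def
    using T.quotient_eq_iff_same_a_r_cos[OF ideal_I, of s t] assms by simp
qed

lemma proj_zero_iff: "t \<in> TC \<Longrightarrow> pr t = \<zero>\<^bsub>A\<^esub> \<longleftrightarrow> t \<in> RI"
proof -
  have "pr 0 = \<zero>\<^bsub>A\<^esub>"
    using additive_zero[of T A pr] ring_T A.ring_axioms proj_closed proj_add
    by (auto simp: ring_def)
  then show "t \<in> TC \<Longrightarrow> ?thesis" using proj_eq_iff[of t 0] TC_closed(4) by simp
qed

lemma phi_closed: "phi c \<in> carrier A"
  unfolding field_map_def using proj_closed TC_closed(2)[OF eone_TC] by simp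

lemma phi_mult_proj: assumes "t \<in> TC"
  shows "phi c \<otimes>\<^bsub>A\<^esub> pr t = pr (pscale c t)" "pr t \<otimes>\<^bsub>A\<^esub> phi c = pr (pscale c t)"
  using assms proj_mult[of "pscale c eone" t] proj_mult[of t "pscale c eone"] TC_closed(2)[OF eone_TC]
  by (simp_all add: field_map_def pmul_pscale_left pmul_pscale_right eone_left eone_right)

lemma phi_central: "a \<in> carrier A \<Longrightarrow> phi c \<otimes>\<^bsub>A\<^esub> a = a \<otimes>\<^bsub>A\<^esub> phi c"
  using proj_surj phi_mult_proj by metis

lemma phi_add: "phi (c + d) = phi c \<oplus>\<^bsub>A\<^esub> phi d"
  unfolding field_map_def
  using proj_add[OF TC_closed(2)[OF eone_TC] TC_closed(2)[OF eone_TC]] by (simp add: pv.scale_left_distrib)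

lemma phi_mult: "phi (c * d) = phi c \<otimes>\<^bsub>A\<^esub> phi d"
  using phi_mult_proj(1)[OF TC_closed(2)[OF eone_TC], of c d] by (simp add: field_map_def)

lemma phi_one: "phi 1 = \<one>\<^bsub>A\<^esub>"
  by (simp add: field_map_def proj_one[simplified])

lemma phi_zero: "phi 0 = \<zero>\<^bsub>A\<^esub>"
  using proj_zero_iff[of 0] TC_closed(4) pv.subspace_0[OF I_subspace] by (simp add: field_map_def)

end

section \<open>The Koszul bimodules\<close>

lemma ring_bimodule_sel [simp]:
  "carrier (ring_bimodule \<phi> \<psi> R) = carrier R" "ring.add (ring_bimodule \<phi> \<psi> R) = ring.add R"
  "ring.zero (ring_bimodule \<phi> \<psi> R) = ring.zero R"
  "l \<odot>\<^bsub>ring_bimodule \<phi> \<psi> R\<^esub> m = \<phi> l \<otimes>\<^bsub>R\<^esub> m" "ract (ring_bimodule \<phi> \<psi> R) m r = m \<otimes>\<^bsub>R\<^esub> \<psi> r"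
  by (simp_all add: ring_bimodule_def)

lemma bimod_ring:
  assumes "ring R" "\<And>l. l \<in> L \<Longrightarrow> \<phi> l \<in> carrier R" "\<And>r. r \<in> S \<Longrightarrow> \<psi> r \<in> carrier R"
  shows "bimod L (ring_bimodule \<phi> \<psi> R) S"
proof -
  interpret R: ring R by fact
  have "abelian_group (ring_bimodule \<phi> \<psi> R)"
  proof (rule abelian_groupI)
    fix x assume "x \<in> carrier (ring_bimodule \<phi> \<psi> R)"
    then show "\<exists>y\<in>carrier (ring_bimodule \<phi> \<psi> R). y \<oplus>\<^bsub>ring_bimodule \<phi> \<psi> R\<^esub> x = \<zero>\<^bsub>ring_bimodule \<phi> \<psi> R\<^esub>"
      by (intro bexI[of _ "\<ominus>\<^bsub>R\<^esub> x"]) (simp_all add: R.l_neg)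
  qed (auto simp: R.a_ac)
  then show ?thesis
    by (intro bimod.intro bimod_axioms.intro) (auto simp: assms R.r_distr R.l_distr R.m_assoc)
qed

context fin_quiver begin

section \<open>The spaces \<open>W\<^sub>p\<close> as bimodules over \<open>k\<close>\<close>

abbreviation "kk \<equiv> vertex_ring F Q"

lemma tensor_power_iff: "f \<in> tensor_power F Q n \<longleftrightarrow> f \<in> TC \<and> (\<forall>r\<in>Poly_Mapping.keys f. path_length r = n)"
  by (simp add: tensor_power_def)

lemma tensor_power_TC: "tensor_power F Q n \<subseteq> TC" by (auto simp: tensor_power_iff)

lemma tensor_power_subspace: "pv.subspace (tensor_power F Q n)"
  by (rule pv.subspaceI)
     (auto simp: tensor_power_iff TC_closed dest!: subsetD[OF keys_add] subsetD[OF keys_pscale])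

lemma tensor_power_induct [consumes 1, case_names zero single add]:
  assumes f: "f \<in> tensor_power F Q n" and "P 0"
    and "\<And>k c. k \<in> paths Q \<Longrightarrow> path_length k = n \<Longrightarrow> P (Poly_Mapping.single k c)"
    and "\<And>a b. \<lbrakk>a \<in> tensor_power F Q n; b \<in> tensor_power F Q n; P a; P b\<rbrakk> \<Longrightarrow> P (a + b)"
  shows "P f"
  by (rule poly_mapping_induct[of f "{k \<in> paths Q. path_length k = n}"])
     (use assms in \<open>auto simp: tensor_power_iff TC_iff subset_eq\<close>)

lemma ei_kk: "i \<in> verts Q \<Longrightarrow> ei i \<in> kk"
  by (auto simp: tensor_power_iff ei_TC idem_def dest: ei_TC)

lemma eone_kk: "eone \<in> kk"
  by (rule pv.subspace_sum[OF tensor_power_subspace]) (rule ei_kk)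

lemma kk_induct [consumes 1, case_names zero idem add]:
  assumes f: "f \<in> kk" and "P 0"
    and "\<And>i c. i \<in> verts Q \<Longrightarrow> P (pscale c (ei i))"
    and "\<And>a b. \<lbrakk>a \<in> kk; b \<in> kk; P a; P b\<rbrakk> \<Longrightarrow> P (a + b)"
  shows "P f"
  using f
proof (induction rule: tensor_power_induct)
  case (single k c)
  obtain j p i where k: "k = (j, p, i)" by (cases k)
  have "p = []" using k single by simp
  then have "j = i" "i \<in> verts Q" using single k path_Nil by auto
  then show ?case using assms(3)[of i c] k \<open>p = []\<close> by (simp add: idem_def pscale_single)
qed (use assms in auto)

lemma tensor_power_mult_single:
  assumes "k \<in> paths Q" "path_length k = m" "l \<in> paths Q" "path_length l = n"
  shows "pmul (Poly_Mapping.single k c) (Poly_Mapping.single l d) \<in> tensor_power F Q (m + n)"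
proof -
  obtain a p b e q f where k: "k = (a, p, b)" and l: "l = (e, q, f)" by (cases k; cases l)
  show ?thesis
  proof (cases "b = e")
    case True
    then have "(a, p @ q, f) \<in> paths Q" using assms k l path_append by blast
    then show ?thesis using True k l assms by (auto simp: pmul_single tensor_power_iff single_TC)
  qed (use pv.subspace_0[OF tensor_power_subspace] in \<open>simp add: k l pmul_single\<close>)
qed

lemma tensor_power_mult:
  assumes "f \<in> tensor_power F Q m" "g \<in> tensor_power F Q n"
  shows "pmul f g \<in> tensor_power F Q (m + n)"
  using assms(1)
proof (induction rule: tensor_power_induct)
  case (single k c)
  show ?case using assms(2)
    by (induction rule: tensor_power_induct)
       (use single in \<open>auto simp: tensor_power_mult_single pmul_add_right
         pv.subspace_add[OF tensor_power_subspace] pv.subspace_0[OF tensor_power_subspace]\<close>)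
qed (auto simp: pmul_add_left pv.subspace_add[OF tensor_power_subspace] pv.subspace_0[OF tensor_power_subspace])

lemma W_0: "W F Q 0 = kk" and W_1: "W F Q (Suc 0) = tensor_power F Q 1"
  by (simp_all add: W_def)

lemma W_large:
  assumes "p \<ge> 2"
  shows "W F Q p = (\<Inter>(i, j)\<in>{(i, j). i + 2 + j = p}. pv.span
       {pmul (pmul v r) w | v r w. v \<in> tensor_power F Q i \<and> r \<in> relations F Q \<and> w \<in> tensor_power F Q j})"
  using assms by (simp add: W_def)

lemma W_subspace: "pv.subspace (W F Q p)"
proof (cases "p < 2")
  case True
  then show ?thesis by (simp add: W_def tensor_power_subspace)
next
  case False
  then show ?thesis by (subst W_large) (auto intro!: pv.subspace_Inter)
qed

lemma span_image_closed:
  assumes "\<And>x y. h (x + y) = h x + h y" "\<And>c x. h (pscale c x) = pscale c (h x)"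
    "\<And>x. x \<in> S \<Longrightarrow> h x \<in> pv.span S'" "x \<in> pv.span S"
  shows "h x \<in> pv.span S'"
  using assms(4)
proof (induction rule: pv.span_induct_alt)
  case base
  have "h 0 = 0" using assms(2)[of 0 0] by simp
  then show ?case by (simp add: pv.span_zero)
next
  case (step c x y)
  then show ?case by (simp add: assms pv.span_add pv.span_scale)
qed

lemma W_left: assumes "e \<in> kk" "w \<in> W F Q p" shows "pmul e w \<in> W F Q p"
proof (cases "p < 2")
  case True
  then show ?thesis using tensor_power_mult[OF assms(1), of w p] assms(2) by (simp add: W_def)
next
  case False
  have "pmul e w \<in> pv.span {pmul (pmul v r) w | v r w. v \<in> tensor_power F Q i \<and> r \<in> relations F Q \<and> w \<in> tensor_power F Q j}"
    if "i + 2 + j = p" for i j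
  proof (rule span_image_closed[where h = "pmul e"])
    show "w \<in> pv.span {pmul (pmul v r) w | v r w. v \<in> tensor_power F Q i \<and> r \<in> relations F Q \<and> w \<in> tensor_power F Q j}"
      using assms(2) that False by (subst (asm) W_large) auto
    fix x assume "x \<in> {pmul (pmul v r) w | v r w. v \<in> tensor_power F Q i \<and> r \<in> relations F Q \<and> w \<in> tensor_power F Q j}"
    then obtain v r w where x: "x = pmul (pmul v r) w" "v \<in> tensor_power F Q i" "r \<in> relations F Q" "w \<in> tensor_power F Q j"
      by blast
    have "pmul e x = pmul (pmul (pmul e v) r) w" by (simp add: x pmul_assoc)
    moreover have "pmul e v \<in> tensor_power F Q i" using tensor_power_mult[OF assms(1) x(2)] by simp
    ultimately show "pmul e x \<in> pv.span {pmul (pmul v r) w | v r w. v \<in> tensor_power F Q i \<and> r \<in> relations F Q \<and> w \<in> tensor_power F Q j}"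
      using x by (intro pv.span_base) blast
  qed (auto simp: pmul_add_right pmul_pscale_right)
  then show ?thesis using False by (subst W_large) auto
qed

lemma W_right: assumes "e \<in> kk" "w \<in> W F Q p" shows "pmul w e \<in> W F Q p"
proof (cases "p < 2")
  case True
  then show ?thesis using tensor_power_mult[of w p e 0] assms by (simp add: W_def)
next
  case False
  have "pmul w e \<in> pv.span {pmul (pmul v r) w | v r w. v \<in> tensor_power F Q i \<and> r \<in> relations F Q \<and> w \<in> tensor_power F Q j}"
    if "i + 2 + j = p" for i j
  proof (rule span_image_closed[where h = "\<lambda>w. pmul w e"])
    show "w \<in> pv.span {pmul (pmul v r) w | v r w. v \<in> tensor_power F Q i \<and> r \<in> relations F Q \<and> w \<in> tensor_power F Q j}"
      using assms(2) that False by (subst (asm) W_large) auto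
    fix x assume "x \<in> {pmul (pmul v r) w | v r w. v \<in> tensor_power F Q i \<and> r \<in> relations F Q \<and> w \<in> tensor_power F Q j}"
    then obtain v r w where x: "x = pmul (pmul v r) w" "v \<in> tensor_power F Q i" "r \<in> relations F Q" "w \<in> tensor_power F Q j"
      by blast
    have "pmul x e = pmul (pmul v r) (pmul w e)" by (simp add: x pmul_assoc)
    moreover have "pmul w e \<in> tensor_power F Q j" using tensor_power_mult[OF x(4) assms(1)] by simp
    ultimately show "pmul x e \<in> pv.span {pmul (pmul v r) w | v r w. v \<in> tensor_power F Q i \<and> r \<in> relations F Q \<and> w \<in> tensor_power F Q j}"
      using x by (intro pv.span_base) blast
  qed (auto simp: pmul_add_left pmul_pscale_left)
  then show ?thesis using False by (subst W_large) auto
qed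

lemma W_bimodule_sel [simp]:
  "carrier (W_bimodule F Q p) = W F Q p" "ring.add (W_bimodule F Q p) = (+)" "ring.zero (W_bimodule F Q p) = 0"
  "l \<odot>\<^bsub>W_bimodule F Q p\<^esub> m = pmul l m" "ract (W_bimodule F Q p) m r = pmul m r"
  by (simp_all add: W_bimodule_def ring_bimodule_def)

lemma W_closed: "\<lbrakk>w \<in> W F Q p; w' \<in> W F Q p\<rbrakk> \<Longrightarrow> w + w' \<in> W F Q p" "w \<in> W F Q p \<Longrightarrow> - w \<in> W F Q p"
    "w \<in> W F Q p \<Longrightarrow> pscale c w \<in> W F Q p" "0 \<in> W F Q p"
  by (rule pv.subspace_add[OF W_subspace] pv.subspace_neg[OF W_subspace] pv.subspace_scale[OF W_subspace]
      pv.subspace_0[OF W_subspace]; assumption?)+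

lemma bimod_W: "bimod kk (W_bimodule F Q p) kk"
proof (intro bimod.intro bimod_axioms.intro)
  show "abelian_group (W_bimodule F Q p)"
  proof (rule abelian_groupI)
    fix x assume "x \<in> carrier (W_bimodule F Q p)"
    then show "\<exists>y\<in>carrier (W_bimodule F Q p). y \<oplus>\<^bsub>W_bimodule F Q p\<^esub> x = \<zero>\<^bsub>W_bimodule F Q p\<^esub>"
      by (intro bexI[of _ "- x"]) (auto simp: W_closed)
  qed (auto simp: W_closed add_ac)
qed (auto simp: W_left W_right pmul_add_left pmul_add_right pmul_assoc)

section \<open>Generators, relations and universal property of \<open>K(A)\<^sub>p\<close>\<close>

abbreviation "K \<equiv> koszul F Q"
abbreviation "kt \<equiv> ktensor F Q"
abbreviation "w1 p \<equiv> pure_tensor kk (ring_bimodule id pr A) (W_bimodule F Q p)"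

lemma kk_TC: "e \<in> kk \<Longrightarrow> e \<in> TC" using tensor_power_TC by blast

lemma pair_left: "tensor_pair (carrier A) (ring_bimodule id pr A) kk (W_bimodule F Q p) kk"
  by (intro tensor_pair.intro bimod_W bimod_ring) (auto simp: A.ring_axioms proj_closed kk_TC)

lemma bimod_AW: "bimod (carrier A) (AW F Q p) kk"
  unfolding AW_def by (rule tensor_pair.bimod_tensor[OF pair_left])

lemma pair_right: "tensor_pair (carrier A) (AW F Q p) kk (ring_bimodule pr id A) (carrier A)"
  by (intro tensor_pair.intro bimod_AW bimod_ring) (auto simp: A.ring_axioms proj_closed kk_TC)

lemma bimod_K: "bimod (carrier A) (K p) (carrier A)"
  unfolding koszul_def by (rule tensor_pair.bimod_tensor[OF pair_right])

lemma K_group: "abelian_group (K p)" by (rule bimod.axioms(1)[OF bimod_K])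

lemma kt_eq: "kt p a w b = pure_tensor kk (AW F Q p) (ring_bimodule pr id A) (w1 p a w) b"
  by (simp add: ktensor_def)

lemma w1_closed: "\<lbrakk>a \<in> carrier A; w \<in> W F Q p\<rbrakk> \<Longrightarrow> w1 p a w \<in> carrier (AW F Q p)"
  unfolding AW_def using tensor_pair.pure_closed[OF pair_left, of a w p] by simp

lemma kt_closed: "\<lbrakk>a \<in> carrier A; w \<in> W F Q p; b \<in> carrier A\<rbrakk> \<Longrightarrow> kt p a w b \<in> carrier (K p)"
  unfolding kt_eq koszul_def using tensor_pair.pure_closed[OF pair_right] w1_closed by simp

lemma kt_add1: "\<lbrakk>a \<in> carrier A; a' \<in> carrier A; w \<in> W F Q p; b \<in> carrier A\<rbrakk> \<Longrightarrow>
    kt p (a \<oplus>\<^bsub>A\<^esub> a') w b = kt p a w b \<oplus>\<^bsub>K p\<^esub> kt p a' w b"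
  unfolding kt_eq koszul_def
  using tensor_pair.pure_add_right[OF pair_right] tensor_pair.pure_add_left[OF pair_right, of "w1 p a w" p "w1 p a' w" b]
    tensor_pair.pure_add_left[OF pair_left, of a a' w p] w1_closed[of a w p] w1_closed[of a' w p]
  unfolding AW_def[symmetric] by simp

lemma kt_add2: "\<lbrakk>a \<in> carrier A; w \<in> W F Q p; w' \<in> W F Q p; b \<in> carrier A\<rbrakk> \<Longrightarrow>
    kt p a (w + w') b = kt p a w b \<oplus>\<^bsub>K p\<^esub> kt p a w' b"
  unfolding kt_eq koszul_def
  using tensor_pair.pure_add_left[OF pair_right, of "w1 p a w" p "w1 p a w'" b]
    tensor_pair.pure_add_right[OF pair_left, of a w p w'] w1_closed[of a w p] w1_closed[of a w' p]
  unfolding AW_def[symmetric] by simp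

lemma kt_add3: "\<lbrakk>a \<in> carrier A; w \<in> W F Q p; b \<in> carrier A; b' \<in> carrier A\<rbrakk> \<Longrightarrow>
    kt p a w (b \<oplus>\<^bsub>A\<^esub> b') = kt p a w b \<oplus>\<^bsub>K p\<^esub> kt p a w b'"
  unfolding kt_eq koszul_def
  using tensor_pair.pure_add_right[OF pair_right, of "w1 p a w" p b b'] w1_closed[of a w p] by simp

lemma kt_balanced1: "\<lbrakk>a \<in> carrier A; e \<in> kk; w \<in> W F Q p\<rbrakk> \<Longrightarrow>
    kt p (a \<otimes>\<^bsub>A\<^esub> pr e) w b = kt p a (pmul e w) b"
  unfolding kt_eq using tensor_pair.pure_balanced[OF pair_left, of a e w p] by simp

lemma AW_ract: "\<lbrakk>a \<in> carrier A; e \<in> kk; w \<in> W F Q p\<rbrakk> \<Longrightarrow>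
    ract (AW F Q p) (w1 p a w) e = w1 p a (pmul w e)"
  unfolding AW_def using tensor_pair.ract_tensor(3)[OF pair_left, of e a w p] by simp

lemma kt_balanced2: "\<lbrakk>a \<in> carrier A; e \<in> kk; w \<in> W F Q p; b \<in> carrier A\<rbrakk> \<Longrightarrow>
    kt p a (pmul w e) b = kt p a w (pr e \<otimes>\<^bsub>A\<^esub> b)"
  unfolding kt_eq using tensor_pair.pure_balanced[OF pair_right, of "w1 p a w" p e b] w1_closed[of a w p] AW_ract[of a e w p]
  by simp

lemma K_lact: "\<lbrakk>c \<in> carrier A; a \<in> carrier A; w \<in> W F Q p; b \<in> carrier A\<rbrakk> \<Longrightarrow>
    c \<odot>\<^bsub>K p\<^esub> kt p a w b = kt p (c \<otimes>\<^bsub>A\<^esub> a) w b"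
  unfolding kt_eq koszul_def
  using tensor_pair.lact_tensor(3)[OF pair_right, of c "w1 p a w" p b] w1_closed[of a w p]
    tensor_pair.lact_tensor(3)[OF pair_left, of c a w p]
  unfolding AW_def[symmetric] by simp

lemma K_ract: "\<lbrakk>c \<in> carrier A; a \<in> carrier A; w \<in> W F Q p; b \<in> carrier A\<rbrakk> \<Longrightarrow>
    ract (K p) (kt p a w b) c = kt p a w (b \<otimes>\<^bsub>A\<^esub> c)"
  unfolding kt_eq koszul_def
  using tensor_pair.ract_tensor(3)[OF pair_right, of c "w1 p a w" p b] w1_closed[of a w p] by simp

lemma AW_induct [consumes 1, case_names pure add]:
  assumes u: "u \<in> carrier (AW F Q p)"
    and pure: "\<And>a w. \<lbrakk>a \<in> carrier A; w \<in> W F Q p\<rbrakk> \<Longrightarrow> P (w1 p a w)"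
    and add: "\<And>u v. \<lbrakk>u \<in> carrier (AW F Q p); v \<in> carrier (AW F Q p); P u; P v\<rbrakk> \<Longrightarrow> P (u \<oplus>\<^bsub>AW F Q p\<^esub> v)"
  shows "P u"
proof (rule tensor_pair.tensor_induct[OF pair_left, folded AW_def, OF u])
  show "P (w1 p a w)" if "a \<in> carrier (ring_bimodule id pr A)" "w \<in> carrier (W_bimodule F Q p)" for a w
    using that by (intro pure) simp_all
qed (rule add)

lemma K_induct [consumes 1, case_names pure add]:
  assumes z: "z \<in> carrier (K p)"
    and pure: "\<And>a w b. \<lbrakk>a \<in> carrier A; w \<in> W F Q p; b \<in> carrier A\<rbrakk> \<Longrightarrow> P (kt p a w b)"
    and add: "\<And>u v. \<lbrakk>u \<in> carrier (K p); v \<in> carrier (K p); P u; P v\<rbrakk> \<Longrightarrow> P (u \<oplus>\<^bsub>K p\<^esub> v)"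
  shows "P z"
proof (rule tensor_pair.tensor_induct[OF pair_right, folded koszul_def, OF z])
  let ?p = "pure_tensor kk (AW F Q p) (ring_bimodule pr id A)"
  fix u b assume u: "u \<in> carrier (AW F Q p)" and "b \<in> carrier (ring_bimodule pr id A)"
  then have b: "b \<in> carrier A" by simp
  note pc = tensor_pair.pure_closed[OF pair_right, folded koszul_def]
  show "P (?p u b)" using u
  proof (induction rule: AW_induct)
    case (pure a w)
    then show ?case using assms(2) b by (simp only: kt_eq)
  next
    case (add u v)
    then have "?p (u \<oplus>\<^bsub>AW F Q p\<^esub> v) b = ?p u b \<oplus>\<^bsub>K p\<^esub> ?p v b"
      using tensor_pair.pure_add_left[OF pair_right add(1,2), of b, folded koszul_def] b by simp
    moreover have "?p u b \<in> carrier (K p)" "?p v b \<in> carrier (K p)"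
      using pc[of u p b] pc[of v p b] b add(1,2) by simp_all
    ultimately show ?case using assms(3) add(3,4) by presburger
  qed
qed (rule add)

lemma pscale_one_left: "w \<in> TC \<Longrightarrow> pmul (pscale c eone) w = pscale c w"
  by (simp add: pmul_pscale_left eone_left)
lemma pscale_one_right: "w \<in> TC \<Longrightarrow> pmul w (pscale c eone) = pscale c w"
  by (simp add: pmul_pscale_right eone_right)

lemma W_TC: "w \<in> W F Q p \<Longrightarrow> w \<in> TC"
proof (cases "p < 2")
  case False
  assume "w \<in> W F Q p"
  then have w: "w \<in> pv.span {pmul (pmul v r) w | v r w. v \<in> tensor_power F Q 0 \<and> r \<in> relations F Q \<and> w \<in> tensor_power F Q (p - 2)}"
    using False by (subst (asm) W_large) force+
  have "pv.span {pmul (pmul v r) w | v r w. v \<in> tensor_power F Q 0 \<and> r \<in> relations F Q \<and> w \<in> tensor_power F Q (p - 2)} \<subseteq> TC"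
    by (rule pv.span_minimal[OF _ TC_subspace]) (use tensor_power_TC relations_TC pmul_TC in blast)
  then show ?thesis using w by blast
qed (use tensor_power_TC in \<open>auto simp: W_def\<close>)

text \<open>The scalar is a multiple of the unit of \<open>k\<close>, so it crosses a tensor sign
  over \<open>k\<close>.\<close>

lemma kt_scale1: assumes "a \<in> carrier A" "w \<in> W F Q p"
  shows "kt p (phi c \<otimes>\<^bsub>A\<^esub> a) w b = kt p a (pscale c w) b"
proof -
  have "pscale c eone \<in> kk" by (rule pv.subspace_scale[OF tensor_power_subspace eone_kk])
  from kt_balanced1[OF assms(1) this assms(2)]
  show ?thesis using assms W_TC unfolding phi_central[OF assms(1)]
    by (simp add: pscale_one_left field_map_def)
qed

lemma kt_scale3: assumes "a \<in> carrier A" "w \<in> W F Q p" "b \<in> carrier A"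
  shows "kt p a w (phi c \<otimes>\<^bsub>A\<^esub> b) = kt p a (pscale c w) b"
proof -
  have "pscale c eone \<in> kk" by (rule pv.subspace_scale[OF tensor_power_subspace eone_kk])
  from kt_balanced2[OF assms(1) this assms(2,3)]
  show ?thesis using assms W_TC by (simp add: pscale_one_right field_map_def)
qed

text \<open>Since \<open>k\<close> is spanned by the idempotents of the vertices, balancedness over
  \<open>k\<close> splits into compatibility with scalars and with the \<open>e\<^sub>i\<close>. In
  this form it can be checked for concrete maps.\<close>

lemma K_lift:
  fixes H :: "('h, 'z) ring_scheme"
  assumes H: "abelian_group H"
    and cl: "\<And>a w b. \<lbrakk>a \<in> carrier A; w \<in> W F Q p; b \<in> carrier A\<rbrakk> \<Longrightarrow> f a w b \<in> carrier H"
    and a1: "\<And>a a' w b. \<lbrakk>a \<in> carrier A; a' \<in> carrier A; w \<in> W F Q p; b \<in> carrier A\<rbrakk> \<Longrightarrow>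
      f (a \<oplus>\<^bsub>A\<^esub> a') w b = f a w b \<oplus>\<^bsub>H\<^esub> f a' w b"
    and a2: "\<And>a w w' b. \<lbrakk>a \<in> carrier A; w \<in> W F Q p; w' \<in> W F Q p; b \<in> carrier A\<rbrakk> \<Longrightarrow>
      f a (w + w') b = f a w b \<oplus>\<^bsub>H\<^esub> f a w' b"
    and a3: "\<And>a w b b'. \<lbrakk>a \<in> carrier A; w \<in> W F Q p; b \<in> carrier A; b' \<in> carrier A\<rbrakk> \<Longrightarrow>
      f a w (b \<oplus>\<^bsub>A\<^esub> b') = f a w b \<oplus>\<^bsub>H\<^esub> f a w b'"
    and s1: "\<And>a w b c. \<lbrakk>a \<in> carrier A; w \<in> W F Q p; b \<in> carrier A\<rbrakk> \<Longrightarrow>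
      f (phi c \<otimes>\<^bsub>A\<^esub> a) w b = f a (pscale c w) b"
    and s3: "\<And>a w b c. \<lbrakk>a \<in> carrier A; w \<in> W F Q p; b \<in> carrier A\<rbrakk> \<Longrightarrow>
      f a w (phi c \<otimes>\<^bsub>A\<^esub> b) = f a (pscale c w) b"
    and e1: "\<And>a w b i. \<lbrakk>a \<in> carrier A; w \<in> W F Q p; b \<in> carrier A; i \<in> verts Q\<rbrakk> \<Longrightarrow>
      f (a \<otimes>\<^bsub>A\<^esub> pr (ei i)) w b = f a (pmul (ei i) w) b"
    and e3: "\<And>a w b i. \<lbrakk>a \<in> carrier A; w \<in> W F Q p; b \<in> carrier A; i \<in> verts Q\<rbrakk> \<Longrightarrow>
      f a (pmul w (ei i)) b = f a w (pr (ei i) \<otimes>\<^bsub>A\<^esub> b)"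
  obtains h where "h \<in> carrier (K p) \<rightarrow> carrier H"
    "\<And>u v. \<lbrakk>u \<in> carrier (K p); v \<in> carrier (K p)\<rbrakk> \<Longrightarrow> h (u \<oplus>\<^bsub>K p\<^esub> v) = h u \<oplus>\<^bsub>H\<^esub> h v"
    "\<And>a w b. \<lbrakk>a \<in> carrier A; w \<in> W F Q p; b \<in> carrier A\<rbrakk> \<Longrightarrow> h (kt p a w b) = f a w b"
proof -
  interpret H: abelian_group H by fact
  have z1: "f \<zero>\<^bsub>A\<^esub> w b = \<zero>\<^bsub>H\<^esub>" if "w \<in> W F Q p" "b \<in> carrier A" for w b
    by (rule additive_zero[OF A.abelian_group_axioms H]) (use that cl a1 in auto)
  have z2: "f a 0 b = \<zero>\<^bsub>H\<^esub>" if "a \<in> carrier A" "b \<in> carrier A" for a b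
  proof -
    have "f a \<zero>\<^bsub>W_bimodule F Q p\<^esub> b = \<zero>\<^bsub>H\<^esub>"
      by (rule additive_zero[OF bimod.axioms(1)[OF bimod_W] H]) (use that cl a2 in auto)
    then show ?thesis by simp
  qed
  have z3: "f a w \<zero>\<^bsub>A\<^esub> = \<zero>\<^bsub>H\<^esub>" if "w \<in> W F Q p" "a \<in> carrier A" for w a
    by (rule additive_zero[OF A.abelian_group_axioms H]) (use that cl a3 in auto)
  have p0: "pr 0 = \<zero>\<^bsub>A\<^esub>" using phi_zero by (simp add: field_map_def)
  have ps: "pr (pscale c (ei i)) = phi c \<otimes>\<^bsub>A\<^esub> pr (ei i)" if "i \<in> verts Q" for c i
    using phi_mult_proj(1)[OF ei_TC[OF that]] by simp
  have b1: "f (a \<otimes>\<^bsub>A\<^esub> pr e) w b = f a (pmul e w) b"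
    if a: "a \<in> carrier A" and w: "w \<in> W F Q p" and b: "b \<in> carrier A" and e: "e \<in> kk" for a w b e
    using e
  proof (induction rule: kk_induct)
    case zero show ?case using a w b z1 z2 by (simp add: p0)
  next
    case (idem i c)
    have pe: "pr (ei i) \<in> carrier A" using idem ei_TC proj_closed by blast
    have "a \<otimes>\<^bsub>A\<^esub> pr (pscale c (ei i)) = phi c \<otimes>\<^bsub>A\<^esub> (a \<otimes>\<^bsub>A\<^esub> pr (ei i))"
      using a pe phi_closed idem by (simp add: ps phi_central[of a c] A.m_assoc[symmetric])
    then have "f (a \<otimes>\<^bsub>A\<^esub> pr (pscale c (ei i))) w b = f (a \<otimes>\<^bsub>A\<^esub> pr (ei i)) (pscale c w) b"
      using s1 a w b pe by simp
    also have "\<dots> = f a (pmul (ei i) (pscale c w)) b" using e1 a w b idem W_closed(3) by simp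
    finally show ?case by (simp add: pmul_pscale_left pmul_pscale_right)
  next
    case (add x y)
    then show ?case using a w b
      by (simp add: proj_add kk_TC A.r_distr proj_closed a1 pmul_add_left a2 W_left)
  qed
  have b3: "f a (pmul w e) b = f a w (pr e \<otimes>\<^bsub>A\<^esub> b)"
    if a: "a \<in> carrier A" and w: "w \<in> W F Q p" and b: "b \<in> carrier A" and e: "e \<in> kk" for a w b e
    using e
  proof (induction rule: kk_induct)
    case zero show ?case using a w b z3 z2 by (simp add: p0)
  next
    case (idem i c)
    have pe: "pr (ei i) \<in> carrier A" using idem ei_TC proj_closed by blast
    have "pr (pscale c (ei i)) \<otimes>\<^bsub>A\<^esub> b = phi c \<otimes>\<^bsub>A\<^esub> (pr (ei i) \<otimes>\<^bsub>A\<^esub> b)"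
      using b pe phi_closed idem by (simp add: ps A.m_assoc)
    then have "f a w (pr (pscale c (ei i)) \<otimes>\<^bsub>A\<^esub> b) = f a (pscale c w) (pr (ei i) \<otimes>\<^bsub>A\<^esub> b)"
      using s3 a w b pe by simp
    also have "\<dots> = f a (pmul (pscale c w) (ei i)) b" using e3 a w b idem W_closed(3) by simp
    finally show ?case by (simp add: pmul_pscale_left pmul_pscale_right)
  next
    case (add x y)
    then show ?case using a w b
      by (simp add: proj_add kk_TC A.l_distr proj_closed a3 pmul_add_right a2 W_right)
  qed
  let ?M = "ring_bimodule id pr A" and ?N = "W_bimodule F Q p"
  let ?AW = "AW F Q p"
  have ex: "\<exists>g. g \<in> carrier ?AW \<rightarrow> carrier H \<and>
      (\<forall>u\<in>carrier ?AW. \<forall>v\<in>carrier ?AW. g (u \<oplus>\<^bsub>?AW\<^esub> v) = g u \<oplus>\<^bsub>H\<^esub> g v) \<and>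
      (\<forall>a\<in>carrier A. \<forall>w\<in>W F Q p. g (w1 p a w) = f a w b)" if b: "b \<in> carrier A" for b
    unfolding AW_def
    by (rule tensor_pair.tensor_lift[OF pair_left H, where \<phi> = "\<lambda>a w. f a w b"])
       (use b cl a1 a2 b1 in auto)
  \<comment> \<open>The tensor product is nested: for each fixed \<open>b\<close> the map is first
    lifted to \<open>AW\<close>. Additivity and balancedness in \<open>b\<close> then follow from
    the values on \<open>a \<otimes> w\<close>, and permit the second lift.\<close>
  define g where "g b = (SOME g. g \<in> carrier ?AW \<rightarrow> carrier H \<and>
      (\<forall>u\<in>carrier ?AW. \<forall>v\<in>carrier ?AW. g (u \<oplus>\<^bsub>?AW\<^esub> v) = g u \<oplus>\<^bsub>H\<^esub> g v) \<and>
      (\<forall>a\<in>carrier A. \<forall>w\<in>W F Q p. g (w1 p a w) = f a w b))" for b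
  have g: "g b \<in> carrier ?AW \<rightarrow> carrier H"
      "\<And>u v. \<lbrakk>u \<in> carrier ?AW; v \<in> carrier ?AW\<rbrakk> \<Longrightarrow> g b (u \<oplus>\<^bsub>?AW\<^esub> v) = g b u \<oplus>\<^bsub>H\<^esub> g b v"
      "\<And>a w. \<lbrakk>a \<in> carrier A; w \<in> W F Q p\<rbrakk> \<Longrightarrow> g b (w1 p a w) = f a w b" if b: "b \<in> carrier A" for b
    using someI_ex[OF ex[OF b], folded g_def] by blast+
  have gc: "g b u \<in> carrier H" if "b \<in> carrier A" "u \<in> carrier ?AW" for b u using g(1) that by blast
  have AWc: "u \<oplus>\<^bsub>?AW\<^esub> v \<in> carrier ?AW" if "u \<in> carrier ?AW" "v \<in> carrier ?AW" for u v
    using that bimod.axioms(1)[OF bimod_AW] by (meson abelian_groupE(1))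
  have gadd: "g (b \<oplus>\<^bsub>A\<^esub> b') u = g b u \<oplus>\<^bsub>H\<^esub> g b' u"
    if b: "b \<in> carrier A" "b' \<in> carrier A" and u: "u \<in> carrier ?AW" for b b' u
    using u
  proof (induction rule: AW_induct)
    case (pure a w) then show ?case using b a3 by (simp add: g)
  next
    case (add u v)
    then show ?case using b by (simp add: g(2) gc H.a_ac)
  qed
  have gbal: "g b (ract ?AW u e) = g (pr e \<otimes>\<^bsub>A\<^esub> b) u"
    if b: "b \<in> carrier A" "e \<in> kk" and u: "u \<in> carrier ?AW" for b e u
    using u
  proof (induction rule: AW_induct)
    case (pure a w)
    then show ?case using b b3 by (simp add: AW_ract g W_right proj_closed kk_TC)
  next
    case (add u v)
    then show ?case
      using b bimod.ract_closed[OF bimod_AW b(2)] bimod.ract_add[OF bimod_AW b(2) add(1,2)]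
      by (simp add: g(2) proj_closed kk_TC)
  qed
  show thesis
    by (rule tensor_pair.tensor_lift[OF pair_right H, where \<phi> = "\<lambda>u b. g b u" and p1 = p])
       (use g gc gadd gbal that w1_closed in \<open>auto simp: koszul_def kt_eq\<close>)
qed

end

section \<open>The Koszul differential\<close>

context fin_quiver begin

sublocale Kg: abelian_group "K p" for p by (rule K_group)

section \<open>Splitting off an arrow on the left or on the right\<close>

lemma lookup_idem_mult:
  "Poly_Mapping.lookup (pmul (ei j) f) (l, p, i) = (if l = j then Poly_Mapping.lookup f (l, p, i) else 0)"
  "Poly_Mapping.lookup (pmul f (ei j)) (l, p, i) = (if i = j then Poly_Mapping.lookup f (l, p, i) else 0)"
proof -
  show "Poly_Mapping.lookup (pmul (ei j) f) (l, p, i) = (if l = j then Poly_Mapping.lookup f (l, p, i) else 0)"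
  proof (rule poly_mapping_induct[of f UNIV])
    fix k c show "Poly_Mapping.lookup (pmul (ei j) (Poly_Mapping.single k c)) (l, p, i) =
        (if l = j then Poly_Mapping.lookup (Poly_Mapping.single k c) (l, p, i) else 0)"
      by (cases k) (auto simp: lookup_single when_def)
  qed (auto simp: pmul_add_right lookup_add)
  show "Poly_Mapping.lookup (pmul f (ei j)) (l, p, i) = (if i = j then Poly_Mapping.lookup f (l, p, i) else 0)"
  proof (rule poly_mapping_induct[of f UNIV])
    fix k c show "Poly_Mapping.lookup (pmul (Poly_Mapping.single k c) (ei j)) (l, p, i) =
        (if i = j then Poly_Mapping.lookup (Poly_Mapping.single k c) (l, p, i) else 0)"
      by (cases k) (auto simp: lookup_single when_def)
  qed (auto simp: pmul_add_left lookup_add)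
qed

lemma lookup_arrow_mult:
  "Poly_Mapping.lookup (pmul (ar x) f) (l, y # p, i) =
    (if x = y \<and> l = tgt x then Poly_Mapping.lookup f (src x, p, i) else 0)"
  "Poly_Mapping.lookup (pmul f (ar x)) (l, p @ [y], i) =
    (if x = y \<and> i = src x then Poly_Mapping.lookup f (l, p, tgt x) else 0)"
proof -
  show "Poly_Mapping.lookup (pmul (ar x) f) (l, y # p, i) =
    (if x = y \<and> l = tgt x then Poly_Mapping.lookup f (src x, p, i) else 0)"
  proof (rule poly_mapping_induct[of f UNIV])
    fix k c show "Poly_Mapping.lookup (pmul (ar x) (Poly_Mapping.single k c)) (l, y # p, i) =
        (if x = y \<and> l = tgt x then Poly_Mapping.lookup (Poly_Mapping.single k c) (src x, p, i) else 0)"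
      by (cases k) (auto simp: arrow_mult_single lookup_single when_def)
  qed (auto simp: pmul_add_right lookup_add)
  show "Poly_Mapping.lookup (pmul f (ar x)) (l, p @ [y], i) =
    (if x = y \<and> i = src x then Poly_Mapping.lookup f (l, p, tgt x) else 0)"
  proof (rule poly_mapping_induct[of f UNIV])
    fix k c show "Poly_Mapping.lookup (pmul (Poly_Mapping.single k c) (ar x)) (l, p @ [y], i) =
        (if x = y \<and> i = src x then Poly_Mapping.lookup (Poly_Mapping.single k c) (l, p, tgt x) else 0)"
    proof -
      obtain l' p' i' where k: "k = (l', p', i')" by (cases k)
      show ?thesis
        by (cases "i' = tgt x"; cases "x = y"; cases "i = src x")
           (simp_all add: k arrow_mult_single lookup_single when_def)
    qed
  qed (auto simp: pmul_add_left lookup_add)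
qed

text \<open>The coefficient of a path whose leftmost arrow is \<open>y\<close> comes from the
  summand of \<open>y\<close> alone. Paths in \<open>u y\<close> that do not end at the source of
  \<open>y\<close> are annihilated by the arrow and leave no trace, hence the idempotent.\<close>

lemma arrow_sum_left_cancel:
  assumes "(\<Sum>x\<in>QA. pmul (ar x) (u x)) = (\<Sum>x\<in>QA. pmul (ar x) (u' x))" "y \<in> QA"
  shows "pmul (ei (src y)) (u y) = pmul (ei (src y)) (u' y)"
proof (rule poly_mapping_eqI)
  fix k :: "('v, 'e) path" obtain l p i where k: "k = (l, p, i)" by (cases k)
  have *: "Poly_Mapping.lookup (\<Sum>x\<in>QA. pmul (ar x) (u x)) (tgt y, y # p, i) = Poly_Mapping.lookup (u y) (src y, p, i)" for u
  proof -
    have "Poly_Mapping.lookup (\<Sum>x\<in>QA. pmul (ar x) (u x)) (tgt y, y # p, i) =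
      (\<Sum>x\<in>QA. if x = y then Poly_Mapping.lookup (u y) (src y, p, i) else 0)"
      unfolding lookup_sum by (rule sum.cong) (auto simp: lookup_arrow_mult)
    then show ?thesis using assms(2) by simp
  qed
  show "Poly_Mapping.lookup (pmul (ei (src y)) (u y)) k = Poly_Mapping.lookup (pmul (ei (src y)) (u' y)) k"
    using *[of u] *[of u'] assms(1) by (simp add: k lookup_idem_mult)
qed

lemma arrow_sum_right_cancel:
  assumes "(\<Sum>x\<in>QA. pmul (u x) (ar x)) = (\<Sum>x\<in>QA. pmul (u' x) (ar x))" "y \<in> QA"
  shows "pmul (u y) (ei (tgt y)) = pmul (u' y) (ei (tgt y))"
proof (rule poly_mapping_eqI)
  fix k :: "('v, 'e) path" obtain l p i where k: "k = (l, p, i)" by (cases k)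
  have *: "Poly_Mapping.lookup (\<Sum>x\<in>QA. pmul (u x) (ar x)) (l, p @ [y], src y) = Poly_Mapping.lookup (u y) (l, p, tgt y)" for u
  proof -
    have "Poly_Mapping.lookup (\<Sum>x\<in>QA. pmul (u x) (ar x)) (l, p @ [y], src y) =
      (\<Sum>x\<in>QA. if x = y then Poly_Mapping.lookup (u y) (l, p, tgt y) else 0)"
      unfolding lookup_sum by (rule sum.cong) (auto simp: lookup_arrow_mult)
    then show ?thesis using assms(2) by simp
  qed
  show "Poly_Mapping.lookup (pmul (u y) (ei (tgt y))) k = Poly_Mapping.lookup (pmul (u' y) (ei (tgt y))) k"
    using *[of u] *[of u'] assms(1) by (simp add: k lookup_idem_mult)
qed

text \<open>\<open>rep p w u v\<close> says that \<open>u\<close> and \<open>v\<close> are the two ways of writing \<open>w \<in> W\<^sub>p\<close> in the definition of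
  the differential.\<close>

definition rep :: "nat \<Rightarrow> ('v, 'e, 'f) pelt \<Rightarrow> ('e + 'e \<Rightarrow> ('v, 'e, 'f) pelt) \<Rightarrow> ('e + 'e \<Rightarrow> ('v, 'e, 'f) pelt) \<Rightarrow> bool" where
  "rep p w u v \<longleftrightarrow> (\<forall>x\<in>QA. u x \<in> W F Q (p - 1) \<and> v x \<in> W F Q (p - 1)) \<and>
     w = (\<Sum>x\<in>QA. pmul (ar x) (u x)) \<and> w = (\<Sum>x\<in>QA. pmul (v x) (ar x))"

lemma rep_add: "rep p w u v \<Longrightarrow> rep p w' u' v' \<Longrightarrow> rep p (w + w') (\<lambda>x. u x + u' x) (\<lambda>x. v x + v' x)"
  by (auto simp: rep_def W_closed pmul_add_left pmul_add_right sum.distrib)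

lemma rep_scale: "rep p w u v \<Longrightarrow> rep p (pscale c w) (\<lambda>x. pscale c (u x)) (\<lambda>x. pscale c (v x))"
  unfolding rep_def by (auto simp: W_closed pmul_pscale_left pmul_pscale_right pv.scale_sum_right[symmetric])

lemma rep_closed: "rep p w u v \<Longrightarrow> x \<in> QA \<Longrightarrow> u x \<in> W F Q (p - 1)" "rep p w u v \<Longrightarrow> x \<in> QA \<Longrightarrow> v x \<in> W F Q (p - 1)"
  by (auto simp: rep_def)

lemma rep_zero: "rep p 0 (\<lambda>x. 0) (\<lambda>x. 0)"
  by (auto simp: rep_def W_closed)

lemma rep_left: assumes "rep p w u v" "i \<in> verts Q"
  shows "rep p (pmul (ei i) w) (\<lambda>x. if tgt x = i then u x else 0) (\<lambda>x. pmul (ei i) (v x))"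
proof -
  have w: "w = (\<Sum>x\<in>QA. pmul (ar x) (u x))" "w = (\<Sum>x\<in>QA. pmul (v x) (ar x))"
    using assms(1) unfolding rep_def by blast+
  have "pmul (ei i) w = (\<Sum>x\<in>QA. pmul (ar x) (if tgt x = i then u x else 0))"
    by (subst w(1)) (auto simp: pmul_sum_right pmul_assoc[symmetric] intro!: sum.cong)
  moreover have "pmul (ei i) w = (\<Sum>x\<in>QA. pmul (pmul (ei i) (v x)) (ar x))"
    by (subst w(2)) (simp add: pmul_sum_right pmul_assoc)
  moreover have "u x \<in> W F Q (p - 1) \<and> v x \<in> W F Q (p - 1)" if "x \<in> QA" for x
    using that assms(1) by (simp add: rep_def)
  ultimately show ?thesis unfolding rep_def using assms(2) by (simp add: W_closed W_left ei_kk)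
qed

lemma rep_right: assumes "rep p w u v" "i \<in> verts Q"
  shows "rep p (pmul w (ei i)) (\<lambda>x. pmul (u x) (ei i)) (\<lambda>x. if src x = i then v x else 0)"
proof -
  have w: "w = (\<Sum>x\<in>QA. pmul (ar x) (u x))" "w = (\<Sum>x\<in>QA. pmul (v x) (ar x))"
    using assms(1) unfolding rep_def by blast+
  have "pmul w (ei i) = (\<Sum>x\<in>QA. pmul (if src x = i then v x else 0) (ar x))"
    by (subst w(2)) (auto simp: pmul_sum_left pmul_assoc intro!: sum.cong)
  moreover have "pmul w (ei i) = (\<Sum>x\<in>QA. pmul (ar x) (pmul (u x) (ei i)))"
    by (subst w(1)) (simp add: pmul_sum_left pmul_assoc)
  moreover have "u x \<in> W F Q (p - 1) \<and> v x \<in> W F Q (p - 1)" if "x \<in> QA" for x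
    using that assms(1) by (simp add: rep_def)
  ultimately show ?thesis unfolding rep_def using assms(2) by (simp add: W_closed W_right ei_kk)
qed

text \<open>The left factor belonging to \<open>x\<close> is unique up to paths not ending at the
  source of \<open>x\<close>. Multiplication by the idempotent removes them, so the result is
  independent of the choice.\<close>

definition ls :: "nat \<Rightarrow> 'e + 'e \<Rightarrow> ('v, 'e, 'f) pelt \<Rightarrow> ('v, 'e, 'f) pelt" where
  "ls p x w = pmul (ei (src x)) ((SOME u. \<exists>v. rep p w u v) x)"

definition rs :: "nat \<Rightarrow> 'e + 'e \<Rightarrow> ('v, 'e, 'f) pelt \<Rightarrow> ('v, 'e, 'f) pelt" where
  "rs p x w = pmul ((SOME v. \<exists>u. rep p w u v) x) (ei (tgt x))"

lemma ls_eq: assumes "rep p w u v" "x \<in> QA" shows "ls p x w = pmul (ei (src x)) (u x)"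
proof -
  have "\<exists>v. rep p w (SOME u. \<exists>v. rep p w u v) v" using assms(1) by (intro someI[of "\<lambda>u. \<exists>v. rep p w u v"]) blast
  then show ?thesis unfolding ls_def using assms by (intro arrow_sum_left_cancel) (auto simp: rep_def)
qed

lemma rs_eq: assumes "rep p w u v" "x \<in> QA" shows "rs p x w = pmul (v x) (ei (tgt x))"
proof -
  have "\<exists>u. rep p w u (SOME v. \<exists>u. rep p w u v)" using assms(1) by (intro someI[of "\<lambda>v. \<exists>u. rep p w u v"]) blast
  then show ?thesis unfolding rs_def using assms by (intro arrow_sum_right_cancel) (auto simp: rep_def)
qed

text \<open>The containment of \<open>W\<^sub>p\<close> in
  \<open>V W\<^sub>p\<^sub>-\<^sub>1\<close> and in \<open>W\<^sub>p\<^sub>-\<^sub>1 V\<close>. It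
  will be established in degrees 1, 2 and 3, from explicit spanning sets.\<close>

definition has_reps :: "nat \<Rightarrow> bool" where
  "has_reps p \<longleftrightarrow> (\<forall>w\<in>W F Q p. \<exists>u v. rep p w u v)"

context
  fixes p assumes reps: "has_reps p"
begin

lemma getrep: assumes "w \<in> W F Q p" obtains u v where "rep p w u v"
  using reps assms unfolding has_reps_def by blast

lemma ls_closed: "w \<in> W F Q p \<Longrightarrow> x \<in> QA \<Longrightarrow> ls p x w \<in> W F Q (p - 1)"
  by (erule getrep) (simp add: ls_eq W_left ei_kk rep_closed del: One_nat_def)
lemma rs_closed: "w \<in> W F Q p \<Longrightarrow> x \<in> QA \<Longrightarrow> rs p x w \<in> W F Q (p - 1)"
  by (erule getrep) (simp add: rs_eq W_right ei_kk rep_closed del: One_nat_def)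

lemma ls_add: "\<lbrakk>w \<in> W F Q p; w' \<in> W F Q p; x \<in> QA\<rbrakk> \<Longrightarrow> ls p x (w + w') = ls p x w + ls p x w'"
  by (erule getrep, erule getrep) (simp add: ls_eq rep_add ls_eq[OF rep_add] pmul_add_right)
lemma rs_add: "\<lbrakk>w \<in> W F Q p; w' \<in> W F Q p; x \<in> QA\<rbrakk> \<Longrightarrow> rs p x (w + w') = rs p x w + rs p x w'"
  by (erule getrep, erule getrep) (simp add: rs_eq rs_eq[OF rep_add] pmul_add_left)
lemma ls_scale: "\<lbrakk>w \<in> W F Q p; x \<in> QA\<rbrakk> \<Longrightarrow> ls p x (pscale c w) = pscale c (ls p x w)"
  by (erule getrep) (simp add: ls_eq ls_eq[OF rep_scale] pmul_pscale_right)
lemma rs_scale: "\<lbrakk>w \<in> W F Q p; x \<in> QA\<rbrakk> \<Longrightarrow> rs p x (pscale c w) = pscale c (rs p x w)"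
  by (erule getrep) (simp add: rs_eq rs_eq[OF rep_scale] pmul_pscale_left)
lemma ls_left: "\<lbrakk>w \<in> W F Q p; x \<in> QA; i \<in> verts Q\<rbrakk> \<Longrightarrow> ls p x (pmul (ei i) w) = (if tgt x = i then ls p x w else 0)"
  by (erule getrep) (simp add: ls_eq ls_eq[OF rep_left])
lemma rs_left: "\<lbrakk>w \<in> W F Q p; x \<in> QA; i \<in> verts Q\<rbrakk> \<Longrightarrow> rs p x (pmul (ei i) w) = pmul (ei i) (rs p x w)"
  by (erule getrep) (simp add: rs_eq rs_eq[OF rep_left] pmul_assoc)
lemma ls_right: "\<lbrakk>w \<in> W F Q p; x \<in> QA; i \<in> verts Q\<rbrakk> \<Longrightarrow> ls p x (pmul w (ei i)) = pmul (ls p x w) (ei i)"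
  by (erule getrep) (simp add: ls_eq ls_eq[OF rep_right] pmul_assoc)
lemma rs_right: "\<lbrakk>w \<in> W F Q p; x \<in> QA; i \<in> verts Q\<rbrakk> \<Longrightarrow> rs p x (pmul w (ei i)) = (if src x = i then rs p x w else 0)"
  by (erule getrep) (simp add: rs_eq rs_eq[OF rep_right])

end

lemma phi_lcomm: "a \<in> carrier A \<Longrightarrow> b \<in> carrier A \<Longrightarrow> a \<otimes>\<^bsub>A\<^esub> (phi s \<otimes>\<^bsub>A\<^esub> b) = phi s \<otimes>\<^bsub>A\<^esub> (a \<otimes>\<^bsub>A\<^esub> b)"
  by (metis A.m_assoc phi_central phi_closed)

lemma ar_A: "x \<in> QA \<Longrightarrow> pr (ar x) \<in> carrier A" by (rule proj_closed[OF ar_TC])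
lemma ei_A: "i \<in> verts Q \<Longrightarrow> pr (ei i) \<in> carrier A" by (rule proj_closed[OF ei_TC])

lemma pr_ar_ei: "x \<in> QA \<Longrightarrow> i \<in> verts Q \<Longrightarrow> pr (ar x) \<otimes>\<^bsub>A\<^esub> pr (ei i) = (if src x = i then pr (ar x) else \<zero>\<^bsub>A\<^esub>)"
  using proj_mult[OF ar_TC ei_TC, of x i] proj_zero_iff[OF TC_closed(4)] pv.subspace_0[OF I_subspace] by auto

lemma pr_ei_ar: "x \<in> QA \<Longrightarrow> i \<in> verts Q \<Longrightarrow> pr (ei i) \<otimes>\<^bsub>A\<^esub> pr (ar x) = (if i = tgt x then pr (ar x) else \<zero>\<^bsub>A\<^esub>)"
  using proj_mult[OF ei_TC ar_TC, of i x] proj_zero_iff[OF TC_closed(4)] pv.subspace_0[OF I_subspace] by auto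

lemma kt_zero: "\<lbrakk>w \<in> W F Q p; b \<in> carrier A\<rbrakk> \<Longrightarrow> kt p \<zero>\<^bsub>A\<^esub> w b = \<zero>\<^bsub>K p\<^esub>"
  "\<lbrakk>a \<in> carrier A; b \<in> carrier A\<rbrakk> \<Longrightarrow> kt p a 0 b = \<zero>\<^bsub>K p\<^esub>"
  "\<lbrakk>a \<in> carrier A; w \<in> W F Q p\<rbrakk> \<Longrightarrow> kt p a w \<zero>\<^bsub>A\<^esub> = \<zero>\<^bsub>K p\<^esub>"
proof -
  show "\<lbrakk>w \<in> W F Q p; b \<in> carrier A\<rbrakk> \<Longrightarrow> kt p \<zero>\<^bsub>A\<^esub> w b = \<zero>\<^bsub>K p\<^esub>"
    by (rule additive_zero[OF A.abelian_group_axioms K_group]) (auto simp: kt_closed kt_add1)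
  show "\<lbrakk>a \<in> carrier A; w \<in> W F Q p\<rbrakk> \<Longrightarrow> kt p a w \<zero>\<^bsub>A\<^esub> = \<zero>\<^bsub>K p\<^esub>"
    by (rule additive_zero[OF A.abelian_group_axioms K_group]) (auto simp: kt_closed kt_add3)
  have "\<lbrakk>a \<in> carrier A; b \<in> carrier A\<rbrakk> \<Longrightarrow> kt p a \<zero>\<^bsub>W_bimodule F Q p\<^esub> b = \<zero>\<^bsub>K p\<^esub>"
    by (rule additive_zero[OF bimod.axioms(1)[OF bimod_W] K_group]) (auto simp: kt_closed kt_add2)
  then show "\<lbrakk>a \<in> carrier A; b \<in> carrier A\<rbrakk> \<Longrightarrow> kt p a 0 b = \<zero>\<^bsub>K p\<^esub>" by simp
qed

section \<open>The two halves of the differential\<close>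

definition dl where "dl q u a b = (\<Oplus>\<^bsub>K q\<^esub>x\<in>QA. kt q (a \<otimes>\<^bsub>A\<^esub> pr (ar x)) (u x) b)"
definition dr where "dr q v a b = (\<Oplus>\<^bsub>K q\<^esub>x\<in>QA. kt q a (v x) (pr (ar x) \<otimes>\<^bsub>A\<^esub> b))"

text \<open>In \<open>A\<close> an arrow absorbs the idempotent of its source, and this idempotent
  crosses the tensor sign. So the half does not see the part of \<open>u\<close> that is left
  undetermined.\<close>

lemma dl_strip:
  assumes "\<And>x. x \<in> QA \<Longrightarrow> u x \<in> W F Q q" "a \<in> carrier A" "b \<in> carrier A"
  shows "dl q u a b = dl q (\<lambda>x. pmul (ei (src x)) (u x)) a b"
  unfolding dl_def
proof (rule Kg.finsum_cong')
  fix x assume x: "x \<in> QA"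
  then have "pr (ar x) = pr (ar x) \<otimes>\<^bsub>A\<^esub> pr (ei (src x))" using pr_ar_ei[of x "src x"] by simp
  then have "kt q (a \<otimes>\<^bsub>A\<^esub> pr (ar x)) (u x) b = kt q (a \<otimes>\<^bsub>A\<^esub> pr (ar x) \<otimes>\<^bsub>A\<^esub> pr (ei (src x))) (u x) b"
    using assms x by (simp add: A.m_assoc ar_A ei_A)
  also have "\<dots> = kt q (a \<otimes>\<^bsub>A\<^esub> pr (ar x)) (pmul (ei (src x)) (u x)) b"
    using assms x by (intro kt_balanced1) (auto simp: ar_A ei_kk)
  finally show "kt q (a \<otimes>\<^bsub>A\<^esub> pr (ar x)) (u x) b = kt q (a \<otimes>\<^bsub>A\<^esub> pr (ar x)) (pmul (ei (src x)) (u x)) b" .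
qed (use assms in \<open>auto simp: ar_A ei_kk W_left kt_closed\<close>)

lemma dr_strip:
  assumes "\<And>x. x \<in> QA \<Longrightarrow> v x \<in> W F Q q" "a \<in> carrier A" "b \<in> carrier A"
  shows "dr q v a b = dr q (\<lambda>x. pmul (v x) (ei (tgt x))) a b"
  unfolding dr_def
proof (rule Kg.finsum_cong')
  fix x assume x: "x \<in> QA"
  then have "pr (ar x) = pr (ei (tgt x)) \<otimes>\<^bsub>A\<^esub> pr (ar x)" using pr_ei_ar[of x "tgt x"] by simp
  then have "kt q a (v x) (pr (ar x) \<otimes>\<^bsub>A\<^esub> b) = kt q a (v x) (pr (ei (tgt x)) \<otimes>\<^bsub>A\<^esub> (pr (ar x) \<otimes>\<^bsub>A\<^esub> b))"
    using assms x by (simp add: A.m_assoc[symmetric] ar_A ei_A)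
  also have "\<dots> = kt q a (pmul (v x) (ei (tgt x))) (pr (ar x) \<otimes>\<^bsub>A\<^esub> b)"
    using assms x by (intro kt_balanced2[symmetric]) (auto simp: ar_A ei_kk)
  finally show "kt q a (v x) (pr (ar x) \<otimes>\<^bsub>A\<^esub> b) = kt q a (pmul (v x) (ei (tgt x))) (pr (ar x) \<otimes>\<^bsub>A\<^esub> b)" .
qed (use assms in \<open>auto simp: ar_A ei_kk W_right kt_closed\<close>)

lemma dl_closed: "\<lbrakk>\<And>x. x \<in> QA \<Longrightarrow> u x \<in> W F Q q; a \<in> carrier A; b \<in> carrier A\<rbrakk> \<Longrightarrow> dl q u a b \<in> carrier (K q)"
  unfolding dl_def by (rule Kg.finsum_closed) (auto simp: ar_A kt_closed)
lemma dr_closed: "\<lbrakk>\<And>x. x \<in> QA \<Longrightarrow> v x \<in> W F Q q; a \<in> carrier A; b \<in> carrier A\<rbrakk> \<Longrightarrow> dr q v a b \<in> carrier (K q)"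
  unfolding dr_def by (rule Kg.finsum_closed) (auto simp: ar_A kt_closed)

lemma finsum_split:
  assumes "\<And>x. x \<in> S \<Longrightarrow> f x = g x \<oplus>\<^bsub>K q\<^esub> h x" "\<And>x. x \<in> S \<Longrightarrow> g x \<in> carrier (K q)"
    "\<And>x. x \<in> S \<Longrightarrow> h x \<in> carrier (K q)"
  shows "finsum (K q) f S = finsum (K q) g S \<oplus>\<^bsub>K q\<^esub> finsum (K q) h S"
proof -
  have "finsum (K q) f S = (\<Oplus>\<^bsub>K q\<^esub>x\<in>S. g x \<oplus>\<^bsub>K q\<^esub> h x)"
    by (rule Kg.finsum_cong') (use assms in \<open>simp_all add: Pi_iff\<close>)
  then show ?thesis using assms by (simp add: Kg.finsum_addf Pi_iff)
qed

text \<open>Each half is balanced by itself, so the two can be lifted separately and combined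
  afterwards with the sign of the degree.\<close>

lemma dl_lift:
  assumes p: "has_reps p" and q: "q = p - 1"
  obtains h where "h \<in> carrier (K p) \<rightarrow> carrier (K q)"
    "\<And>u v. \<lbrakk>u \<in> carrier (K p); v \<in> carrier (K p)\<rbrakk> \<Longrightarrow> h (u \<oplus>\<^bsub>K p\<^esub> v) = h u \<oplus>\<^bsub>K q\<^esub> h v"
    "\<And>a w b. \<lbrakk>a \<in> carrier A; w \<in> W F Q p; b \<in> carrier A\<rbrakk> \<Longrightarrow> h (kt p a w b) = dl q (\<lambda>x. ls p x w) a b"
proof (rule K_lift[of "K q" p "\<lambda>a w b. dl q (\<lambda>x. ls p x w) a b"])
  note c = ls_closed[OF p, folded q]
  show "abelian_group (K q)" by (rule K_group)
  show "dl q (\<lambda>x. ls p x w) a b \<in> carrier (K q)" if "a \<in> carrier A" "w \<in> W F Q p" "b \<in> carrier A" for a w b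
    using that c by (intro dl_closed) auto
  show "dl q (\<lambda>x. ls p x w) (a \<oplus>\<^bsub>A\<^esub> a') b = dl q (\<lambda>x. ls p x w) a b \<oplus>\<^bsub>K q\<^esub> dl q (\<lambda>x. ls p x w) a' b"
    if "a \<in> carrier A" "a' \<in> carrier A" "w \<in> W F Q p" "b \<in> carrier A" for a a' w b
    unfolding dl_def using that c
    by (intro finsum_split) (simp_all add: kt_closed ar_A A.l_distr kt_add1)
  show "dl q (\<lambda>x. ls p x (w + w')) a b = dl q (\<lambda>x. ls p x w) a b \<oplus>\<^bsub>K q\<^esub> dl q (\<lambda>x. ls p x w') a b"
    if "a \<in> carrier A" "w \<in> W F Q p" "w' \<in> W F Q p" "b \<in> carrier A" for a w w' b
    unfolding dl_def using that c
    by (intro finsum_split) (simp_all add: kt_closed ar_A ls_add[OF p] kt_add2)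
  show "dl q (\<lambda>x. ls p x w) a (b \<oplus>\<^bsub>A\<^esub> b') = dl q (\<lambda>x. ls p x w) a b \<oplus>\<^bsub>K q\<^esub> dl q (\<lambda>x. ls p x w) a b'"
    if "a \<in> carrier A" "w \<in> W F Q p" "b \<in> carrier A" "b' \<in> carrier A" for a w b b'
    unfolding dl_def using that c
    by (intro finsum_split) (simp_all add: kt_closed ar_A kt_add3)
  show "dl q (\<lambda>x. ls p x w) (phi s \<otimes>\<^bsub>A\<^esub> a) b = dl q (\<lambda>x. ls p x (pscale s w)) a b"
    if "a \<in> carrier A" "w \<in> W F Q p" "b \<in> carrier A" for a w b s
    unfolding dl_def using that c
    by (intro Kg.finsum_cong') (simp_all add: Pi_iff kt_closed ar_A phi_closed A.m_assoc ls_scale[OF p] kt_scale1 W_closed)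
  show "dl q (\<lambda>x. ls p x w) a (phi s \<otimes>\<^bsub>A\<^esub> b) = dl q (\<lambda>x. ls p x (pscale s w)) a b"
    if "a \<in> carrier A" "w \<in> W F Q p" "b \<in> carrier A" for a w b s
    unfolding dl_def using that c
    by (intro Kg.finsum_cong') (simp_all add: Pi_iff kt_closed ar_A phi_closed ls_scale[OF p] kt_scale3 W_closed)
  show "dl q (\<lambda>x. ls p x w) (a \<otimes>\<^bsub>A\<^esub> pr (ei i)) b = dl q (\<lambda>x. ls p x (pmul (ei i) w)) a b"
    if "a \<in> carrier A" "w \<in> W F Q p" "b \<in> carrier A" "i \<in> verts Q" for a w b i
    unfolding dl_def using that c
    by (intro Kg.finsum_cong') (simp_all add: Pi_iff kt_closed ar_A ei_A A.m_assoc pr_ei_ar ls_left[OF p] kt_zero W_closed)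
  show "dl q (\<lambda>x. ls p x (pmul w (ei i))) a b = dl q (\<lambda>x. ls p x w) a (pr (ei i) \<otimes>\<^bsub>A\<^esub> b)"
    if "a \<in> carrier A" "w \<in> W F Q p" "b \<in> carrier A" "i \<in> verts Q" for a w b i
    unfolding dl_def using that c
    by (intro Kg.finsum_cong') (simp_all add: Pi_iff kt_closed ar_A ei_A ls_right[OF p] kt_balanced2 ei_kk)
qed (rule that)

lemma dr_lift:
  assumes p: "has_reps p" and q: "q = p - 1"
  obtains h where "h \<in> carrier (K p) \<rightarrow> carrier (K q)"
    "\<And>u v. \<lbrakk>u \<in> carrier (K p); v \<in> carrier (K p)\<rbrakk> \<Longrightarrow> h (u \<oplus>\<^bsub>K p\<^esub> v) = h u \<oplus>\<^bsub>K q\<^esub> h v"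
    "\<And>a w b. \<lbrakk>a \<in> carrier A; w \<in> W F Q p; b \<in> carrier A\<rbrakk> \<Longrightarrow> h (kt p a w b) = dr q (\<lambda>x. rs p x w) a b"
proof (rule K_lift[of "K q" p "\<lambda>a w b. dr q (\<lambda>x. rs p x w) a b"])
  note c = rs_closed[OF p, folded q]
  show "abelian_group (K q)" by (rule K_group)
  show "dr q (\<lambda>x. rs p x w) a b \<in> carrier (K q)" if "a \<in> carrier A" "w \<in> W F Q p" "b \<in> carrier A" for a w b
    using that c by (intro dr_closed) auto
  show "dr q (\<lambda>x. rs p x w) (a \<oplus>\<^bsub>A\<^esub> a') b = dr q (\<lambda>x. rs p x w) a b \<oplus>\<^bsub>K q\<^esub> dr q (\<lambda>x. rs p x w) a' b"
    if "a \<in> carrier A" "a' \<in> carrier A" "w \<in> W F Q p" "b \<in> carrier A" for a a' w b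
    unfolding dr_def using that c
    by (intro finsum_split) (simp_all add: kt_closed ar_A kt_add1)
  show "dr q (\<lambda>x. rs p x (w + w')) a b = dr q (\<lambda>x. rs p x w) a b \<oplus>\<^bsub>K q\<^esub> dr q (\<lambda>x. rs p x w') a b"
    if "a \<in> carrier A" "w \<in> W F Q p" "w' \<in> W F Q p" "b \<in> carrier A" for a w w' b
    unfolding dr_def using that c
    by (intro finsum_split) (simp_all add: kt_closed ar_A rs_add[OF p] kt_add2)
  show "dr q (\<lambda>x. rs p x w) a (b \<oplus>\<^bsub>A\<^esub> b') = dr q (\<lambda>x. rs p x w) a b \<oplus>\<^bsub>K q\<^esub> dr q (\<lambda>x. rs p x w) a b'"
    if "a \<in> carrier A" "w \<in> W F Q p" "b \<in> carrier A" "b' \<in> carrier A" for a w b b'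
    unfolding dr_def using that c
    by (intro finsum_split) (simp_all add: kt_closed ar_A A.r_distr kt_add3)
  show "dr q (\<lambda>x. rs p x w) (phi s \<otimes>\<^bsub>A\<^esub> a) b = dr q (\<lambda>x. rs p x (pscale s w)) a b"
    if "a \<in> carrier A" "w \<in> W F Q p" "b \<in> carrier A" for a w b s
    unfolding dr_def using that c
    by (intro Kg.finsum_cong') (simp_all add: Pi_iff kt_closed ar_A phi_closed rs_scale[OF p] kt_scale1 W_closed)
  show "dr q (\<lambda>x. rs p x w) a (phi s \<otimes>\<^bsub>A\<^esub> b) = dr q (\<lambda>x. rs p x (pscale s w)) a b"
    if "a \<in> carrier A" "w \<in> W F Q p" "b \<in> carrier A" for a w b s
    unfolding dr_def using that c
    by (intro Kg.finsum_cong') (simp_all add: Pi_iff kt_closed ar_A phi_closed rs_scale[OF p] kt_scale3 phi_lcomm W_closed)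
  show "dr q (\<lambda>x. rs p x w) (a \<otimes>\<^bsub>A\<^esub> pr (ei i)) b = dr q (\<lambda>x. rs p x (pmul (ei i) w)) a b"
    if "a \<in> carrier A" "w \<in> W F Q p" "b \<in> carrier A" "i \<in> verts Q" for a w b i
    unfolding dr_def using that c
    by (intro Kg.finsum_cong') (simp_all add: Pi_iff kt_closed ar_A ei_A rs_left[OF p] kt_balanced1 ei_kk W_left)
  show "dr q (\<lambda>x. rs p x (pmul w (ei i))) a b = dr q (\<lambda>x. rs p x w) a (pr (ei i) \<otimes>\<^bsub>A\<^esub> b)"
    if "a \<in> carrier A" "w \<in> W F Q p" "b \<in> carrier A" "i \<in> verts Q" for a w b i
    unfolding dr_def using that c
    by (intro Kg.finsum_cong') (simp_all add: Pi_iff kt_closed ar_A ei_A rs_right[OF p] A.m_assoc[symmetric] pr_ar_ei kt_zero W_closed)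
qed (rule that)

abbreviation "d \<equiv> koszul_diff F Q"

text \<open>The property inside the definite description of \<open>koszul_diff\<close>, with the
  conditions on \<open>u\<close> and \<open>v\<close> gathered in \<open>rep\<close>.\<close>

definition d_spec where
  "d_spec p h \<longleftrightarrow> h \<in> additive_maps (K p) (K (p - 1)) \<and>
    (\<forall>a\<in>carrier A. \<forall>b\<in>carrier A. \<forall>w\<in>W F Q p. \<forall>u v. rep p w u v \<longrightarrow>
      h (kt p a w b) = (if even p then dl (p - 1) u a b \<oplus>\<^bsub>K (p - 1)\<^esub> dr (p - 1) v a b
        else dl (p - 1) u a b \<ominus>\<^bsub>K (p - 1)\<^esub> dr (p - 1) v a b))"

lemma d_def: "p > 0 \<Longrightarrow> d p = (THE h. d_spec p h)"
proof -
  assume "p > 0"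
  then have "d p = (THE d. d \<in> additive_maps (koszul F Q p) (koszul F Q (p - 1)) \<and>
       (\<forall>a\<in>carrier (preprojective F Q). \<forall>a'\<in>carrier (preprojective F Q). \<forall>w\<in>W F Q p. \<forall>u v.
          (\<forall>x\<in>arcs (double_quiver Q). u x \<in> W F Q (p - 1) \<and> v x \<in> W F Q (p - 1)) \<longrightarrow>
          w = (\<Sum>x\<in>arcs (double_quiver Q). arrow Q x \<otimes>\<^bsub>path_algebra F Q\<^esub> u x) \<longrightarrow>
          w = (\<Sum>x\<in>arcs (double_quiver Q). v x \<otimes>\<^bsub>path_algebra F Q\<^esub> arrow Q x) \<longrightarrow>
          (let l = dl (p - 1) u a a'; r = dr (p - 1) v a a'
           in d (ktensor F Q p a w a') =
             (if even p then l \<oplus>\<^bsub>koszul F Q (p - 1)\<^esub> r else l \<ominus>\<^bsub>koszul F Q (p - 1)\<^esub> r))))"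
    unfolding koszul_diff_def dl_def dr_def by (simp only: if_not_P[OF neq0_conv[THEN iffD2]])
  then show ?thesis unfolding d_spec_def rep_def Let_def by (simp only: path_algebra_sel imp_conjL)
qed

text \<open>Existence comes from the lifts of the two halves, once the stripping lemmas have shown
  that every choice of \<open>u\<close> and \<open>v\<close> gives the same value. Uniqueness holds
  because tensors generate and every \<open>w\<close> admits some \<open>u\<close> and
  \<open>v\<close>; extensionality settles the arguments outside the carrier.\<close>

lemma d_spec:
  assumes p: "has_reps p" and "p > 0"
  shows "d_spec p (d p)"
proof -
  define q where q: "q = p - 1"
  obtain hl where hl: "hl \<in> carrier (K p) \<rightarrow> carrier (K q)"
    "\<And>u v. \<lbrakk>u \<in> carrier (K p); v \<in> carrier (K p)\<rbrakk> \<Longrightarrow> hl (u \<oplus>\<^bsub>K p\<^esub> v) = hl u \<oplus>\<^bsub>K q\<^esub> hl v"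
    "\<And>a w b. \<lbrakk>a \<in> carrier A; w \<in> W F Q p; b \<in> carrier A\<rbrakk> \<Longrightarrow> hl (kt p a w b) = dl q (\<lambda>x. ls p x w) a b"
    using dl_lift[OF p q] by blast
  obtain hr where hr: "hr \<in> carrier (K p) \<rightarrow> carrier (K q)"
    "\<And>u v. \<lbrakk>u \<in> carrier (K p); v \<in> carrier (K p)\<rbrakk> \<Longrightarrow> hr (u \<oplus>\<^bsub>K p\<^esub> v) = hr u \<oplus>\<^bsub>K q\<^esub> hr v"
    "\<And>a w b. \<lbrakk>a \<in> carrier A; w \<in> W F Q p; b \<in> carrier A\<rbrakk> \<Longrightarrow> hr (kt p a w b) = dr q (\<lambda>x. rs p x w) a b"
    using dr_lift[OF p q] by blast
  have lc: "hl z \<in> carrier (K q)" "hr z \<in> carrier (K q)" if "z \<in> carrier (K p)" for z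
    using that hl(1) hr(1) by auto
  define h where "h = (\<lambda>z\<in>carrier (K p). if even p then hl z \<oplus>\<^bsub>K q\<^esub> hr z else hl z \<ominus>\<^bsub>K q\<^esub> hr z)"
  have add: "h \<in> additive_maps (K p) (K q)"
    unfolding additive_maps_def
    by (auto simp: h_def hl hr lc a_minus_def Kg.a_ac Kg.minus_add)
  have hs: "d_spec p h"
    unfolding d_spec_def q[symmetric]
  proof (intro conjI add ballI allI impI)
    fix a b w u v assume a: "a \<in> carrier A" and b: "b \<in> carrier A" and w: "w \<in> W F Q p" and r: "rep p w u v"
    have u: "u x \<in> W F Q q" "v x \<in> W F Q q" if "x \<in> QA" for x using r that by (auto simp: rep_def q)
    have "dl q u a b = dl q (\<lambda>x. pmul (ei (src x)) (u x)) a b" by (rule dl_strip[OF u(1) a b])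
    also have "\<dots> = dl q (\<lambda>x. ls p x w) a b"
      unfolding dl_def
      by (rule Kg.finsum_cong') (use a b u in \<open>simp_all add: Pi_iff ls_eq[OF r] kt_closed ar_A W_left ei_kk\<close>)
    finally have l: "dl q u a b = dl q (\<lambda>x. ls p x w) a b" .
    have "dr q v a b = dr q (\<lambda>x. pmul (v x) (ei (tgt x))) a b" by (rule dr_strip[OF u(2) a b])
    also have "\<dots> = dr q (\<lambda>x. rs p x w) a b"
      unfolding dr_def
      by (rule Kg.finsum_cong') (use a b u in \<open>simp_all add: Pi_iff rs_eq[OF r] kt_closed ar_A W_right ei_kk\<close>)
    finally have "dr q v a b = dr q (\<lambda>x. rs p x w) a b" .
    with l show "h (kt p a w b) = (if even p then dl q u a b \<oplus>\<^bsub>K q\<^esub> dr q v a b else dl q u a b \<ominus>\<^bsub>K q\<^esub> dr q v a b)"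
      using a b w by (simp add: h_def kt_closed hl(3) hr(3))
  qed
  have uniq: "h' = h" if h': "d_spec p h'" for h'
  proof
    fix z
    have am: "h' \<in> additive_maps (K p) (K q)" using h' by (simp add: d_spec_def q)
    show "h' z = h z"
    proof (cases "z \<in> carrier (K p)")
      case True
      then show ?thesis
      proof (induction rule: K_induct)
        case (pure a w b)
        obtain u v where "rep p w u v" using p pure unfolding has_reps_def by blast
        then show ?case using h' hs pure unfolding d_spec_def by metis
      next
        case (add u v)
        then show ?case using am \<open>h \<in> additive_maps (K p) (K q)\<close> unfolding additive_maps_def by simp
      qed
    next
      case False
      then show ?thesis using am add unfolding additive_maps_def PiE_def extensional_def by simp
    qed
  qed
  show ?thesis unfolding d_def[OF assms(2)]
    by (rule theI[of "d_spec p" h]) (use hs uniq in blast)+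
qed

lemma d_closed: "has_reps p \<Longrightarrow> p > 0 \<Longrightarrow> z \<in> carrier (K p) \<Longrightarrow> d p z \<in> carrier (K (p - 1))"
  using d_spec[of p] unfolding d_spec_def additive_maps_def by blast

lemma d_add: "has_reps p \<Longrightarrow> p > 0 \<Longrightarrow> z \<in> carrier (K p) \<Longrightarrow> z' \<in> carrier (K p) \<Longrightarrow>
    d p (z \<oplus>\<^bsub>K p\<^esub> z') = d p z \<oplus>\<^bsub>K (p - 1)\<^esub> d p z'"
  using d_spec[of p] unfolding d_spec_def additive_maps_def by blast

lemma d_kt: "has_reps p \<Longrightarrow> p > 0 \<Longrightarrow> a \<in> carrier A \<Longrightarrow> w \<in> W F Q p \<Longrightarrow> b \<in> carrier A \<Longrightarrow> rep p w u v \<Longrightarrow>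
  d p (kt p a w b) = (if even p then dl (p - 1) u a b \<oplus>\<^bsub>K (p - 1)\<^esub> dr (p - 1) v a b
        else dl (p - 1) u a b \<ominus>\<^bsub>K (p - 1)\<^esub> dr (p - 1) v a b)"
  using d_spec[of p] unfolding d_spec_def by blast

lemma K_lact_closed: "c \<in> carrier A \<Longrightarrow> z \<in> carrier (K p) \<Longrightarrow> c \<odot>\<^bsub>K p\<^esub> z \<in> carrier (K p)"
  by (rule bimod.lact_closed[OF bimod_K])
lemma K_ract_closed: "c \<in> carrier A \<Longrightarrow> z \<in> carrier (K p) \<Longrightarrow> ract (K p) z c \<in> carrier (K p)"
  by (rule bimod.ract_closed[OF bimod_K])
lemma K_lact_add: "c \<in> carrier A \<Longrightarrow> z \<in> carrier (K p) \<Longrightarrow> z' \<in> carrier (K p) \<Longrightarrow>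
  c \<odot>\<^bsub>K p\<^esub> (z \<oplus>\<^bsub>K p\<^esub> z') = c \<odot>\<^bsub>K p\<^esub> z \<oplus>\<^bsub>K p\<^esub> c \<odot>\<^bsub>K p\<^esub> z'"
  by (rule bimod.lact_add[OF bimod_K])
lemma K_ract_add: "c \<in> carrier A \<Longrightarrow> z \<in> carrier (K p) \<Longrightarrow> z' \<in> carrier (K p) \<Longrightarrow>
  ract (K p) (z \<oplus>\<^bsub>K p\<^esub> z') c = ract (K p) z c \<oplus>\<^bsub>K p\<^esub> ract (K p) z' c"
  by (rule bimod.ract_add[OF bimod_K])

lemma K_lact_minus: "c \<in> carrier A \<Longrightarrow> z \<in> carrier (K p) \<Longrightarrow> c \<odot>\<^bsub>K p\<^esub> (\<ominus>\<^bsub>K p\<^esub> z) = \<ominus>\<^bsub>K p\<^esub> (c \<odot>\<^bsub>K p\<^esub> z)"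
  by (rule additive_minus[OF K_group K_group]) (auto simp: K_lact_closed K_lact_add)
lemma K_ract_minus: "c \<in> carrier A \<Longrightarrow> z \<in> carrier (K p) \<Longrightarrow> ract (K p) (\<ominus>\<^bsub>K p\<^esub> z) c = \<ominus>\<^bsub>K p\<^esub> (ract (K p) z c)"
  by (rule additive_minus[OF K_group K_group]) (auto simp: K_ract_closed K_ract_add)

lemma K_lact_sum: "c \<in> carrier A \<Longrightarrow> finite S \<Longrightarrow> (\<And>s. s \<in> S \<Longrightarrow> g s \<in> carrier (K p)) \<Longrightarrow>
    c \<odot>\<^bsub>K p\<^esub> (\<Oplus>\<^bsub>K p\<^esub>s\<in>S. g s) = (\<Oplus>\<^bsub>K p\<^esub>s\<in>S. c \<odot>\<^bsub>K p\<^esub> g s)"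
  by (rule additive_finsum[OF K_group K_group]) (auto simp: K_lact_closed K_lact_add)
lemma K_ract_sum: "c \<in> carrier A \<Longrightarrow> finite S \<Longrightarrow> (\<And>s. s \<in> S \<Longrightarrow> g s \<in> carrier (K p)) \<Longrightarrow>
    ract (K p) (\<Oplus>\<^bsub>K p\<^esub>s\<in>S. g s) c = (\<Oplus>\<^bsub>K p\<^esub>s\<in>S. ract (K p) (g s) c)"
  by (rule additive_finsum[OF K_group K_group]) (auto simp: K_ract_closed K_ract_add)

lemma dl_lact:
  assumes "\<And>x. x \<in> QA \<Longrightarrow> u x \<in> W F Q q" "a \<in> carrier A" "b \<in> carrier A" "c \<in> carrier A"
  shows "c \<odot>\<^bsub>K q\<^esub> dl q u a b = dl q u (c \<otimes>\<^bsub>A\<^esub> a) b" "ract (K q) (dl q u a b) c = dl q u a (b \<otimes>\<^bsub>A\<^esub> c)"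
    "c \<odot>\<^bsub>K q\<^esub> dr q u a b = dr q u (c \<otimes>\<^bsub>A\<^esub> a) b" "ract (K q) (dr q u a b) c = dr q u a (b \<otimes>\<^bsub>A\<^esub> c)"
proof -
  have 1: "kt q (a \<otimes>\<^bsub>A\<^esub> pr (ar x)) (u x) b \<in> carrier (K q)" "kt q a (u x) (pr (ar x) \<otimes>\<^bsub>A\<^esub> b) \<in> carrier (K q)"
    if "x \<in> QA" for x using assms that by (auto simp: kt_closed ar_A)
  show "c \<odot>\<^bsub>K q\<^esub> dl q u a b = dl q u (c \<otimes>\<^bsub>A\<^esub> a) b" "ract (K q) (dl q u a b) c = dl q u a (b \<otimes>\<^bsub>A\<^esub> c)"
    "c \<odot>\<^bsub>K q\<^esub> dr q u a b = dr q u (c \<otimes>\<^bsub>A\<^esub> a) b" "ract (K q) (dr q u a b) c = dr q u a (b \<otimes>\<^bsub>A\<^esub> c)"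
    unfolding dl_def dr_def using assms 1
    by (simp_all add: K_lact_sum K_ract_sum K_lact K_ract ar_A A.m_assoc kt_closed cong: Kg.finsum_cong)
qed

lemma d_lact:
  assumes p: "has_reps p" "p > 0" and c: "c \<in> carrier A" and z: "z \<in> carrier (K p)"
  shows "d p (c \<odot>\<^bsub>K p\<^esub> z) = c \<odot>\<^bsub>K (p - 1)\<^esub> d p z"
  using z
proof (induction rule: K_induct)
  case (pure a w b)
  obtain u v where r: "rep p w u v" using p pure unfolding has_reps_def by blast
  then have "\<And>x. x \<in> QA \<Longrightarrow> u x \<in> W F Q (p - 1)" "\<And>x. x \<in> QA \<Longrightarrow> v x \<in> W F Q (p - 1)" by (auto simp: rep_def)
  then show ?case using pure c r
    by (simp add: K_lact d_kt[OF p] K_lact_add K_lact_minus a_minus_def dl_lact dl_closed dr_closed del: One_nat_def)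
qed (use c in \<open>simp add: K_lact_add d_add[OF p] K_lact_closed d_closed[OF p] del: One_nat_def\<close>)

lemma d_ract:
  assumes p: "has_reps p" "p > 0" and c: "c \<in> carrier A" and z: "z \<in> carrier (K p)"
  shows "d p (ract (K p) z c) = ract (K (p - 1)) (d p z) c"
  using z
proof (induction rule: K_induct)
  case (pure a w b)
  obtain u v where r: "rep p w u v" using p pure unfolding has_reps_def by blast
  then have "\<And>x. x \<in> QA \<Longrightarrow> u x \<in> W F Q (p - 1)" "\<And>x. x \<in> QA \<Longrightarrow> v x \<in> W F Q (p - 1)" by (auto simp: rep_def)
  then show ?case using pure c r
    by (simp add: K_ract d_kt[OF p] K_ract_add K_ract_minus a_minus_def dl_lact dl_closed dr_closed del: One_nat_def)
qed (use c in \<open>simp add: K_ract_add d_add[OF p] K_ract_closed d_closed[OF p] del: One_nat_def\<close>)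

end

section \<open>Cochains and the swap\<close>

lemma bimodule_homsD:
  assumes "f \<in> bimodule_homs R M N"
  shows "x \<in> carrier M \<Longrightarrow> f x \<in> carrier N"
    "\<lbrakk>x \<in> carrier M; y \<in> carrier M\<rbrakk> \<Longrightarrow> f (x \<oplus>\<^bsub>M\<^esub> y) = f x \<oplus>\<^bsub>N\<^esub> f y"
    "f \<in> extensional (carrier M)"
    "\<lbrakk>a \<in> carrier R; x \<in> carrier M\<rbrakk> \<Longrightarrow> f (a \<odot>\<^bsub>M\<^esub> x) = a \<odot>\<^bsub>N\<^esub> f x"
    "\<lbrakk>a \<in> carrier R; x \<in> carrier M\<rbrakk> \<Longrightarrow> f (ract M x a) = ract N (f x) a"
  using assms by (auto simp: bimodule_homs_def additive_maps_def PiE_def)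

lemma bimodule_homsI:
  assumes "\<And>x. x \<in> carrier M \<Longrightarrow> f x \<in> carrier N"
    "\<And>x y. \<lbrakk>x \<in> carrier M; y \<in> carrier M\<rbrakk> \<Longrightarrow> f (x \<oplus>\<^bsub>M\<^esub> y) = f x \<oplus>\<^bsub>N\<^esub> f y"
    "f \<in> extensional (carrier M)"
    "\<And>a x. \<lbrakk>a \<in> carrier R; x \<in> carrier M\<rbrakk> \<Longrightarrow> f (a \<odot>\<^bsub>M\<^esub> x) = a \<odot>\<^bsub>N\<^esub> f x"
    "\<And>a x. \<lbrakk>a \<in> carrier R; x \<in> carrier M\<rbrakk> \<Longrightarrow> f (ract M x a) = ract N (f x) a"
  shows "f \<in> bimodule_homs R M N"
  using assms by (simp add: bimodule_homs_def additive_maps_def PiE_def)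

context fin_quiver begin

section \<open>The tensor square of \<open>A\<close> with its outer and inner structures\<close>

abbreviation "E \<equiv> env_outer F Q"
abbreviation "EI \<equiv> env_inner F Q"
definition et where
  "et = pure_tensor (UNIV :: 'f set) (ring_bimodule id phi A) (ring_bimodule phi id A)"

lemma pair_env: "tensor_pair (carrier A) (ring_bimodule id phi A) (UNIV :: 'f set) (ring_bimodule phi id A) (carrier A)"
  by (intro tensor_pair.intro bimod_ring) (auto simp: A.ring_axioms phi_closed)

lemma bimod_E: "bimod (carrier A) E (carrier A)"
  unfolding env_outer_def by (rule tensor_pair.bimod_tensor[OF pair_env])

sublocale Eg: abelian_group E by (rule bimod.axioms(1)[OF bimod_E])

lemma et_closed: "\<lbrakk>a \<in> carrier A; b \<in> carrier A\<rbrakk> \<Longrightarrow> et a b \<in> carrier E"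
  unfolding env_outer_def et_def using tensor_pair.pure_closed[OF pair_env, of a b] by simp
lemma et_add1: "\<lbrakk>a \<in> carrier A; a' \<in> carrier A; b \<in> carrier A\<rbrakk> \<Longrightarrow> et (a \<oplus>\<^bsub>A\<^esub> a') b = et a b \<oplus>\<^bsub>E\<^esub> et a' b"
  unfolding env_outer_def et_def using tensor_pair.pure_add_left[OF pair_env, of a a' b] by simp
lemma et_add2: "\<lbrakk>a \<in> carrier A; b \<in> carrier A; b' \<in> carrier A\<rbrakk> \<Longrightarrow> et a (b \<oplus>\<^bsub>A\<^esub> b') = et a b \<oplus>\<^bsub>E\<^esub> et a b'"
  unfolding env_outer_def et_def using tensor_pair.pure_add_right[OF pair_env, of a b b'] by simp
lemma et_scale: "\<lbrakk>a \<in> carrier A; b \<in> carrier A\<rbrakk> \<Longrightarrow> et a (phi c \<otimes>\<^bsub>A\<^esub> b) = et (phi c \<otimes>\<^bsub>A\<^esub> a) b"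
  unfolding et_def using tensor_pair.pure_balanced[OF pair_env, of a c b] by (simp add: phi_central)
lemma E_lact: "\<lbrakk>c \<in> carrier A; a \<in> carrier A; b \<in> carrier A\<rbrakk> \<Longrightarrow> c \<odot>\<^bsub>E\<^esub> et a b = et (c \<otimes>\<^bsub>A\<^esub> a) b"
  unfolding env_outer_def et_def using tensor_pair.lact_tensor(3)[OF pair_env, of c a b] by simp
lemma E_ract: "\<lbrakk>c \<in> carrier A; a \<in> carrier A; b \<in> carrier A\<rbrakk> \<Longrightarrow> ract E (et a b) c = et a (b \<otimes>\<^bsub>A\<^esub> c)"
  unfolding env_outer_def et_def using tensor_pair.ract_tensor(3)[OF pair_env, of c a b] by simp

lemma E_induct [consumes 1, case_names pure add]:
  assumes u: "u \<in> carrier E"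
    and pure: "\<And>a b. \<lbrakk>a \<in> carrier A; b \<in> carrier A\<rbrakk> \<Longrightarrow> P (et a b)"
    and add: "\<And>u v. \<lbrakk>u \<in> carrier E; v \<in> carrier E; P u; P v\<rbrakk> \<Longrightarrow> P (u \<oplus>\<^bsub>E\<^esub> v)"
  shows "P u"
proof (rule tensor_pair.tensor_induct[OF pair_env, folded env_outer_def, OF u])
  show "P (pure_tensor (UNIV :: 'f set) (ring_bimodule id phi A) (ring_bimodule phi id A) a b)" if "a \<in> carrier (ring_bimodule id phi A)" "b \<in> carrier (ring_bimodule phi id A)" for a b
    using that unfolding et_def[symmetric] by (intro pure) simp_all
qed (rule add)

lemma E_closed: "c \<in> carrier A \<Longrightarrow> z \<in> carrier E \<Longrightarrow> c \<odot>\<^bsub>E\<^esub> z \<in> carrier E"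
  "c \<in> carrier A \<Longrightarrow> z \<in> carrier E \<Longrightarrow> ract E z c \<in> carrier E"
  by (rule bimod.lact_closed[OF bimod_E] bimod.ract_closed[OF bimod_E]; assumption)+
lemma E_act_add: "c \<in> carrier A \<Longrightarrow> z \<in> carrier E \<Longrightarrow> z' \<in> carrier E \<Longrightarrow> c \<odot>\<^bsub>E\<^esub> (z \<oplus>\<^bsub>E\<^esub> z') = c \<odot>\<^bsub>E\<^esub> z \<oplus>\<^bsub>E\<^esub> c \<odot>\<^bsub>E\<^esub> z'"
  "c \<in> carrier A \<Longrightarrow> z \<in> carrier E \<Longrightarrow> z' \<in> carrier E \<Longrightarrow> ract E (z \<oplus>\<^bsub>E\<^esub> z') c = ract E z c \<oplus>\<^bsub>E\<^esub> ract E z' c"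
  by (rule bimod.lact_add[OF bimod_E] bimod.ract_add[OF bimod_E]; assumption)+

lemma E_minus: "c \<in> carrier A \<Longrightarrow> z \<in> carrier E \<Longrightarrow> c \<odot>\<^bsub>E\<^esub> (\<ominus>\<^bsub>E\<^esub> z) = \<ominus>\<^bsub>E\<^esub> (c \<odot>\<^bsub>E\<^esub> z)"
  "c \<in> carrier A \<Longrightarrow> z \<in> carrier E \<Longrightarrow> ract E (\<ominus>\<^bsub>E\<^esub> z) c = \<ominus>\<^bsub>E\<^esub> (ract E z c)"
proof -
  show "c \<in> carrier A \<Longrightarrow> z \<in> carrier E \<Longrightarrow> c \<odot>\<^bsub>E\<^esub> (\<ominus>\<^bsub>E\<^esub> z) = \<ominus>\<^bsub>E\<^esub> (c \<odot>\<^bsub>E\<^esub> z)"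
    by (rule additive_minus[OF Eg.abelian_group_axioms Eg.abelian_group_axioms]) (simp_all add: E_closed E_act_add Pi_iff)
  show "c \<in> carrier A \<Longrightarrow> z \<in> carrier E \<Longrightarrow> ract E (\<ominus>\<^bsub>E\<^esub> z) c = \<ominus>\<^bsub>E\<^esub> (ract E z c)"
    by (rule additive_minus[OF Eg.abelian_group_axioms Eg.abelian_group_axioms]) (simp_all add: E_closed E_act_add Pi_iff)
qed

lemma et_zero: "b \<in> carrier A \<Longrightarrow> et \<zero>\<^bsub>A\<^esub> b = \<zero>\<^bsub>E\<^esub>"
  by (rule additive_zero[OF A.abelian_group_axioms Eg.abelian_group_axioms]) (simp_all add: et_closed et_add1 Pi_iff)
lemma et_zero2: "b \<in> carrier A \<Longrightarrow> et b \<zero>\<^bsub>A\<^esub> = \<zero>\<^bsub>E\<^esub>"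
  by (rule additive_zero[OF A.abelian_group_axioms Eg.abelian_group_axioms]) (simp_all add: et_closed et_add2 Pi_iff)

lemma EI_sel: "carrier EI = carrier E" "ring.add EI = ring.add E" "ring.zero EI = ring.zero E"
  by (simp_all add: env_inner_def Let_def)

lemma EI_act:
  assumes c: "c \<in> carrier A"
  shows "z \<in> carrier E \<Longrightarrow> c \<odot>\<^bsub>EI\<^esub> z \<in> carrier E"
    and "z \<in> carrier E \<Longrightarrow> ract EI z c \<in> carrier E"
    and "z \<in> carrier E \<Longrightarrow> z' \<in> carrier E \<Longrightarrow> c \<odot>\<^bsub>EI\<^esub> (z \<oplus>\<^bsub>E\<^esub> z') = c \<odot>\<^bsub>EI\<^esub> z \<oplus>\<^bsub>E\<^esub> c \<odot>\<^bsub>EI\<^esub> z'"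
    and "z \<in> carrier E \<Longrightarrow> z' \<in> carrier E \<Longrightarrow> ract EI (z \<oplus>\<^bsub>E\<^esub> z') c = ract EI z c \<oplus>\<^bsub>E\<^esub> ract EI z' c"
    and "a \<in> carrier A \<Longrightarrow> b \<in> carrier A \<Longrightarrow> c \<odot>\<^bsub>EI\<^esub> et a b = et a (c \<otimes>\<^bsub>A\<^esub> b)"
    and "a \<in> carrier A \<Longrightarrow> b \<in> carrier A \<Longrightarrow> ract EI (et a b) c = et (a \<otimes>\<^bsub>A\<^esub> c) b"
proof -
  let ?M = "ring_bimodule id phi A" and ?N = "ring_bimodule phi id A"
  have l: "smult EI c = tensor_map UNIV ?M ?N id (\<lambda>\<beta>. c \<otimes>\<^bsub>A\<^esub> \<beta>)"
    and r: "(\<lambda>z. ract EI z c) = tensor_map UNIV ?M ?N (\<lambda>\<alpha>. \<alpha> \<otimes>\<^bsub>A\<^esub> c) id"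
    by (simp_all add: env_inner_def Let_def)
  have h1: "id \<in> carrier ?M \<rightarrow> carrier ?M" "(\<lambda>\<beta>. c \<otimes>\<^bsub>A\<^esub> \<beta>) \<in> carrier ?N \<rightarrow> carrier ?N"
    "id \<in> carrier ?N \<rightarrow> carrier ?N" "(\<lambda>\<alpha>. \<alpha> \<otimes>\<^bsub>A\<^esub> c) \<in> carrier ?M \<rightarrow> carrier ?M"
    using c by (simp_all add: Pi_iff)
  have h2: "c \<otimes>\<^bsub>A\<^esub> (b \<odot>\<^bsub>?N\<^esub> y) = b \<odot>\<^bsub>?N\<^esub> (c \<otimes>\<^bsub>A\<^esub> y)" if "y \<in> carrier ?N" for b y
    using c that by (simp add: phi_lcomm)
  have h3: "ract ?M y b \<otimes>\<^bsub>A\<^esub> c = ract ?M (y \<otimes>\<^bsub>A\<^esub> c) b" if "y \<in> carrier ?M" for b y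
    using c that by (simp add: A.m_assoc phi_closed phi_central)
  note L = tensor_pair.tensor_map[OF pair_env, folded env_outer_def, where \<phi> = id and \<psi> = "\<lambda>\<beta>. c \<otimes>\<^bsub>A\<^esub> \<beta>", OF h1(1) _ _ h1(2), folded l]
  note R = tensor_pair.tensor_map[OF pair_env, folded env_outer_def, where \<phi> = "\<lambda>\<alpha>. \<alpha> \<otimes>\<^bsub>A\<^esub> c" and \<psi> = id, OF h1(4) _ _ h1(3), folded r]
  have L1: "smult EI c \<in> carrier E \<rightarrow> carrier E" by (rule L(1)) (use c h2 in \<open>simp_all add: A.r_distr\<close>)
  have R1: "(\<lambda>z. ract EI z c) \<in> carrier E \<rightarrow> carrier E" by (rule R(1)) (use c h3 in \<open>simp_all add: A.l_distr\<close>)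
  show "z \<in> carrier E \<Longrightarrow> c \<odot>\<^bsub>EI\<^esub> z \<in> carrier E" "z \<in> carrier E \<Longrightarrow> ract EI z c \<in> carrier E"
    using L1 R1 by (simp_all add: Pi_iff)
  show "z \<in> carrier E \<Longrightarrow> z' \<in> carrier E \<Longrightarrow> c \<odot>\<^bsub>EI\<^esub> (z \<oplus>\<^bsub>E\<^esub> z') = c \<odot>\<^bsub>EI\<^esub> z \<oplus>\<^bsub>E\<^esub> c \<odot>\<^bsub>EI\<^esub> z'"
    by (rule L(2)) (use c h2 in \<open>simp_all add: A.r_distr\<close>)
  have rr: "ract EI u c = tensor_map UNIV ?M ?N (\<lambda>\<alpha>. \<alpha> \<otimes>\<^bsub>A\<^esub> c) id u" for u using fun_cong[OF r] .
  show "z \<in> carrier E \<Longrightarrow> z' \<in> carrier E \<Longrightarrow> ract EI (z \<oplus>\<^bsub>E\<^esub> z') c = ract EI z c \<oplus>\<^bsub>E\<^esub> ract EI z' c"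
    unfolding rr
    by (rule tensor_pair.tensor_map(2)[OF pair_env, folded env_outer_def])
       (use c h1 h3 in \<open>simp_all add: A.l_distr\<close>)
  show "a \<in> carrier A \<Longrightarrow> b \<in> carrier A \<Longrightarrow> c \<odot>\<^bsub>EI\<^esub> et a b = et a (c \<otimes>\<^bsub>A\<^esub> b)"
    unfolding l et_def
    by (subst tensor_pair.tensor_map(3)[OF pair_env]) (use c h1 h2 in \<open>simp_all add: A.r_distr\<close>)
  show "a \<in> carrier A \<Longrightarrow> b \<in> carrier A \<Longrightarrow> ract EI (et a b) c = et (a \<otimes>\<^bsub>A\<^esub> c) b"
    unfolding rr et_def
    by (subst tensor_pair.tensor_map(3)[OF pair_env]) (use c h1 h3 in \<open>simp_all add: A.l_distr\<close>)
qed

text \<open>On a pure tensor, an inner and an outer operator act either on different factors or on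
  opposite sides of the same factor. This is why the inner structure preserves cochains.\<close>

lemma inner_outer:
  assumes c: "c \<in> carrier A" and a: "a \<in> carrier A" and z: "z \<in> carrier E"
  shows "c \<odot>\<^bsub>EI\<^esub> (a \<odot>\<^bsub>E\<^esub> z) = a \<odot>\<^bsub>E\<^esub> (c \<odot>\<^bsub>EI\<^esub> z)" "ract EI (a \<odot>\<^bsub>E\<^esub> z) c = a \<odot>\<^bsub>E\<^esub> ract EI z c"
    "c \<odot>\<^bsub>EI\<^esub> ract E z a = ract E (c \<odot>\<^bsub>EI\<^esub> z) a" "ract EI (ract E z a) c = ract E (ract EI z c) a"
proof -
  have "c \<odot>\<^bsub>EI\<^esub> (a \<odot>\<^bsub>E\<^esub> z) = a \<odot>\<^bsub>E\<^esub> (c \<odot>\<^bsub>EI\<^esub> z) \<and> ract EI (a \<odot>\<^bsub>E\<^esub> z) c = a \<odot>\<^bsub>E\<^esub> ract EI z c \<and>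
    c \<odot>\<^bsub>EI\<^esub> ract E z a = ract E (c \<odot>\<^bsub>EI\<^esub> z) a \<and> ract EI (ract E z a) c = ract E (ract EI z c) a"
    using z
  proof (induction rule: E_induct)
    case (pure x y) then show ?case using a c by (simp add: E_lact E_ract EI_act A.m_assoc)
  next
    case (add u v) then show ?case using a c by (simp add: E_closed E_act_add EI_act)
  qed
  then show "c \<odot>\<^bsub>EI\<^esub> (a \<odot>\<^bsub>E\<^esub> z) = a \<odot>\<^bsub>E\<^esub> (c \<odot>\<^bsub>EI\<^esub> z)" "ract EI (a \<odot>\<^bsub>E\<^esub> z) c = a \<odot>\<^bsub>E\<^esub> ract EI z c"
    "c \<odot>\<^bsub>EI\<^esub> ract E z a = ract E (c \<odot>\<^bsub>EI\<^esub> z) a" "ract EI (ract E z a) c = ract E (ract EI z c) a" by simp_all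
qed

text \<open>The swap \<open>\<alpha> \<otimes> \<beta> \<mapsto> \<beta> \<otimes> w \<otimes> \<alpha>\<close>, which turns the inner structure of the enveloping algebra
  into the bimodule structure of the Koszul complex.\<close>

definition sw where
  "sw q w = (SOME h. h \<in> carrier E \<rightarrow> carrier (K q) \<and>
    (\<forall>u\<in>carrier E. \<forall>v\<in>carrier E. h (u \<oplus>\<^bsub>E\<^esub> v) = h u \<oplus>\<^bsub>K q\<^esub> h v) \<and>
    (\<forall>a\<in>carrier A. \<forall>b\<in>carrier A. h (et a b) = kt q b w a))"

lemma sw:
  assumes w: "w \<in> W F Q q"
  shows "z \<in> carrier E \<Longrightarrow> sw q w z \<in> carrier (K q)"
    "\<lbrakk>u \<in> carrier E; v \<in> carrier E\<rbrakk> \<Longrightarrow> sw q w (u \<oplus>\<^bsub>E\<^esub> v) = sw q w u \<oplus>\<^bsub>K q\<^esub> sw q w v"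
    "\<lbrakk>a \<in> carrier A; b \<in> carrier A\<rbrakk> \<Longrightarrow> sw q w (et a b) = kt q b w a"
proof -
  have ex: "\<exists>h. h \<in> carrier E \<rightarrow> carrier (K q) \<and>
    (\<forall>u\<in>carrier E. \<forall>v\<in>carrier E. h (u \<oplus>\<^bsub>E\<^esub> v) = h u \<oplus>\<^bsub>K q\<^esub> h v) \<and>
    (\<forall>a\<in>carrier A. \<forall>b\<in>carrier A. h (et a b) = kt q b w a)"
    unfolding env_outer_def et_def
    by (rule tensor_pair.tensor_lift[OF pair_env K_group, where \<phi> = "\<lambda>a b. kt q b w a"])
       (use w in \<open>simp_all add: kt_closed kt_add1 kt_add3 kt_scale1 kt_scale3 phi_central[symmetric], blast\<close>)
  note s = someI_ex[OF ex, folded sw_def]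
  from s show "z \<in> carrier E \<Longrightarrow> sw q w z \<in> carrier (K q)" by blast
  from s show "\<lbrakk>u \<in> carrier E; v \<in> carrier E\<rbrakk> \<Longrightarrow> sw q w (u \<oplus>\<^bsub>E\<^esub> v) = sw q w u \<oplus>\<^bsub>K q\<^esub> sw q w v" by blast
  from s show "\<lbrakk>a \<in> carrier A; b \<in> carrier A\<rbrakk> \<Longrightarrow> sw q w (et a b) = kt q b w a" by blast
qed

lemma sw_inner:
  assumes w: "w \<in> W F Q q" and c: "c \<in> carrier A" and z: "z \<in> carrier E"
  shows "sw q w (c \<odot>\<^bsub>EI\<^esub> z) = c \<odot>\<^bsub>K q\<^esub> sw q w z" "sw q w (ract EI z c) = ract (K q) (sw q w z) c"
proof -
  have "sw q w (c \<odot>\<^bsub>EI\<^esub> z) = c \<odot>\<^bsub>K q\<^esub> sw q w z \<and> sw q w (ract EI z c) = ract (K q) (sw q w z) c"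
    using z
  proof (induction rule: E_induct)
    case (pure a b)
    then show ?case using w c by (simp add: EI_act sw K_lact K_ract)
  next
    case (add u v)
    then show ?case using w c by (simp add: EI_act sw K_lact_add K_ract_add)
  qed
  then show "sw q w (c \<odot>\<^bsub>EI\<^esub> z) = c \<odot>\<^bsub>K q\<^esub> sw q w z" "sw q w (ract EI z c) = ract (K q) (sw q w z) c" by simp_all
qed

section \<open>Cochains and their bimodule structure\<close>

abbreviation "C \<equiv> koszul_cochains F Q"

lemma C_sel: "carrier (C p) = bimodule_homs A (K p) E"
  "f \<oplus>\<^bsub>C p\<^esub> g = (\<lambda>x\<in>carrier (K p). f x \<oplus>\<^bsub>E\<^esub> g x)" "\<zero>\<^bsub>C p\<^esub> = (\<lambda>x\<in>carrier (K p). \<zero>\<^bsub>E\<^esub>)"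
  "c \<odot>\<^bsub>C p\<^esub> f = (\<lambda>x\<in>carrier (K p). c \<odot>\<^bsub>EI\<^esub> f x)" "ract (C p) f c = (\<lambda>x\<in>carrier (K p). ract EI (f x) c)"
  by (simp_all add: koszul_cochains_def Let_def EI_sel)

lemma E_act_zero: "c \<in> carrier A \<Longrightarrow> c \<odot>\<^bsub>E\<^esub> \<zero>\<^bsub>E\<^esub> = \<zero>\<^bsub>E\<^esub>" "c \<in> carrier A \<Longrightarrow> ract E \<zero>\<^bsub>E\<^esub> c = \<zero>\<^bsub>E\<^esub>"
proof -
  show "c \<in> carrier A \<Longrightarrow> c \<odot>\<^bsub>E\<^esub> \<zero>\<^bsub>E\<^esub> = \<zero>\<^bsub>E\<^esub>"
    by (rule additive_zero[OF Eg.abelian_group_axioms Eg.abelian_group_axioms]) (simp_all add: E_closed E_act_add Pi_iff)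
  show "c \<in> carrier A \<Longrightarrow> ract E \<zero>\<^bsub>E\<^esub> c = \<zero>\<^bsub>E\<^esub>"
    by (rule additive_zero[OF Eg.abelian_group_axioms Eg.abelian_group_axioms]) (simp_all add: E_closed E_act_add Pi_iff)
qed

lemma C_closed:
  "f \<in> carrier (C p) \<Longrightarrow> g \<in> carrier (C p) \<Longrightarrow> f \<oplus>\<^bsub>C p\<^esub> g \<in> carrier (C p)" "\<zero>\<^bsub>C p\<^esub> \<in> carrier (C p)"
  "c \<in> carrier A \<Longrightarrow> f \<in> carrier (C p) \<Longrightarrow> c \<odot>\<^bsub>C p\<^esub> f \<in> carrier (C p)"
  "c \<in> carrier A \<Longrightarrow> f \<in> carrier (C p) \<Longrightarrow> ract (C p) f c \<in> carrier (C p)"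
  unfolding C_sel
  by (rule bimodule_homsI; simp add: bimodule_homsD K_lact_closed K_ract_closed Kg.a_closed E_closed E_act_add
    EI_act inner_outer E_act_zero Eg.a_ac)+

lemma K_units:
  assumes "y \<in> W F Q p" "a \<in> carrier A" "b \<in> carrier A"
  shows "kt p a y b = ract (K p) (a \<odot>\<^bsub>K p\<^esub> kt p \<one>\<^bsub>A\<^esub> y \<one>\<^bsub>A\<^esub>) b"
  using assms by (simp add: K_lact K_ract)

lemma C_ext:
  assumes f: "f \<in> carrier (C p)" and g: "g \<in> carrier (C p)"
    and eq: "\<And>y. y \<in> W F Q p \<Longrightarrow> f (kt p \<one>\<^bsub>A\<^esub> y \<one>\<^bsub>A\<^esub>) = g (kt p \<one>\<^bsub>A\<^esub> y \<one>\<^bsub>A\<^esub>)"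
  shows "f = g"
proof
  fix z
  note F = bimodule_homsD[OF f[unfolded C_sel]] and G = bimodule_homsD[OF g[unfolded C_sel]]
  show "f z = g z"
  proof (cases "z \<in> carrier (K p)")
    case True
    then show ?thesis
    proof (induction rule: K_induct)
      case (pure a w b)
      then show ?case unfolding K_units[OF pure(2,1,3)] by (simp add: F G eq kt_closed K_lact_closed)
    next
      case (add u v) then show ?case by (simp add: F G)
    qed
  next
    case False
    then show ?thesis using F(3) G(3) by (simp add: extensional_def)
  qed
qed

end

text \<open>A basis of \<open>W\<^sub>p\<close> adapted to the vertices: \<open>tb b\<close> and
  \<open>sb b\<close> are the target and the source of the basis element \<open>w b\<close>, and
  \<open>c b\<close> is its coordinate function.\<close>

locale Wbasis = fin_quiver F Q for F :: "'f::field itself" and Q :: "('v, 'e) pre_digraph" +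
  fixes p :: nat and B :: "'b set" and w :: "'b \<Rightarrow> ('v, 'e, 'f) pelt" and tb sb :: "'b \<Rightarrow> 'v"
    and c :: "'b \<Rightarrow> ('v, 'e, 'f) pelt \<Rightarrow> 'f"
  assumes finB: "finite B"
    and w_W: "b \<in> B \<Longrightarrow> w b \<in> W F Q p"
    and tb: "b \<in> B \<Longrightarrow> tb b \<in> verts Q" and sb: "b \<in> B \<Longrightarrow> sb b \<in> verts Q"
    and w_left: "b \<in> B \<Longrightarrow> pmul (idem (tb b)) (w b) = w b"
    and w_right: "b \<in> B \<Longrightarrow> pmul (w b) (idem (sb b)) = w b"
    and c_add: "b \<in> B \<Longrightarrow> y \<in> W F Q p \<Longrightarrow> y' \<in> W F Q p \<Longrightarrow> c b (y + y') = c b y + c b y'"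
    and c_scale: "b \<in> B \<Longrightarrow> y \<in> W F Q p \<Longrightarrow> c b (pscale s y) = s * c b y"
    and c_left: "b \<in> B \<Longrightarrow> y \<in> W F Q p \<Longrightarrow> i \<in> verts Q \<Longrightarrow> c b (pmul (idem i) y) = (if i = tb b then c b y else 0)"
    and c_right: "b \<in> B \<Longrightarrow> y \<in> W F Q p \<Longrightarrow> i \<in> verts Q \<Longrightarrow> c b (pmul y (idem i)) = (if i = sb b then c b y else 0)"
    and c_w: "b \<in> B \<Longrightarrow> b' \<in> B \<Longrightarrow> c b (w b') = (if b = b' then 1 else 0)"
    and expand: "y \<in> W F Q p \<Longrightarrow> y = (\<Sum>b\<in>B. pscale (c b y) (w b))"

text \<open>Both bases have the same index set, but \<open>w' b\<close> runs in the direction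
  opposite to \<open>w b\<close>. This matches the swap: a value in
  \<open>e\<^sub>t A \<otimes> A e\<^sub>s\<close> becomes a tensor with \<open>A e\<^sub>s\<close>
  on the left and \<open>e\<^sub>t A\<close> on the right.\<close>

locale dual_pair = X: Wbasis F Q p B w tb sb c + Y: Wbasis F Q q B w' sb tb c'
  for F :: "'f::field itself" and Q :: "('v, 'e) pre_digraph"
    and p :: nat and q :: nat and B :: "'b set" and w :: "'b \<Rightarrow> ('v, 'e, 'f) pelt"
    and w' :: "'b \<Rightarrow> ('v, 'e, 'f) pelt" and tb sb :: "'b \<Rightarrow> 'v"
    and c c' :: "'b \<Rightarrow> ('v, 'e, 'f) pelt \<Rightarrow> 'f"
begin

section \<open>The comparison map from cochains to chains\<close>

abbreviation "unit b \<equiv> X.kt p \<one>\<^bsub>X.A\<^esub> (w b) \<one>\<^bsub>X.A\<^esub>"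

text \<open>If the value of \<open>f\<close> on \<open>w b\<close> is
  \<open>\<alpha>\<^sub>b \<otimes> \<beta>\<^sub>b\<close>, the image is the sum of the tensors
  \<open>\<beta>\<^sub>b \<otimes> w' b \<otimes> \<alpha>\<^sub>b\<close>.\<close>

definition Phi where
  "Phi = (\<lambda>f\<in>carrier (X.C p). \<Oplus>\<^bsub>X.K q\<^esub>b\<in>B. X.sw q (w' b) (f (unit b)))"

lemma unit_closed: "b \<in> B \<Longrightarrow> unit b \<in> carrier (X.K p)"
  by (simp add: X.kt_closed X.w_W)

lemma value_closed: "f \<in> carrier (X.C p) \<Longrightarrow> b \<in> B \<Longrightarrow> f (unit b) \<in> carrier X.E"
  using bimodule_homsD(1)[of f X.A "X.K p" X.E] unit_closed by (simp add: X.C_sel)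

lemma term_closed: "f \<in> carrier (X.C p) \<Longrightarrow> b \<in> B \<Longrightarrow> X.sw q (w' b) (f (unit b)) \<in> carrier (X.K q)"
  by (simp add: X.sw Y.w_W value_closed)

lemma Phi_hom: "Phi \<in> bimodule_homs X.A (X.C p) (X.K q)"
proof (rule bimodule_homsI)
  fix f assume f: "f \<in> carrier (X.C p)"
  then show "Phi f \<in> carrier (X.K q)"
    unfolding Phi_def by (simp add: X.Kg.finsum_closed Pi_iff term_closed)
  fix g assume g: "g \<in> carrier (X.C p)"
  have "Phi (f \<oplus>\<^bsub>X.C p\<^esub> g) = (\<Oplus>\<^bsub>X.K q\<^esub>b\<in>B. X.sw q (w' b) ((f \<oplus>\<^bsub>X.C p\<^esub> g) (unit b)))"
    unfolding Phi_def using f g by (simp add: X.C_closed)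
  also have "\<dots> = (\<Oplus>\<^bsub>X.K q\<^esub>b\<in>B. X.sw q (w' b) (f (unit b))) \<oplus>\<^bsub>X.K q\<^esub> (\<Oplus>\<^bsub>X.K q\<^esub>b\<in>B. X.sw q (w' b) (g (unit b)))"
    by (rule X.finsum_split) (use f g in \<open>simp_all add: term_closed X.C_sel(2) unit_closed X.sw Y.w_W value_closed\<close>)
  finally show "Phi (f \<oplus>\<^bsub>X.C p\<^esub> g) = Phi f \<oplus>\<^bsub>X.K q\<^esub> Phi g" unfolding Phi_def using f g by simp
next
  fix a f assume a: "a \<in> carrier X.A" and f: "f \<in> carrier (X.C p)"
  have "Phi (a \<odot>\<^bsub>X.C p\<^esub> f) = (\<Oplus>\<^bsub>X.K q\<^esub>b\<in>B. X.sw q (w' b) ((a \<odot>\<^bsub>X.C p\<^esub> f) (unit b)))"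
    unfolding Phi_def using f a by (simp add: X.C_closed)
  also have "\<dots> = (\<Oplus>\<^bsub>X.K q\<^esub>b\<in>B. a \<odot>\<^bsub>X.K q\<^esub> X.sw q (w' b) (f (unit b)))"
    by (rule X.Kg.finsum_cong') (use a f in \<open>simp_all add: Pi_iff term_closed X.C_sel(4) unit_closed X.sw_inner Y.w_W value_closed X.K_lact_closed\<close>)
  also have "\<dots> = a \<odot>\<^bsub>X.K q\<^esub> Phi f"
    unfolding Phi_def using a f by (simp add: X.K_lact_sum X.finB term_closed)
  finally show "Phi (a \<odot>\<^bsub>X.C p\<^esub> f) = a \<odot>\<^bsub>X.K q\<^esub> Phi f" .
  have "Phi (ract (X.C p) f a) = (\<Oplus>\<^bsub>X.K q\<^esub>b\<in>B. X.sw q (w' b) ((ract (X.C p) f a) (unit b)))"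
    unfolding Phi_def using f a by (simp add: X.C_closed)
  also have "\<dots> = (\<Oplus>\<^bsub>X.K q\<^esub>b\<in>B. ract (X.K q) (X.sw q (w' b) (f (unit b))) a)"
    by (rule X.Kg.finsum_cong') (use a f in \<open>simp_all add: Pi_iff term_closed X.C_sel(5) unit_closed X.sw_inner Y.w_W value_closed X.K_ract_closed\<close>)
  also have "\<dots> = ract (X.K q) (Phi f) a"
    unfolding Phi_def using a f by (simp add: X.K_ract_sum X.finB term_closed)
  finally show "Phi (ract (X.C p) f a) = ract (X.K q) (Phi f) a" .
qed (simp add: Phi_def)

lemma pr_ei_ei: "i \<in> verts Q \<Longrightarrow> j \<in> verts Q \<Longrightarrow> X.pr (X.ei i) \<otimes>\<^bsub>X.A\<^esub> X.pr (X.ei j) = (if i = j then X.pr (X.ei i) else \<zero>\<^bsub>X.A\<^esub>)"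
  using X.proj_mult[OF X.ei_TC X.ei_TC, of i j] X.phi_zero by (cases "i = j") (simp_all add: field_map_def)

text \<open>This map reads off the component of \<open>w' b\<close> and swaps back. The two
  idempotents make it balanced over \<open>k\<close>; they do no harm, since the values to be
  recovered absorb them.\<close>

lemma psi_ex:
  assumes b: "b \<in> B"
  obtains h where "h \<in> carrier (X.K q) \<rightarrow> carrier X.E"
    "\<And>u v. \<lbrakk>u \<in> carrier (X.K q); v \<in> carrier (X.K q)\<rbrakk> \<Longrightarrow> h (u \<oplus>\<^bsub>X.K q\<^esub> v) = h u \<oplus>\<^bsub>X.E\<^esub> h v"
    "\<And>a y a'. \<lbrakk>a \<in> carrier X.A; y \<in> W F Q q; a' \<in> carrier X.A\<rbrakk> \<Longrightarrow>
      h (X.kt q a y a') = X.et (X.phi (c' b y) \<otimes>\<^bsub>X.A\<^esub> (X.pr (X.ei (tb b)) \<otimes>\<^bsub>X.A\<^esub> a')) (a \<otimes>\<^bsub>X.A\<^esub> X.pr (X.ei (sb b)))"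
proof (rule X.K_lift[of X.E q "\<lambda>a y a'. X.et (X.phi (c' b y) \<otimes>\<^bsub>X.A\<^esub> (X.pr (X.ei (tb b)) \<otimes>\<^bsub>X.A\<^esub> a')) (a \<otimes>\<^bsub>X.A\<^esub> X.pr (X.ei (sb b)))"])
  note e = X.ei_A[OF X.tb[OF b]] X.ei_A[OF X.sb[OF b]]
  note S = X.phi_closed X.et_closed X.ei_A e
  let ?f = "\<lambda>a y a'. X.et (X.phi (c' b y) \<otimes>\<^bsub>X.A\<^esub> (X.pr (X.ei (tb b)) \<otimes>\<^bsub>X.A\<^esub> a')) (a \<otimes>\<^bsub>X.A\<^esub> X.pr (X.ei (sb b)))"
  show "abelian_group X.E" by (rule X.Eg.abelian_group_axioms)
  fix a y a' assume h: "a \<in> carrier X.A" "y \<in> W F Q q" "a' \<in> carrier X.A"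
  show "?f a y a' \<in> carrier X.E" using h by (simp add: S)
  show "?f (a \<oplus>\<^bsub>X.A\<^esub> a2) y a' = ?f a y a' \<oplus>\<^bsub>X.E\<^esub> ?f a2 y a'" if "a2 \<in> carrier X.A" for a2
    using h that by (simp add: S X.A.l_distr X.et_add2)
  show "?f a (y + y2) a' = ?f a y a' \<oplus>\<^bsub>X.E\<^esub> ?f a y2 a'" if "y2 \<in> W F Q q" for y2
    using h that by (simp add: S X.A.l_distr X.et_add1 Y.c_add[OF b] X.phi_add)
  show "?f a y (a' \<oplus>\<^bsub>X.A\<^esub> a2) = ?f a y a' \<oplus>\<^bsub>X.E\<^esub> ?f a y a2" if "a2 \<in> carrier X.A" for a2
    using h that by (simp add: S X.A.r_distr X.et_add1)
  show "?f (X.phi s \<otimes>\<^bsub>X.A\<^esub> a) y a' = ?f a (pscale s y) a'" for s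
    using h by (simp add: S X.A.m_assoc X.et_scale Y.c_scale[OF b] X.phi_mult)
  show "?f a y (X.phi s \<otimes>\<^bsub>X.A\<^esub> a') = ?f a (pscale s y) a'" for s
    using h by (simp add: S X.A.m_assoc X.phi_lcomm[OF e(1)] Y.c_scale[OF b] mult.commute[of s] X.phi_mult)
  fix i assume i: "i \<in> verts Q"
  show "?f (a \<otimes>\<^bsub>X.A\<^esub> X.pr (X.ei i)) y a' = ?f a (pmul (X.ei i) y) a'"
    using h i by (simp add: S X.A.m_assoc pr_ei_ei Y.c_left[OF b] X.sb[OF b] X.phi_zero X.et_zero X.et_zero2)
  show "?f a (pmul y (X.ei i)) a' = ?f a y (X.pr (X.ei i) \<otimes>\<^bsub>X.A\<^esub> a')"
    using h i by (simp add: S X.A.m_assoc[symmetric] pr_ei_ei Y.c_right[OF b] X.tb[OF b] X.phi_zero X.et_zero X.et_zero2)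
qed (rule that)

text \<open>\<open>w b\<close> absorbs the idempotents of its ends, these move through the tensor
  signs to the outer factors, and \<open>f\<close> commutes with the outer actions.\<close>

lemma unit_idem:
  assumes f: "f \<in> carrier (X.C p)" and b: "b \<in> B"
  shows "ract X.E (X.pr (X.ei (tb b)) \<odot>\<^bsub>X.E\<^esub> f (unit b)) (X.pr (X.ei (sb b))) = f (unit b)"
proof -
  note H = bimodule_homsD[OF f[unfolded X.C_sel]]
  note e = X.ei_A[OF X.tb[OF b]] X.ei_A[OF X.sb[OF b]]
  have "ract (X.K p) (X.pr (X.ei (tb b)) \<odot>\<^bsub>X.K p\<^esub> unit b) (X.pr (X.ei (sb b))) = X.kt p (X.pr (X.ei (tb b))) (w b) (X.pr (X.ei (sb b)))"
    using e b by (simp add: X.K_lact X.K_ract X.w_W)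
  also have "\<dots> = X.kt p (\<one>\<^bsub>X.A\<^esub> \<otimes>\<^bsub>X.A\<^esub> X.pr (X.ei (tb b))) (w b) (X.pr (X.ei (sb b)) \<otimes>\<^bsub>X.A\<^esub> \<one>\<^bsub>X.A\<^esub>)"
    using e by simp
  also have "\<dots> = unit b"
    by (subst X.kt_balanced1, simp_all add: X.ei_kk X.tb X.w_W b X.w_left,
        subst X.kt_balanced2[symmetric], simp_all add: X.ei_kk X.sb X.w_W b X.w_right)
  finally show ?thesis
    using e b by (simp add: H(4,5)[symmetric] unit_closed X.K_lact_closed)
qed

lemma psi_sw:
  assumes b: "b \<in> B" "b' \<in> B"
    and h: "h \<in> carrier (X.K q) \<rightarrow> carrier X.E"
    "\<And>u v. \<lbrakk>u \<in> carrier (X.K q); v \<in> carrier (X.K q)\<rbrakk> \<Longrightarrow> h (u \<oplus>\<^bsub>X.K q\<^esub> v) = h u \<oplus>\<^bsub>X.E\<^esub> h v"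
    "\<And>a y a'. \<lbrakk>a \<in> carrier X.A; y \<in> W F Q q; a' \<in> carrier X.A\<rbrakk> \<Longrightarrow>
      h (X.kt q a y a') = X.et (X.phi (c' b y) \<otimes>\<^bsub>X.A\<^esub> (X.pr (X.ei (tb b)) \<otimes>\<^bsub>X.A\<^esub> a')) (a \<otimes>\<^bsub>X.A\<^esub> X.pr (X.ei (sb b)))"
    and z: "z \<in> carrier X.E"
  shows "h (X.sw q (w' b') z) = (if b = b' then ract X.E (X.pr (X.ei (tb b)) \<odot>\<^bsub>X.E\<^esub> z) (X.pr (X.ei (sb b))) else \<zero>\<^bsub>X.E\<^esub>)"
  using z
proof (induction rule: X.E_induct)
  note e = X.ei_A[OF X.tb[OF b(1)]] X.ei_A[OF X.sb[OF b(1)]]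
  case (pure x y)
  then show ?case using b e
    by (cases "b = b'") (simp_all add: X.sw Y.w_W h(3) Y.c_w X.phi_one X.phi_zero X.et_zero X.E_lact X.E_ract)
next
  note e = X.ei_A[OF X.tb[OF b(1)]] X.ei_A[OF X.sb[OF b(1)]]
  case (add u v)
  then show ?case using b e by (simp add: X.sw Y.w_W h(2) X.E_act_add X.E_closed split: if_splits)
qed

lemma Phi_inj: "inj_on Phi (carrier (X.C p))"
proof (rule inj_onI)
  fix f g assume f: "f \<in> carrier (X.C p)" and g: "g \<in> carrier (X.C p)" and eq: "Phi f = Phi g"
  \<comment> \<open>The component map of \<open>b\<close> annihilates all summands of
    \<open>Phi f\<close> except the one of \<open>b\<close>, where it undoes the swap.\<close>
  have key: "f (unit b) = h (Phi f)"
    if b: "b \<in> B" and f: "f \<in> carrier (X.C p)" and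
      h: "h \<in> carrier (X.K q) \<rightarrow> carrier X.E"
    "\<And>u v. \<lbrakk>u \<in> carrier (X.K q); v \<in> carrier (X.K q)\<rbrakk> \<Longrightarrow> h (u \<oplus>\<^bsub>X.K q\<^esub> v) = h u \<oplus>\<^bsub>X.E\<^esub> h v"
    "\<And>a y a'. \<lbrakk>a \<in> carrier X.A; y \<in> W F Q q; a' \<in> carrier X.A\<rbrakk> \<Longrightarrow>
      h (X.kt q a y a') = X.et (X.phi (c' b y) \<otimes>\<^bsub>X.A\<^esub> (X.pr (X.ei (tb b)) \<otimes>\<^bsub>X.A\<^esub> a')) (a \<otimes>\<^bsub>X.A\<^esub> X.pr (X.ei (sb b)))"
    for b f h
  proof -
    have "h (Phi f) = (\<Oplus>\<^bsub>X.E\<^esub>b'\<in>B. h (X.sw q (w' b') (f (unit b'))))"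
      unfolding Phi_def using f
      by (simp add: additive_finsum[OF X.K_group X.Eg.abelian_group_axioms h(1) h(2)] X.finB term_closed)
    also have "\<dots> = (\<Oplus>\<^bsub>X.E\<^esub>b'\<in>B. if b = b' then f (unit b') else \<zero>\<^bsub>X.E\<^esub>)"
      by (rule X.Eg.finsum_cong')
         (use b f in \<open>simp_all add: Pi_iff value_closed psi_sw[OF b _ h] unit_idem\<close>)
    also have "\<dots> = f (unit b)"
      using X.Eg.finsum_singleton[of b B "\<lambda>b. f (unit b)"] b f X.finB by (simp add: Pi_iff value_closed)
    finally show ?thesis by simp
  qed
  have units: "f (unit b) = g (unit b)" if b: "b \<in> B" for b
  proof (rule psi_ex[OF b])
    fix h assume h: "h \<in> carrier (X.K q) \<rightarrow> carrier X.E"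
    "\<And>u v. \<lbrakk>u \<in> carrier (X.K q); v \<in> carrier (X.K q)\<rbrakk> \<Longrightarrow> h (u \<oplus>\<^bsub>X.K q\<^esub> v) = h u \<oplus>\<^bsub>X.E\<^esub> h v"
    "\<And>a y a'. \<lbrakk>a \<in> carrier X.A; y \<in> W F Q q; a' \<in> carrier X.A\<rbrakk> \<Longrightarrow>
      h (X.kt q a y a') = X.et (X.phi (c' b y) \<otimes>\<^bsub>X.A\<^esub> (X.pr (X.ei (tb b)) \<otimes>\<^bsub>X.A\<^esub> a')) (a \<otimes>\<^bsub>X.A\<^esub> X.pr (X.ei (sb b)))"
    show ?thesis using key[OF b f h] key[OF b g h] eq by simp
  qed
  note F = bimodule_homsD[OF f[unfolded X.C_sel]] and G = bimodule_homsD[OF g[unfolded X.C_sel]]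
  show "f = g"
  proof (rule X.C_ext[OF f g])
    fix y assume y: "y \<in> W F Q p"
    have "f (X.kt p \<one>\<^bsub>X.A\<^esub> (\<Sum>b\<in>S. pscale (c b y) (w b)) \<one>\<^bsub>X.A\<^esub>) = g (X.kt p \<one>\<^bsub>X.A\<^esub> (\<Sum>b\<in>S. pscale (c b y) (w b)) \<one>\<^bsub>X.A\<^esub>) \<and>
      (\<Sum>b\<in>S. pscale (c b y) (w b)) \<in> W F Q p" if "finite S" "S \<subseteq> B" for S
      using that
    proof (induction S rule: finite_induct)
      case empty
      show ?case
        using additive_zero[OF X.K_group X.Eg.abelian_group_axioms, of f] additive_zero[OF X.K_group X.Eg.abelian_group_axioms, of g]
        by (simp add: X.kt_zero F G Pi_iff X.W_closed)
    next
      case (insert b S)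
      have b: "b \<in> B" using insert by simp
      have u: "X.kt p \<one>\<^bsub>X.A\<^esub> (pscale (c b y) (w b)) \<one>\<^bsub>X.A\<^esub> = X.phi (c b y) \<odot>\<^bsub>X.K p\<^esub> unit b"
        using b X.kt_scale1[of "\<one>\<^bsub>X.A\<^esub>" "w b" p "c b y" "\<one>\<^bsub>X.A\<^esub>"] by (simp add: X.w_W X.K_lact X.phi_closed)
      have "X.kt p \<one>\<^bsub>X.A\<^esub> (\<Sum>b\<in>insert b S. pscale (c b y) (w b)) \<one>\<^bsub>X.A\<^esub> =
          X.phi (c b y) \<odot>\<^bsub>X.K p\<^esub> unit b \<oplus>\<^bsub>X.K p\<^esub> X.kt p \<one>\<^bsub>X.A\<^esub> (\<Sum>b\<in>S. pscale (c b y) (w b)) \<one>\<^bsub>X.A\<^esub>"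
        using insert b by (simp add: X.kt_add2 X.W_closed X.w_W u)
      then show ?case using insert b
        by (simp add: F G X.phi_closed unit_closed X.K_lact_closed X.kt_closed units X.W_closed X.w_W)
    qed
    from this[OF X.finB subset_refl] X.expand[OF y]
    show "f (X.kt p \<one>\<^bsub>X.A\<^esub> y \<one>\<^bsub>X.A\<^esub>) = g (X.kt p \<one>\<^bsub>X.A\<^esub> y \<one>\<^bsub>X.A\<^esub>)" by simp
  qed
qed

text \<open>The cochain concentrated on a single basis element, with value
  \<open>e\<^sub>t \<alpha> \<otimes> \<beta> e\<^sub>s\<close> there. Its image under
  \<open>Phi\<close> is \<open>\<beta> \<otimes> w' b \<otimes> \<alpha>\<close>, and scalar
  multiples and sums of such tensors exhaust \<open>K(A)\<^sub>q\<close>.\<close>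

lemma gen_ex:
  assumes b: "b \<in> B" and \<alpha>: "\<alpha> \<in> carrier X.A" and \<beta>: "\<beta> \<in> carrier X.A"
  obtains g where "g \<in> carrier (X.C p)"
    "\<And>x y x'. \<lbrakk>x \<in> carrier X.A; y \<in> W F Q p; x' \<in> carrier X.A\<rbrakk> \<Longrightarrow>
      g (X.kt p x y x') = X.et (X.phi (c b y) \<otimes>\<^bsub>X.A\<^esub> (x \<otimes>\<^bsub>X.A\<^esub> (X.pr (X.ei (tb b)) \<otimes>\<^bsub>X.A\<^esub> \<alpha>))) (\<beta> \<otimes>\<^bsub>X.A\<^esub> X.pr (X.ei (sb b)) \<otimes>\<^bsub>X.A\<^esub> x')"
proof -
  let ?f = "\<lambda>x y x'. X.et (X.phi (c b y) \<otimes>\<^bsub>X.A\<^esub> (x \<otimes>\<^bsub>X.A\<^esub> (X.pr (X.ei (tb b)) \<otimes>\<^bsub>X.A\<^esub> \<alpha>))) (\<beta> \<otimes>\<^bsub>X.A\<^esub> X.pr (X.ei (sb b)) \<otimes>\<^bsub>X.A\<^esub> x')"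
  note e = X.ei_A[OF X.tb[OF b]] X.ei_A[OF X.sb[OF b]]
  note S = X.phi_closed X.et_closed X.ei_A e \<alpha> \<beta>
  have ex: "\<exists>h. h \<in> carrier (X.K p) \<rightarrow> carrier X.E \<and>
    (\<forall>u\<in>carrier (X.K p). \<forall>v\<in>carrier (X.K p). h (u \<oplus>\<^bsub>X.K p\<^esub> v) = h u \<oplus>\<^bsub>X.E\<^esub> h v) \<and>
    (\<forall>x\<in>carrier X.A. \<forall>y\<in>W F Q p. \<forall>x'\<in>carrier X.A. h (X.kt p x y x') = ?f x y x')"
  proof (rule X.K_lift[of X.E p ?f])
    show "abelian_group X.E" by (rule X.Eg.abelian_group_axioms)
    fix a y a' assume h: "a \<in> carrier X.A" "y \<in> W F Q p" "a' \<in> carrier X.A"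
    show "?f a y a' \<in> carrier X.E" using h by (simp add: S)
    show "?f (a \<oplus>\<^bsub>X.A\<^esub> a2) y a' = ?f a y a' \<oplus>\<^bsub>X.E\<^esub> ?f a2 y a'" if "a2 \<in> carrier X.A" for a2
      using h that by (simp add: S X.A.l_distr X.A.r_distr X.et_add1)
    show "?f a (y + y2) a' = ?f a y a' \<oplus>\<^bsub>X.E\<^esub> ?f a y2 a'" if "y2 \<in> W F Q p" for y2
      using h that by (simp add: S X.A.l_distr X.et_add1 X.c_add[OF b] X.phi_add)
    show "?f a y (a' \<oplus>\<^bsub>X.A\<^esub> a2) = ?f a y a' \<oplus>\<^bsub>X.E\<^esub> ?f a y a2" if "a2 \<in> carrier X.A" for a2
      using h that by (simp add: S X.A.r_distr X.et_add2)
    show "?f (X.phi s \<otimes>\<^bsub>X.A\<^esub> a) y a' = ?f a (pscale s y) a'" for s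
      using h by (simp add: S X.A.m_assoc X.c_scale[OF b] mult.commute[of s] X.phi_mult)
    show "?f a y (X.phi s \<otimes>\<^bsub>X.A\<^esub> a') = ?f a (pscale s y) a'" for s
      using h by (simp add: S X.A.m_assoc X.phi_lcomm[OF e(2)] X.phi_lcomm[OF \<beta>] X.et_scale X.c_scale[OF b] X.phi_mult)
    fix i assume i: "i \<in> verts Q"
    have e1: "a \<otimes>\<^bsub>X.A\<^esub> X.pr (X.ei i) \<otimes>\<^bsub>X.A\<^esub> (X.pr (X.ei (tb b)) \<otimes>\<^bsub>X.A\<^esub> \<alpha>) =
       (if i = tb b then a \<otimes>\<^bsub>X.A\<^esub> (X.pr (X.ei (tb b)) \<otimes>\<^bsub>X.A\<^esub> \<alpha>) else \<zero>\<^bsub>X.A\<^esub>)"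
    proof -
      have "a \<otimes>\<^bsub>X.A\<^esub> X.pr (X.ei i) \<otimes>\<^bsub>X.A\<^esub> (X.pr (X.ei (tb b)) \<otimes>\<^bsub>X.A\<^esub> \<alpha>) = a \<otimes>\<^bsub>X.A\<^esub> (X.pr (X.ei i) \<otimes>\<^bsub>X.A\<^esub> X.pr (X.ei (tb b)) \<otimes>\<^bsub>X.A\<^esub> \<alpha>)"
        using h i by (simp add: S X.A.m_assoc)
      then show ?thesis using h i by (simp add: S pr_ei_ei X.tb[OF b])
    qed
    show "?f (a \<otimes>\<^bsub>X.A\<^esub> X.pr (X.ei i)) y a' = ?f a (pmul (X.ei i) y) a'"
      unfolding e1 using h i by (simp add: S X.c_left[OF b] X.phi_zero X.et_zero)
    have e3: "\<beta> \<otimes>\<^bsub>X.A\<^esub> X.pr (X.ei (sb b)) \<otimes>\<^bsub>X.A\<^esub> (X.pr (X.ei i) \<otimes>\<^bsub>X.A\<^esub> a') =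
       (if i = sb b then \<beta> \<otimes>\<^bsub>X.A\<^esub> X.pr (X.ei (sb b)) \<otimes>\<^bsub>X.A\<^esub> a' else \<zero>\<^bsub>X.A\<^esub>)"
    proof -
      have "\<beta> \<otimes>\<^bsub>X.A\<^esub> X.pr (X.ei (sb b)) \<otimes>\<^bsub>X.A\<^esub> (X.pr (X.ei i) \<otimes>\<^bsub>X.A\<^esub> a') = \<beta> \<otimes>\<^bsub>X.A\<^esub> (X.pr (X.ei (sb b)) \<otimes>\<^bsub>X.A\<^esub> X.pr (X.ei i)) \<otimes>\<^bsub>X.A\<^esub> a'"
        using h i by (simp add: S X.A.m_assoc)
      then show ?thesis using h i by (simp add: S pr_ei_ei X.sb[OF b])
    qed
    show "?f a (pmul y (X.ei i)) a' = ?f a y (X.pr (X.ei i) \<otimes>\<^bsub>X.A\<^esub> a')"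
      unfolding e3 using h i by (simp add: S X.c_right[OF b] X.phi_zero X.et_zero X.et_zero2)
  qed blast
  then obtain h where h: "h \<in> carrier (X.K p) \<rightarrow> carrier X.E"
    "\<And>u v. \<lbrakk>u \<in> carrier (X.K p); v \<in> carrier (X.K p)\<rbrakk> \<Longrightarrow> h (u \<oplus>\<^bsub>X.K p\<^esub> v) = h u \<oplus>\<^bsub>X.E\<^esub> h v"
    "\<And>x y x'. \<lbrakk>x \<in> carrier X.A; y \<in> W F Q p; x' \<in> carrier X.A\<rbrakk> \<Longrightarrow> h (X.kt p x y x') = ?f x y x'" by blast
  have hc: "h z \<in> carrier X.E" if "z \<in> carrier (X.K p)" for z using h(1) that by blast
  have act: "h (a \<odot>\<^bsub>X.K p\<^esub> z) = a \<odot>\<^bsub>X.E\<^esub> h z \<and> h (ract (X.K p) z a) = ract X.E (h z) a"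
    if "a \<in> carrier X.A" "z \<in> carrier (X.K p)" for a z
    using that(2)
  proof (induction rule: X.K_induct)
    case (pure x y x')
    then show ?case using that(1) by (simp add: X.K_lact X.K_ract h(3) X.E_lact X.E_ract S X.A.m_assoc X.phi_lcomm[OF that(1)])
  next
    case (add u v)
    then show ?case using that(1) by (simp add: h(2) X.K_lact_add X.K_ract_add X.K_lact_closed X.K_ract_closed X.E_act_add hc)
  qed
  have "(\<lambda>z\<in>carrier (X.K p). h z) \<in> carrier (X.C p)"
    unfolding X.C_sel by (rule bimodule_homsI) (simp_all add: hc h(2) act X.K_lact_closed X.K_ract_closed)
  then show thesis by (rule that) (simp add: h(3) X.kt_closed)
qed

lemma Phi_surj_gen:
  assumes b: "b \<in> B" and \<alpha>: "\<alpha> \<in> carrier X.A" and \<beta>: "\<beta> \<in> carrier X.A"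
  shows "X.kt q \<beta> (w' b) \<alpha> \<in> Phi ` carrier (X.C p)"
proof (rule gen_ex[OF b \<alpha> \<beta>])
  fix g assume g: "g \<in> carrier (X.C p)"
    "\<And>x y x'. \<lbrakk>x \<in> carrier X.A; y \<in> W F Q p; x' \<in> carrier X.A\<rbrakk> \<Longrightarrow>
      g (X.kt p x y x') = X.et (X.phi (c b y) \<otimes>\<^bsub>X.A\<^esub> (x \<otimes>\<^bsub>X.A\<^esub> (X.pr (X.ei (tb b)) \<otimes>\<^bsub>X.A\<^esub> \<alpha>))) (\<beta> \<otimes>\<^bsub>X.A\<^esub> X.pr (X.ei (sb b)) \<otimes>\<^bsub>X.A\<^esub> x')"
  note e = X.ei_A[OF X.tb[OF b]] X.ei_A[OF X.sb[OF b]]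
  have w'b: "X.kt q (\<beta> \<otimes>\<^bsub>X.A\<^esub> X.pr (X.ei (sb b))) (w' b) (X.pr (X.ei (tb b)) \<otimes>\<^bsub>X.A\<^esub> \<alpha>) = X.kt q \<beta> (w' b) \<alpha>"
    using b \<alpha> \<beta> e
    by (simp add: X.kt_balanced1 X.kt_balanced2[symmetric] X.ei_kk X.sb X.tb Y.w_W Y.w_left Y.w_right)
  have "Phi g = (\<Oplus>\<^bsub>X.K q\<^esub>b'\<in>B. X.sw q (w' b') (g (unit b')))" unfolding Phi_def using g by simp
  also have "\<dots> = (\<Oplus>\<^bsub>X.K q\<^esub>b'\<in>B. if b = b' then X.kt q \<beta> (w' b') \<alpha> else \<zero>\<^bsub>X.K q\<^esub>)"
  proof (rule X.Kg.finsum_cong')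
    fix b' assume b': "b' \<in> B"
    show "X.sw q (w' b') (g (unit b')) = (if b = b' then X.kt q \<beta> (w' b') \<alpha> else \<zero>\<^bsub>X.K q\<^esub>)"
      using b b' e \<alpha> \<beta> w'b
      by (cases "b = b'") (simp_all add: g(2) X.w_W X.c_w X.phi_one X.phi_zero X.sw Y.w_W X.kt_zero)
  qed (use b \<alpha> \<beta> in \<open>simp_all add: X.kt_closed Y.w_W\<close>)
  also have "\<dots> = X.kt q \<beta> (w' b) \<alpha>"
    using X.Kg.finsum_singleton[of b B "\<lambda>b. X.kt q \<beta> (w' b) \<alpha>"] b \<alpha> \<beta> X.finB by (simp add: X.kt_closed Y.w_W)
  finally show ?thesis using g(1) by (metis imageI)
qed

lemma Phi_surj: "Phi ` carrier (X.C p) = carrier (X.K q)"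
proof
  note H = bimodule_homsD[OF Phi_hom]
  show "Phi ` carrier (X.C p) \<subseteq> carrier (X.K q)" using H(1) by blast
  have im_add: "u \<oplus>\<^bsub>X.K q\<^esub> v \<in> Phi ` carrier (X.C p)" if u: "u \<in> Phi ` carrier (X.C p)" "v \<in> Phi ` carrier (X.C p)" for u v
  proof -
    obtain f g where "u = Phi f" "v = Phi g" "f \<in> carrier (X.C p)" "g \<in> carrier (X.C p)" using u by blast
    then show ?thesis using H(2)[of f g] X.C_closed(1)[of f p g] by (metis imageI)
  qed
  show "carrier (X.K q) \<subseteq> Phi ` carrier (X.C p)"
  proof
    fix z assume "z \<in> carrier (X.K q)"
    then show "z \<in> Phi ` carrier (X.C p)"
    proof (induction rule: X.K_induct)
      case (pure a y a')
      have "X.kt q a (\<Sum>b\<in>S. pscale (c' b y) (w' b)) a' \<in> Phi ` carrier (X.C p) \<and>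
        (\<Sum>b\<in>S. pscale (c' b y) (w' b)) \<in> W F Q q" if "finite S" "S \<subseteq> B" for S
        using that
      proof (induction S rule: finite_induct)
        case empty
        have "Phi \<zero>\<^bsub>X.C p\<^esub> = (\<Oplus>\<^bsub>X.K q\<^esub>b\<in>B. X.sw q (w' b) (\<zero>\<^bsub>X.C p\<^esub> (unit b)))"
          unfolding Phi_def by (simp add: X.C_closed)
        also have "\<dots> = (\<Oplus>\<^bsub>X.K q\<^esub>b\<in>B. \<zero>\<^bsub>X.K q\<^esub>)"
        proof (rule X.Kg.finsum_cong')
          fix b assume b: "b \<in> B"
          have "X.sw q (w' b) \<zero>\<^bsub>X.E\<^esub> = \<zero>\<^bsub>X.K q\<^esub>"
            by (rule additive_zero[OF X.Eg.abelian_group_axioms X.K_group]) (simp_all add: X.sw Y.w_W b Pi_iff)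
          then show "X.sw q (w' b) (\<zero>\<^bsub>X.C p\<^esub> (unit b)) = \<zero>\<^bsub>X.K q\<^esub>" using b by (simp add: X.C_sel(3) unit_closed)
        qed simp_all
        finally have "Phi \<zero>\<^bsub>X.C p\<^esub> = \<zero>\<^bsub>X.K q\<^esub>" by simp
        then have "\<zero>\<^bsub>X.K q\<^esub> \<in> Phi ` carrier (X.C p)" using X.C_closed(2) by (metis imageI)
        then show ?case using pure by (simp add: X.kt_zero X.W_closed)
      next
        case (insert b S)
        have b: "b \<in> B" using insert by simp
        have "X.kt q a (pscale (c' b y) (w' b)) a' = X.kt q (X.phi (c' b y) \<otimes>\<^bsub>X.A\<^esub> a) (w' b) a'"
          using pure b by (simp add: X.kt_scale1 Y.w_W)
        then have "X.kt q a (pscale (c' b y) (w' b)) a' \<in> Phi ` carrier (X.C p)"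
          using Phi_surj_gen[OF b, of a' "X.phi (c' b y) \<otimes>\<^bsub>X.A\<^esub> a"] pure X.phi_closed by simp
        then show ?case using insert pure b im_add by (simp add: X.kt_add2 X.W_closed Y.w_W)
      qed
      from this[OF X.finB subset_refl] Y.expand[OF pure(2)] show ?case by simp
    next
      case (add u v) then show ?case by (intro im_add)
    qed
  qed
qed

end

section \<open>Subquotients, and bases of the spaces \<open>W\<^sub>p\<close>\<close>

lemma mem_coset_iff: "x \<in> H +>\<^bsub>M\<^esub> a \<longleftrightarrow> (\<exists>h\<in>H. x = h \<oplus>\<^bsub>M\<^esub> a)"
  unfolding a_r_coset_def r_coset_def by auto

lemma mem_set_add_iff: "x \<in> H <+>\<^bsub>M\<^esub> H' \<longleftrightarrow> (\<exists>h\<in>H. \<exists>h'\<in>H'. x = h \<oplus>\<^bsub>M\<^esub> h')"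
  unfolding set_add_def set_mult_def by auto

definition sub_bimodule where
  "sub_bimodule R M Z \<longleftrightarrow> Z \<subseteq> carrier M \<and> \<zero>\<^bsub>M\<^esub> \<in> Z \<and> (\<forall>x\<in>Z. \<forall>y\<in>Z. x \<oplus>\<^bsub>M\<^esub> y \<in> Z) \<and> (\<forall>x\<in>Z. \<ominus>\<^bsub>M\<^esub> x \<in> Z) \<and>
    (\<forall>r\<in>carrier R. \<forall>x\<in>Z. r \<odot>\<^bsub>M\<^esub> x \<in> Z \<and> ract M x r \<in> Z)"

lemma sub_bimoduleD:
  assumes "sub_bimodule R M Z"
  shows "x \<in> Z \<Longrightarrow> x \<in> carrier M" "\<zero>\<^bsub>M\<^esub> \<in> Z" "\<lbrakk>x \<in> Z; y \<in> Z\<rbrakk> \<Longrightarrow> x \<oplus>\<^bsub>M\<^esub> y \<in> Z" "x \<in> Z \<Longrightarrow> \<ominus>\<^bsub>M\<^esub> x \<in> Z"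
    "\<lbrakk>r \<in> carrier R; x \<in> Z\<rbrakk> \<Longrightarrow> r \<odot>\<^bsub>M\<^esub> x \<in> Z" "\<lbrakk>r \<in> carrier R; x \<in> Z\<rbrakk> \<Longrightarrow> ract M x r \<in> Z"
  using assms by (auto simp: sub_bimodule_def)

lemma subquotient_sel:
  "carrier (subquotient M Z B) = {B +>\<^bsub>M\<^esub> z | z. z \<in> Z}" "ring.add (subquotient M Z B) = set_add M"
  "ring.zero (subquotient M Z B) = B"
  "l \<odot>\<^bsub>subquotient M Z B\<^esub> S = (\<Union>x\<in>S. B +>\<^bsub>M\<^esub> (l \<odot>\<^bsub>M\<^esub> x))"
  "ract (subquotient M Z B) S r = (\<Union>x\<in>S. B +>\<^bsub>M\<^esub> (ract M x r))"
  by (simp_all add: subquotient_def)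

locale sub_bimod = bimod "carrier R" M "carrier R" for R :: "('a, 'z) ring_scheme" and M :: "('a, 'm, 'a) bimodule" (structure) +
  fixes B assumes sub: "sub_bimodule R M B"
begin

lemmas B = sub_bimoduleD[OF sub]

lemma coset_self: "x \<in> carrier M \<Longrightarrow> x \<in> B +> x"
  using B(2) unfolding mem_coset_iff by (intro bexI[of _ \<zero>]) simp_all

lemma coset_eq_iff:
  assumes "x \<in> carrier M" "y \<in> carrier M"
  shows "B +> x = B +> y \<longleftrightarrow> x \<ominus> y \<in> B"
proof
  assume "B +> x = B +> y"
  then have "x \<in> B +> y" using coset_self[OF assms(1)] by simp
  then obtain b where b: "b \<in> B" "x = b \<oplus> y" unfolding mem_coset_iff by blast
  have "x \<ominus> y = b" using b B(1)[OF b(1)] assms by (simp add: a_minus_def a_assoc r_neg)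
  then show "x \<ominus> y \<in> B" using b by simp
next
  have key: "B +> x \<subseteq> B +> y" if xy: "x \<in> carrier M" "y \<in> carrier M" "x \<ominus> y \<in> B" for x y
  proof
    fix z assume "z \<in> B +> x"
    then obtain b where b: "b \<in> B" "z = b \<oplus> x" unfolding mem_coset_iff by blast
    have "z = (b \<oplus> (x \<ominus> y)) \<oplus> y" using b B(1)[OF b(1)] xy by (simp add: a_minus_def a_assoc l_neg)
    then show "z \<in> B +> y" using B(3)[OF b(1) xy(3)] unfolding mem_coset_iff by blast
  qed
  assume d: "x \<ominus> y \<in> B"
  have "y \<ominus> x = \<ominus> (x \<ominus> y)" using assms by (simp add: a_minus_def minus_add a_comm)
  then have "y \<ominus> x \<in> B" using B(4)[OF d] by simp
  then show "B +> x = B +> y" using key assms d by blast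
qed

lemma coset_absorb: "b \<in> B \<Longrightarrow> x \<in> carrier M \<Longrightarrow> B +> (b \<oplus> x) = B +> x"
  using B(1)[of b] by (subst coset_eq_iff) (simp_all add: a_minus_def a_assoc r_neg)

lemma coset_subset: "x \<in> carrier M \<Longrightarrow> B +> x \<subseteq> carrier M"
  using B(1) unfolding subset_iff mem_coset_iff by auto

lemma coset_add:
  assumes x: "x \<in> carrier M" and y: "y \<in> carrier M"
  shows "(B +> x) <+>\<^bsub>M\<^esub> (B +> y) = B +> (x \<oplus> y)"
proof
  show "(B +> x) <+>\<^bsub>M\<^esub> (B +> y) \<subseteq> B +> (x \<oplus> y)"
  proof
    fix z assume "z \<in> (B +> x) <+>\<^bsub>M\<^esub> (B +> y)"
    then obtain h h' where "h \<in> B +> x" "h' \<in> B +> y" "z = h \<oplus> h'" unfolding mem_set_add_iff by blast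
    moreover from this obtain b b' where "b \<in> B" "h = b \<oplus> x" "b' \<in> B" "h' = b' \<oplus> y"
      unfolding mem_coset_iff by blast
    ultimately have b: "b \<in> B" "b' \<in> B" "z = (b \<oplus> x) \<oplus> (b' \<oplus> y)" by blast+
    then have "z = (b \<oplus> b') \<oplus> (x \<oplus> y)" using B(1) x y by (simp add: a_ac)
    then show "z \<in> B +> (x \<oplus> y)" using B(3) b unfolding mem_coset_iff by blast
  qed
  show "B +> (x \<oplus> y) \<subseteq> (B +> x) <+>\<^bsub>M\<^esub> (B +> y)"
  proof
    fix z assume "z \<in> B +> (x \<oplus> y)"
    then obtain b where b: "b \<in> B" "z = b \<oplus> (x \<oplus> y)" unfolding mem_coset_iff by blast
    then have "z = (b \<oplus> x) \<oplus> y" using B(1) x y by (simp add: a_assoc)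
    moreover have "b \<oplus> x \<in> B +> x" using b unfolding mem_coset_iff by blast
    ultimately show "z \<in> (B +> x) <+>\<^bsub>M\<^esub> (B +> y)"
      using coset_self[OF y] unfolding mem_set_add_iff by blast
  qed
qed

lemma coset_lact:
  assumes x: "x \<in> carrier M" and r: "r \<in> carrier R"
  shows "(\<Union>y\<in>B +> x. B +> (r \<odot> y)) = B +> (r \<odot> x)" "(\<Union>y\<in>B +> x. B +> (ract M y r)) = B +> (ract M x r)"
proof -
  have "B +> (r \<odot> y) = B +> (r \<odot> x) \<and> B +> (ract M y r) = B +> (ract M x r)" if y: "y \<in> B +> x" for y
  proof -
    obtain b where b: "b \<in> B" "y = b \<oplus> x" using y unfolding mem_coset_iff by blast
    then show ?thesis using B(1,5,6) x r by (simp add: lact_add ract_add coset_absorb lact_closed ract_closed)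
  qed
  then show "(\<Union>y\<in>B +> x. B +> (r \<odot> y)) = B +> (r \<odot> x)" "(\<Union>y\<in>B +> x. B +> (ract M y r)) = B +> (ract M x r)"
    using coset_self[OF x] by blast+
qed

lemma subquotient_ops:
  assumes "x \<in> carrier M" "y \<in> carrier M" "r \<in> carrier R"
  shows "(B +> x) \<oplus>\<^bsub>subquotient M Z B\<^esub> (B +> y) = B +> (x \<oplus> y)"
    "r \<odot>\<^bsub>subquotient M Z B\<^esub> (B +> x) = B +> (r \<odot> x)"
    "ract (subquotient M Z B) (B +> x) r = B +> (ract M x r)"
  using assms by (simp_all add: subquotient_sel coset_add coset_lact)

end

lemma image_coset:
  assumes "f \<in> bimodule_homs R M N" "B \<subseteq> carrier M" "z \<in> carrier M"
  shows "f ` (B +>\<^bsub>M\<^esub> z) = (f ` B) +>\<^bsub>N\<^esub> f z"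
proof -
  have *: "f (b \<oplus>\<^bsub>M\<^esub> z) = f b \<oplus>\<^bsub>N\<^esub> f z" if "b \<in> B" for b using bimodule_homsD(2)[OF assms(1)] assms(2,3) that by blast
  show ?thesis
  proof (intro equalityI subsetI)
    fix y assume "y \<in> f ` (B +>\<^bsub>M\<^esub> z)"
    then obtain x where x: "x \<in> B +>\<^bsub>M\<^esub> z" "y = f x" by blast
    then obtain b where b: "b \<in> B" "x = b \<oplus>\<^bsub>M\<^esub> z" unfolding mem_coset_iff by blast
    show "y \<in> (f ` B) +>\<^bsub>N\<^esub> f z"
      unfolding mem_coset_iff by (rule bexI[of _ "f b"]) (simp_all add: x(2) b *)
  next
    fix y assume "y \<in> (f ` B) +>\<^bsub>N\<^esub> f z"
    then obtain b where b: "b \<in> B" "y = f b \<oplus>\<^bsub>N\<^esub> f z" unfolding mem_coset_iff by blast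
    show "y \<in> f ` (B +>\<^bsub>M\<^esub> z)"
      by (rule image_eqI[of _ _ "b \<oplus>\<^bsub>M\<^esub> z"]) (use b in \<open>auto simp: * mem_coset_iff\<close>)
  qed
qed

lemma subquotient_iso:
  assumes M: "sub_bimod R M B" and Z: "sub_bimodule R M Z"
    and f: "f \<in> bimodule_homs R M N" and bij: "bij_betw f (carrier M) (carrier N)"
    and N: "sub_bimod R N (f ` B)"
  shows "bimodule_iso R (subquotient M Z B) (subquotient N (f ` Z) (f ` B))"
proof -
  interpret M: sub_bimod R M B by (rule M)
  interpret N: sub_bimod R N "f ` B" by (rule N)
  note Zc = sub_bimoduleD[OF Z] and H = bimodule_homsD[OF f]
  have Bc: "B \<subseteq> carrier M" using M.B(1) by blast
  let ?S = "subquotient M Z B" and ?T = "subquotient N (f ` Z) (f ` B)"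
  \<comment> \<open>A bijection acts on cosets by direct image, so no representative has to be
    chosen and injectivity is that of the image map on subsets.\<close>
  let ?g = "\<lambda>S\<in>carrier ?S. f ` S"
  have g: "?g (B +>\<^bsub>M\<^esub> z) = (f ` B) +>\<^bsub>N\<^esub> f z" and gc: "B +>\<^bsub>M\<^esub> z \<in> carrier ?S" if "z \<in> Z" for z
    using that image_coset[OF f Bc Zc(1)[OF that]] by (auto simp: subquotient_sel)
  have "?g \<in> bimodule_homs R ?S ?T"
  proof (rule bimodule_homsI)
    fix S assume "S \<in> carrier ?S"
    then obtain z where z: "S = B +>\<^bsub>M\<^esub> z" "z \<in> Z" by (auto simp: subquotient_sel)
    then show "?g S \<in> carrier ?T" unfolding z(1) g[OF z(2)] by (auto simp: subquotient_sel)
    fix S' assume "S' \<in> carrier ?S"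
    then obtain z' where z': "S' = B +>\<^bsub>M\<^esub> z'" "z' \<in> Z" by (auto simp: subquotient_sel)
    have "S \<oplus>\<^bsub>?S\<^esub> S' = B +>\<^bsub>M\<^esub> (z \<oplus>\<^bsub>M\<^esub> z')"
      unfolding z z' using z z' Zc(1) by (simp add: subquotient_sel M.coset_add)
    then have "?g (S \<oplus>\<^bsub>?S\<^esub> S') = (f ` B) +>\<^bsub>N\<^esub> (f z \<oplus>\<^bsub>N\<^esub> f z')"
      using z z' Zc g[of "z \<oplus>\<^bsub>M\<^esub> z'"] H(2) by (simp only:)
    also have "\<dots> = ?g S \<oplus>\<^bsub>?T\<^esub> ?g S'"
      unfolding z z' g[OF z(2)] g[OF z'(2)] using z z' Zc(1) H(1) by (simp add: subquotient_sel N.coset_add)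
    finally show "?g (S \<oplus>\<^bsub>?S\<^esub> S') = ?g S \<oplus>\<^bsub>?T\<^esub> ?g S'" .
  next
    fix r S assume r: "r \<in> carrier R" and "S \<in> carrier ?S"
    then obtain z where z: "S = B +>\<^bsub>M\<^esub> z" "z \<in> Z" by (auto simp: subquotient_sel)
    have zc: "z \<in> carrier M" "f z \<in> carrier N" using Zc(1) z(2) H(1) by blast+
    have "?g (r \<odot>\<^bsub>?S\<^esub> S) = (f ` B) +>\<^bsub>N\<^esub> (r \<odot>\<^bsub>N\<^esub> f z)"
      unfolding z(1) M.subquotient_ops(2)[OF zc(1) zc(1) r] g[OF Zc(5)[OF r z(2)]] H(4)[OF r zc(1)] ..
    also have "\<dots> = r \<odot>\<^bsub>?T\<^esub> ?g S"
      unfolding z(1) g[OF z(2)] N.subquotient_ops(2)[OF zc(2) zc(2) r] ..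
    finally show "?g (r \<odot>\<^bsub>?S\<^esub> S) = r \<odot>\<^bsub>?T\<^esub> ?g S" .
    have "?g (ract ?S S r) = (f ` B) +>\<^bsub>N\<^esub> (ract N (f z) r)"
      unfolding z(1) M.subquotient_ops(3)[OF zc(1) zc(1) r] g[OF Zc(6)[OF r z(2)]] H(5)[OF r zc(1)] ..
    also have "\<dots> = ract ?T (?g S) r"
      unfolding z(1) g[OF z(2)] N.subquotient_ops(3)[OF zc(2) zc(2) r] ..
    finally show "?g (ract ?S S r) = ract ?T (?g S) r" .
  qed simp
  moreover have "bij_betw ?g (carrier ?S) (carrier ?T)"
  proof (rule bij_betwI')
    have sub: "S \<subseteq> carrier M" if "S \<in> carrier ?S" for S
    proof -
      obtain z where z: "S = B +>\<^bsub>M\<^esub> z" "z \<in> Z" using \<open>S \<in> carrier ?S\<close> by (auto simp: subquotient_sel)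
      then show ?thesis using M.coset_subset[OF Zc(1)[OF z(2)]] by simp
    qed
    fix S S' assume S: "S \<in> carrier ?S" "S' \<in> carrier ?S"
    with sub[OF S(1)] sub[OF S(2)] show "(?g S = ?g S') = (S = S')"
      using inj_on_image_eq_iff[OF bij_betw_imp_inj_on[OF bij]] by simp
  next
    fix S assume "S \<in> carrier ?S"
    then obtain z where z: "S = B +>\<^bsub>M\<^esub> z" "z \<in> Z" by (auto simp: subquotient_sel)
    then show "?g S \<in> carrier ?T" unfolding z(1) g[OF z(2)] by (auto simp: subquotient_sel)
  next
    fix T assume "T \<in> carrier ?T"
    then obtain z where z: "T = (f ` B) +>\<^bsub>N\<^esub> f z" "z \<in> Z" by (auto simp: subquotient_sel)
    then show "\<exists>S\<in>carrier ?S. T = ?g S" using g[OF z(2)] gc[OF z(2)] by metis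
  qed
  ultimately show ?thesis unfolding bimodule_iso_def by blast
qed

lemma first_iso:
  assumes M: "sub_bimod R M B" and N: "abelian_group N"
    and f: "f \<in> bimodule_homs R M N" and surj: "f ` carrier M = carrier N"
    and ker: "B = {z \<in> carrier M. f z = \<zero>\<^bsub>N\<^esub>}"
  shows "bimodule_iso R (subquotient M (carrier M) B) N"
proof -
  interpret M: sub_bimod R M B by (rule M)
  interpret N: abelian_group N by (rule N)
  note H = bimodule_homsD[OF f]
  let ?S = "subquotient M (carrier M) B"
  \<comment> \<open>Here \<open>f\<close> need not be injective, so its common value on the coset is
    read off at an arbitrary element.\<close>
  let ?g = "\<lambda>S\<in>carrier ?S. f (SOME z. z \<in> S)"
  have fm: "f (x \<ominus>\<^bsub>M\<^esub> y) = f x \<ominus>\<^bsub>N\<^esub> f y" if "x \<in> carrier M" "y \<in> carrier M" for x y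
    using that additive_minus[OF M.abelian_group_axioms N, of f y] H(1,2) by (simp add: a_minus_def Pi_iff)
  have eq: "f x = f y \<longleftrightarrow> B +>\<^bsub>M\<^esub> x = B +>\<^bsub>M\<^esub> y" if "x \<in> carrier M" "y \<in> carrier M" for x y
  proof -
    have "B +>\<^bsub>M\<^esub> x = B +>\<^bsub>M\<^esub> y \<longleftrightarrow> f x \<ominus>\<^bsub>N\<^esub> f y = \<zero>\<^bsub>N\<^esub>"
      unfolding M.coset_eq_iff[OF that] using that by (subst ker) (simp add: fm)
    also have "\<dots> \<longleftrightarrow> f x = f y" using N.minus_to_eq H(1) that by (auto simp: a_minus_def N.r_neg)
    finally show ?thesis by simp
  qed
  have gc: "B +>\<^bsub>M\<^esub> z \<in> carrier ?S" if "z \<in> carrier M" for z using that by (auto simp: subquotient_sel)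
  have g: "?g (B +>\<^bsub>M\<^esub> z) = f z" if z: "z \<in> carrier M" for z
  proof -
    define y where "y = (SOME y. y \<in> B +>\<^bsub>M\<^esub> z)"
    have "y \<in> B +>\<^bsub>M\<^esub> z" unfolding y_def by (rule someI[of _ z]) (rule M.coset_self[OF z])
    then obtain b where b: "b \<in> B" "y = b \<oplus>\<^bsub>M\<^esub> z" unfolding mem_coset_iff by blast
    have "B +>\<^bsub>M\<^esub> y = B +>\<^bsub>M\<^esub> z" "y \<in> carrier M" using M.coset_absorb[OF b(1) z] M.B(1)[OF b(1)] b z by simp_all
    then have "f y = f z" using eq z by blast
    then show ?thesis using gc[OF z] by (simp add: y_def)
  qed
  have "?g \<in> bimodule_homs R ?S N"
  proof (rule bimodule_homsI)
    fix S assume "S \<in> carrier ?S"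
    then obtain z where z: "S = B +>\<^bsub>M\<^esub> z" "z \<in> carrier M" by (auto simp: subquotient_sel)
    then show "?g S \<in> carrier N" unfolding z(1) g[OF z(2)] using H(1) by blast
    fix S' assume "S' \<in> carrier ?S"
    then obtain z' where z': "S' = B +>\<^bsub>M\<^esub> z'" "z' \<in> carrier M" by (auto simp: subquotient_sel)
    have "S \<oplus>\<^bsub>?S\<^esub> S' = B +>\<^bsub>M\<^esub> (z \<oplus>\<^bsub>M\<^esub> z')"
      unfolding z(1) z'(1) using z z' by (simp add: subquotient_sel M.coset_add)
    then show "?g (S \<oplus>\<^bsub>?S\<^esub> S') = ?g S \<oplus>\<^bsub>N\<^esub> ?g S'"
      unfolding z(1) z'(1) using g[OF z(2)] g[OF z'(2)] g[OF M.a_closed[OF z(2) z'(2)]] H(2)[OF z(2) z'(2)] by simp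
  next
    fix r S assume r: "r \<in> carrier R" and "S \<in> carrier ?S"
    then obtain z where z: "S = B +>\<^bsub>M\<^esub> z" "z \<in> carrier M" by (auto simp: subquotient_sel)
    show "?g (r \<odot>\<^bsub>?S\<^esub> S) = r \<odot>\<^bsub>N\<^esub> ?g S" "?g (ract ?S S r) = ract N (?g S) r"
      unfolding z(1) M.subquotient_ops(2,3)[OF z(2) z(2) r] g[OF z(2)] g[OF M.lact_closed[OF r z(2)]]
        g[OF M.ract_closed[OF r z(2)]] H(4,5)[OF r z(2)] by (rule refl)+
  qed simp
  moreover have "bij_betw ?g (carrier ?S) (carrier N)"
  proof (rule bij_betwI')
    fix S S' assume "S \<in> carrier ?S" "S' \<in> carrier ?S"
    then obtain z z' where z: "S = B +>\<^bsub>M\<^esub> z" "z \<in> carrier M" "S' = B +>\<^bsub>M\<^esub> z'" "z' \<in> carrier M"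
      by (auto simp: subquotient_sel)
    show "(?g S = ?g S') = (S = S')" unfolding z(1,3) g[OF z(2)] g[OF z(4)] using eq z by blast
  next
    fix S assume "S \<in> carrier ?S"
    then obtain z where z: "S = B +>\<^bsub>M\<^esub> z" "z \<in> carrier M" by (auto simp: subquotient_sel)
    then show "?g S \<in> carrier N" unfolding z(1) g[OF z(2)] using H(1) by blast
  next
    fix n assume "n \<in> carrier N"
    then obtain z where "n = f z" "z \<in> carrier M" using surj by blast
    then show "\<exists>S\<in>carrier ?S. n = ?g S" using g gc by metis
  qed
  ultimately show ?thesis unfolding bimodule_iso_def by blast
qed

context fin_quiver begin

lemma C_bimod: "bimod (carrier A) (C p) (carrier A)"
proof (intro bimod.intro bimod_axioms.intro)
  have ext: "f = g" if "f \<in> carrier (C p)" "g \<in> carrier (C p)" "\<And>x. x \<in> carrier (K p) \<Longrightarrow> f x = g x" for f g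
    using that bimodule_homsD(3)[of f A "K p" E] bimodule_homsD(3)[of g A "K p" E]
    unfolding C_sel by (intro extensionalityI) auto
  have val: "f x \<in> carrier E" if "f \<in> carrier (C p)" "x \<in> carrier (K p)" for f x
    using bimodule_homsD(1)[of f A "K p" E x] that by (simp add: C_sel)
  show "abelian_group (C p)"
  proof (rule abelian_groupI)
    fix f assume f: "f \<in> carrier (C p)"
    note H = bimodule_homsD[OF f[unfolded C_sel]]
    have g: "(\<lambda>x\<in>carrier (K p). \<ominus>\<^bsub>E\<^esub> f x) \<in> carrier (C p)" unfolding C_sel
      by (rule bimodule_homsI) (simp_all add: H K_lact_closed K_ract_closed E_minus Eg.minus_add)
    show "\<exists>g\<in>carrier (C p). g \<oplus>\<^bsub>C p\<^esub> f = \<zero>\<^bsub>C p\<^esub>"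
      by (rule bexI[OF _ g], rule ext[OF C_closed(1)[OF g f] C_closed(2)]) (simp add: C_sel H Eg.l_neg)
    show "\<zero>\<^bsub>C p\<^esub> \<oplus>\<^bsub>C p\<^esub> f = f"
      by (rule ext[OF C_closed(1)[OF C_closed(2) f] f]) (simp add: C_sel H)
    fix g assume g: "g \<in> carrier (C p)"
    show "f \<oplus>\<^bsub>C p\<^esub> g = g \<oplus>\<^bsub>C p\<^esub> f"
      by (rule ext[OF C_closed(1)[OF f g] C_closed(1)[OF g f]]) (simp add: C_sel(2) val f g Eg.a_comm)
    fix h assume h: "h \<in> carrier (C p)"
    show "f \<oplus>\<^bsub>C p\<^esub> g \<oplus>\<^bsub>C p\<^esub> h = f \<oplus>\<^bsub>C p\<^esub> (g \<oplus>\<^bsub>C p\<^esub> h)"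
      by (rule ext[OF C_closed(1)[OF C_closed(1)[OF f g] h] C_closed(1)[OF f C_closed(1)[OF g h]]])
         (simp add: C_sel(2) val f g h Eg.a_assoc)
  qed (simp_all add: C_closed)
  fix a f assume a: "a \<in> carrier A" and f: "f \<in> carrier (C p)"
  show "a \<odot>\<^bsub>C p\<^esub> f \<in> carrier (C p)" "ract (C p) f a \<in> carrier (C p)" using a f by (simp_all add: C_closed)
  fix g assume g: "g \<in> carrier (C p)"
  show "a \<odot>\<^bsub>C p\<^esub> (f \<oplus>\<^bsub>C p\<^esub> g) = a \<odot>\<^bsub>C p\<^esub> f \<oplus>\<^bsub>C p\<^esub> a \<odot>\<^bsub>C p\<^esub> g"
    by (rule ext) (use a f g in \<open>simp_all add: C_closed, simp add: C_sel(2,4) val EI_act\<close>)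
  show "ract (C p) (f \<oplus>\<^bsub>C p\<^esub> g) a = ract (C p) f a \<oplus>\<^bsub>C p\<^esub> ract (C p) g a"
    by (rule ext) (use a f g in \<open>simp_all add: C_closed, simp add: C_sel(2,5) val EI_act\<close>)
next
  fix l r f assume l: "l \<in> carrier A" and r: "r \<in> carrier A" and f: "f \<in> carrier (C p)"
  have "ract EI (l \<odot>\<^bsub>EI\<^esub> z) r = l \<odot>\<^bsub>EI\<^esub> ract EI z r" if "z \<in> carrier E" for z
    using that
  proof (induction rule: E_induct)
    case (pure a b) then show ?case using l r by (simp add: EI_act)
  next
    case (add u v) then show ?case using l r by (simp add: EI_act)
  qed
  then show "ract (C p) (l \<odot>\<^bsub>C p\<^esub> f) r = l \<odot>\<^bsub>C p\<^esub> ract (C p) f r"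
    using bimodule_homsD(1)[OF f[unfolded C_sel]] by (auto simp: C_sel(4,5) fun_eq_iff restrict_def)
qed

end

section \<open>Bases of \<open>W\<^sub>0\<close>, \<open>W\<^sub>1\<close> and
  \<open>W\<^sub>2\<close>, and the vanishing of \<open>W\<^sub>3\<close>\<close>

text \<open>The second assumption fails exactly when \<open>x\<close> and \<open>x\<^sup>*\<close> form a component of type \<open>A\<^sub>2\<close>.\<close>

locale koszul_quiver = fin_quiver F Q for F :: "'f::field itself" and Q :: "('v, 'e) pre_digraph" +
  assumes no_isolated: "i \<in> verts Q \<Longrightarrow> \<exists>x\<in>arcs (double_quiver Q). head (double_quiver Q) x = i"
    and not_A2: "x \<in> arcs (double_quiver Q) \<Longrightarrow> \<exists>y\<in>arcs (double_quiver Q).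
      head (double_quiver Q) y = tail (double_quiver Q) x \<and> y \<noteq> star x \<or>
      head (double_quiver Q) y = head (double_quiver Q) x \<and> y \<noteq> x"
begin

lemma kk_relations:
  assumes "e \<in> kk" "r \<in> relations F Q"
  shows "pmul e r \<in> relations F Q" "pmul r e \<in> relations F Q"
proof -
  have R: "pv.subspace (relations F Q)" by (simp add: relations_eq)
  have g: "sg i \<in> relations F Q" if "i \<in> verts Q" for i using that by (simp add: relations_eq pv.span_base)
  have l: "pmul (ei j) r \<in> relations F Q" for j
    unfolding relations_eq
    by (rule span_image_closed[where S = "sg ` verts Q" and h = "pmul (ei j)"])
       (use assms(2) g in \<open>auto simp: pmul_add_right pmul_pscale_right ei_sg relations_eq pv.span_zero\<close>)
  have r: "pmul r (ei j) \<in> relations F Q" for j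
    unfolding relations_eq
    by (rule span_image_closed[where S = "sg ` verts Q" and h = "\<lambda>r. pmul r (ei j)"])
       (use assms(2) g in \<open>auto simp: pmul_add_left pmul_pscale_left sg_ei relations_eq pv.span_zero\<close>)
  show "pmul e r \<in> relations F Q" using assms(1)
    by (induction rule: kk_induct)
       (auto simp: pmul_add_left pmul_pscale_left l pv.subspace_0[OF R] pv.subspace_scale[OF R] pv.subspace_add[OF R])
  show "pmul r e \<in> relations F Q" using assms(1)
    by (induction rule: kk_induct)
       (auto simp: pmul_add_right pmul_pscale_right r pv.subspace_0[OF R] pv.subspace_scale[OF R] pv.subspace_add[OF R])
qed

text \<open>For \<open>p = 2\<close> the only decomposition is \<open>i = j = 0\<close>, and the
  span of the \<open>\<sigma>\<^sub>i = e\<^sub>i \<sigma>\<^sub>i e\<^sub>i\<close> is already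
  stable under \<open>k\<close>.\<close>

lemma W_2: "W F Q 2 = relations F Q"
proof -
  have R: "pv.subspace (relations F Q)" by (simp add: relations_eq)
  let ?S = "{pmul (pmul v r) w | v r w. v \<in> kk \<and> r \<in> relations F Q \<and> w \<in> kk}"
  have "{(i, j). i + 2 + j = (2::nat)} = {(0, 0)}" by auto
  then have "W F Q 2 = pv.span ?S" using W_large[of 2] by simp
  also have "\<dots> = relations F Q"
  proof
    show "pv.span ?S \<subseteq> relations F Q"
      by (rule pv.span_minimal[OF _ R]) (use kk_relations in blast)
    show "relations F Q \<subseteq> pv.span ?S"
    proof
      fix r assume r: "r \<in> relations F Q"
      then have "r = pmul (pmul eone r) eone" using relations_TC by (simp add: eone_left eone_right subset_iff)
      then show "r \<in> pv.span ?S" using r eone_kk by (intro pv.span_base) blast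
    qed
  qed
  finally show ?thesis .
qed

lemma sg_W: "i \<in> verts Q \<Longrightarrow> sg i \<in> W F Q 2"
  by (simp add: W_2 relations_eq pv.span_base)

definition arr where "arr i = (SOME x. x \<in> QA \<and> tgt x = i)"

lemma arr: assumes "i \<in> verts Q" shows "arr i \<in> QA" "tgt (arr i) = i"
proof -
  have "\<exists>x. x \<in> QA \<and> tgt x = i" using no_isolated[OF assms] by blast
  from someI_ex[OF this] show "arr i \<in> QA" "tgt (arr i) = i" by (simp_all add: arr_def)
qed

lemma pmul_ar_ar: "pmul (ar x) (ar y) = (if src x = tgt y then Poly_Mapping.single (tgt x, [x, y], src y) 1 else 0)"
  by (simp add: arrow_def pmul_single)

lemma lookup_sg:
  assumes "x \<in> QA"
  shows "Poly_Mapping.lookup (sg i) (l, [x, y], m) = (if i = tgt x \<and> l = i \<and> m = i \<and> y = star x then eps x else 0)"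
proof -
  have "Poly_Mapping.lookup (sg i) (l, [x, y], m) =
    (\<Sum>z | z \<in> QA \<and> tgt z = i. if z = x then (if l = i \<and> m = i \<and> y = star x then eps x else 0) else 0)"
    unfolding sg_eq lookup_sum
    by (rule sum.cong) (auto simp: lookup_pscale pmul_ar_ar lookup_single when_def)
  then show ?thesis using assms by (simp add: sum.delta)
qed

text \<open>The path through \<open>star (arr i)\<close> and \<open>arr i\<close> occurs in
  \<open>\<sigma>\<^sub>i\<close> with coefficient \<open>eps (arr i)\<close>, which is its own
  inverse, and in no other relation. So this is the coordinate of \<open>\<sigma>\<^sub>i\<close>.
  It needs an arrow ending at \<open>i\<close>: at an isolated vertex the relation is an empty
  sum.\<close>

definition cs :: "'v \<Rightarrow> ('v, 'e, 'f) pelt \<Rightarrow> 'f" where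
  "cs i w = eps (arr i) * Poly_Mapping.lookup w (i, [arr i, star (arr i)], i)"

lemma cs_lin: "cs i (x + y) = cs i x + cs i y" "cs i (pscale s x) = s * cs i x" "cs i 0 = 0"
  by (simp_all add: cs_def lookup_add lookup_pscale algebra_simps)

lemma cs_sg: "i \<in> verts Q \<Longrightarrow> cs i (sg j) = (if i = j then 1 else 0)"
  by (auto simp: cs_def lookup_sg arr)

lemma cs_idem: "cs b (pmul (ei i) y) = (if i = b then cs b y else 0)" "cs b (pmul y (ei i)) = (if i = b then cs b y else 0)"
  by (auto simp: cs_def lookup_idem_mult)

lemma relations_expand:
  assumes "y \<in> relations F Q" shows "y = (\<Sum>b\<in>verts Q. pscale (cs b y) (sg b))"
  using assms unfolding relations_eq
proof (induction rule: pv.span_induct_alt)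
  case base then show ?case by (simp add: cs_lin)
next
  case (step s x y)
  then obtain i where i: "x = sg i" "i \<in> verts Q" by blast
  have "(\<Sum>b\<in>verts Q. pscale (cs b (pscale s x + y)) (sg b)) =
    (\<Sum>b\<in>verts Q. (if b = i then pscale s (sg i) else 0) + pscale (cs b y) (sg b))"
    by (rule sum.cong) (auto simp: cs_lin i cs_sg pv.scale_left_distrib)
  also have "\<dots> = pscale s x + y"
    using i finite_verts step(2) by (simp add: sum.distrib sum.delta)
  finally show ?case by simp
qed

lemma W0_iff: "y \<in> W F Q 0 \<Longrightarrow> y = (\<Sum>b\<in>verts Q. pscale (Poly_Mapping.lookup y (b, [], b)) (ei b))"
  unfolding W_0
proof (induction rule: kk_induct)
  case (idem i c)
  have "(\<Sum>b\<in>verts Q. pscale (Poly_Mapping.lookup (pscale c (ei i)) (b, [], b)) (ei b)) =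
    (\<Sum>b\<in>verts Q. if b = i then pscale c (ei i) else 0)"
    by (rule sum.cong) (auto simp: lookup_pscale idem_def lookup_single when_def)
  then show ?case using idem finite_verts by simp
next
  case (add a b) then show ?case by (simp add: lookup_add pv.scale_left_distrib sum.distrib)
qed simp

lemma W1_iff: "y \<in> W F Q (Suc 0) \<Longrightarrow> y = (\<Sum>x\<in>QA. pscale (Poly_Mapping.lookup y (tgt x, [x], src x)) (ar x))"
  unfolding W_1
proof (induction rule: tensor_power_induct)
  case (single k c)
  obtain l p i where k: "k = (l, p, i)" by (cases k)
  obtain x where "p = [x]" using single k by (auto simp: length_Suc_conv)
  then have k: "k = (tgt x, [x], src x)" "x \<in> QA" using single k path_single by auto
  have "(\<Sum>y\<in>QA. pscale (Poly_Mapping.lookup (Poly_Mapping.single k c) (tgt y, [y], src y)) (ar y)) =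
    (\<Sum>y\<in>QA. if y = x then Poly_Mapping.single k c else 0)"
    by (rule sum.cong) (auto simp: k lookup_single when_def arrow_def pscale_single)
  then show ?case using k by simp
next
  case (add a b) then show ?case by (simp add: lookup_add pv.scale_left_distrib sum.distrib)
qed simp

lemma ar_W: "x \<in> QA \<Longrightarrow> ar x \<in> W F Q (Suc 0)"
  by (auto simp: W_1 tensor_power_iff ar_TC arrow_def dest: ar_TC)

text \<open>The partner of \<open>x\<close> in the dual basis: \<open>\<sigma>\<^sub>i\<close> is
  the sum of the products of \<open>ar x\<close> with \<open>xs x\<close> over the arrows
  \<open>x\<close> ending at \<open>i\<close>.\<close>

abbreviation "xs x \<equiv> pscale (eps x) (ar (star x))"

lemma xs_W: "x \<in> QA \<Longrightarrow> xs x \<in> W F Q (Suc 0)" by (simp add: W_closed ar_W)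

lemma lookup_ei: "Poly_Mapping.lookup (ei i) (l, [], m) = (if l = i \<and> m = i then 1 else 0)"
  by (auto simp: idem_def lookup_single when_def)

lemma lookup_ar: "Poly_Mapping.lookup (ar x) (l, [y], m) = (if x = y \<and> l = tgt x \<and> m = src x then 1 else 0)"
  by (auto simp: arrow_def lookup_single when_def)

lemma basis0: "Wbasis F Q 0 (verts Q) idem (\<lambda>i. i) (\<lambda>i. i) (\<lambda>i y. Poly_Mapping.lookup y (i, [], i))"
  using finite_verts
  by unfold_locales
     (auto simp: W_0 ei_kk lookup_add lookup_pscale lookup_idem_mult W0_iff[unfolded W_0, symmetric] lookup_ei)

lemma basis1: "Wbasis F Q (Suc 0) QA ar tgt src (\<lambda>x y. Poly_Mapping.lookup y (tgt x, [x], src x))"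
  by unfold_locales
     (auto simp: ar_W lookup_add lookup_pscale lookup_idem_mult W1_iff[symmetric] lookup_ar)

text \<open>The involution permutes the arrows and the signs square to 1, so this is the basis of
  arrows up to order and sign, now with sources and targets interchanged.\<close>

lemma basis1': "Wbasis F Q (Suc 0) QA xs src tgt (\<lambda>x y. eps x * Poly_Mapping.lookup y (src x, [star x], tgt x))"
proof unfold_locales
  fix y assume y: "y \<in> W F Q (Suc 0)"
  have "(\<Sum>b\<in>QA. pscale (eps b * Poly_Mapping.lookup y (src b, [star b], tgt b)) (xs b)) =
    (\<Sum>x\<in>QA. pscale (Poly_Mapping.lookup y (tgt x, [x], src x)) (ar x))"
    by (rule sum.reindex_bij_witness[of _ star star]) (simp_all add: mult.assoc[symmetric] mult.commute mult.left_commute)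
  then show "y = (\<Sum>b\<in>QA. pscale (eps b * Poly_Mapping.lookup y (src b, [star b], tgt b)) (xs b))"
    using W1_iff[OF y] by simp
qed (auto simp: xs_W lookup_add lookup_pscale lookup_idem_mult lookup_ar pmul_pscale_left pmul_pscale_right algebra_simps)

lemma basis2: "Wbasis F Q 2 (verts Q) sg (\<lambda>i. i) (\<lambda>i. i) cs"
  using finite_verts
  by unfold_locales
     (auto simp: sg_W[unfolded W_2] ei_sg sg_ei cs_lin cs_sg cs_idem relations_expand[symmetric] W_2)

lemma rep_ar: "x \<in> QA \<Longrightarrow> rep (Suc 0) (ar x) (\<lambda>y. if y = x then ei (src x) else 0) (\<lambda>y. if y = x then ei (tgt x) else 0)"
  unfolding rep_def
  by (auto simp: W_0 ei_kk pv.subspace_0[OF tensor_power_subspace] if_distrib[of "pmul _"] if_distrib[of "\<lambda>u. pmul u _"] cong: if_cong)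

text \<open>Reading \<open>\<sigma>\<^sub>i\<close> from the right means running through
  \<open>star x\<close> instead of \<open>x\<close>. As \<open>eps (star x) = - eps x\<close>, the
  right-hand factors acquire the minus sign.\<close>

lemma rep_sg: "i \<in> verts Q \<Longrightarrow> rep 2 (sg i) (\<lambda>x. if tgt x = i then xs x else 0) (\<lambda>x. if src x = i then - xs x else 0)"
proof -
  assume i: "i \<in> verts Q"
  have "(\<Sum>x\<in>QA. pmul (ar x) (if tgt x = i then xs x else 0)) = sg i"
    unfolding sg_eq sum.inter_filter[OF finite_QA]
    by (rule sum.cong) (auto simp: pmul_pscale_right)
  moreover have "(\<Sum>x\<in>QA. pmul (if src x = i then - xs x else 0) (ar x)) = sg i"
    unfolding sg_eq sum.inter_filter[OF finite_QA]
    by (rule sum.reindex_bij_witness[of _ star star]) (auto simp: pmul_pscale_left pmul_minus_left)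
  ultimately show ?thesis unfolding rep_def by (auto simp: W_closed xs_W)
qed

text \<open>An element of both \<open>V R\<close> and \<open>R V\<close> is a sum of terms
  \<open>a\<^sub>x x \<sigma>\<close> and also of terms \<open>b\<^sub>x \<sigma> x\<close>. The
  first form contains only paths \<open>x y (star y)\<close>, the second only paths
  \<open>x (star x) z\<close>. If \<open>y\<close> other than \<open>star x\<close> ends at the
  source of \<open>x\<close>, then \<open>x y (star y)\<close> occurs only in the first form, so
  \<open>a\<^sub>x = 0\<close>. If \<open>y\<close> other than \<open>x\<close> ends at the target
  of \<open>x\<close>, then \<open>y (star y) x\<close> gives \<open>b\<^sub>x = 0\<close>, and
  comparing at \<open>x (star x) x\<close> again gives \<open>a\<^sub>x = 0\<close>.\<close>

lemma W_3: "W F Q 3 = {0}"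
proof -
  have "w = 0" if "w \<in> W F Q 3" for w
  proof -
    let ?S = "\<lambda>i j. {pmul (pmul v r) w | v r w. v \<in> tensor_power F Q i \<and> r \<in> relations F Q \<and> w \<in> tensor_power F Q j}"
    have mem: "w \<in> pv.span (?S 1 0)" "w \<in> pv.span (?S 0 1)"
      using that W_large[of 3] by auto
    \<comment> \<open>By orthogonality of the idempotents an arrow meets a nonzero product only with
      the relation at its own source or target, so \<open>U\<close> and \<open>V\<close> contain all
      of \<open>V R\<close> and of \<open>R V\<close>.\<close>
    define U where "U = {w :: ('v, 'e, 'f) pelt. \<exists>u. w = (\<Sum>x\<in>QA. pscale (u x) (pmul (ar x) (sg (src x))))}"
    define V where "V = {w :: ('v, 'e, 'f) pelt. \<exists>u. w = (\<Sum>x\<in>QA. pscale (u x) (pmul (sg (tgt x)) (ar x)))}"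
    have U: "pv.subspace U"
    proof (rule pv.subspaceI)
      show "0 \<in> U" unfolding U_def by (auto intro!: exI[of _ "\<lambda>x. 0"])
      show "a + b \<in> U" if "a \<in> U" "b \<in> U" for a b
      proof -
        obtain u v where "a = (\<Sum>x\<in>QA. pscale (u x) (pmul (ar x) (sg (src x))))" "b = (\<Sum>x\<in>QA. pscale (v x) (pmul (ar x) (sg (src x))))"
          using \<open>a \<in> U\<close> \<open>b \<in> U\<close> unfolding U_def by blast
        then show ?thesis unfolding U_def by (auto intro!: exI[of _ "\<lambda>x. u x + v x"] simp: pv.scale_left_distrib sum.distrib)
      qed
      show "pscale c a \<in> U" if a: "a \<in> U" for c a
      proof -
        obtain u where "a = (\<Sum>x\<in>QA. pscale (u x) (pmul (ar x) (sg (src x))))" using a unfolding U_def by blast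
        then show ?thesis unfolding U_def by (auto intro!: exI[of _ "\<lambda>x. c * u x"] simp: pv.scale_sum_right)
      qed
    qed
    have V: "pv.subspace V"
    proof (rule pv.subspaceI)
      show "0 \<in> V" unfolding V_def by (auto intro!: exI[of _ "\<lambda>x. 0"])
      show "a + b \<in> V" if "a \<in> V" "b \<in> V" for a b
      proof -
        obtain u v where "a = (\<Sum>x\<in>QA. pscale (u x) (pmul (sg (tgt x)) (ar x)))" "b = (\<Sum>x\<in>QA. pscale (v x) (pmul (sg (tgt x)) (ar x)))"
          using \<open>a \<in> V\<close> \<open>b \<in> V\<close> unfolding V_def by blast
        then show ?thesis unfolding V_def by (auto intro!: exI[of _ "\<lambda>x. u x + v x"] simp: pv.scale_left_distrib sum.distrib)
      qed
      show "pscale c a \<in> V" if a: "a \<in> V" for c a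
      proof -
        obtain u where "a = (\<Sum>x\<in>QA. pscale (u x) (pmul (sg (tgt x)) (ar x)))" using a unfolding V_def by blast
        then show ?thesis unfolding V_def by (auto intro!: exI[of _ "\<lambda>x. c * u x"] simp: pv.scale_sum_right)
      qed
    qed
    have "?S 1 0 \<subseteq> U"
    proof
      fix s assume "s \<in> ?S 1 0"
      then obtain v r e where s: "s = pmul (pmul v r) e" "v \<in> tensor_power F Q 1" "r \<in> relations F Q" "e \<in> kk" by blast
      define r' where "r' = pmul r e"
      have r': "r' \<in> relations F Q" unfolding r'_def using kk_relations s by blast
      define c where "c x = Poly_Mapping.lookup v (tgt x, [x], src x)" for x
      have "s = pmul (\<Sum>x\<in>QA. pscale (c x) (ar x)) (\<Sum>b\<in>verts Q. pscale (cs b r') (sg b))"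
        using W1_iff[of v] s relations_expand[OF r'] by (simp add: W_1 c_def r'_def pmul_assoc)
      also have "\<dots> = (\<Sum>x\<in>QA. \<Sum>b\<in>verts Q. if b = src x then pscale (c x * cs (src x) r') (pmul (ar x) (sg (src x))) else 0)"
        unfolding pmul_sum_left pmul_sum_right
      proof (subst sum.swap, intro sum.cong refl)
        fix x b assume "x \<in> QA" "b \<in> verts Q"
        have "pmul (ar x) (sg b) = pmul (pmul (ar x) (ei (src x))) (sg b)" by simp
        also have "\<dots> = (if b = src x then pmul (ar x) (sg (src x)) else 0)" unfolding pmul_assoc by (simp add: ei_sg)
        finally show "pmul (pscale (c x) (ar x)) (pscale (cs b r') (sg b)) =
          (if b = src x then pscale (c x * cs (src x) r') (pmul (ar x) (sg (src x))) else 0)"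
          by (simp add: pmul_pscale_left pmul_pscale_right mult.commute)
      qed
      also have "\<dots> = (\<Sum>x\<in>QA. pscale (c x * cs (src x) r') (pmul (ar x) (sg (src x))))"
        by (rule sum.cong) (use finite_verts in simp_all)
      finally show "s \<in> U" unfolding U_def mem_Collect_eq by (rule exI[of _ "\<lambda>x. c x * cs (src x) r'"])
    qed
    then have wU: "w \<in> U" using mem(1) pv.span_minimal[OF _ U] by blast
    have "?S 0 1 \<subseteq> V"
    proof
      fix s assume "s \<in> ?S 0 1"
      then obtain v r e where s: "s = pmul (pmul e r) v" "v \<in> tensor_power F Q 1" "r \<in> relations F Q" "e \<in> kk" by blast
      define r' where "r' = pmul e r"
      have r': "r' \<in> relations F Q" unfolding r'_def using kk_relations s by blast
      define c where "c x = Poly_Mapping.lookup v (tgt x, [x], src x)" for x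
      have "s = pmul (\<Sum>b\<in>verts Q. pscale (cs b r') (sg b)) (\<Sum>x\<in>QA. pscale (c x) (ar x))"
        using W1_iff[of v] s relations_expand[OF r'] by (simp add: W_1 c_def r'_def)
      also have "\<dots> = (\<Sum>x\<in>QA. \<Sum>b\<in>verts Q. if b = tgt x then pscale (c x * cs (tgt x) r') (pmul (sg (tgt x)) (ar x)) else 0)"
        unfolding pmul_sum_left pmul_sum_right
      proof (intro sum.cong refl)
        fix x b assume "x \<in> QA" "b \<in> verts Q"
        have "pmul (sg b) (ar x) = pmul (sg b) (pmul (ei (tgt x)) (ar x))" by simp
        also have "\<dots> = (if b = tgt x then pmul (sg (tgt x)) (ar x) else 0)" unfolding pmul_assoc[symmetric] by (simp add: sg_ei)
        finally show "pmul (pscale (cs b r') (sg b)) (pscale (c x) (ar x)) =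
          (if b = tgt x then pscale (c x * cs (tgt x) r') (pmul (sg (tgt x)) (ar x)) else 0)"
          by (simp add: pmul_pscale_left pmul_pscale_right mult.commute)
      qed
      also have "\<dots> = (\<Sum>x\<in>QA. pscale (c x * cs (tgt x) r') (pmul (sg (tgt x)) (ar x)))"
        by (rule sum.cong) (use finite_verts in simp_all)
      finally show "s \<in> V" unfolding V_def mem_Collect_eq by (rule exI[of _ "\<lambda>x. c x * cs (tgt x) r'"])
    qed
    then have wV: "w \<in> V" using mem(2) pv.span_minimal[OF _ V] by blast
    obtain a where a: "w = (\<Sum>x\<in>QA. pscale (a x) (pmul (ar x) (sg (src x))))" using wU unfolding U_def by blast
    obtain b where b: "w = (\<Sum>x\<in>QA. pscale (b x) (pmul (sg (tgt x)) (ar x)))" using wV unfolding V_def by blast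
    have la: "Poly_Mapping.lookup w (tgt x, [x, y, z], src z) = (if tgt y = src x \<and> z = star y then a x * eps y else 0)"
      if "x \<in> QA" "y \<in> QA" for x y z
    proof -
      have "Poly_Mapping.lookup w (tgt x, [x, y, z], src z) =
        (\<Sum>x'\<in>QA. if x' = x then (if tgt y = src x \<and> z = star y then a x * eps y else 0) else 0)"
        unfolding a lookup_sum
        by (rule sum.cong) (use that in \<open>auto simp: lookup_pscale lookup_arrow_mult lookup_sg\<close>)
      then show ?thesis using that by simp
    qed
    have lb: "Poly_Mapping.lookup w (tgt x, [x, y, z], src z) = (if tgt x = tgt z \<and> y = star x then b z * eps x else 0)"
      if "x \<in> QA" "y \<in> QA" "z \<in> QA" for x y z
    proof -
      have l: "Poly_Mapping.lookup (pmul f (ar x')) (l, [x, y, z], m) =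
        (if x' = z \<and> m = src x' then Poly_Mapping.lookup f (l, [x, y], tgt x') else 0)" for f x' l m
        using lookup_arrow_mult(2)[of f x' l "[x, y]" z m] by simp
      have "Poly_Mapping.lookup w (tgt x, [x, y, z], src z) =
        (\<Sum>x'\<in>QA. if x' = z then (if tgt x = tgt z \<and> y = star x then b z * eps x else 0) else 0)"
        unfolding b lookup_sum
      proof (rule sum.cong[OF refl])
        fix x' assume "x' \<in> QA"
        show "Poly_Mapping.lookup (pscale (b x') (pmul (sg (tgt x')) (ar x'))) (tgt x, [x, y, z], src z) =
          (if x' = z then (if tgt x = tgt z \<and> y = star x then b z * eps x else 0) else 0)"
          by (cases "x' = z"; cases "tgt x = tgt z") (simp_all add: lookup_pscale l lookup_sg[OF that(1)])
      qed
      then show ?thesis using that by simp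
    qed
    have "a x = 0" if x: "x \<in> QA" for x
    proof -
      obtain y where y: "y \<in> QA" "tgt y = src x \<and> y \<noteq> star x \<or> tgt y = tgt x \<and> y \<noteq> x"
        using not_A2[OF x] by blast
      from y(2) show ?thesis
      proof
        assume h: "tgt y = src x \<and> y \<noteq> star x"
        have "a x * eps y = 0" using la[OF x y(1), of "star y"] lb[OF x y(1), of "star y"] h y by simp
        then show ?thesis by simp
      next
        assume h: "tgt y = tgt x \<and> y \<noteq> x"
        have "0 = b x * eps y"
          using la[of y "star y" x] lb[of y "star y" x] h x y by auto
        then have "b x = 0" by simp
        then have "a x * eps (star x) = 0" using la[of x "star x" x] lb[of x "star x" x] x by simp
        then show ?thesis by simp
      qed
    qed
    then show "w = 0" unfolding a by simp
  qed
  moreover have "0 \<in> W F Q 3" by (rule W_closed)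
  ultimately show ?thesis by blast
qed

lemma has_reps_span:
  assumes "W F Q p \<subseteq> pv.span S" "\<And>s. s \<in> S \<Longrightarrow> \<exists>u v. rep p s u v"
  shows "has_reps p"
  unfolding has_reps_def
proof
  fix w assume "w \<in> W F Q p"
  then have "w \<in> pv.span S" using assms(1) by blast
  then show "\<exists>u v. rep p w u v"
  proof (induction rule: pv.span_induct_alt)
    case base then show ?case using rep_zero by blast
  next
    case (step c x y)
    then show ?case using assms(2) rep_scale rep_add by meson
  qed
qed

lemma reps1: "has_reps (Suc 0)"
proof (rule has_reps_span[of _ "ar ` QA"])
  show "W F Q (Suc 0) \<subseteq> pv.span (ar ` QA)"
  proof
    fix w assume "w \<in> W F Q (Suc 0)"
    from W1_iff[OF this] show "w \<in> pv.span (ar ` QA)"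
      by (metis (no_types, lifting) imageI pv.span_base pv.span_scale pv.span_sum)
  qed
qed (use rep_ar in blast)

lemma reps2: "has_reps 2"
  by (rule has_reps_span[of _ "sg ` verts Q"]) (use rep_sg in \<open>auto simp: W_2 relations_eq\<close>)

lemma reps3: "has_reps 3"
  using rep_zero by (auto simp: has_reps_def W_3)

end

section \<open>Duality of the Koszul complex\<close>

lemma (in abelian_group) finsum_add:
  assumes "\<And>x. x \<in> S \<Longrightarrow> f x = g x \<oplus> h x" "\<And>x. x \<in> S \<Longrightarrow> g x \<in> carrier G" "\<And>x. x \<in> S \<Longrightarrow> h x \<in> carrier G"
  shows "finsum G f S = finsum G g S \<oplus> finsum G h S"
proof -
  have "finsum G f S = (\<Oplus>x\<in>S. g x \<oplus> h x)"
    by (rule finsum_cong') (use assms in \<open>simp_all add: Pi_iff\<close>)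
  then show ?thesis using assms by (simp add: finsum_addf Pi_iff)
qed

lemma (in abelian_group) finsum_delta:
  assumes "finite S" "i \<in> S" "g i \<in> carrier G"
  shows "(\<Oplus>x\<in>S. if x = i then g x else \<zero>) = g i" "(\<Oplus>x\<in>S. if i = x then g x else \<zero>) = g i"
proof -
  have "(\<Oplus>x\<in>S. if i = x then g x else \<zero>) = (\<Oplus>x\<in>S. if i = x then (if x = i then g x else \<zero>) else \<zero>)"
    by (rule finsum_cong') (use assms in auto)
  also have "\<dots> = g i" using assms by (subst finsum_singleton) auto
  finally show "(\<Oplus>x\<in>S. if i = x then g x else \<zero>) = g i" .
  moreover have "(\<Oplus>x\<in>S. if i = x then g x else \<zero>) = (\<Oplus>x\<in>S. if x = i then g x else \<zero>)"
    by (rule finsum_cong') (use assms in auto)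
  ultimately show "(\<Oplus>x\<in>S. if x = i then g x else \<zero>) = g i" by simp
qed

lemma (in abelian_group) finsum_swap:
  assumes "finite S" "\<And>i x. i \<in> S \<Longrightarrow> x \<in> T \<Longrightarrow> g i x \<in> carrier G"
  shows "(\<Oplus>i\<in>S. \<Oplus>x\<in>T. g i x) = (\<Oplus>x\<in>T. \<Oplus>i\<in>S. g i x)"
  using assms
proof (induction S rule: finite_induct)
  case (insert i S)
  have "(\<Oplus>i\<in>insert i S. \<Oplus>x\<in>T. g i x) = (\<Oplus>x\<in>T. g i x) \<oplus> (\<Oplus>x\<in>T. \<Oplus>i\<in>S. g i x)"
    using insert by (subst finsum_insert) (simp_all add: Pi_iff finsum_closed)
  also have "\<dots> = (\<Oplus>x\<in>T. \<Oplus>i\<in>insert i S. g i x)"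
    by (rule finsum_add[symmetric]) (use insert in \<open>simp_all add: Pi_iff finsum_closed finsum_insert\<close>)
  finally show ?case .
qed simp

context koszul_quiver begin

section \<open>The differentials on generators and after the swap\<close>

abbreviation "pa x \<equiv> pr (ar x)"

lemma kt_minus: "\<lbrakk>a \<in> carrier A; w \<in> W F Q p; b \<in> carrier A\<rbrakk> \<Longrightarrow> kt p a (- w) b = \<ominus>\<^bsub>K p\<^esub> kt p a w b"
proof -
  assume h: "a \<in> carrier A" "w \<in> W F Q p" "b \<in> carrier A"
  have "kt p a (- w) b \<oplus>\<^bsub>K p\<^esub> kt p a w b = \<zero>\<^bsub>K p\<^esub>"
    using h by (simp add: kt_add2[symmetric] W_closed kt_zero)
  then show ?thesis using h by (intro Kg.minus_equality[symmetric]) (simp_all add: kt_closed W_closed)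
qed

lemma ei_W: "i \<in> verts Q \<Longrightarrow> ei i \<in> W F Q 0" by (simp add: W_0 ei_kk)

lemma d1_kt:
  assumes x: "x \<in> QA" and a: "a \<in> carrier A" and b: "b \<in> carrier A"
  shows "d (Suc 0) (kt (Suc 0) a (ar x) b) =
    kt 0 (a \<otimes>\<^bsub>A\<^esub> pa x) (ei (src x)) b \<ominus>\<^bsub>K 0\<^esub> kt 0 a (ei (tgt x)) (pa x \<otimes>\<^bsub>A\<^esub> b)"
proof -
  have "dl 0 (\<lambda>y. if y = x then ei (src x) else 0) a b = (\<Oplus>\<^bsub>K 0\<^esub>y\<in>QA. if y = x then kt 0 (a \<otimes>\<^bsub>A\<^esub> pa y) (ei (src y)) b else \<zero>\<^bsub>K 0\<^esub>)"
    unfolding dl_def by (rule Kg.finsum_cong') (use a b in \<open>simp_all add: Pi_iff kt_zero ar_A kt_closed ei_W\<close>)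
  moreover have "dr 0 (\<lambda>y. if y = x then ei (tgt x) else 0) a b = (\<Oplus>\<^bsub>K 0\<^esub>y\<in>QA. if y = x then kt 0 a (ei (tgt y)) (pa y \<otimes>\<^bsub>A\<^esub> b) else \<zero>\<^bsub>K 0\<^esub>)"
    unfolding dr_def by (rule Kg.finsum_cong') (use a b in \<open>simp_all add: Pi_iff kt_zero ar_A kt_closed ei_W\<close>)
  ultimately show ?thesis
    using d_kt[OF reps1 _ a ar_W[OF x] b rep_ar[OF x]] a b x
    by (simp add: Kg.finsum_delta kt_closed ar_A ei_W)
qed

lemma d2_kt:
  assumes i: "i \<in> verts Q" and a: "a \<in> carrier A" and b: "b \<in> carrier A"
  shows "d 2 (kt 2 a (sg i) b) = (\<Oplus>\<^bsub>K (Suc 0)\<^esub>x\<in>QA.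
    (if tgt x = i then kt (Suc 0) (a \<otimes>\<^bsub>A\<^esub> pa x) (xs x) b else \<zero>\<^bsub>K (Suc 0)\<^esub>) \<oplus>\<^bsub>K (Suc 0)\<^esub>
    (if src x = i then \<ominus>\<^bsub>K (Suc 0)\<^esub> kt (Suc 0) a (xs x) (pa x \<otimes>\<^bsub>A\<^esub> b) else \<zero>\<^bsub>K (Suc 0)\<^esub>))"
proof -
  have l: "dl (Suc 0) (\<lambda>x. if tgt x = i then xs x else 0) a b =
      (\<Oplus>\<^bsub>K (Suc 0)\<^esub>x\<in>QA. if tgt x = i then kt (Suc 0) (a \<otimes>\<^bsub>A\<^esub> pa x) (xs x) b else \<zero>\<^bsub>K (Suc 0)\<^esub>)"
    unfolding dl_def by (rule Kg.finsum_cong') (use a b in \<open>simp_all add: Pi_iff kt_zero ar_A kt_closed xs_W\<close>)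
  have r: "dr (Suc 0) (\<lambda>x. if src x = i then - xs x else 0) a b =
      (\<Oplus>\<^bsub>K (Suc 0)\<^esub>x\<in>QA. if src x = i then \<ominus>\<^bsub>K (Suc 0)\<^esub> kt (Suc 0) a (xs x) (pa x \<otimes>\<^bsub>A\<^esub> b) else \<zero>\<^bsub>K (Suc 0)\<^esub>)"
    unfolding dr_def by (rule Kg.finsum_cong') (use a b in \<open>simp_all add: Pi_iff kt_zero ar_A kt_closed kt_minus xs_W\<close>)
  have "d 2 (kt 2 a (sg i) b) = dl (Suc 0) (\<lambda>x. if tgt x = i then xs x else 0) a b \<oplus>\<^bsub>K (Suc 0)\<^esub> dr (Suc 0) (\<lambda>x. if src x = i then - xs x else 0) a b"
    using d_kt[OF reps2 _ a sg_W[OF i] b rep_sg[OF i]] by simp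
  note this[unfolded l r]
  also have "(\<Oplus>\<^bsub>K (Suc 0)\<^esub>x\<in>QA. if tgt x = i then kt (Suc 0) (a \<otimes>\<^bsub>A\<^esub> pa x) (xs x) b else \<zero>\<^bsub>K (Suc 0)\<^esub>) \<oplus>\<^bsub>K (Suc 0)\<^esub>
      (\<Oplus>\<^bsub>K (Suc 0)\<^esub>x\<in>QA. if src x = i then \<ominus>\<^bsub>K (Suc 0)\<^esub> kt (Suc 0) a (xs x) (pa x \<otimes>\<^bsub>A\<^esub> b) else \<zero>\<^bsub>K (Suc 0)\<^esub>) =
    (\<Oplus>\<^bsub>K (Suc 0)\<^esub>x\<in>QA.
    (if tgt x = i then kt (Suc 0) (a \<otimes>\<^bsub>A\<^esub> pa x) (xs x) b else \<zero>\<^bsub>K (Suc 0)\<^esub>) \<oplus>\<^bsub>K (Suc 0)\<^esub>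
    (if src x = i then \<ominus>\<^bsub>K (Suc 0)\<^esub> kt (Suc 0) a (xs x) (pa x \<otimes>\<^bsub>A\<^esub> b) else \<zero>\<^bsub>K (Suc 0)\<^esub>))"
    by (rule Kg.finsum_add[symmetric]) (use a b in \<open>simp_all add: ar_A kt_closed xs_W\<close>)
  finally show ?thesis .
qed

text \<open>The swap turns right multiplication of the first factor of \<open>K(A)\<^sub>2\<close>
  into the right outer action, and left multiplication of the last factor into the left outer
  action. The formula therefore makes sense for all of \<open>A \<otimes> A\<close> and is additive
  in \<open>z\<close>.\<close>

lemma d2_sw:
  assumes i: "i \<in> verts Q" and z: "z \<in> carrier E"
  shows "d 2 (sw 2 (sg i) z) = (\<Oplus>\<^bsub>K (Suc 0)\<^esub>x\<in>QA.
    (if tgt x = i then sw (Suc 0) (xs x) (ract E z (pa x)) else \<zero>\<^bsub>K (Suc 0)\<^esub>) \<oplus>\<^bsub>K (Suc 0)\<^esub>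
    (if src x = i then \<ominus>\<^bsub>K (Suc 0)\<^esub> sw (Suc 0) (xs x) (pa x \<odot>\<^bsub>E\<^esub> z) else \<zero>\<^bsub>K (Suc 0)\<^esub>))"
  using z
proof (induction rule: E_induct)
  case (pure a b)
  have e: "sw 2 (sg i) (et a b) = kt 2 b (sg i) a" using pure i by (simp add: sw sg_W)
  show ?case unfolding e d2_kt[OF i pure(2,1)]
    by (rule Kg.finsum_cong') (use pure in \<open>simp_all add: Pi_iff E_lact E_ract ar_A sw xs_W kt_closed\<close>)
next
  case (add u v)
  have "d 2 (sw 2 (sg i) (u \<oplus>\<^bsub>E\<^esub> v)) = d 2 (sw 2 (sg i) u) \<oplus>\<^bsub>K (Suc 0)\<^esub> d 2 (sw 2 (sg i) v)"
    using d_add[OF reps2, of "sw 2 (sg i) u" "sw 2 (sg i) v"] add(1,2) i by (simp add: sw sg_W)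
  then show ?case unfolding add(3,4)
    by (simp, intro Kg.finsum_add[symmetric])
       (use add(1,2) in \<open>simp_all add: sw xs_W E_closed E_act_add ar_A Kg.minus_add Kg.a_ac\<close>)
qed

lemma pe_eq: "x \<in> QA \<Longrightarrow> pr (xs x) = phi (eps x) \<otimes>\<^bsub>A\<^esub> pa (star x)"
  by (simp add: phi_mult_proj ar_TC)

lemma d1_sw:
  assumes x: "x \<in> QA" and z: "z \<in> carrier E"
  shows "d (Suc 0) (sw (Suc 0) (xs x) z) =
    sw 0 (ei (tgt x)) (ract E z (pr (xs x))) \<ominus>\<^bsub>K 0\<^esub> sw 0 (ei (src x)) (pr (xs x) \<odot>\<^bsub>E\<^esub> z)"
  using z
proof (induction rule: E_induct)
  have pe: "pr (xs x) \<in> carrier A" "pa (star x) \<in> carrier A" using x by (simp_all add: pe_eq phi_closed ar_A)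
  {
    case (pure a b)
    have "sw (Suc 0) (xs x) (et a b) = kt (Suc 0) (phi (eps x) \<otimes>\<^bsub>A\<^esub> b) (ar (star x)) a"
      using pure x by (simp add: sw xs_W kt_scale1 ar_W)
    then have "d (Suc 0) (sw (Suc 0) (xs x) (et a b)) =
      kt 0 (phi (eps x) \<otimes>\<^bsub>A\<^esub> b \<otimes>\<^bsub>A\<^esub> pa (star x)) (ei (tgt x)) a \<ominus>\<^bsub>K 0\<^esub>
      kt 0 (phi (eps x) \<otimes>\<^bsub>A\<^esub> b) (ei (src x)) (pa (star x) \<otimes>\<^bsub>A\<^esub> a)"
      using pure x d1_kt[of "star x" "phi (eps x) \<otimes>\<^bsub>A\<^esub> b" a] by (simp add: phi_closed)
    moreover have "phi (eps x) \<otimes>\<^bsub>A\<^esub> b \<otimes>\<^bsub>A\<^esub> pa (star x) = b \<otimes>\<^bsub>A\<^esub> pr (xs x)"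
      using pure x pe by (simp add: pe_eq phi_closed A.m_assoc phi_lcomm[of b])
    moreover have "kt 0 (phi (eps x) \<otimes>\<^bsub>A\<^esub> b) (ei (src x)) (pa (star x) \<otimes>\<^bsub>A\<^esub> a) = kt 0 b (ei (src x)) (pr (xs x) \<otimes>\<^bsub>A\<^esub> a)"
      using pure x pe by (simp add: pe_eq phi_closed A.m_assoc kt_scale1 kt_scale3 ei_W)
    ultimately show ?case
      using pure x pe by (simp add: E_lact E_ract sw ei_W)
  next
    case (add u v)
    have "d (Suc 0) (sw (Suc 0) (xs x) (u \<oplus>\<^bsub>E\<^esub> v)) =
      d (Suc 0) (sw (Suc 0) (xs x) u) \<oplus>\<^bsub>K 0\<^esub> d (Suc 0) (sw (Suc 0) (xs x) v)"
      using d_add[OF reps1, of "sw (Suc 0) (xs x) u" "sw (Suc 0) (xs x) v"] add(1,2) x by (simp add: sw xs_W)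
    then show ?case unfolding add(3,4)
      using add(1,2) x pe by (simp add: sw ei_W E_closed E_act_add a_minus_def Kg.minus_add Kg.a_ac)
  }
qed

section \<open>Compatibility of the comparison maps with the differentials\<close>

lemma dual0: "dual_pair F Q 0 2 (verts Q) idem sg (\<lambda>i. i) (\<lambda>i. i) (\<lambda>i y. Poly_Mapping.lookup y (i, [], i)) cs"
  by (intro dual_pair.intro basis0 basis2)
lemma dual1: "dual_pair F Q (Suc 0) (Suc 0) QA ar xs tgt src (\<lambda>x y. Poly_Mapping.lookup y (tgt x, [x], src x))
    (\<lambda>x y. eps x * Poly_Mapping.lookup y (src x, [star x], tgt x))"
  by (intro dual_pair.intro basis1 basis1')
lemma dual2: "dual_pair F Q 2 0 (verts Q) sg idem (\<lambda>i. i) (\<lambda>i. i) cs (\<lambda>i y. Poly_Mapping.lookup y (i, [], i))"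
  by (intro dual_pair.intro basis0 basis2)

interpretation D0: dual_pair F Q 0 2 "verts Q" idem sg "\<lambda>i. i" "\<lambda>i. i" "\<lambda>i y. Poly_Mapping.lookup y (i, [], i)" cs
  by (rule dual0)
interpretation D1: dual_pair F Q "Suc 0" "Suc 0" QA ar xs tgt src "\<lambda>x y. Poly_Mapping.lookup y (tgt x, [x], src x)"
    "\<lambda>x y. eps x * Poly_Mapping.lookup y (src x, [star x], tgt x)"
  by (rule dual1)
interpretation D2: dual_pair F Q 2 0 "verts Q" sg idem "\<lambda>i. i" "\<lambda>i. i" cs "\<lambda>i y. Poly_Mapping.lookup y (i, [], i)"
  by (rule dual2)

abbreviation "codiff \<equiv> koszul_codiff F Q"

lemma CD: assumes "f \<in> carrier (C p)"
  shows "z \<in> carrier (K p) \<Longrightarrow> f z \<in> carrier E"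
    "\<lbrakk>y \<in> carrier (K p); z \<in> carrier (K p)\<rbrakk> \<Longrightarrow> f (y \<oplus>\<^bsub>K p\<^esub> z) = f y \<oplus>\<^bsub>E\<^esub> f z"
    "f \<in> extensional (carrier (K p))"
    "\<lbrakk>a \<in> carrier A; z \<in> carrier (K p)\<rbrakk> \<Longrightarrow> f (a \<odot>\<^bsub>K p\<^esub> z) = a \<odot>\<^bsub>E\<^esub> f z"
    "\<lbrakk>a \<in> carrier A; z \<in> carrier (K p)\<rbrakk> \<Longrightarrow> f (ract (K p) z a) = ract E (f z) a"
    "z \<in> carrier (K p) \<Longrightarrow> f (\<ominus>\<^bsub>K p\<^esub> z) = \<ominus>\<^bsub>E\<^esub> f z"
proof -
  note H = bimodule_homsD[OF assms[unfolded C_sel]]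
  show "z \<in> carrier (K p) \<Longrightarrow> f z \<in> carrier E" by (rule H(1))
  show "\<lbrakk>y \<in> carrier (K p); z \<in> carrier (K p)\<rbrakk> \<Longrightarrow> f (y \<oplus>\<^bsub>K p\<^esub> z) = f y \<oplus>\<^bsub>E\<^esub> f z" by (rule H(2))
  show "f \<in> extensional (carrier (K p))" by (rule H(3))
  show "\<lbrakk>a \<in> carrier A; z \<in> carrier (K p)\<rbrakk> \<Longrightarrow> f (a \<odot>\<^bsub>K p\<^esub> z) = a \<odot>\<^bsub>E\<^esub> f z" by (rule H(4))
  show "\<lbrakk>a \<in> carrier A; z \<in> carrier (K p)\<rbrakk> \<Longrightarrow> f (ract (K p) z a) = ract E (f z) a" by (rule H(5))
  show "z \<in> carrier (K p) \<Longrightarrow> f (\<ominus>\<^bsub>K p\<^esub> z) = \<ominus>\<^bsub>E\<^esub> f z"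
    by (rule additive_minus[OF K_group Eg.abelian_group_axioms]) (use H in \<open>simp_all add: Pi_iff\<close>)
qed

lemma codiff_closed:
  assumes "has_reps (Suc p)" "f \<in> carrier (C p)" shows "codiff p f \<in> carrier (C (Suc p))"
proof -
  note dd = d_closed[OF assms(1), simplified] d_add[OF assms(1), simplified] d_lact[OF assms(1), simplified] d_ract[OF assms(1), simplified]
  show ?thesis
    unfolding C_sel koszul_codiff_def
    by (rule bimodule_homsI)
       (simp_all add: dd CD[OF assms(2)] K_lact_closed K_ract_closed E_minus Eg.minus_add)
qed

lemma sw_minus: "w \<in> W F Q q \<Longrightarrow> z \<in> carrier E \<Longrightarrow> sw q w (\<ominus>\<^bsub>E\<^esub> z) = \<ominus>\<^bsub>K q\<^esub> sw q w z"
  by (rule additive_minus[OF Eg.abelian_group_axioms K_group]) (simp_all add: sw Pi_iff)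
lemma sw_zero: "w \<in> W F Q q \<Longrightarrow> sw q w \<zero>\<^bsub>E\<^esub> = \<zero>\<^bsub>K q\<^esub>"
  by (rule additive_zero[OF Eg.abelian_group_axioms K_group]) (simp_all add: sw Pi_iff)
lemma sw_sum: "w \<in> W F Q q \<Longrightarrow> finite S \<Longrightarrow> (\<And>s. s \<in> S \<Longrightarrow> g s \<in> carrier E) \<Longrightarrow>
    sw q w (\<Oplus>\<^bsub>E\<^esub>s\<in>S. g s) = (\<Oplus>\<^bsub>K q\<^esub>s\<in>S. sw q w (g s))"
  by (rule additive_finsum[OF Eg.abelian_group_axioms K_group]) (simp_all add: sw Pi_iff)

lemma d_sum: "has_reps p \<Longrightarrow> p > 0 \<Longrightarrow> finite S \<Longrightarrow> (\<And>s. s \<in> S \<Longrightarrow> g s \<in> carrier (K p)) \<Longrightarrow>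
    d p (\<Oplus>\<^bsub>K p\<^esub>s\<in>S. g s) = (\<Oplus>\<^bsub>K (p - 1)\<^esub>s\<in>S. d p (g s))"
  by (rule additive_finsum[OF K_group K_group]) (simp_all add: d_closed d_add Pi_iff del: One_nat_def)

text \<open>Every arrow has exactly one target and one source, so it contributes once in either role
  when the vertices are summed over.\<close>

lemma finsum_vertex:
  assumes g: "\<And>x. x \<in> QA \<Longrightarrow> g x \<in> carrier (K q)" "\<And>x. x \<in> QA \<Longrightarrow> h x \<in> carrier (K q)"
  shows "(\<Oplus>\<^bsub>K q\<^esub>i\<in>verts Q. \<Oplus>\<^bsub>K q\<^esub>x\<in>QA. (if tgt x = i then g x else \<zero>\<^bsub>K q\<^esub>) \<oplus>\<^bsub>K q\<^esub> (if src x = i then h x else \<zero>\<^bsub>K q\<^esub>)) =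
    (\<Oplus>\<^bsub>K q\<^esub>x\<in>QA. g x \<oplus>\<^bsub>K q\<^esub> h x)"
proof -
  have "(\<Oplus>\<^bsub>K q\<^esub>i\<in>verts Q. \<Oplus>\<^bsub>K q\<^esub>x\<in>QA. (if tgt x = i then g x else \<zero>\<^bsub>K q\<^esub>) \<oplus>\<^bsub>K q\<^esub> (if src x = i then h x else \<zero>\<^bsub>K q\<^esub>)) =
    (\<Oplus>\<^bsub>K q\<^esub>x\<in>QA. \<Oplus>\<^bsub>K q\<^esub>i\<in>verts Q. (if tgt x = i then g x else \<zero>\<^bsub>K q\<^esub>) \<oplus>\<^bsub>K q\<^esub> (if src x = i then h x else \<zero>\<^bsub>K q\<^esub>))"
    by (rule Kg.finsum_swap[OF finite_verts]) (use g in simp)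
  also have "\<dots> = (\<Oplus>\<^bsub>K q\<^esub>x\<in>QA. g x \<oplus>\<^bsub>K q\<^esub> h x)"
  proof (rule Kg.finsum_cong')
    fix x assume x: "x \<in> QA"
    have "(\<Oplus>\<^bsub>K q\<^esub>i\<in>verts Q. (if tgt x = i then g x else \<zero>\<^bsub>K q\<^esub>) \<oplus>\<^bsub>K q\<^esub> (if src x = i then h x else \<zero>\<^bsub>K q\<^esub>)) =
      (\<Oplus>\<^bsub>K q\<^esub>i\<in>verts Q. if tgt x = i then g x else \<zero>\<^bsub>K q\<^esub>) \<oplus>\<^bsub>K q\<^esub> (\<Oplus>\<^bsub>K q\<^esub>i\<in>verts Q. if src x = i then h x else \<zero>\<^bsub>K q\<^esub>)"
      by (rule Kg.finsum_add) (use g x in simp_all)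
    also have "\<dots> = g x \<oplus>\<^bsub>K q\<^esub> h x"
      using Kg.finsum_delta(2)[OF finite_verts tgt_src_verts(1)[OF x], of "\<lambda>_. g x" q]
        Kg.finsum_delta(2)[OF finite_verts tgt_src_verts(2)[OF x], of "\<lambda>_. h x" q] g x by simp
    finally show "(\<Oplus>\<^bsub>K q\<^esub>i\<in>verts Q. (if tgt x = i then g x else \<zero>\<^bsub>K q\<^esub>) \<oplus>\<^bsub>K q\<^esub> (if src x = i then h x else \<zero>\<^bsub>K q\<^esub>)) = g x \<oplus>\<^bsub>K q\<^esub> h x" .
  qed (use g in \<open>simp_all add: Pi_iff\<close>)
  finally show ?thesis .
qed

text \<open>Both sides are the sum over the arrows \<open>x\<close> of the swapped elements
  \<open>f(e\<^sub>t) x - x f(e\<^sub>s)\<close>, with \<open>t\<close> and \<open>s\<close> the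
  ends of \<open>x\<close>. The sign in the codifferential of degree 0 is what puts the two terms in
  this order.\<close>

lemma compat0:
  assumes f: "f \<in> carrier (C 0)"
  shows "d 2 (D0.Phi f) = D1.Phi (codiff 0 f)"
proof -
  note fv = D0.value_closed[OF f]
  have "d 2 (D0.Phi f) = (\<Oplus>\<^bsub>K (Suc 0)\<^esub>i\<in>verts Q. d 2 (sw 2 (sg i) (f (D0.unit i))))"
    unfolding D0.Phi_def using f by (simp add: d_sum[OF reps2] finite_verts D0.term_closed)
  also have "\<dots> = (\<Oplus>\<^bsub>K (Suc 0)\<^esub>i\<in>verts Q. \<Oplus>\<^bsub>K (Suc 0)\<^esub>x\<in>QA.
      (if tgt x = i then sw (Suc 0) (xs x) (ract E (f (D0.unit (tgt x))) (pa x)) else \<zero>\<^bsub>K (Suc 0)\<^esub>) \<oplus>\<^bsub>K (Suc 0)\<^esub>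
      (if src x = i then \<ominus>\<^bsub>K (Suc 0)\<^esub> sw (Suc 0) (xs x) (pa x \<odot>\<^bsub>E\<^esub> f (D0.unit (src x))) else \<zero>\<^bsub>K (Suc 0)\<^esub>))"
  proof (rule Kg.finsum_cong')
    fix i assume i: "i \<in> verts Q"
    show "d 2 (sw 2 (sg i) (f (D0.unit i))) = (\<Oplus>\<^bsub>K (Suc 0)\<^esub>x\<in>QA.
      (if tgt x = i then sw (Suc 0) (xs x) (ract E (f (D0.unit (tgt x))) (pa x)) else \<zero>\<^bsub>K (Suc 0)\<^esub>) \<oplus>\<^bsub>K (Suc 0)\<^esub>
      (if src x = i then \<ominus>\<^bsub>K (Suc 0)\<^esub> sw (Suc 0) (xs x) (pa x \<odot>\<^bsub>E\<^esub> f (D0.unit (src x))) else \<zero>\<^bsub>K (Suc 0)\<^esub>))"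
      unfolding d2_sw[OF i fv[OF i]]
      by (rule Kg.finsum_cong') (use i in \<open>simp_all add: Pi_iff sw xs_W E_closed ar_A fv\<close>)
  qed (simp_all add: Pi_iff Kg.finsum_closed sw xs_W E_closed ar_A fv)
  also have "\<dots> = (\<Oplus>\<^bsub>K (Suc 0)\<^esub>x\<in>QA. sw (Suc 0) (xs x) (ract E (f (D0.unit (tgt x))) (pa x)) \<oplus>\<^bsub>K (Suc 0)\<^esub>
      \<ominus>\<^bsub>K (Suc 0)\<^esub> sw (Suc 0) (xs x) (pa x \<odot>\<^bsub>E\<^esub> f (D0.unit (src x))))"
    by (rule finsum_vertex) (simp_all add: sw xs_W E_closed ar_A fv)
  also have "\<dots> = (\<Oplus>\<^bsub>K (Suc 0)\<^esub>x\<in>QA. sw (Suc 0) (xs x) (codiff 0 f (D1.unit x)))"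
  proof (rule Kg.finsum_cong')
    fix x assume x: "x \<in> QA"
    have "d (Suc 0) (D1.unit x) = pa x \<odot>\<^bsub>K 0\<^esub> D0.unit (src x) \<ominus>\<^bsub>K 0\<^esub> ract (K 0) (D0.unit (tgt x)) (pa x)"
      using x by (simp add: d1_kt K_lact K_ract ar_A ei_W)
    then have "codiff 0 f (D1.unit x) = \<ominus>\<^bsub>E\<^esub> (pa x \<odot>\<^bsub>E\<^esub> f (D0.unit (src x)) \<oplus>\<^bsub>E\<^esub> \<ominus>\<^bsub>E\<^esub> (ract E (f (D0.unit (tgt x))) (pa x)))"
      using x by (simp add: koszul_codiff_def D1.unit_closed a_minus_def CD[OF f] D0.unit_closed K_lact_closed K_ract_closed ar_A)
    also have "\<dots> = ract E (f (D0.unit (tgt x))) (pa x) \<oplus>\<^bsub>E\<^esub> \<ominus>\<^bsub>E\<^esub> (pa x \<odot>\<^bsub>E\<^esub> f (D0.unit (src x)))"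
      using x by (simp add: Eg.minus_add E_closed ar_A fv Eg.a_comm)
    finally show "sw (Suc 0) (xs x) (ract E (f (D0.unit (tgt x))) (pa x)) \<oplus>\<^bsub>K (Suc 0)\<^esub>
      \<ominus>\<^bsub>K (Suc 0)\<^esub> sw (Suc 0) (xs x) (pa x \<odot>\<^bsub>E\<^esub> f (D0.unit (src x))) = sw (Suc 0) (xs x) (codiff 0 f (D1.unit x))"
      using x by (simp add: sw sw_minus xs_W E_closed ar_A fv)
  qed (use D1.term_closed[OF codiff_closed[OF reps1 f]] in \<open>simp_all add: Pi_iff\<close>)
  also have "\<dots> = D1.Phi (codiff 0 f)"
    unfolding D1.Phi_def using codiff_closed[OF reps1 f] by simp
  finally show ?thesis .
qed

lemma E_lact_neg: "a \<in> carrier A \<Longrightarrow> z \<in> carrier E \<Longrightarrow> (\<ominus>\<^bsub>A\<^esub> a) \<odot>\<^bsub>E\<^esub> z = \<ominus>\<^bsub>E\<^esub> (a \<odot>\<^bsub>E\<^esub> z)"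
proof -
  assume a: "a \<in> carrier A"
  have m: "et (\<ominus>\<^bsub>A\<^esub> x) y = \<ominus>\<^bsub>E\<^esub> et x y" if "x \<in> carrier A" "y \<in> carrier A" for x y
    by (rule additive_minus[OF A.abelian_group_axioms Eg.abelian_group_axioms]) (use that in \<open>simp_all add: Pi_iff et_closed et_add1\<close>)
  show "z \<in> carrier E \<Longrightarrow> (\<ominus>\<^bsub>A\<^esub> a) \<odot>\<^bsub>E\<^esub> z = \<ominus>\<^bsub>E\<^esub> (a \<odot>\<^bsub>E\<^esub> z)"
  proof (induction rule: E_induct)
    case (pure x y) then show ?case using a by (simp add: E_lact m A.l_minus)
  next
    case (add u v) then show ?case using a by (simp add: E_act_add E_closed Eg.minus_add)
  qed
qed

lemma E_ract_neg: "a \<in> carrier A \<Longrightarrow> z \<in> carrier E \<Longrightarrow> ract E z (\<ominus>\<^bsub>A\<^esub> a) = \<ominus>\<^bsub>E\<^esub> (ract E z a)"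
proof -
  assume a: "a \<in> carrier A"
  have m: "et x (\<ominus>\<^bsub>A\<^esub> y) = \<ominus>\<^bsub>E\<^esub> et x y" if "x \<in> carrier A" "y \<in> carrier A" for x y
    by (rule additive_minus[OF A.abelian_group_axioms Eg.abelian_group_axioms]) (use that in \<open>simp_all add: Pi_iff et_closed et_add2\<close>)
  show "z \<in> carrier E \<Longrightarrow> ract E z (\<ominus>\<^bsub>A\<^esub> a) = \<ominus>\<^bsub>E\<^esub> (ract E z a)"
  proof (induction rule: E_induct)
    case (pure x y) then show ?case using a by (simp add: E_ract m A.r_minus)
  next
    case (add u v) then show ?case using a by (simp add: E_act_add E_closed Eg.minus_add)
  qed
qed

lemma pr_minus: "t \<in> TC \<Longrightarrow> pr (- t) = \<ominus>\<^bsub>A\<^esub> pr t"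
proof -
  assume t: "t \<in> TC"
  have "pr (- t) \<oplus>\<^bsub>A\<^esub> pr t = \<zero>\<^bsub>A\<^esub>"
    using proj_add[OF TC_closed(5)[OF t] t] proj_zero_iff[OF TC_closed(4)] pv.subspace_0[OF I_subspace] by simp
  then show ?thesis using t by (intro A.minus_equality[symmetric]) (simp_all add: proj_closed TC_closed)
qed

text \<open>The boundary of \<open>\<sigma>\<^sub>i\<close> involves the duals \<open>xs x\<close>,
  so the codifferential evaluates \<open>f\<close> at \<open>star x\<close>, whereas
  \<open>D1.Phi f\<close> evaluates it at \<open>x\<close>. Passing from \<open>x\<close> to
  \<open>star x\<close> reconciles the two, and its sign turns the sum of the halves into the
  difference required by \<open>d\<close> in degree 1.\<close>

lemma compat1:
  assumes f: "f \<in> carrier (C (Suc 0))"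
  shows "d (Suc 0) (D1.Phi f) = D2.Phi (codiff (Suc 0) f)"
proof -
  note fv = D1.value_closed[OF f]
  let ?q = "\<lambda>x. phi (eps x) \<otimes>\<^bsub>A\<^esub> pa x"
  have q: "?q x \<in> carrier A" if "x \<in> QA" for x using that by (simp add: phi_closed ar_A)
  have pe: "pr (xs x) \<in> carrier A" if "x \<in> QA" for x using that by (simp add: pe_eq phi_closed ar_A)
  \<comment> \<open>The antisymmetry of \<open>eps\<close>, which is the whole sign bookkeeping of
    this proof.\<close>
  have qs: "?q (star x) = \<ominus>\<^bsub>A\<^esub> pr (xs x)" if "x \<in> QA" for x
  proof -
    have "?q (star x) = pr (- xs x)" using that by (simp add: phi_mult_proj ar_TC)
    then show ?thesis using that pr_minus[of "xs x"] W_TC[OF xs_W] by simp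
  qed
  have cu: "codiff (Suc 0) f (D2.unit i) = (\<Oplus>\<^bsub>E\<^esub>x\<in>QA.
      (if tgt x = i then ?q x \<odot>\<^bsub>E\<^esub> f (D1.unit (star x)) else \<zero>\<^bsub>E\<^esub>) \<oplus>\<^bsub>E\<^esub>
      (if src x = i then \<ominus>\<^bsub>E\<^esub> ract E (f (D1.unit (star x))) (?q x) else \<zero>\<^bsub>E\<^esub>))" if i: "i \<in> verts Q" for i
  proof -
    have k1: "kt (Suc 0) (\<one>\<^bsub>A\<^esub> \<otimes>\<^bsub>A\<^esub> pa x) (xs x) \<one>\<^bsub>A\<^esub> = ?q x \<odot>\<^bsub>K (Suc 0)\<^esub> D1.unit (star x)" if "x \<in> QA" for x
      using that kt_scale1[of "pa x" "ar (star x)" "Suc 0" "eps x" "\<one>\<^bsub>A\<^esub>"] by (simp add: K_lact q ar_A ar_W)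
    have k2: "kt (Suc 0) \<one>\<^bsub>A\<^esub> (xs x) (pa x \<otimes>\<^bsub>A\<^esub> \<one>\<^bsub>A\<^esub>) = ract (K (Suc 0)) (D1.unit (star x)) (?q x)" if "x \<in> QA" for x
      using that kt_scale3[of "\<one>\<^bsub>A\<^esub>" "ar (star x)" "Suc 0" "pa x" "eps x"] by (simp add: K_ract q ar_A ar_W)
    note c = D1.unit_closed K_lact_closed K_ract_closed q
    have f0: "f \<zero>\<^bsub>K (Suc 0)\<^esub> = \<zero>\<^bsub>E\<^esub>"
      by (rule additive_zero[OF K_group Eg.abelian_group_axioms]) (simp_all add: CD[OF f] Pi_iff)
    have "codiff (Suc 0) f (D2.unit i) = f (d 2 (D2.unit i))"
      using i D2.unit_closed[OF i] by (simp add: koszul_codiff_def numeral_2_eq_2)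
    also have "\<dots> = f (\<Oplus>\<^bsub>K (Suc 0)\<^esub>x\<in>QA.
      (if tgt x = i then ?q x \<odot>\<^bsub>K (Suc 0)\<^esub> D1.unit (star x) else \<zero>\<^bsub>K (Suc 0)\<^esub>) \<oplus>\<^bsub>K (Suc 0)\<^esub>
      (if src x = i then \<ominus>\<^bsub>K (Suc 0)\<^esub> ract (K (Suc 0)) (D1.unit (star x)) (?q x) else \<zero>\<^bsub>K (Suc 0)\<^esub>))"
      unfolding d2_kt[OF i A.one_closed A.one_closed]
      by (rule arg_cong[of _ _ f], rule Kg.finsum_cong') (simp_all add: Pi_iff k1 k2 c)
    also have "\<dots> = (\<Oplus>\<^bsub>E\<^esub>x\<in>QA. f (
      (if tgt x = i then ?q x \<odot>\<^bsub>K (Suc 0)\<^esub> D1.unit (star x) else \<zero>\<^bsub>K (Suc 0)\<^esub>) \<oplus>\<^bsub>K (Suc 0)\<^esub>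
      (if src x = i then \<ominus>\<^bsub>K (Suc 0)\<^esub> ract (K (Suc 0)) (D1.unit (star x)) (?q x) else \<zero>\<^bsub>K (Suc 0)\<^esub>)))"
      by (rule additive_finsum[OF K_group Eg.abelian_group_axioms]) (simp_all add: CD[OF f] Pi_iff c)
    also have "\<dots> = (\<Oplus>\<^bsub>E\<^esub>x\<in>QA.
      (if tgt x = i then ?q x \<odot>\<^bsub>E\<^esub> f (D1.unit (star x)) else \<zero>\<^bsub>E\<^esub>) \<oplus>\<^bsub>E\<^esub>
      (if src x = i then \<ominus>\<^bsub>E\<^esub> ract E (f (D1.unit (star x))) (?q x) else \<zero>\<^bsub>E\<^esub>))"
      by (rule Eg.finsum_cong') (simp_all add: CD[OF f] Pi_iff c E_closed f0)
    finally show ?thesis .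
  qed
  have fs: "f (D1.unit (star x)) \<in> carrier E" if "x \<in> QA" for x using that fv by simp
  have "D2.Phi (codiff (Suc 0) f) = (\<Oplus>\<^bsub>K 0\<^esub>i\<in>verts Q. sw 0 (ei i) (codiff (Suc 0) f (D2.unit i)))"
    unfolding D2.Phi_def using codiff_closed[OF _ f] reps2 by (simp add: numeral_2_eq_2)
  also have "\<dots> = (\<Oplus>\<^bsub>K 0\<^esub>i\<in>verts Q. \<Oplus>\<^bsub>K 0\<^esub>x\<in>QA.
      (if tgt x = i then sw 0 (ei (tgt x)) (?q x \<odot>\<^bsub>E\<^esub> f (D1.unit (star x))) else \<zero>\<^bsub>K 0\<^esub>) \<oplus>\<^bsub>K 0\<^esub>
      (if src x = i then \<ominus>\<^bsub>K 0\<^esub> sw 0 (ei (src x)) (ract E (f (D1.unit (star x))) (?q x)) else \<zero>\<^bsub>K 0\<^esub>))"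
  proof (rule Kg.finsum_cong')
    fix i assume i: "i \<in> verts Q"
    have "sw 0 (ei i) (codiff (Suc 0) f (D2.unit i)) = (\<Oplus>\<^bsub>K 0\<^esub>x\<in>QA. sw 0 (ei i) (
      (if tgt x = i then ?q x \<odot>\<^bsub>E\<^esub> f (D1.unit (star x)) else \<zero>\<^bsub>E\<^esub>) \<oplus>\<^bsub>E\<^esub>
      (if src x = i then \<ominus>\<^bsub>E\<^esub> ract E (f (D1.unit (star x))) (?q x) else \<zero>\<^bsub>E\<^esub>)))"
      unfolding cu[OF i] by (rule sw_sum[OF ei_W[OF i]]) (simp_all add: E_closed q fs)
    also have "\<dots> = (\<Oplus>\<^bsub>K 0\<^esub>x\<in>QA.
      (if tgt x = i then sw 0 (ei (tgt x)) (?q x \<odot>\<^bsub>E\<^esub> f (D1.unit (star x))) else \<zero>\<^bsub>K 0\<^esub>) \<oplus>\<^bsub>K 0\<^esub>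
      (if src x = i then \<ominus>\<^bsub>K 0\<^esub> sw 0 (ei (src x)) (ract E (f (D1.unit (star x))) (?q x)) else \<zero>\<^bsub>K 0\<^esub>))"
    proof (rule Kg.finsum_cong')
      fix x assume x: "x \<in> QA"
      show "sw 0 (ei i) ((if tgt x = i then ?q x \<odot>\<^bsub>E\<^esub> f (D1.unit (star x)) else \<zero>\<^bsub>E\<^esub>) \<oplus>\<^bsub>E\<^esub>
        (if src x = i then \<ominus>\<^bsub>E\<^esub> ract E (f (D1.unit (star x))) (?q x) else \<zero>\<^bsub>E\<^esub>)) =
        (if tgt x = i then sw 0 (ei (tgt x)) (?q x \<odot>\<^bsub>E\<^esub> f (D1.unit (star x))) else \<zero>\<^bsub>K 0\<^esub>) \<oplus>\<^bsub>K 0\<^esub>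
        (if src x = i then \<ominus>\<^bsub>K 0\<^esub> sw 0 (ei (src x)) (ract E (f (D1.unit (star x))) (?q x)) else \<zero>\<^bsub>K 0\<^esub>)"
        using ei_W[OF i] x
        by (cases "tgt x = i"; cases "src x = i") (simp_all add: sw sw_minus sw_zero E_closed q fs)
    qed (use i in \<open>simp_all add: Pi_iff sw ei_W E_closed q fs\<close>)
    finally show "sw 0 (ei i) (codiff (Suc 0) f (D2.unit i)) = (\<Oplus>\<^bsub>K 0\<^esub>x\<in>QA.
      (if tgt x = i then sw 0 (ei (tgt x)) (?q x \<odot>\<^bsub>E\<^esub> f (D1.unit (star x))) else \<zero>\<^bsub>K 0\<^esub>) \<oplus>\<^bsub>K 0\<^esub>
      (if src x = i then \<ominus>\<^bsub>K 0\<^esub> sw 0 (ei (src x)) (ract E (f (D1.unit (star x))) (?q x)) else \<zero>\<^bsub>K 0\<^esub>))" .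
  qed (simp_all add: Pi_iff Kg.finsum_closed sw ei_W E_closed q fs)
  also have "\<dots> = (\<Oplus>\<^bsub>K 0\<^esub>x\<in>QA. sw 0 (ei (tgt x)) (?q x \<odot>\<^bsub>E\<^esub> f (D1.unit (star x))) \<oplus>\<^bsub>K 0\<^esub>
      \<ominus>\<^bsub>K 0\<^esub> sw 0 (ei (src x)) (ract E (f (D1.unit (star x))) (?q x)))"
    by (rule finsum_vertex) (simp_all add: sw ei_W E_closed q fs)
  \<comment> \<open>The index set is written as its own image under the involution, in order to
    reindex by \<open>star\<close>.\<close>
  also have "\<dots> = (\<Oplus>\<^bsub>K 0\<^esub>x\<in>star ` QA. sw 0 (ei (tgt x)) (?q x \<odot>\<^bsub>E\<^esub> f (D1.unit (star x))) \<oplus>\<^bsub>K 0\<^esub>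
      \<ominus>\<^bsub>K 0\<^esub> sw 0 (ei (src x)) (ract E (f (D1.unit (star x))) (?q x)))"
  proof -
    have "star ` QA = QA" by (auto intro!: image_eqI[of _ star "star _"])
    then show ?thesis by simp
  qed
  also have "\<dots> = (\<Oplus>\<^bsub>K 0\<^esub>x\<in>QA. sw 0 (ei (src x)) (?q (star x) \<odot>\<^bsub>E\<^esub> f (D1.unit x)) \<oplus>\<^bsub>K 0\<^esub>
      \<ominus>\<^bsub>K 0\<^esub> sw 0 (ei (tgt x)) (ract E (f (D1.unit x)) (?q (star x))))"
    by (subst Kg.finsum_reindex) (simp_all add: Pi_iff inj_on_def sw ei_W E_closed q fs fv phi_closed ar_A)
  also have "\<dots> = (\<Oplus>\<^bsub>K 0\<^esub>x\<in>QA. d (Suc 0) (sw (Suc 0) (xs x) (f (D1.unit x))))"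
  proof (rule Kg.finsum_cong')
    fix x assume x: "x \<in> QA"
    show "sw 0 (ei (src x)) (?q (star x) \<odot>\<^bsub>E\<^esub> f (D1.unit x)) \<oplus>\<^bsub>K 0\<^esub>
      \<ominus>\<^bsub>K 0\<^esub> sw 0 (ei (tgt x)) (ract E (f (D1.unit x)) (?q (star x))) = d (Suc 0) (sw (Suc 0) (xs x) (f (D1.unit x)))"
      unfolding qs[OF x] d1_sw[OF x fv[OF x]]
      using x by (simp add: E_lact_neg E_ract_neg pe fv E_closed sw_minus ei_W sw a_minus_def Kg.a_comm)
  qed (use d_closed[OF reps1] in \<open>simp_all add: Pi_iff sw xs_W fv\<close>)
  also have "\<dots> = d (Suc 0) (D1.Phi f)"
    unfolding D1.Phi_def using f by (simp add: d_sum[OF reps1] D1.term_closed)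
  finally show ?thesis by simp
qed

end

lemma sub_bimodule_vimage:
  assumes M: "bimod (carrier R) M (carrier R)" and N: "abelian_group N"
    and f: "f \<in> bimodule_homs R M N" and Z: "sub_bimodule R N Z"
  shows "sub_bimodule R M {x \<in> carrier M. f x \<in> Z}"
proof -
  interpret M: bimod "carrier R" M "carrier R" by (rule M)
  note H = bimodule_homsD[OF f] and S = sub_bimoduleD[OF Z]
  have "f \<zero>\<^bsub>M\<^esub> = \<zero>\<^bsub>N\<^esub>" by (rule additive_zero[OF M.abelian_group_axioms N]) (simp_all add: H Pi_iff)
  moreover have "f (\<ominus>\<^bsub>M\<^esub> x) = \<ominus>\<^bsub>N\<^esub> f x" if "x \<in> carrier M" for x
    by (rule additive_minus[OF M.abelian_group_axioms N]) (use that in \<open>simp_all add: H Pi_iff\<close>)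
  ultimately show ?thesis unfolding sub_bimodule_def
    by (simp add: H S M.lact_closed M.ract_closed subset_eq)
qed

context koszul_quiver begin

interpretation D0: dual_pair F Q 0 2 "verts Q" idem sg "\<lambda>i. i" "\<lambda>i. i" "\<lambda>i y. Poly_Mapping.lookup y (i, [], i)" cs
  by (rule dual0)
interpretation D1: dual_pair F Q "Suc 0" "Suc 0" QA ar xs tgt src "\<lambda>x y. Poly_Mapping.lookup y (tgt x, [x], src x)"
    "\<lambda>x y. eps x * Poly_Mapping.lookup y (src x, [star x], tgt x)"
  by (rule dual1)
interpretation D2: dual_pair F Q 2 0 "verts Q" sg idem "\<lambda>i. i" "\<lambda>i. i" cs "\<lambda>i y. Poly_Mapping.lookup y (i, [], i)"
  by (rule dual2)

section \<open>Cycles and boundaries on both sides of the comparison\<close>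

definition Zk where "Zk q = {x \<in> carrier (K q). d q x = \<zero>\<^bsub>K (q - 1)\<^esub>}"
definition Bk where "Bk q = d (Suc q) ` carrier (K (Suc q))"

lemma d_zero: "has_reps p \<Longrightarrow> p > 0 \<Longrightarrow> d p \<zero>\<^bsub>K p\<^esub> = \<zero>\<^bsub>K (p - 1)\<^esub>"
  by (rule additive_zero[OF K_group K_group]) (simp_all add: d_closed d_add Pi_iff del: One_nat_def)

lemma d_minus: "has_reps p \<Longrightarrow> p > 0 \<Longrightarrow> z \<in> carrier (K p) \<Longrightarrow> d p (\<ominus>\<^bsub>K p\<^esub> z) = \<ominus>\<^bsub>K (p - 1)\<^esub> d p z"
  by (rule additive_minus[OF K_group K_group]) (simp_all add: d_closed d_add Pi_iff del: One_nat_def)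

lemma K_act_zero: "c \<in> carrier A \<Longrightarrow> c \<odot>\<^bsub>K p\<^esub> \<zero>\<^bsub>K p\<^esub> = \<zero>\<^bsub>K p\<^esub>" "c \<in> carrier A \<Longrightarrow> ract (K p) \<zero>\<^bsub>K p\<^esub> c = \<zero>\<^bsub>K p\<^esub>"
proof -
  show "c \<in> carrier A \<Longrightarrow> c \<odot>\<^bsub>K p\<^esub> \<zero>\<^bsub>K p\<^esub> = \<zero>\<^bsub>K p\<^esub>"
    by (rule additive_zero[OF K_group K_group]) (simp_all add: K_lact_closed K_lact_add Pi_iff)
  show "c \<in> carrier A \<Longrightarrow> ract (K p) \<zero>\<^bsub>K p\<^esub> c = \<zero>\<^bsub>K p\<^esub>"
    by (rule additive_zero[OF K_group K_group]) (simp_all add: K_ract_closed K_ract_add Pi_iff)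
qed

lemma sub_K: "sub_bimodule A (K q) (carrier (K q))"
  by (simp add: sub_bimodule_def K_lact_closed K_ract_closed)

lemma sub_Zk: assumes "has_reps q" "q > 0" shows "sub_bimodule A (K q) (Zk q)"
  unfolding sub_bimodule_def Zk_def
  by (simp add: d_zero[OF assms] d_add[OF assms] d_minus[OF assms] d_lact[OF assms] d_ract[OF assms] subset_eq
    K_lact_closed K_ract_closed K_act_zero Kg.minus_equality del: One_nat_def)

lemma sub_Bk: assumes "has_reps (Suc q)" shows "sub_bimodule A (K q) (Bk q)"
proof -
  note D = d_closed[OF assms, simplified] d_add[OF assms, simplified] d_lact[OF assms, simplified]
    d_ract[OF assms, simplified] d_zero[OF assms, simplified] d_minus[OF assms, simplified]
  show ?thesis unfolding sub_bimodule_def Bk_def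
  proof (intro conjI ballI)
    show "d (Suc q) ` carrier (K (Suc q)) \<subseteq> carrier (K q)" using D(1) by blast
    show "\<zero>\<^bsub>K q\<^esub> \<in> d (Suc q) ` carrier (K (Suc q))"
      by (rule image_eqI[of _ _ "\<zero>\<^bsub>K (Suc q)\<^esub>"]) (simp_all add: D)
    fix x assume "x \<in> d (Suc q) ` carrier (K (Suc q))"
    then obtain u where u: "x = d (Suc q) u" "u \<in> carrier (K (Suc q))" by blast
    show "\<ominus>\<^bsub>K q\<^esub> x \<in> d (Suc q) ` carrier (K (Suc q))"
      by (rule image_eqI[of _ _ "\<ominus>\<^bsub>K (Suc q)\<^esub> u"]) (simp_all add: D u)
    show "r \<odot>\<^bsub>K q\<^esub> x \<in> d (Suc q) ` carrier (K (Suc q))" if "r \<in> carrier A" for r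
      by (rule image_eqI[of _ _ "r \<odot>\<^bsub>K (Suc q)\<^esub> u"]) (simp_all add: D u that K_lact_closed)
    show "ract (K q) x r \<in> d (Suc q) ` carrier (K (Suc q))" if "r \<in> carrier A" for r
      by (rule image_eqI[of _ _ "ract (K (Suc q)) u r"]) (simp_all add: D u that K_ract_closed)
    fix y assume "y \<in> d (Suc q) ` carrier (K (Suc q))"
    then obtain v where v: "y = d (Suc q) v" "v \<in> carrier (K (Suc q))" by blast
    show "x \<oplus>\<^bsub>K q\<^esub> y \<in> d (Suc q) ` carrier (K (Suc q))"
      by (rule image_eqI[of _ _ "u \<oplus>\<^bsub>K (Suc q)\<^esub> v"]) (simp_all add: D u v)
  qed
qed

lemma K3: "carrier (K 3) = {\<zero>\<^bsub>K 3\<^esub>}"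
proof -
  have "z = \<zero>\<^bsub>K 3\<^esub>" if "z \<in> carrier (K 3)" for z
    using that
  proof (induction rule: K_induct)
    case (pure a w b) then show ?case by (simp add: W_3 kt_zero)
  qed simp
  then show ?thesis by auto
qed

lemma Bk2: "Bk 2 = {\<zero>\<^bsub>K 2\<^esub>}"
  using K3 d_zero[OF reps3] by (simp add: Bk_def numeral_3_eq_3[symmetric] numeral_2_eq_2[symmetric])

lemma Zk0: "Zk 0 = carrier (K 0)"
  by (auto simp: Zk_def koszul_diff_def)

lemma homology_eq: "koszul_homology F Q q = subquotient (K q) (Zk q) (Bk q)"
  by (simp add: koszul_homology_def Zk_def Bk_def)

definition Zc where "Zc p = {f \<in> carrier (C p). codiff p f = \<zero>\<^bsub>C (Suc p)\<^esub>}"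
abbreviation "Bc \<equiv> koszul_coboundaries F Q"

lemma HK_eq: "HK F Q p = subquotient (C p) (Zc p) (Bc p)"
  by (simp add: HK_def Zc_def)

lemma Phi_iso:
  assumes Phi: "Phi \<in> bimodule_homs A (C p) (K q)" "inj_on Phi (carrier (C p))" "Phi ` carrier (C p) = carrier (K q)"
    and Z: "Zc p = {x \<in> carrier (C p). Phi x \<in> Zk q}" and B: "Bc p = {x \<in> carrier (C p). Phi x \<in> Bk q}"
    and sub: "sub_bimodule A (K q) (Zk q)" "sub_bimodule A (K q) (Bk q)"
  shows "bimodule_iso A (HK F Q p) (koszul_homology F Q q)" "sub_bimod A (C p) (Bc p)"
proof -
  have im: "Phi ` {x \<in> carrier (C p). Phi x \<in> S} = S" if "S \<subseteq> carrier (K q)" for S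
  proof (intro equalityI subsetI)
    fix s assume s: "s \<in> S"
    have "s \<in> Phi ` carrier (C p)" unfolding Phi(3) using that s by (rule subsetD)
    then obtain x where "x \<in> carrier (C p)" "s = Phi x" by (elim imageE)
    with s show "s \<in> Phi ` {x \<in> carrier (C p). Phi x \<in> S}" by simp
  next
    fix s assume "s \<in> Phi ` {x \<in> carrier (C p). Phi x \<in> S}"
    then show "s \<in> S" by (elim imageE) simp
  qed
  have c: "Zk q \<subseteq> carrier (K q)" "Bk q \<subseteq> carrier (K q)" using sub by (simp_all add: sub_bimodule_def)
  show BC: "sub_bimod A (C p) (Bc p)"
    unfolding B by (intro sub_bimod.intro sub_bimod_axioms.intro C_bimod sub_bimodule_vimage[OF C_bimod K_group Phi(1)] sub)
  have ZC: "sub_bimodule A (C p) (Zc p)"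
    unfolding Z by (rule sub_bimodule_vimage[OF C_bimod K_group Phi(1) sub(1)])
  have NB: "sub_bimod A (K q) (Phi ` Bc p)"
    unfolding B im[OF c(2)] by (intro sub_bimod.intro sub_bimod_axioms.intro bimod_K sub)
  have "bimodule_iso A (subquotient (C p) (Zc p) (Bc p)) (subquotient (K q) (Phi ` Zc p) (Phi ` Bc p))"
    by (rule subquotient_iso[OF BC ZC Phi(1) _ NB]) (simp add: bij_betw_def Phi)
  then show "bimodule_iso A (HK F Q p) (koszul_homology F Q q)"
    unfolding HK_eq homology_eq B Z im[OF c(1)] im[OF c(2)] .
qed

lemma Phi_zero: "dual_pair F Q p q B w w' tb sb c c' \<Longrightarrow> dual_pair.Phi F Q p q B w w' \<zero>\<^bsub>C p\<^esub> = \<zero>\<^bsub>K q\<^esub>"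
  by (rule additive_zero[OF bimod.axioms(1)[OF C_bimod] K_group])
     (simp_all add: bimodule_homsD[OF dual_pair.Phi_hom] Pi_iff)

lemma Phi_eq_zero:
  assumes D: "dual_pair F Q p q B w w' tb sb c c'" and f: "f \<in> carrier (C p)"
  shows "dual_pair.Phi F Q p q B w w' f = \<zero>\<^bsub>K q\<^esub> \<longleftrightarrow> f = \<zero>\<^bsub>C p\<^esub>"
  using inj_onD[OF dual_pair.Phi_inj[OF D] _ f C_closed(2)] Phi_zero[OF D] by auto

text \<open>By compatibility, \<open>d\<close> applied to the image of \<open>f\<close> is the image
  of the codifferential of \<open>f\<close>; injectivity of the comparison map in the next degree
  then makes the two vanish together.\<close>

lemma Zc0: "Zc 0 = {x \<in> carrier (C 0). D0.Phi x \<in> Zk 2}"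
proof -
  have "codiff 0 f = \<zero>\<^bsub>C (Suc 0)\<^esub> \<longleftrightarrow> D0.Phi f \<in> Zk 2" if f: "f \<in> carrier (C 0)" for f
    using Phi_eq_zero[OF dual1 codiff_closed[OF reps1 f]] compat0[OF f] bimodule_homsD(1)[OF D0.Phi_hom f]
    by (simp add: Zk_def)
  then show ?thesis unfolding Zc_def by blast
qed

lemma Zc1: "Zc (Suc 0) = {x \<in> carrier (C (Suc 0)). D1.Phi x \<in> Zk (Suc 0)}"
proof -
  have "codiff (Suc 0) f = \<zero>\<^bsub>C (Suc (Suc 0))\<^esub> \<longleftrightarrow> D1.Phi f \<in> Zk (Suc 0)" if f: "f \<in> carrier (C (Suc 0))" for f
    using Phi_eq_zero[OF dual2, of "codiff (Suc 0) f"] codiff_closed[OF _ f] reps2 compat1[OF f] bimodule_homsD(1)[OF D1.Phi_hom f]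
    by (simp add: Zk_def numeral_2_eq_2)
  then show ?thesis unfolding Zc_def by blast
qed

text \<open>Cochains of degree 3 are functions on \<open>K(A)\<^sub>3\<close>, which is zero because
  \<open>W\<^sub>3\<close> is; so every cochain of degree 2 is a cocycle.\<close>

lemma Zc2: "Zc 2 = carrier (C 2)"
proof -
  have "codiff 2 f = \<zero>\<^bsub>C (Suc 2)\<^esub>" if f: "f \<in> carrier (C 2)" for f
  proof -
    have "f \<zero>\<^bsub>K 2\<^esub> = \<zero>\<^bsub>E\<^esub>"
      by (rule additive_zero[OF K_group Eg.abelian_group_axioms]) (simp_all add: CD[OF f] Pi_iff)
    moreover have "\<ominus>\<^bsub>E\<^esub> \<zero>\<^bsub>E\<^esub> = \<zero>\<^bsub>E\<^esub>" by (rule Eg.minus_equality) simp_all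
    moreover have "d 3 \<zero>\<^bsub>K 3\<^esub> = \<zero>\<^bsub>K 2\<^esub>" using d_zero[OF reps3] by simp
    ultimately show ?thesis
      by (auto simp: koszul_codiff_def C_sel(3) fun_eq_iff restrict_def numeral_3_eq_3[symmetric] K3 eval_nat_numeral(2,3)[symmetric])
  qed
  then show ?thesis unfolding Zc_def by blast
qed

lemma Bc0: "Bc 0 = {x \<in> carrier (C 0). D0.Phi x \<in> Bk 2}"
  using Phi_eq_zero[OF dual0] C_closed(2) by (auto simp: koszul_coboundaries_def Bk2)

lemma Bc1: "Bc (Suc 0) = {x \<in> carrier (C (Suc 0)). D1.Phi x \<in> Bk (Suc 0)}"
proof -
  have "Bk (Suc 0) = d 2 ` D0.Phi ` carrier (C 0)" unfolding D0.Phi_surj unfolding Bk_def numeral_2_eq_2 ..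
  also have "\<dots> = D1.Phi ` codiff 0 ` carrier (C 0)" unfolding image_image by (rule image_cong) (simp_all add: compat0)
  finally have e: "Bk (Suc 0) = D1.Phi ` codiff 0 ` carrier (C 0)" .
  have "codiff 0 ` carrier (C 0) \<subseteq> carrier (C (Suc 0))" using codiff_closed[OF reps1] by blast
  then show ?thesis unfolding koszul_coboundaries_def e using D1.Phi_inj by (auto simp: inj_on_def)
qed

lemma Bc2: "Bc 2 = {x \<in> carrier (C 2). D2.Phi x \<in> Bk 0}"
proof -
  have "Bk 0 = d (Suc 0) ` D1.Phi ` carrier (C (Suc 0))" by (simp add: Bk_def D1.Phi_surj)
  also have "\<dots> = D2.Phi ` codiff (Suc 0) ` carrier (C (Suc 0))" unfolding image_image by (rule image_cong) (simp_all add: compat1)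
  finally have e: "Bk 0 = D2.Phi ` codiff (Suc 0) ` carrier (C (Suc 0))" .
  have "codiff (Suc 0) ` carrier (C (Suc 0)) \<subseteq> carrier (C 2)" using codiff_closed reps2 by (fastforce simp: numeral_2_eq_2)
  then show ?thesis unfolding koszul_coboundaries_def e using D2.Phi_inj by (auto simp: inj_on_def)
qed

lemma HK_iso:
  "bimodule_iso A (HK F Q 0) (koszul_homology F Q 2)"
  "bimodule_iso A (HK F Q (Suc 0)) (koszul_homology F Q (Suc 0))"
  "bimodule_iso A (HK F Q 2) (koszul_homology F Q 0)"
proof -
  have r2: "has_reps (Suc (Suc 0))" using reps2 by (simp add: numeral_2_eq_2)
  have r3: "has_reps (Suc 2)" using reps3 by (simp add: numeral_3_eq_3 numeral_2_eq_2)
  show "bimodule_iso A (HK F Q 0) (koszul_homology F Q 2)"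
    by (rule Phi_iso(1)[OF D0.Phi_hom D0.Phi_inj D0.Phi_surj Zc0 Bc0 sub_Zk[OF reps2] sub_Bk[OF r3]]) simp
  show "bimodule_iso A (HK F Q (Suc 0)) (koszul_homology F Q (Suc 0))"
    by (rule Phi_iso(1)[OF D1.Phi_hom D1.Phi_inj D1.Phi_surj Zc1 Bc1 sub_Zk[OF reps1] sub_Bk[OF r2]]) simp
  show "bimodule_iso A (HK F Q 2) (koszul_homology F Q 0)"
    by (rule Phi_iso(1)[OF D2.Phi_hom D2.Phi_inj D2.Phi_surj _ Bc2 _ sub_Bk[OF reps1]])
       (use Zc2 Zk0 sub_K[of 0] bimodule_homsD(1)[OF D2.Phi_hom] in auto)
qed

text \<open>Following the comparison map by \<open>m\<close> gives a surjection from the cochains of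
  degree 2, all of them cocycles, with the coboundaries as kernel. The isomorphism theorem applies
  to it directly, without composing two isomorphisms.\<close>

lemma HK2_transfer:
  assumes m: "m \<in> bimodule_homs A (K 0) N" and N: "abelian_group N" and surj: "m ` carrier (K 0) = carrier N"
    and ker: "\<And>z. z \<in> carrier (K 0) \<Longrightarrow> m z = \<zero>\<^bsub>N\<^esub> \<longleftrightarrow> z \<in> Bk 0"
  shows "bimodule_iso A (HK F Q 2) N"
proof -
  have sB: "sub_bimod A (C 2) (Bc 2)"
    unfolding Bc2 by (intro sub_bimod.intro sub_bimod_axioms.intro C_bimod sub_bimodule_vimage[OF C_bimod K_group D2.Phi_hom] sub_Bk reps1)
  let ?g = "\<lambda>f\<in>carrier (C 2). m (D2.Phi f)"
  note H = bimodule_homsD[OF D2.Phi_hom] and G = bimodule_homsD[OF m]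
  have cc: "f \<oplus>\<^bsub>C 2\<^esub> f' \<in> carrier (C 2)" "a \<odot>\<^bsub>C 2\<^esub> f \<in> carrier (C 2)" "ract (C 2) f a \<in> carrier (C 2)"
    if "f \<in> carrier (C 2)" "f' \<in> carrier (C 2)" "a \<in> carrier A" for f f' a using that by (simp_all add: C_closed)
  have "?g \<in> bimodule_homs A (C 2) N"
    by (rule bimodule_homsI) (simp_all add: H G C_closed)
  moreover have "?g ` carrier (C 2) = carrier N"
    using D2.Phi_surj surj by (simp add: image_image[symmetric])
  moreover have "Bc 2 = {z \<in> carrier (C 2). ?g z = \<zero>\<^bsub>N\<^esub>}"
    unfolding Bc2 using ker H(1) by auto
  ultimately show ?thesis unfolding HK_eq Zc2 by (intro first_iso[OF sB N])
qed

lemma HK1_trivial: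
  assumes "Zk (Suc 0) \<subseteq> Bk (Suc 0)"
  shows "carrier (HK F Q (Suc 0)) = {\<zero>\<^bsub>HK F Q (Suc 0)\<^esub>}"
proof -
  have r2: "has_reps (Suc (Suc 0))" using reps2 by (simp add: numeral_2_eq_2)
  have sB: "sub_bimod A (C (Suc 0)) (Bc (Suc 0))"
    unfolding Bc1 by (intro sub_bimod.intro sub_bimod_axioms.intro C_bimod sub_bimodule_vimage[OF C_bimod K_group D1.Phi_hom] sub_Bk r2)
  interpret B: sub_bimod A "C (Suc 0)" "Bc (Suc 0)" by (rule sB)
  have ZB: "Zc (Suc 0) \<subseteq> Bc (Suc 0)" unfolding Zc1 Bc1 using assms by blast
  have cz: "Bc (Suc 0) +>\<^bsub>C (Suc 0)\<^esub> z = Bc (Suc 0)" if "z \<in> Bc (Suc 0)" for z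
  proof -
    have "Bc (Suc 0) +>\<^bsub>C (Suc 0)\<^esub> \<zero>\<^bsub>C (Suc 0)\<^esub> = Bc (Suc 0)"
      using B.B(1) by (auto simp: set_eq_iff mem_coset_iff)
    moreover have "Bc (Suc 0) +>\<^bsub>C (Suc 0)\<^esub> (z \<oplus>\<^bsub>C (Suc 0)\<^esub> \<zero>\<^bsub>C (Suc 0)\<^esub>) = Bc (Suc 0) +>\<^bsub>C (Suc 0)\<^esub> \<zero>\<^bsub>C (Suc 0)\<^esub>"
      by (rule B.coset_absorb[OF that]) simp
    ultimately show ?thesis using B.B(1)[OF that] by simp
  qed
  have "\<zero>\<^bsub>C (Suc 0)\<^esub> \<in> Zc (Suc 0)"
    unfolding Zc1 using Phi_zero[OF dual1] d_zero[OF reps1] C_closed(2) by (simp add: Zk_def)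
  then show ?thesis unfolding HK_eq subquotient_sel using cz ZB by auto
qed

text \<open>There are no nonzero boundaries in degree 2, so homology classes are singletons and a
  nonzero cycle is a nonzero class.\<close>

lemma homology2_nontrivial:
  assumes "z \<in> Zk 2" "z \<noteq> \<zero>\<^bsub>K 2\<^esub>"
  shows "carrier (koszul_homology F Q 2) \<noteq> {\<zero>\<^bsub>koszul_homology F Q 2\<^esub>}"
proof
  have zc: "z \<in> carrier (K 2)" using assms(1) by (simp add: Zk_def)
  have "{\<zero>\<^bsub>K 2\<^esub>} +>\<^bsub>K 2\<^esub> z = {z}"
    using zc by (auto simp: set_eq_iff mem_coset_iff)
  then have "{z} \<in> carrier (koszul_homology F Q 2)" using assms(1) unfolding homology_eq subquotient_sel Bk2 by auto
  moreover assume "carrier (koszul_homology F Q 2) = {\<zero>\<^bsub>koszul_homology F Q 2\<^esub>}"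
  ultimately have "{z} = {\<zero>\<^bsub>K 2\<^esub>}" unfolding homology_eq subquotient_sel Bk2 by auto
  then show False using assms(2) by simp
qed

end

section \<open>The universal derivation\<close>

context koszul_quiver begin

section \<open>Module laws for the actions on \<open>K(A)\<^sub>p\<close>\<close>

lemma K_lact_zero: "z \<in> carrier (K p) \<Longrightarrow> \<zero>\<^bsub>A\<^esub> \<odot>\<^bsub>K p\<^esub> z = \<zero>\<^bsub>K p\<^esub>"
proof (induction rule: K_induct)
  case (pure a w b) then show ?case by (simp add: K_lact kt_zero)
qed (simp add: K_lact_add)

lemma K_ract_zero: "z \<in> carrier (K p) \<Longrightarrow> ract (K p) z \<zero>\<^bsub>A\<^esub> = \<zero>\<^bsub>K p\<^esub>"
proof (induction rule: K_induct)
  case (pure a w b) then show ?case by (simp add: K_ract kt_zero)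
qed (simp add: K_ract_add)

lemma K_lact_add_left: "z \<in> carrier (K p) \<Longrightarrow> a \<in> carrier A \<Longrightarrow> a' \<in> carrier A \<Longrightarrow>
  (a \<oplus>\<^bsub>A\<^esub> a') \<odot>\<^bsub>K p\<^esub> z = a \<odot>\<^bsub>K p\<^esub> z \<oplus>\<^bsub>K p\<^esub> a' \<odot>\<^bsub>K p\<^esub> z"
proof (induction rule: K_induct)
  case (pure x w b) then show ?case by (simp add: K_lact A.l_distr kt_add1)
qed (simp add: K_lact_add K_lact_closed Kg.a_ac)

lemma K_ract_add_right: "z \<in> carrier (K p) \<Longrightarrow> a \<in> carrier A \<Longrightarrow> a' \<in> carrier A \<Longrightarrow>
  ract (K p) z (a \<oplus>\<^bsub>A\<^esub> a') = ract (K p) z a \<oplus>\<^bsub>K p\<^esub> ract (K p) z a'"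
proof (induction rule: K_induct)
  case (pure x w b) then show ?case by (simp add: K_ract A.r_distr kt_add3)
qed (simp add: K_ract_add K_ract_closed Kg.a_ac)

lemma K_lact_assoc: "z \<in> carrier (K p) \<Longrightarrow> a \<in> carrier A \<Longrightarrow> a' \<in> carrier A \<Longrightarrow>
  (a \<otimes>\<^bsub>A\<^esub> a') \<odot>\<^bsub>K p\<^esub> z = a \<odot>\<^bsub>K p\<^esub> (a' \<odot>\<^bsub>K p\<^esub> z)"
proof (induction rule: K_induct)
  case (pure x w b) then show ?case by (simp add: K_lact A.m_assoc)
qed (simp add: K_lact_add K_lact_closed)

lemma K_ract_assoc: "z \<in> carrier (K p) \<Longrightarrow> a \<in> carrier A \<Longrightarrow> a' \<in> carrier A \<Longrightarrow>
  ract (K p) z (a \<otimes>\<^bsub>A\<^esub> a') = ract (K p) (ract (K p) z a) a'"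
proof (induction rule: K_induct)
  case (pure x w b) then show ?case by (simp add: K_ract A.m_assoc)
qed (simp add: K_ract_add K_ract_closed)

lemma K_lact_ract: "z \<in> carrier (K p) \<Longrightarrow> a \<in> carrier A \<Longrightarrow> a' \<in> carrier A \<Longrightarrow>
  ract (K p) (a \<odot>\<^bsub>K p\<^esub> z) a' = a \<odot>\<^bsub>K p\<^esub> ract (K p) z a'"
  using bimod.lact_ract[OF bimod_K] by blast

lemma K_one: "z \<in> carrier (K p) \<Longrightarrow> \<one>\<^bsub>A\<^esub> \<odot>\<^bsub>K p\<^esub> z = z" "z \<in> carrier (K p) \<Longrightarrow> ract (K p) z \<one>\<^bsub>A\<^esub> = z"
proof -
  show "z \<in> carrier (K p) \<Longrightarrow> \<one>\<^bsub>A\<^esub> \<odot>\<^bsub>K p\<^esub> z = z"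
  proof (induction rule: K_induct)
    case (pure x w b) then show ?case by (simp add: K_lact)
  qed (simp add: K_lact_add)
  show "z \<in> carrier (K p) \<Longrightarrow> ract (K p) z \<one>\<^bsub>A\<^esub> = z"
  proof (induction rule: K_induct)
    case (pure x w b) then show ?case by (simp add: K_ract)
  qed (simp add: K_ract_add)
qed

lemma K_phi: "z \<in> carrier (K p) \<Longrightarrow> ract (K p) z (phi c) = phi c \<odot>\<^bsub>K p\<^esub> z"
proof (induction rule: K_induct)
  case (pure x w b)
  then show ?case using kt_scale1[of x w p c b] kt_scale3[of x w p b c]
    by (simp add: K_ract K_lact phi_closed phi_central[of b])
qed (simp add: K_ract_add K_lact_add phi_closed)

abbreviation "K1 \<equiv> K (Suc 0)"

abbreviation path1 :: "('v, 'e) path \<Rightarrow> ('v, 'e, 'f) pelt" where "path1 k \<equiv> Poly_Mapping.single k 1"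

lemma path1_A: "k \<in> paths Q \<Longrightarrow> pr (path1 k) \<in> carrier A" by (simp add: proj_closed single_TC)

text \<open>The universal derivation of the path algebra, with values in \<open>K(A)\<^sub>1\<close>. It carries the ideal of
  relations into the image of \<open>K(A)\<^sub>2\<close>.\<close>

primrec Dp where
  "Dp [] i = \<zero>\<^bsub>K1\<^esub>"
| "Dp (x # p) i = kt (Suc 0) \<one>\<^bsub>A\<^esub> (ar x) (pr (path1 (src x, p, i))) \<oplus>\<^bsub>K1\<^esub> pa x \<odot>\<^bsub>K1\<^esub> Dp p i"

text \<open>On a path \<open>x\<^sub>1 \<dots> x\<^sub>n\<close> this is the sum over
  \<open>i\<close> of the tensors with \<open>x\<^sub>i\<close> in the middle,
  \<open>x\<^sub>1 \<dots> x\<^sub>i\<^sub>-\<^sub>1\<close> on the left and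
  \<open>x\<^sub>i\<^sub>+\<^sub>1 \<dots> x\<^sub>n\<close> on the right. The initial vertex enters
  only as the end of the last factor.\<close>

definition D where
  "D t = (\<Oplus>\<^bsub>K1\<^esub>k\<in>Poly_Mapping.keys t. phi (Poly_Mapping.lookup t k) \<odot>\<^bsub>K1\<^esub> Dp (fst (snd k)) (snd (snd k)))"

lemma Dp_closed: "(l, p, i) \<in> paths Q \<Longrightarrow> Dp p i \<in> carrier K1"
proof (induction p arbitrary: l)
  case (Cons x p)
  then have x: "x \<in> QA" "(src x, p, i) \<in> paths Q" by (simp_all add: path_Cons)
  show ?case using Cons.IH[OF x(2)] x by (simp add: kt_closed ar_W path1_A K_lact_closed ar_A)
qed simp

lemma D_eq:
  assumes "finite S" "Poly_Mapping.keys t \<subseteq> S" "S \<subseteq> paths Q"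
  shows "D t = (\<Oplus>\<^bsub>K1\<^esub>k\<in>S. phi (Poly_Mapping.lookup t k) \<odot>\<^bsub>K1\<^esub> Dp (fst (snd k)) (snd (snd k)))"
proof -
  have c: "Dp (fst (snd k)) (snd (snd k)) \<in> carrier K1" if "k \<in> S" for k
    using that assms(3) Dp_closed[of "fst k" "fst (snd k)" "snd (snd k)"] by auto
  show ?thesis unfolding D_def
    by (rule Kg.add.finprod_mono_neutral_cong_left[OF assms(1,2), folded finsum_def])
       (use c assms in \<open>auto simp: in_keys_iff phi_zero K_lact_zero phi_closed K_lact_closed\<close>)
qed

lemma D_closed: assumes "t \<in> TC" shows "D t \<in> carrier K1"
proof -
  have "Dp (fst (snd k)) (snd (snd k)) \<in> carrier K1" if "k \<in> Poly_Mapping.keys t" for k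
    using that assms Dp_closed[of "fst k" "fst (snd k)" "snd (snd k)"] by (auto simp: TC_iff)
  then show ?thesis unfolding D_def by (intro Kg.finsum_closed) (simp add: Pi_iff K_lact_closed phi_closed)
qed

lemma D_add: assumes "t \<in> TC" "u \<in> TC" shows "D (t + u) = D t \<oplus>\<^bsub>K1\<^esub> D u"
proof -
  let ?S = "Poly_Mapping.keys t \<union> Poly_Mapping.keys u"
  have S: "finite ?S" "?S \<subseteq> paths Q" using assms by (auto simp: TC_iff)
  have c: "Dp (fst (snd k)) (snd (snd k)) \<in> carrier K1" if "k \<in> ?S" for k
    using that S(2) Dp_closed[of "fst k" "fst (snd k)" "snd (snd k)"] by auto
  show ?thesis
    unfolding D_eq[OF S(1) keys_add S(2)] D_eq[OF S(1) Un_upper1 S(2)] D_eq[OF S(1) Un_upper2 S(2)]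
    by (rule Kg.finsum_add) (use c in \<open>simp_all add: lookup_add phi_add K_lact_add_left phi_closed K_lact_closed\<close>)
qed

lemma D_single: "(l, p, i) \<in> paths Q \<Longrightarrow> D (Poly_Mapping.single (l, p, i) c) = phi c \<odot>\<^bsub>K1\<^esub> Dp p i"
  using D_eq[of "{(l, p, i)}" "Poly_Mapping.single (l, p, i) c"] Dp_closed[of l p i]
  by (simp add: phi_closed K_lact_closed)

lemma D_zero: "D 0 = \<zero>\<^bsub>K1\<^esub>" by (simp add: D_def)

lemma D_scale: assumes "t \<in> TC" shows "D (pscale c t) = phi c \<odot>\<^bsub>K1\<^esub> D t"
  using assms
proof (induction rule: TC_induct)
  case zero then show ?case by (simp add: D_zero K_act_zero phi_closed)
next
  case (single k e)
  obtain l p i where k: "k = (l, p, i)" by (cases k)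
  show ?case using single Dp_closed[of l p i] by (simp add: k pscale_single D_single phi_mult K_lact_assoc phi_closed)
next
  case (add a b)
  then show ?case by (simp add: pv.scale_right_distrib D_add TC_closed K_lact_add phi_closed D_closed)
qed

lemma D_minus: assumes "t \<in> TC" shows "D (- t) = \<ominus>\<^bsub>K1\<^esub> D t"
proof -
  have "D (- t) \<oplus>\<^bsub>K1\<^esub> D t = \<zero>\<^bsub>K1\<^esub>" using D_add[OF TC_closed(5)[OF assms] assms] by (simp add: D_zero)
  then show ?thesis using assms by (intro Kg.minus_equality[symmetric]) (simp_all add: D_closed TC_closed)
qed

lemma path1_Cons: "(l, x # p, i) \<in> paths Q \<Longrightarrow> pr (path1 (l, x # p, i)) = pa x \<otimes>\<^bsub>A\<^esub> pr (path1 (src x, p, i))"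
  using proj_mult[OF ar_TC single_TC, of x "(src x, p, i)" 1] by (simp add: path_Cons arrow_mult_single)

lemma path1_ends:
  assumes "(l, p, i) \<in> paths Q" "j \<in> verts Q"
  shows "pr (ei j) \<otimes>\<^bsub>A\<^esub> pr (path1 (l, p, i)) = (if j = l then pr (path1 (l, p, i)) else \<zero>\<^bsub>A\<^esub>)"
    "pr (path1 (l, p, i)) \<otimes>\<^bsub>A\<^esub> pr (ei j) = (if j = i then pr (path1 (l, p, i)) else \<zero>\<^bsub>A\<^esub>)"
  using proj_mult[OF ei_TC single_TC, of j "(l, p, i)" 1] proj_mult[OF single_TC ei_TC, of "(l, p, i)" j 1] assms
    proj_zero_iff[OF TC_closed(4)] pv.subspace_0[OF I_subspace]
  by (cases "j = l"; cases "j = i"; simp)+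

lemma Dp_right: "(l, p, i) \<in> paths Q \<Longrightarrow> ract K1 (Dp p i) (pr (ei i)) = Dp p i"
proof (induction p arbitrary: l)
  case Nil then show ?case using path_ends by (simp add: K_act_zero ei_A)
next
  case (Cons x p)
  then have x: "x \<in> QA" "(src x, p, i) \<in> paths Q" by (simp_all add: path_Cons)
  have i: "i \<in> verts Q" using path_ends[OF x(2)] by simp
  show ?case using Cons.IH[OF x(2)] x i Dp_closed[OF x(2)]
    by (simp add: K_ract_add kt_closed ar_W path1_A K_lact_closed ar_A ei_A K_ract K_lact_ract path1_ends)
qed

lemma kt_ei: "x \<in> QA \<Longrightarrow> b \<in> carrier A \<Longrightarrow> kt (Suc 0) (pr (ei (tgt x))) (ar x) b = kt (Suc 0) \<one>\<^bsub>A\<^esub> (ar x) b"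
  using kt_balanced1[of "\<one>\<^bsub>A\<^esub>" "ei (tgt x)" "ar x" "Suc 0" b] by (simp add: ei_kk ar_W ei_A)

lemma Dp_left: "(l, p, i) \<in> paths Q \<Longrightarrow> pr (ei l) \<odot>\<^bsub>K1\<^esub> Dp p i = Dp p i"
proof (cases p)
  case Nil
  assume "(l, p, i) \<in> paths Q" then show ?thesis using Nil path_ends by (simp add: K_act_zero ei_A)
next
  case (Cons x q)
  assume h: "(l, p, i) \<in> paths Q"
  then have x: "x \<in> QA" "l = tgt x" "(src x, q, i) \<in> paths Q" by (simp_all add: Cons path_Cons)
  show ?thesis using x Dp_closed[OF x(3)]
    by (simp add: Cons K_lact_add kt_closed ar_W path1_A K_lact_closed ar_A ei_A K_lact kt_ei K_lact_assoc[symmetric] pr_ei_ar)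
qed

lemma Dp_append:
  assumes "(l, p, m) \<in> paths Q" "(m, q, i) \<in> paths Q"
  shows "Dp (p @ q) i = ract K1 (Dp p m) (pr (path1 (m, q, i))) \<oplus>\<^bsub>K1\<^esub> pr (path1 (l, p, m)) \<odot>\<^bsub>K1\<^esub> Dp q i"
  using assms
proof (induction p arbitrary: l)
  case Nil
  then have "l = m" by (simp add: path_Nil)
  then show ?case using Nil Dp_left[OF Nil(2)] Dp_closed[OF Nil(2)] by (simp add: K_act_zero path1_A idem_def)
next
  case (Cons x p)
  have x: "x \<in> QA" "(src x, p, m) \<in> paths Q" using Cons.prems by (simp_all add: path_Cons)
  have pq: "(src x, p @ q, i) \<in> paths Q" using x Cons.prems path_append by blast
  have e: "pr (path1 (src x, p @ q, i)) = pr (path1 (src x, p, m)) \<otimes>\<^bsub>A\<^esub> pr (path1 (m, q, i))"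
    using proj_mult[OF single_TC[OF x(2)] single_TC[OF Cons.prems(2)], of 1 1] by (simp add: pmul_single)
  note c = Dp_closed[OF x(2)] Dp_closed[OF Cons.prems(2)] path1_A[OF x(2)] path1_A[OF Cons.prems(2)]
  have "Dp ((x # p) @ q) i = kt (Suc 0) \<one>\<^bsub>A\<^esub> (ar x) (pr (path1 (src x, p @ q, i))) \<oplus>\<^bsub>K1\<^esub> pa x \<odot>\<^bsub>K1\<^esub> Dp (p @ q) i" by simp
  also have "\<dots> = ract K1 (Dp (x # p) m) (pr (path1 (m, q, i))) \<oplus>\<^bsub>K1\<^esub> pr (path1 (l, x # p, m)) \<odot>\<^bsub>K1\<^esub> Dp q i"
    unfolding Cons.IH[OF x(2) Cons.prems(2)] e path1_Cons[OF Cons.prems(1)]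
    using c x by (simp add: K_lact_add K_ract_add K_ract K_lact_closed K_ract_closed kt_closed ar_W ar_A K_lact_ract K_lact_assoc Kg.a_assoc)
  finally show ?case .
qed

lemma Leibniz:
  assumes t: "t \<in> TC" and u: "u \<in> TC"
  shows "D (pmul t u) = ract K1 (D t) (pr u) \<oplus>\<^bsub>K1\<^esub> pr t \<odot>\<^bsub>K1\<^esub> D u"
  using t
proof (induction rule: TC_induct)
  have p0: "pr 0 = \<zero>\<^bsub>A\<^esub>" using phi_zero by (simp add: field_map_def)
  {
    case zero show ?case using u by (simp add: p0 D_zero K_lact_zero D_closed K_act_zero proj_closed)
  next
    case (single k c)
    obtain l p j where k: "k = (l, p, j)" by (cases k)
    have kp: "(l, p, j) \<in> paths Q" using single k by simp
    note ks = single_TC[OF kp]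
    show ?case using u
    proof (induction rule: TC_induct)
      case zero then show ?case using D_closed[OF ks, of c] ks by (simp add: k p0 D_zero K_ract_zero K_act_zero proj_closed)
    next
      case (single k' c')
      obtain m q i where k': "k' = (m, q, i)" by (cases k')
      have kp': "(m, q, i) \<in> paths Q" using single k' by simp
      have s: "pr (Poly_Mapping.single (a, r, b) e) = phi e \<otimes>\<^bsub>A\<^esub> pr (path1 (a, r, b))" if "(a, r, b) \<in> paths Q" for a r b e
        using phi_mult_proj(1)[OF single_TC[OF that], of e 1] by (simp add: pscale_single)
      note c1 = Dp_closed[OF kp] Dp_closed[OF kp'] path1_A[OF kp] path1_A[OF kp'] phi_closed
      have r: "ract K1 (D (Poly_Mapping.single k c)) (pr (Poly_Mapping.single k' c')) =
          phi c \<odot>\<^bsub>K1\<^esub> (phi c' \<odot>\<^bsub>K1\<^esub> ract K1 (Dp p j) (pr (path1 (m, q, i))))"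
        unfolding k k' s[OF kp', of c'] D_single[OF kp]
        using c1 by (simp add: K_ract_assoc K_lact_closed K_ract_closed K_phi K_lact_ract K_lact_assoc[symmetric] phi_central[of "phi c" c'])
      have l: "pr (Poly_Mapping.single k c) \<odot>\<^bsub>K1\<^esub> D (Poly_Mapping.single k' c') =
          phi c \<odot>\<^bsub>K1\<^esub> (phi c' \<odot>\<^bsub>K1\<^esub> (pr (path1 (l, p, j)) \<odot>\<^bsub>K1\<^esub> Dp q i))"
        unfolding k k' s[OF kp, of c] D_single[OF kp']
        using c1 by (simp add: K_lact_assoc[symmetric] A.m_assoc phi_central[of "pr (path1 (l, p, j))" c', symmetric])
      show ?case
      proof (cases "j = m")
        case True
        have pq: "(l, p @ q, i) \<in> paths Q" using kp kp' True path_append by blast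
        have "D (pmul (Poly_Mapping.single k c) (Poly_Mapping.single k' c')) = phi c \<odot>\<^bsub>K1\<^esub> (phi c' \<odot>\<^bsub>K1\<^esub> Dp (p @ q) i)"
          using True pq Dp_closed[OF pq] by (simp add: k k' pmul_single D_single phi_mult K_lact_assoc phi_closed)
        also have "\<dots> = ract K1 (D (Poly_Mapping.single k c)) (pr (Poly_Mapping.single k' c')) \<oplus>\<^bsub>K1\<^esub> pr (Poly_Mapping.single k c) \<odot>\<^bsub>K1\<^esub> D (Poly_Mapping.single k' c')"
          unfolding r l Dp_append[OF kp[unfolded True] kp'] using c1 True by (simp add: K_lact_add K_lact_closed K_ract_closed)
        finally show ?thesis .
      next
        \<comment> \<open>The product of paths that do not compose is zero. Both terms on the right
          vanish as well: inserting the idempotents of the mismatched ends gives a product of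
          orthogonal idempotents.\<close>
        case False
        have v: "j \<in> verts Q" "m \<in> verts Q" using path_ends kp kp' by blast+
        have "ract K1 (Dp p j) (pr (path1 (m, q, i))) = ract K1 (Dp p j) (pr (ei j) \<otimes>\<^bsub>A\<^esub> pr (path1 (m, q, i)))"
          using c1 v Dp_right[OF kp] by (simp add: K_ract_assoc ei_A)
        then have 1: "ract K1 (Dp p j) (pr (path1 (m, q, i))) = \<zero>\<^bsub>K1\<^esub>" using False c1 v kp' by (simp add: path1_ends K_ract_zero)
        have "pr (path1 (l, p, j)) \<odot>\<^bsub>K1\<^esub> Dp q i = (pr (path1 (l, p, j)) \<otimes>\<^bsub>A\<^esub> pr (ei m)) \<odot>\<^bsub>K1\<^esub> Dp q i"
          using c1 v Dp_left[OF kp'] by (simp add: K_lact_assoc ei_A)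
        then have 2: "pr (path1 (l, p, j)) \<odot>\<^bsub>K1\<^esub> Dp q i = \<zero>\<^bsub>K1\<^esub>" using False c1 v kp by (simp add: path1_ends K_lact_zero)
        show ?thesis unfolding r l 1 2 using False by (simp add: k k' pmul_single D_zero K_act_zero phi_closed)
      qed
    next
      case (add a b)
      then show ?case using single single_TC[OF kp]
        by (simp add: k pmul_add_right D_add pmul_TC proj_add K_ract_add_right K_lact_add proj_closed D_closed K_lact_closed K_ract_closed Kg.a_ac)
    qed
  next
    case (add a b)
    then show ?case using u
      by (simp add: pmul_add_left D_add pmul_TC proj_add K_ract_add K_lact_add_left proj_closed D_closed K_lact_closed K_ract_closed Kg.a_ac)
  }
qed

lemma D_ei: "i \<in> verts Q \<Longrightarrow> D (ei i) = \<zero>\<^bsub>K1\<^esub>"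
  unfolding idem_def by (subst D_single) (simp_all add: path_Nil K_act_zero phi_closed)

lemma D_ar: "x \<in> QA \<Longrightarrow> D (ar x) = kt (Suc 0) \<one>\<^bsub>A\<^esub> (ar x) \<one>\<^bsub>A\<^esub>"
proof -
  assume x: "x \<in> QA"
  have "D (ar x) = Dp [x] (src x)"
    unfolding arrow_def by (subst D_single) (use x in \<open>simp_all add: path_single phi_one K_one kt_closed ar_W path1_A path_Nil K_act_zero ar_A\<close>)
  also have "\<dots> = kt (Suc 0) \<one>\<^bsub>A\<^esub> (ar x) (pr (ei (src x)))"
    using x by (simp add: K_act_zero ar_A kt_closed ar_W path1_A path_Nil idem_def)
  also have "\<dots> = kt (Suc 0) \<one>\<^bsub>A\<^esub> (ar x) \<one>\<^bsub>A\<^esub>"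
    using kt_balanced2[of "\<one>\<^bsub>A\<^esub>" "ei (src x)" "ar x" "Suc 0" "\<one>\<^bsub>A\<^esub>"] x by (simp add: ei_kk ar_W ei_A)
  finally show ?thesis .
qed

lemma D_sum: "finite S \<Longrightarrow> (\<And>s. s \<in> S \<Longrightarrow> g s \<in> TC) \<Longrightarrow> D (\<Sum>s\<in>S. g s) = (\<Oplus>\<^bsub>K1\<^esub>s\<in>S. D (g s))"
proof (induction S rule: finite_induct)
  case (insert x S)
  then show ?case using TC_sum[of S g] by (simp add: D_add Kg.finsum_insert Pi_iff D_closed)
qed (simp add: D_zero)

lemma kt_phi: "w \<in> W F Q p \<Longrightarrow> kt p (phi c) w b = kt p \<one>\<^bsub>A\<^esub> (pscale c w) b"
  using kt_scale1[of "\<one>\<^bsub>A\<^esub>" w p c b] by (simp add: phi_closed)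

text \<open>By the Leibniz rule each product of \<open>x\<close> with \<open>star x\<close> yields
  one term with \<open>x\<close> and one with \<open>star x\<close> in the middle. Running through
  the arrows by the involution collects the former into the right half of the differential; the
  latter form the left half.\<close>

lemma D_sg: assumes i: "i \<in> verts Q" shows "D (sg i) = d 2 (kt 2 \<one>\<^bsub>A\<^esub> (sg i) \<one>\<^bsub>A\<^esub>)"
proof -
  let ?g = "\<lambda>x. kt (Suc 0) (pa x) (xs x) \<one>\<^bsub>A\<^esub>" and ?h = "\<lambda>x. \<ominus>\<^bsub>K1\<^esub> kt (Suc 0) \<one>\<^bsub>A\<^esub> (xs x) (pa x)"
  have c: "?g x \<in> carrier K1" "?h x \<in> carrier K1" if "x \<in> QA" for x using that by (simp_all add: kt_closed ar_A xs_W)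
  have st: "star ` QA = QA" by (auto intro!: image_eqI[of _ star "star _"])
  have hs: "?h (star x) = kt (Suc 0) \<one>\<^bsub>A\<^esub> (pscale (eps x) (ar x)) (pa (star x))" if "x \<in> QA" for x
    using that by (simp add: kt_minus W_closed ar_W ar_A kt_closed)
  have "d 2 (kt 2 \<one>\<^bsub>A\<^esub> (sg i) \<one>\<^bsub>A\<^esub>) = (\<Oplus>\<^bsub>K1\<^esub>x\<in>QA. (if tgt x = i then ?g x else \<zero>\<^bsub>K1\<^esub>) \<oplus>\<^bsub>K1\<^esub> (if src x = i then ?h x else \<zero>\<^bsub>K1\<^esub>))"
    unfolding d2_kt[OF i A.one_closed A.one_closed] by (rule Kg.finsum_cong') (use c in \<open>simp_all add: Pi_iff ar_A\<close>)
  also have "\<dots> = (\<Oplus>\<^bsub>K1\<^esub>x\<in>QA. (if tgt x = i then ?g x else \<zero>\<^bsub>K1\<^esub>)) \<oplus>\<^bsub>K1\<^esub> (\<Oplus>\<^bsub>K1\<^esub>x\<in>QA. (if src x = i then ?h x else \<zero>\<^bsub>K1\<^esub>))"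
    by (rule Kg.finsum_add) (use c in simp_all)
  also have "(\<Oplus>\<^bsub>K1\<^esub>x\<in>QA. (if src x = i then ?h x else \<zero>\<^bsub>K1\<^esub>)) = (\<Oplus>\<^bsub>K1\<^esub>x\<in>star ` QA. (if src x = i then ?h x else \<zero>\<^bsub>K1\<^esub>))"
    unfolding st ..
  also have "\<dots> = (\<Oplus>\<^bsub>K1\<^esub>x\<in>QA. (if tgt x = i then ?h (star x) else \<zero>\<^bsub>K1\<^esub>))"
    by (subst Kg.finsum_reindex) (use c in \<open>simp_all add: Pi_iff inj_on_def st\<close>)
  also have "(\<Oplus>\<^bsub>K1\<^esub>x\<in>QA. (if tgt x = i then ?g x else \<zero>\<^bsub>K1\<^esub>)) \<oplus>\<^bsub>K1\<^esub> (\<Oplus>\<^bsub>K1\<^esub>x\<in>QA. (if tgt x = i then ?h (star x) else \<zero>\<^bsub>K1\<^esub>)) =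
    (\<Oplus>\<^bsub>K1\<^esub>x\<in>QA. D (if tgt x = i then pscale (eps x) (pmul (ar x) (ar (star x))) else 0))"
  proof (rule Kg.finsum_add[symmetric])
    fix x assume x: "x \<in> QA"
    have "D (pscale (eps x) (pmul (ar x) (ar (star x)))) = phi (eps x) \<odot>\<^bsub>K1\<^esub> (kt (Suc 0) \<one>\<^bsub>A\<^esub> (ar x) (pa (star x)) \<oplus>\<^bsub>K1\<^esub> kt (Suc 0) (pa x) (ar (star x)) \<one>\<^bsub>A\<^esub>)"
      using x by (simp add: D_scale pmul_TC ar_TC Leibniz D_ar K_ract K_lact ar_W ar_A)
    also have "\<dots> = ?g x \<oplus>\<^bsub>K1\<^esub> ?h (star x)"
      unfolding hs[OF x] using x by (simp add: K_lact_add K_lact kt_closed ar_W ar_A phi_closed kt_scale1 kt_phi Kg.a_comm W_closed)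
    finally show "D (if tgt x = i then pscale (eps x) (pmul (ar x) (ar (star x))) else 0) =
      (if tgt x = i then ?g x else \<zero>\<^bsub>K1\<^esub>) \<oplus>\<^bsub>K1\<^esub> (if tgt x = i then ?h (star x) else \<zero>\<^bsub>K1\<^esub>)" by (simp add: D_zero)
  qed (simp_all add: kt_closed ar_A ar_W W_closed)
  also have "\<dots> = D (\<Sum>x\<in>QA. if tgt x = i then pscale (eps x) (pmul (ar x) (ar (star x))) else 0)"
    by (rule D_sum[symmetric]) (auto simp: TC_closed pmul_TC ar_TC)
  also have "\<dots> = D (sg i)" unfolding sg_eq sum.inter_filter[OF finite_QA] ..
  finally show ?thesis by simp
qed

text \<open>As \<open>\<sigma>\<^sub>i\<close> is zero in \<open>A\<close>, two of the three Leibniz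
  terms of \<open>D (p \<sigma>\<^sub>i q)\<close> vanish, and what remains is
  \<open>p D(\<sigma>\<^sub>i) q\<close>, a bimodule multiple of a boundary.\<close>

lemma D_I: assumes "t \<in> RI" shows "D t \<in> Bk (Suc 0)"
proof -
  have r2: "has_reps (Suc (Suc 0))" using reps2 by (simp add: numeral_2_eq_2)
  note B = sub_bimoduleD[OF sub_Bk[OF r2]]
  have "t \<in> pv.span sandwich" using assms by (simp add: I_eq)
  then have "t \<in> TC \<and> D t \<in> Bk (Suc 0)"
  proof (induction rule: pv.span_induct_alt)
    case base show ?case using B(2) by (simp add: D_zero TC_closed)
  next
    case (step c x y)
    obtain p i q where x: "x = pmul (pmul (path1 p) (sg i)) (path1 q)" "p \<in> paths Q" "i \<in> verts Q" "q \<in> paths Q"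
      using step(1) unfolding sandwich_def by blast
    note m = single_TC[OF x(2), of 1] sg_TC[of i] single_TC[OF x(4), of 1]
    have ps: "pr (sg i) = \<zero>\<^bsub>A\<^esub>" using proj_zero_iff[OF sg_TC] sg_I[OF x(3)] by blast
    have "D x = ract K1 (pr (path1 p) \<odot>\<^bsub>K1\<^esub> D (sg i)) (pr (path1 q))"
      unfolding x(1) using m by (simp add: Leibniz pmul_TC proj_mult ps proj_closed K_ract_zero K_lact_zero D_closed K_lact_closed K_ract_closed)
    moreover have "D (sg i) \<in> Bk (Suc 0)"
      unfolding D_sg[OF x(3)] Bk_def by (rule image_eqI[of _ _ "kt 2 \<one>\<^bsub>A\<^esub> (sg i) \<one>\<^bsub>A\<^esub>"]) (simp_all add: numeral_2_eq_2[symmetric] kt_closed sg_W x)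
    ultimately have "D x \<in> Bk (Suc 0)" using B(5,6) path1_A x by simp
    moreover have xT: "x \<in> TC" using x m pmul_TC by blast
    ultimately show ?case using step(2) B(3,5) phi_closed by (simp add: TC_closed D_add D_scale)
  qed
  then show ?thesis by simp
qed

end

section \<open>Homology in degrees zero and one\<close>

context fin_quiver begin

text \<open>An \<open>F\<close>-linear and right \<open>k\<close>-linear section of the projection of the path algebra onto \<open>A\<close>,
  composed with that projection.\<close>

lemma rho_ex: "\<exists>\<rho> :: ('v, 'e, 'f) pelt \<Rightarrow> ('v, 'e, 'f) pelt.
   (\<forall>s t. \<rho> (s + t) = \<rho> s + \<rho> t) \<and> (\<forall>c t. \<rho> (pscale c t) = pscale c (\<rho> t)) \<and>
   (\<forall>t\<in>TC. t - \<rho> t \<in> RI) \<and> (\<forall>t\<in>RI. \<rho> t = 0) \<and>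
   (\<forall>t. \<forall>i\<in>verts Q. \<rho> (pmul t (ei i)) = pmul (\<rho> t) (ei i))"
proof -
  interpret pp: vector_space_pair "pscale :: 'f \<Rightarrow> ('v, 'e, 'f) pelt \<Rightarrow> ('v, 'e, 'f) pelt" pscale
    by unfold_locales
  have "\<exists>g. g ` UNIV \<subseteq> RI \<and> Vector_Spaces.linear pscale pscale g \<and> (\<forall>v\<in>RI. g (id v) = v)"
    by (rule pp.linear_exists_left_inverse_on[OF pv.linear_id I_subspace]) simp
  then obtain g :: "('v, 'e, 'f) pelt \<Rightarrow> ('v, 'e, 'f) pelt" where
    g: "\<And>t. g t \<in> RI" "Vector_Spaces.linear pscale pscale g" "\<And>v. v \<in> RI \<Longrightarrow> g v = v" by auto
  interpret g: Vector_Spaces.linear pscale pscale g by (rule g(2))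
  \<comment> \<open>Since \<open>g\<close> is a linear retraction onto the ideal,
    \<open>t \<mapsto> t - g t\<close> kills the ideal and changes \<open>t\<close> only within it.
    Cutting \<open>t\<close> into the pieces \<open>t e\<^sub>i\<close>, and each result by
    \<open>e\<^sub>i\<close> again, adds compatibility with right multiplication by
    \<open>k\<close>.\<close>
  define \<rho> where "\<rho> t = (\<Sum>i\<in>verts Q. pmul (pmul t (ei i) - g (pmul t (ei i))) (ei i))" for t
  have add: "\<rho> (s + t) = \<rho> s + \<rho> t" for s t
    by (simp add: \<rho>_def pmul_add_left g.add pmul_diff_left sum.distrib[symmetric] algebra_simps)
  have scale: "\<rho> (pscale c t) = pscale c (\<rho> t)" for c t
    by (simp add: \<rho>_def pmul_pscale_left g.scale pv.scale_right_diff_distrib[symmetric] pv.scale_sum_right)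
  have sec: "t - \<rho> t \<in> RI" if t: "t \<in> TC" for t
  proof -
    have "\<rho> t = (\<Sum>i\<in>verts Q. pmul t (ei i)) - (\<Sum>i\<in>verts Q. pmul (g (pmul t (ei i))) (ei i))"
      by (simp add: \<rho>_def pmul_diff_left pmul_assoc sum_subtractf)
    also have "(\<Sum>i\<in>verts Q. pmul t (ei i)) = t" using eone_right[OF t] by (simp add: pmul_sum_right)
    finally have "t - \<rho> t = (\<Sum>i\<in>verts Q. pmul (g (pmul t (ei i))) (ei i))" by simp
    moreover have "(\<Sum>i\<in>verts Q. pmul (g (pmul t (ei i))) (ei i)) \<in> RI"
      by (rule pv.subspace_sum[OF I_subspace]) (simp add: I_right ei_TC g(1))
    ultimately show ?thesis by simp
  qed
  have ker: "\<rho> t = 0" if "t \<in> RI" for t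
    unfolding \<rho>_def by (rule sum.neutral) (use that in \<open>simp add: g(3) I_right ei_TC\<close>)
  have idem: "\<rho> (pmul t (ei i)) = pmul (\<rho> t) (ei i)" if "i \<in> verts Q" for t i
  proof -
    have "\<rho> (pmul t (ei i)) = (\<Sum>j\<in>verts Q. if j = i then pmul (pmul t (ei i) - g (pmul t (ei i))) (ei i) else 0)"
      unfolding \<rho>_def by (rule sum.cong) (simp_all add: pmul_assoc g.zero)
    moreover have "pmul (\<rho> t) (ei i) = (\<Sum>j\<in>verts Q. if j = i then pmul (pmul t (ei i) - g (pmul t (ei i))) (ei i) else 0)"
      unfolding \<rho>_def pmul_sum_left by (rule sum.cong) (simp_all add: pmul_assoc)
    ultimately show ?thesis by simp
  qed
  show ?thesis using add scale sec ker idem by (intro exI[of _ \<rho>]) blast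
qed

definition rho :: "('v, 'e, 'f) pelt \<Rightarrow> ('v, 'e, 'f) pelt" where
  "rho = (SOME \<rho>. (\<forall>s t. \<rho> (s + t) = \<rho> s + \<rho> t) \<and> (\<forall>c t. \<rho> (pscale c t) = pscale c (\<rho> t)) \<and>
   (\<forall>t\<in>TC. t - \<rho> t \<in> RI) \<and> (\<forall>t\<in>RI. \<rho> t = 0) \<and>
   (\<forall>t. \<forall>i\<in>verts Q. \<rho> (pmul t (ei i)) = pmul (\<rho> t) (ei i)))"

lemma rho: "rho (s + t) = rho s + rho t" "rho (pscale c t) = pscale c (rho t)" "t \<in> TC \<Longrightarrow> t - rho t \<in> RI"
  "t \<in> RI \<Longrightarrow> rho t = 0" "i \<in> verts Q \<Longrightarrow> rho (pmul t (ei i)) = pmul (rho t) (ei i)"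
  using someI_ex[OF rho_ex, folded rho_def] by blast+

lemma rho_diff: "rho (s - t) = rho s - rho t"
  by (metis add_diff_cancel diff_add_cancel rho(1))

lemma rho_TC: "t \<in> TC \<Longrightarrow> rho t \<in> TC"
proof -
  assume t: "t \<in> TC"
  show ?thesis using TC_closed(3)[OF t subsetD[OF I_TC rho(3)[OF t]]] by simp
qed

lemma rho_iff: "t \<in> TC \<Longrightarrow> rho t = 0 \<longleftrightarrow> t \<in> RI"
  using rho(3)[of t] rho(4)[of t] by auto

text \<open>Two lifts of \<open>a\<close> differ by an element of the ideal, which
  \<open>rho\<close> annihilates, so the chosen lift is immaterial.\<close>

definition sec :: "('v, 'e, 'f) palg \<Rightarrow> ('v, 'e, 'f) pelt" where
  "sec a = rho (SOME t. t \<in> TC \<and> a = pr t)"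

lemma sec_pr: assumes t: "t \<in> TC" shows "sec (pr t) = rho t"
proof -
  define u where "u = (SOME u. u \<in> TC \<and> pr t = pr u)"
  have "u \<in> TC \<and> pr t = pr u" unfolding u_def by (rule someI[of _ t]) (simp add: t)
  then have "t - u \<in> RI" using proj_eq_iff t by blast
  then have "rho t = rho u" using rho(4) rho_diff by fastforce
  then show ?thesis by (simp add: sec_def u_def)
qed

lemma sec_TC: "a \<in> carrier A \<Longrightarrow> sec a \<in> TC" using proj_surj sec_pr rho_TC by metis

lemma pr_sec: "a \<in> carrier A \<Longrightarrow> pr (sec a) = a"
proof -
  assume "a \<in> carrier A"
  then obtain t where t: "t \<in> TC" "a = pr t" using proj_surj by blast
  have "pr t = pr (rho t)" using proj_eq_iff[OF t(1) rho_TC[OF t(1)]] rho(3)[OF t(1)] by blast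
  then show ?thesis unfolding t(2) sec_pr[OF t(1)] by (rule sym)
qed

lemma sec_add: "a \<in> carrier A \<Longrightarrow> b \<in> carrier A \<Longrightarrow> sec (a \<oplus>\<^bsub>A\<^esub> b) = sec a + sec b"
proof -
  assume "a \<in> carrier A" "b \<in> carrier A"
  then obtain t u where "t \<in> TC" "a = pr t" "u \<in> TC" "b = pr u" using proj_surj by blast
  then show ?thesis by (simp add: proj_add[symmetric] sec_pr TC_closed rho)
qed

lemma sec_scale: "a \<in> carrier A \<Longrightarrow> sec (phi c \<otimes>\<^bsub>A\<^esub> a) = pscale c (sec a)"
proof -
  assume "a \<in> carrier A"
  then obtain t where "t \<in> TC" "a = pr t" using proj_surj by blast
  then show ?thesis by (simp add: phi_mult_proj sec_pr TC_closed rho)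
qed

lemma sec_idem: "a \<in> carrier A \<Longrightarrow> i \<in> verts Q \<Longrightarrow> sec (a \<otimes>\<^bsub>A\<^esub> pr (ei i)) = pmul (sec a) (ei i)"
proof -
  assume "a \<in> carrier A" and i: "i \<in> verts Q"
  then obtain t where "t \<in> TC" "a = pr t" using proj_surj by blast
  then show ?thesis using i by (simp add: proj_mult[symmetric] ei_TC sec_pr pmul_TC rho)
qed

section \<open>The augmentation of \<open>A\<close>\<close>

lemma lookup_Nil_mult:
  fixes f g :: "('v, 'e, 'f) pelt"
  assumes "\<And>l m. Poly_Mapping.lookup g (l, [], m) = 0"
  shows "Poly_Mapping.lookup (pmul f g) (l, [], m) = 0" "Poly_Mapping.lookup (pmul g f) (l, [], m) = 0"
proof -
  have k: "p \<noteq> []" if "(l, p, m) \<in> Poly_Mapping.keys g" for l p m using assms that by (auto simp: in_keys_iff)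
  have 1: "Poly_Mapping.lookup (path_mult q p) (l, [], m) = (0 :: 'f)" if "p \<in> Poly_Mapping.keys g" for q p :: "('v, 'e) path" and l m
    using that k by (cases q; cases p) (auto simp: lookup_single when_def)
  have 2: "Poly_Mapping.lookup (path_mult p q) (l, [], m) = (0 :: 'f)" if "p \<in> Poly_Mapping.keys g" for q p :: "('v, 'e) path" and l m
    using that k by (cases q; cases p) (auto simp: lookup_single when_def)
  show "Poly_Mapping.lookup (pmul f g) (l, [], m) = 0" unfolding pmul_def lookup_sum lookup_pscale
    by (intro sum.neutral ballI) (simp add: 1)
  show "Poly_Mapping.lookup (pmul g f) (l, [], m) = 0" unfolding pmul_def lookup_sum lookup_pscale
    by (intro sum.neutral ballI) (simp add: 2)
qed

lemma lookup_Nil_I: "t \<in> RI \<Longrightarrow> Poly_Mapping.lookup t (l, [], m) = 0"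
  unfolding I_eq
proof (induction rule: pv.span_induct_alt)
  case (step c x y)
  obtain p i q where x: "x = pmul (pmul (Poly_Mapping.single p 1) (sg i)) (Poly_Mapping.single q 1)"
    using step(1) unfolding sandwich_def by blast
  have "Poly_Mapping.lookup (ar z) (l, [], m) = 0" for z l m by (simp add: arrow_def lookup_single when_def)
  then have "Poly_Mapping.lookup (sg i) (l, [], m) = 0" for l m
    unfolding sg_eq lookup_sum lookup_pscale by (intro sum.neutral ballI) (simp add: lookup_Nil_mult)
  then show ?case using step(2) by (simp add: x lookup_add lookup_pscale lookup_Nil_mult)
qed simp

text \<open>The constant term at the vertex \<open>j\<close>. It is well defined on \<open>A\<close>
  because the relations have length 2, so that elements of the ideal have no coefficients at trivial
  paths.\<close>

definition aug :: "'v \<Rightarrow> ('v, 'e, 'f) palg \<Rightarrow> 'f" where "aug j a = Poly_Mapping.lookup (sec a) (j, [], j)"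

lemma aug_pr: "t \<in> TC \<Longrightarrow> aug j (pr t) = Poly_Mapping.lookup t (j, [], j)"
  using lookup_Nil_I[OF rho(3), of t j j] by (simp add: aug_def sec_pr lookup_minus)

lemma aug_add: "a \<in> carrier A \<Longrightarrow> b \<in> carrier A \<Longrightarrow> aug j (a \<oplus>\<^bsub>A\<^esub> b) = aug j a + aug j b"
  by (simp add: aug_def sec_add lookup_add)
lemma aug_scale: "a \<in> carrier A \<Longrightarrow> aug j (phi c \<otimes>\<^bsub>A\<^esub> a) = c * aug j a"
  by (simp add: aug_def sec_scale lookup_pscale)
lemma aug_idem: "a \<in> carrier A \<Longrightarrow> i \<in> verts Q \<Longrightarrow> aug j (pr (ei i) \<otimes>\<^bsub>A\<^esub> a) = (if i = j then aug j a else 0)"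
proof -
  assume "a \<in> carrier A" and i: "i \<in> verts Q"
  then obtain t where t: "t \<in> TC" "a = pr t" using proj_surj by blast
  then show ?thesis using i aug_pr[of "pmul (ei i) t" j] by (simp add: proj_mult[symmetric] ei_TC pmul_TC aug_pr lookup_idem_mult)
qed
lemma aug_arrow: "a \<in> carrier A \<Longrightarrow> x \<in> QA \<Longrightarrow> aug j (a \<otimes>\<^bsub>A\<^esub> pr (ar x)) = 0"
proof -
  assume "a \<in> carrier A" and x: "x \<in> QA"
  then obtain t where t: "t \<in> TC" "a = pr t" using proj_surj by blast
  have "Poly_Mapping.lookup (ar x) (l, [], m) = 0" for l m by (simp add: arrow_def lookup_single when_def)
  then show ?thesis using x t by (simp add: proj_mult[symmetric] ar_TC pmul_TC aug_pr lookup_Nil_mult)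
qed
lemma aug_one: "j \<in> verts Q \<Longrightarrow> aug j \<one>\<^bsub>A\<^esub> = 1"
proof -
  assume j: "j \<in> verts Q"
  have "aug j \<one>\<^bsub>A\<^esub> = Poly_Mapping.lookup eone (j, [], j)" using aug_pr[OF eone_TC] by (simp add: proj_one)
  also have "\<dots> = (\<Sum>i\<in>verts Q. if i = j then 1 else 0)"
    unfolding lookup_sum by (rule sum.cong) (auto simp: idem_def lookup_single when_def)
  finally show ?thesis using j finite_verts by simp
qed

end

context koszul_quiver begin

text \<open>The contracting homotopy sends \<open>a \<otimes> b\<close> to
  \<open>D(sec a) b\<close>. It is right linear over \<open>A\<close>, and it is balanced over
  \<open>k\<close> because \<open>sec\<close> commutes with the idempotents on the right and
  \<open>D\<close> vanishes on them.\<close>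

definition h0_spec where
  "h0_spec h \<longleftrightarrow> h \<in> carrier (K 0) \<rightarrow> carrier K1 \<and>
    (\<forall>u\<in>carrier (K 0). \<forall>v\<in>carrier (K 0). h (u \<oplus>\<^bsub>K 0\<^esub> v) = h u \<oplus>\<^bsub>K1\<^esub> h v) \<and>
    (\<forall>a\<in>carrier A. \<forall>w\<in>W F Q 0. \<forall>b\<in>carrier A. h (kt 0 a w b) = ract K1 (D (sec (a \<otimes>\<^bsub>A\<^esub> pr w))) b)"

lemma pr_W: "w \<in> W F Q p \<Longrightarrow> pr w \<in> carrier A" using W_TC proj_closed by blast

lemma h0_ex: "\<exists>h. h0_spec h"
proof (rule K_lift[of K1 0 "\<lambda>a w b. ract K1 (D (sec (a \<otimes>\<^bsub>A\<^esub> pr w))) b"])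
  let ?f = "\<lambda>a w b. ract K1 (D (sec (a \<otimes>\<^bsub>A\<^esub> pr w))) b"
  note S = pr_W sec_TC D_closed K_ract_closed
  show "abelian_group K1" by (rule K_group)
  fix a w b assume h: "a \<in> carrier A" "w \<in> W F Q 0" "b \<in> carrier A"
  note wT = W_TC[OF h(2)]
  show "?f a w b \<in> carrier K1" using h by (simp add: S)
  show "?f (a \<oplus>\<^bsub>A\<^esub> a2) w b = ?f a w b \<oplus>\<^bsub>K1\<^esub> ?f a2 w b" if "a2 \<in> carrier A" for a2
    using h that by (simp add: S A.l_distr sec_add D_add K_ract_add)
  show "?f a (w + w2) b = ?f a w b \<oplus>\<^bsub>K1\<^esub> ?f a w2 b" if "w2 \<in> W F Q 0" for w2
    using h that W_TC[OF that] wT by (simp add: S proj_add A.r_distr sec_add D_add K_ract_add)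
  show "?f a w (b \<oplus>\<^bsub>A\<^esub> b2) = ?f a w b \<oplus>\<^bsub>K1\<^esub> ?f a w b2" if "b2 \<in> carrier A" for b2
    using h that by (simp add: S K_ract_add_right)
  have pw: "pr (pscale c w) = phi c \<otimes>\<^bsub>A\<^esub> pr w" for c using phi_mult_proj(1)[OF wT] by simp
  show "?f (phi c \<otimes>\<^bsub>A\<^esub> a) w b = ?f a (pscale c w) b" for c
    using h by (simp add: pw S phi_closed A.m_assoc phi_lcomm[OF h(1)])
  show "?f a w (phi c \<otimes>\<^bsub>A\<^esub> b) = ?f a (pscale c w) b" for c
    using h by (simp add: pw S phi_closed phi_lcomm[OF h(1)] sec_scale D_scale K_lact_ract K_ract_assoc K_phi)
  fix i assume i: "i \<in> verts Q"
  show "?f (a \<otimes>\<^bsub>A\<^esub> pr (ei i)) w b = ?f a (pmul (ei i) w) b"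
    using h i wT by (simp add: S ei_A proj_mult ei_TC A.m_assoc)
  have "D (pmul (sec (a \<otimes>\<^bsub>A\<^esub> pr w)) (ei i)) = ract K1 (D (sec (a \<otimes>\<^bsub>A\<^esub> pr w))) (pr (ei i))"
    using h i by (simp add: Leibniz S ei_TC D_ei K_act_zero proj_closed ei_A)
  then show "?f a (pmul w (ei i)) b = ?f a w (pr (ei i) \<otimes>\<^bsub>A\<^esub> b)"
    using h i wT by (simp add: S ei_A proj_mult ei_TC A.m_assoc[symmetric] sec_idem K_ract_assoc)
qed (auto simp: h0_spec_def)

definition h0 where "h0 = (SOME h. h0_spec h)"

lemma h0: "z \<in> carrier (K 0) \<Longrightarrow> h0 z \<in> carrier K1"
  "u \<in> carrier (K 0) \<Longrightarrow> v \<in> carrier (K 0) \<Longrightarrow> h0 (u \<oplus>\<^bsub>K 0\<^esub> v) = h0 u \<oplus>\<^bsub>K1\<^esub> h0 v"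
  "a \<in> carrier A \<Longrightarrow> w \<in> W F Q 0 \<Longrightarrow> b \<in> carrier A \<Longrightarrow> h0 (kt 0 a w b) = ract K1 (D (sec (a \<otimes>\<^bsub>A\<^esub> pr w))) b"
proof -
  have s: "h0_spec h0" unfolding h0_def by (rule someI_ex[OF h0_ex])
  show "z \<in> carrier (K 0) \<Longrightarrow> h0 z \<in> carrier K1" using s unfolding h0_spec_def by blast
  show "u \<in> carrier (K 0) \<Longrightarrow> v \<in> carrier (K 0) \<Longrightarrow> h0 (u \<oplus>\<^bsub>K 0\<^esub> v) = h0 u \<oplus>\<^bsub>K1\<^esub> h0 v" using s unfolding h0_spec_def by blast
  show "a \<in> carrier A \<Longrightarrow> w \<in> W F Q 0 \<Longrightarrow> b \<in> carrier A \<Longrightarrow> h0 (kt 0 a w b) = ract K1 (D (sec (a \<otimes>\<^bsub>A\<^esub> pr w))) b"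
    using s unfolding h0_spec_def by blast
qed

lemma h0_zero: "h0 \<zero>\<^bsub>K 0\<^esub> = \<zero>\<^bsub>K1\<^esub>"
  by (rule additive_zero[OF K_group K_group]) (simp_all add: h0 Pi_iff)
lemma h0_minus: "z \<in> carrier (K 0) \<Longrightarrow> h0 (\<ominus>\<^bsub>K 0\<^esub> z) = \<ominus>\<^bsub>K1\<^esub> h0 z"
  by (rule additive_minus[OF K_group K_group]) (simp_all add: h0 Pi_iff)

lemma h0_ract: "z \<in> carrier (K 0) \<Longrightarrow> c \<in> carrier A \<Longrightarrow> h0 (ract (K 0) z c) = ract K1 (h0 z) c"
proof (induction rule: K_induct)
  case (pure a w b) then show ?case by (simp add: K_ract h0 K_ract_assoc D_closed sec_TC pr_W)
next
  case (add u v) then show ?case by (simp add: K_ract_add h0 K_ract_closed)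
qed

lemma r2: "has_reps (Suc (Suc 0))" using reps2 by (simp add: numeral_2_eq_2)

lemmas B1 = sub_bimoduleD[OF sub_Bk[OF r2]]
lemmas B0 = sub_bimoduleD[OF sub_Bk[OF reps1]]

lemma K1_induct [consumes 1, case_names arrow zero add]:
  assumes z: "z \<in> carrier K1"
    and pure: "\<And>a x b. \<lbrakk>a \<in> carrier A; x \<in> QA; b \<in> carrier A\<rbrakk> \<Longrightarrow> P (kt (Suc 0) a (ar x) b)"
    and zero: "P \<zero>\<^bsub>K1\<^esub>"
    and add: "\<And>u v. \<lbrakk>u \<in> carrier K1; v \<in> carrier K1; P u; P v\<rbrakk> \<Longrightarrow> P (u \<oplus>\<^bsub>K1\<^esub> v)"
  shows "P z"
  using z
proof (induction rule: K_induct)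
  case (pure a w b)
  define c where "c x = Poly_Mapping.lookup w (tgt x, [x], src x)" for x
  have w: "w = (\<Sum>x\<in>QA. pscale (c x) (ar x))" unfolding c_def by (rule W1_iff[OF pure(2)])
  have "P (kt (Suc 0) a (\<Sum>x\<in>S. pscale (c x) (ar x)) b) \<and> (\<Sum>x\<in>S. pscale (c x) (ar x)) \<in> W F Q (Suc 0)"
    if "finite S" "S \<subseteq> QA" for S using that
  proof (induction S rule: finite_induct)
    case empty then show ?case using zero pure by (simp add: kt_zero W_closed)
  next
    case (insert x S)
    have x: "x \<in> QA" using insert by simp
    have "kt (Suc 0) a (pscale (c x) (ar x)) b = kt (Suc 0) (phi (c x) \<otimes>\<^bsub>A\<^esub> a) (ar x) b"
      using pure x by (simp add: kt_scale1 ar_W)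
    then have "P (kt (Suc 0) a (pscale (c x) (ar x)) b)" using assms(2) pure x phi_closed by simp
    then show ?case using insert x pure add by (simp add: kt_add2 W_closed ar_W kt_closed)
  qed
  from this[OF finite_QA subset_refl] show ?case using w by simp
qed (rule add)

text \<open>Take \<open>z = a \<otimes> x \<otimes> b\<close> and let \<open>t\<close> be the lift
  of \<open>a e\<^sub>j\<close>, with \<open>j\<close> the target of \<open>x\<close>. Then
  \<open>D(t x) = D(t) x + a \<otimes> x \<otimes> 1\<close>, and
  \<open>h0 (d z) = D(rho(t x)) b - D(t) x b\<close>. The difference in question is therefore
  \<open>D(t x - rho(t x)) b\<close>, and the argument of \<open>D\<close> lies in the
  ideal.\<close>

lemma homotopy: assumes z: "z \<in> carrier K1" shows "z \<ominus>\<^bsub>K1\<^esub> h0 (d (Suc 0) z) \<in> Bk (Suc 0)"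
proof -
  have dc: "d (Suc 0) z \<in> carrier (K 0)" if "z \<in> carrier K1" for z using d_closed[OF reps1 _ that] by simp
  show ?thesis using z
  proof (induction rule: K1_induct)
    case (arrow a x b)
    let ?e = "pr (ei (tgt x))"
    have e: "?e \<in> carrier A" "pr (ei (src x)) \<in> carrier A" "pa x \<in> carrier A" using arrow by (simp_all add: ei_A ar_A)
    define t where "t = sec (a \<otimes>\<^bsub>A\<^esub> ?e)"
    have t: "t \<in> TC" "pr t = a \<otimes>\<^bsub>A\<^esub> ?e" unfolding t_def using arrow e by (simp_all add: sec_TC pr_sec)
    have tx: "pmul t (ar x) \<in> TC" "pr (pmul t (ar x)) = a \<otimes>\<^bsub>A\<^esub> pa x"
      using arrow e t by (simp_all add: pmul_TC ar_TC proj_mult A.m_assoc pr_ei_ar)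
    have s: "sec (a \<otimes>\<^bsub>A\<^esub> pa x) = rho (pmul t (ar x))" using sec_pr[OF tx(1)] tx(2) by simp
    let ?u = "pmul t (ar x) - rho (pmul t (ar x))"
    have u: "?u \<in> RI" using rho(3) tx(1) by blast
    have Du: "D ?u = D (pmul t (ar x)) \<ominus>\<^bsub>K1\<^esub> D (rho (pmul t (ar x)))"
      using D_add[OF tx(1) TC_closed(5)[OF rho_TC[OF tx(1)]]] D_minus[OF rho_TC[OF tx(1)]] by (simp add: a_minus_def)
    have Dt: "D (pmul t (ar x)) = ract K1 (D t) (pa x) \<oplus>\<^bsub>K1\<^esub> kt (Suc 0) a (ar x) \<one>\<^bsub>A\<^esub>"
    proof -
      have "kt (Suc 0) (a \<otimes>\<^bsub>A\<^esub> ?e) (ar x) \<one>\<^bsub>A\<^esub> = kt (Suc 0) a (ar x) \<one>\<^bsub>A\<^esub>"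
        using kt_balanced1[OF arrow(1) ei_kk ar_W] arrow by simp
      then show ?thesis using arrow e t by (simp add: Leibniz ar_TC D_ar K_lact ar_W)
    qed
    have h1: "h0 (kt 0 (a \<otimes>\<^bsub>A\<^esub> pa x) (ei (src x)) b) = ract K1 (D (rho (pmul t (ar x)))) b"
      using arrow e by (simp add: h0 ei_W A.m_assoc pr_ar_ei s)
    have h2: "h0 (kt 0 a (ei (tgt x)) (pa x \<otimes>\<^bsub>A\<^esub> b)) = ract K1 (ract K1 (D t) (pa x)) b"
      using arrow e t by (simp add: h0 ei_W t_def[symmetric] K_ract_assoc D_closed)
    have c: "D (rho (pmul t (ar x))) \<in> carrier K1" "D t \<in> carrier K1" "ract K1 (D t) (pa x) \<in> carrier K1" "kt (Suc 0) a (ar x) \<one>\<^bsub>A\<^esub> \<in> carrier K1"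
      using t tx arrow e by (simp_all add: D_closed rho_TC K_ract_closed kt_closed ar_W)
    have kb: "kt (Suc 0) a (ar x) b = ract K1 (kt (Suc 0) a (ar x) \<one>\<^bsub>A\<^esub>) b" using arrow by (simp add: K_ract ar_W)
    have "kt (Suc 0) a (ar x) b \<ominus>\<^bsub>K1\<^esub> h0 (d (Suc 0) (kt (Suc 0) a (ar x) b)) = ract K1 (D ?u) b"
      unfolding Du Dt d1_kt[OF arrow(2,1,3)]
      using c arrow e
      by (simp add: kb a_minus_def h0 h0_minus kt_closed ei_W h1 h2 K_ract_add K_ract_minus K_ract_closed Kg.minus_add Kg.a_ac Kg.r_neg1 Kg.r_neg2 Kg.r_neg)
    then show ?case using B1(6)[OF arrow(3) D_I[OF u]] by simp
  next
    case zero
    have "\<zero>\<^bsub>K1\<^esub> \<ominus>\<^bsub>K1\<^esub> h0 (d (Suc 0) \<zero>\<^bsub>K1\<^esub>) = \<zero>\<^bsub>K1\<^esub>" using d_zero[OF reps1] by (simp add: h0_zero a_minus_def Kg.r_neg)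
    then show ?case using B1(2) by simp
  next
    case (add u v)
    have "(u \<oplus>\<^bsub>K1\<^esub> v) \<ominus>\<^bsub>K1\<^esub> h0 (d (Suc 0) (u \<oplus>\<^bsub>K1\<^esub> v)) =
      (u \<ominus>\<^bsub>K1\<^esub> h0 (d (Suc 0) u)) \<oplus>\<^bsub>K1\<^esub> (v \<ominus>\<^bsub>K1\<^esub> h0 (d (Suc 0) v))"
      using add(1,2) d_add[OF reps1 _ add(1,2)] dc h0(1)[OF dc[OF add(1)]] h0(1)[OF dc[OF add(2)]]
      by (simp add: h0(2) a_minus_def Kg.minus_add Kg.a_ac)
    then show ?case using B1(3) add by simp
  qed
qed

lemma Zk_Bk1: "Zk (Suc 0) \<subseteq> Bk (Suc 0)"
proof
  fix z assume "z \<in> Zk (Suc 0)"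
  then have z: "z \<in> carrier K1" "d (Suc 0) z = \<zero>\<^bsub>K 0\<^esub>" by (simp_all add: Zk_def)
  have "z \<ominus>\<^bsub>K1\<^esub> \<zero>\<^bsub>K1\<^esub> = z" using z(1) by (simp add: a_minus_def Kg.minus_equality)
  then show "z \<in> Bk (Suc 0)" using homotopy[OF z(1)] z(2) h0_zero by simp
qed

section \<open>The multiplication map and homology in degree zero\<close>

lemma mult_ex: obtains m where "m \<in> carrier (K 0) \<rightarrow> carrier A"
    "\<And>u v. \<lbrakk>u \<in> carrier (K 0); v \<in> carrier (K 0)\<rbrakk> \<Longrightarrow> m (u \<oplus>\<^bsub>K 0\<^esub> v) = m u \<oplus>\<^bsub>A\<^esub> m v"
    "\<And>a w b. \<lbrakk>a \<in> carrier A; w \<in> W F Q 0; b \<in> carrier A\<rbrakk> \<Longrightarrow> m (kt 0 a w b) = a \<otimes>\<^bsub>A\<^esub> pr w \<otimes>\<^bsub>A\<^esub> b"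
proof (rule K_lift[of A 0 "\<lambda>a w b. a \<otimes>\<^bsub>A\<^esub> pr w \<otimes>\<^bsub>A\<^esub> b"])
  show "abelian_group A" by (rule A.abelian_group_axioms)
  fix a w b assume h: "a \<in> carrier A" "w \<in> W F Q 0" "b \<in> carrier A"
  note wT = W_TC[OF h(2)] and pw = phi_mult_proj(1)[OF W_TC[OF h(2)], symmetric]
  show "a \<otimes>\<^bsub>A\<^esub> pr w \<otimes>\<^bsub>A\<^esub> b \<in> carrier A" using h by (simp add: pr_W)
  show "(a \<oplus>\<^bsub>A\<^esub> a') \<otimes>\<^bsub>A\<^esub> pr w \<otimes>\<^bsub>A\<^esub> b = a \<otimes>\<^bsub>A\<^esub> pr w \<otimes>\<^bsub>A\<^esub> b \<oplus>\<^bsub>A\<^esub> a' \<otimes>\<^bsub>A\<^esub> pr w \<otimes>\<^bsub>A\<^esub> b" if "a' \<in> carrier A" for a'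
    using h that by (simp add: pr_W A.l_distr)
  show "a \<otimes>\<^bsub>A\<^esub> pr (w + w') \<otimes>\<^bsub>A\<^esub> b = a \<otimes>\<^bsub>A\<^esub> pr w \<otimes>\<^bsub>A\<^esub> b \<oplus>\<^bsub>A\<^esub> a \<otimes>\<^bsub>A\<^esub> pr w' \<otimes>\<^bsub>A\<^esub> b" if "w' \<in> W F Q 0" for w'
    using h that by (simp add: pr_W proj_add W_TC A.l_distr A.r_distr)
  show "a \<otimes>\<^bsub>A\<^esub> pr w \<otimes>\<^bsub>A\<^esub> (b \<oplus>\<^bsub>A\<^esub> b') = a \<otimes>\<^bsub>A\<^esub> pr w \<otimes>\<^bsub>A\<^esub> b \<oplus>\<^bsub>A\<^esub> a \<otimes>\<^bsub>A\<^esub> pr w \<otimes>\<^bsub>A\<^esub> b'" if "b' \<in> carrier A" for b'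
    using h that by (simp add: pr_W A.r_distr)
  show "phi c \<otimes>\<^bsub>A\<^esub> a \<otimes>\<^bsub>A\<^esub> pr w \<otimes>\<^bsub>A\<^esub> b = a \<otimes>\<^bsub>A\<^esub> pr (pscale c w) \<otimes>\<^bsub>A\<^esub> b" for c
    unfolding pw using h by (simp add: pr_W phi_closed A.m_assoc phi_lcomm[OF h(1)])
  show "a \<otimes>\<^bsub>A\<^esub> pr w \<otimes>\<^bsub>A\<^esub> (phi c \<otimes>\<^bsub>A\<^esub> b) = a \<otimes>\<^bsub>A\<^esub> pr (pscale c w) \<otimes>\<^bsub>A\<^esub> b" for c
    unfolding pw using h by (simp add: pr_W phi_closed A.m_assoc phi_lcomm[OF pr_W[OF h(2)]])
  fix i assume i: "i \<in> verts Q"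
  show "a \<otimes>\<^bsub>A\<^esub> pr (ei i) \<otimes>\<^bsub>A\<^esub> pr w \<otimes>\<^bsub>A\<^esub> b = a \<otimes>\<^bsub>A\<^esub> pr (pmul (ei i) w) \<otimes>\<^bsub>A\<^esub> b"
    "a \<otimes>\<^bsub>A\<^esub> pr (pmul w (ei i)) \<otimes>\<^bsub>A\<^esub> b = a \<otimes>\<^bsub>A\<^esub> pr w \<otimes>\<^bsub>A\<^esub> (pr (ei i) \<otimes>\<^bsub>A\<^esub> b)"
    using h i by (simp_all add: proj_mult ei_TC wT pr_W ei_A A.m_assoc)
qed (rule that)

lemma eone_W: "eone \<in> W F Q 0" by (simp add: W_0 eone_kk)

text \<open>A middle factor from \<open>k\<close> can be absorbed on either side, so
  \<open>K(A)\<^sub>0\<close> is just the tensor square of \<open>A\<close> over \<open>k\<close>,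
  with \<open>eone\<close> as the neutral middle factor.\<close>

lemma kt0_eone: assumes "a \<in> carrier A" "w \<in> W F Q 0" "b \<in> carrier A"
  shows "kt 0 a w b = kt 0 (a \<otimes>\<^bsub>A\<^esub> pr w) eone b" "kt 0 a w b = kt 0 a eone (pr w \<otimes>\<^bsub>A\<^esub> b)"
proof -
  have w: "w \<in> kk" "w \<in> TC" using assms(2) W_TC[OF assms(2)] by (simp_all add: W_0)
  show "kt 0 a w b = kt 0 (a \<otimes>\<^bsub>A\<^esub> pr w) eone b"
    using kt_balanced1[OF assms(1) w(1) eone_W] w by (simp add: eone_right)
  show "kt 0 a w b = kt 0 a eone (pr w \<otimes>\<^bsub>A\<^esub> b)"
    using kt_balanced2[OF assms(1) w(1) eone_W assms(3)] w by (simp add: eone_left)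
qed

text \<open>The sum telescopes along a path: the boundary of
  \<open>1 \<otimes> x \<otimes> p\<close> is \<open>x \<otimes> p - 1 \<otimes> x p\<close>, and
  \<open>x\<close> times the formula for \<open>p\<close> is
  \<open>x p \<otimes> 1 - x \<otimes> p\<close>.\<close>

lemma d1_D: assumes "t \<in> TC" shows "d (Suc 0) (D t) = kt 0 (pr t) eone \<one>\<^bsub>A\<^esub> \<ominus>\<^bsub>K 0\<^esub> kt 0 \<one>\<^bsub>A\<^esub> eone (pr t)"
proof -
  have dD: "d (Suc 0) (Dp p i) = kt 0 (pr (path1 (l, p, i))) eone \<one>\<^bsub>A\<^esub> \<ominus>\<^bsub>K 0\<^esub> kt 0 \<one>\<^bsub>A\<^esub> eone (pr (path1 (l, p, i)))"
    if "(l, p, i) \<in> paths Q" for l p i using that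
  proof (induction p arbitrary: l)
    case Nil
    then have i: "l = i" "i \<in> verts Q" by (auto simp: path_Nil)
    have "kt 0 (pr (ei i)) eone \<one>\<^bsub>A\<^esub> = kt 0 \<one>\<^bsub>A\<^esub> eone (pr (ei i))"
      using kt0_eone[OF A.one_closed ei_W[OF i(2)] A.one_closed] i by (simp add: ei_A)
    then have "kt 0 (pr (path1 (l, [], i))) eone \<one>\<^bsub>A\<^esub> = kt 0 \<one>\<^bsub>A\<^esub> eone (pr (path1 (l, [], i)))"
      by (simp add: i idem_def)
    moreover have "kt 0 \<one>\<^bsub>A\<^esub> eone (pr (path1 (l, [], i))) \<in> carrier (K 0)" using Nil by (simp add: kt_closed eone_W path1_A)
    ultimately show ?case using d_zero[OF reps1] by (simp add: a_minus_def Kg.r_neg)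
  next
    case (Cons x p)
    have x: "x \<in> QA" "(src x, p, i) \<in> paths Q" "l = tgt x" using Cons.prems by (simp_all add: path_Cons)
    let ?p = "pr (path1 (src x, p, i))"
    note c = path1_A[OF x(2)] ar_A[OF x(1)] Dp_closed[OF x(2)]
    have "d (Suc 0) (Dp (x # p) i) = d (Suc 0) (kt (Suc 0) \<one>\<^bsub>A\<^esub> (ar x) ?p) \<oplus>\<^bsub>K 0\<^esub> pa x \<odot>\<^bsub>K 0\<^esub> d (Suc 0) (Dp p i)"
      using c x d_add[OF reps1] d_lact[OF reps1] by (simp add: kt_closed ar_W K_lact_closed)
    also have "\<dots> = (kt 0 (pa x) (ei (src x)) ?p \<ominus>\<^bsub>K 0\<^esub> kt 0 \<one>\<^bsub>A\<^esub> (ei (tgt x)) (pa x \<otimes>\<^bsub>A\<^esub> ?p)) \<oplus>\<^bsub>K 0\<^esub>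
      (kt 0 (pa x \<otimes>\<^bsub>A\<^esub> ?p) eone \<one>\<^bsub>A\<^esub> \<ominus>\<^bsub>K 0\<^esub> kt 0 (pa x) eone ?p)"
      unfolding Cons.IH[OF x(2)] using c x
      by (simp add: d1_kt a_minus_def K_lact_add K_lact_minus K_lact kt_closed eone_W)
    also have "kt 0 (pa x) (ei (src x)) ?p = kt 0 (pa x) eone ?p"
      using c x kt0_eone(1)[of "pa x" "ei (src x)" ?p] by (simp add: ei_W pr_ar_ei)
    also have "kt 0 \<one>\<^bsub>A\<^esub> (ei (tgt x)) (pa x \<otimes>\<^bsub>A\<^esub> ?p) = kt 0 \<one>\<^bsub>A\<^esub> eone (pa x \<otimes>\<^bsub>A\<^esub> ?p)"
      using c x kt0_eone(2)[of "\<one>\<^bsub>A\<^esub>" "ei (tgt x)" "pa x \<otimes>\<^bsub>A\<^esub> ?p"] by (simp add: ei_W ei_A A.m_assoc[symmetric] pr_ei_ar)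
    finally show ?case unfolding path1_Cons[OF Cons.prems]
      using c by (simp add: a_minus_def kt_closed eone_W Kg.a_ac Kg.r_neg1 Kg.r_neg2)
  qed
  show ?thesis using assms
  proof (induction rule: TC_induct)
    case zero
    have "pr 0 = \<zero>\<^bsub>A\<^esub>" using phi_zero by (simp add: field_map_def)
    then show ?case using d_zero[OF reps1] by (simp add: D_zero kt_zero eone_W a_minus_def Kg.r_neg)
  next
    case (single k c)
    obtain l p i where k: "k = (l, p, i)" by (cases k)
    have kp: "(l, p, i) \<in> paths Q" using single k by simp
    have s: "pr (Poly_Mapping.single (l, p, i) c) = phi c \<otimes>\<^bsub>A\<^esub> pr (path1 (l, p, i))"
      using phi_mult_proj(1)[OF single_TC[OF kp], of c 1] by (simp add: pscale_single)
    have e: "kt 0 (phi c) eone (pr (path1 (l, p, i))) = kt 0 \<one>\<^bsub>A\<^esub> eone (phi c \<otimes>\<^bsub>A\<^esub> pr (path1 (l, p, i)))"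
      using kt_phi[OF eone_W] kt_scale3[OF A.one_closed eone_W path1_A[OF kp]] by simp
    show ?case unfolding k D_single[OF kp] s[of]
      using path1_A[OF kp] Dp_closed[OF kp] d_lact[OF reps1 _ phi_closed[of c] Dp_closed[OF kp]] dD[OF kp] e
      by (simp add: a_minus_def K_lact_add K_lact_minus K_lact kt_closed eone_W phi_closed)
  next
    case (add a b)
    then show ?case using d_add[OF reps1 _ D_closed D_closed, of a b]
      by (simp add: D_add proj_add proj_closed kt_add1 kt_add3 eone_W a_minus_def Kg.minus_add kt_closed Kg.a_ac)
  qed
qed

lemma HK2_iso: "bimodule_iso A (HK F Q 2) (regular_bimodule A)"
proof (rule mult_ex)
  fix m assume m: "m \<in> carrier (K 0) \<rightarrow> carrier A"
    "\<And>u v. \<lbrakk>u \<in> carrier (K 0); v \<in> carrier (K 0)\<rbrakk> \<Longrightarrow> m (u \<oplus>\<^bsub>K 0\<^esub> v) = m u \<oplus>\<^bsub>A\<^esub> m v"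
    "\<And>a w b. \<lbrakk>a \<in> carrier A; w \<in> W F Q 0; b \<in> carrier A\<rbrakk> \<Longrightarrow> m (kt 0 a w b) = a \<otimes>\<^bsub>A\<^esub> pr w \<otimes>\<^bsub>A\<^esub> b"
  have mc: "m z \<in> carrier A" if "z \<in> carrier (K 0)" for z using m(1) that by blast
  have mm: "m (\<ominus>\<^bsub>K 0\<^esub> z) = \<ominus>\<^bsub>A\<^esub> m z" if "z \<in> carrier (K 0)" for z
    by (rule additive_minus[OF K_group A.abelian_group_axioms m(1,2) that])
  have m0: "m \<zero>\<^bsub>K 0\<^esub> = \<zero>\<^bsub>A\<^esub>"
    by (rule additive_zero[OF K_group A.abelian_group_axioms m(1,2)])
  have act: "m (a \<odot>\<^bsub>K 0\<^esub> z) = a \<otimes>\<^bsub>A\<^esub> m z \<and> m (ract (K 0) z a) = m z \<otimes>\<^bsub>A\<^esub> a" if "a \<in> carrier A" "z \<in> carrier (K 0)" for a z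
    using that(2)
  proof (induction rule: K_induct)
    case (pure x w y) then show ?case using that(1) by (simp add: K_lact K_ract m(3) pr_W A.m_assoc)
  next
    case (add u v) then show ?case using that(1)
      by (simp add: K_lact_add K_ract_add m(2) K_lact_closed K_ract_closed mc A.r_distr A.l_distr)
  qed
  have dc: "d (Suc 0) z \<in> carrier (K 0)" if "z \<in> carrier K1" for z using d_closed[OF reps1 _ that] by simp
  have md: "m (d (Suc 0) z) = \<zero>\<^bsub>A\<^esub>" if "z \<in> carrier K1" for z using that
  proof (induction rule: K1_induct)
    case (arrow a x b)
    have "pr (ei (tgt x)) \<otimes>\<^bsub>A\<^esub> (pa x \<otimes>\<^bsub>A\<^esub> b) = pa x \<otimes>\<^bsub>A\<^esub> b" "pa x \<otimes>\<^bsub>A\<^esub> (pr (ei (src x)) \<otimes>\<^bsub>A\<^esub> b) = pa x \<otimes>\<^bsub>A\<^esub> b"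
      using arrow by (simp_all add: A.m_assoc[symmetric] ar_A ei_A pr_ei_ar pr_ar_ei)
    then show ?case using arrow
      by (simp add: d1_kt a_minus_def m(2,3) mm kt_closed ei_W ar_A ei_A A.m_assoc A.r_neg)
  next
    case zero then show ?case using d_zero[OF reps1] m0 by simp
  next
    case (add u v) then show ?case using d_add[OF reps1 _ add(1,2)] dc by (simp add: m(2))
  qed
  \<comment> \<open>With \<open>t\<close> a lift of \<open>b\<close>, the elements
    \<open>c \<otimes> b\<close> and \<open>c b \<otimes> 1\<close> differ by the boundary of
    \<open>c D(t)\<close>. So modulo boundaries an element of \<open>K(A)\<^sub>0\<close> depends
    only on its product.\<close>
  have ker: "z \<ominus>\<^bsub>K 0\<^esub> kt 0 (m z) eone \<one>\<^bsub>A\<^esub> \<in> Bk 0" if "z \<in> carrier (K 0)" for z using that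
  proof (induction rule: K_induct)
    case (pure a w b)
    obtain t where t: "t \<in> TC" "b = pr t" using proj_surj pure by blast
    define c where "c = a \<otimes>\<^bsub>A\<^esub> pr w"
    have c: "c \<in> carrier A" unfolding c_def using pure by (simp add: pr_W)
    have "kt 0 a w b \<ominus>\<^bsub>K 0\<^esub> kt 0 (m (kt 0 a w b)) eone \<one>\<^bsub>A\<^esub> = kt 0 c eone b \<ominus>\<^bsub>K 0\<^esub> kt 0 (c \<otimes>\<^bsub>A\<^esub> b) eone \<one>\<^bsub>A\<^esub>"
    proof -
      have "m (kt 0 a w b) = c \<otimes>\<^bsub>A\<^esub> b" unfolding c_def by (rule m(3)[OF pure])
      moreover have "kt 0 a w b = kt 0 c eone b" unfolding c_def by (rule kt0_eone(1)[OF pure])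
      ultimately show ?thesis by metis
    qed
    also have "\<dots> = \<ominus>\<^bsub>K 0\<^esub> (c \<odot>\<^bsub>K 0\<^esub> d (Suc 0) (D t))"
      unfolding d1_D[OF t(1)] t(2)[symmetric] using c pure
      by (simp add: a_minus_def K_lact_add K_lact_minus K_lact kt_closed eone_W Kg.minus_add Kg.a_comm)
    also have "\<dots> \<in> Bk 0"
    proof -
      have "d (Suc 0) (D t) \<in> Bk 0" unfolding Bk_def using D_closed[OF t(1)] by blast
      then show ?thesis using B0(4,5) c by blast
    qed
    finally show ?case .
  next
    case (add u v)
    have "(u \<oplus>\<^bsub>K 0\<^esub> v) \<ominus>\<^bsub>K 0\<^esub> kt 0 (m (u \<oplus>\<^bsub>K 0\<^esub> v)) eone \<one>\<^bsub>A\<^esub> =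
      (u \<ominus>\<^bsub>K 0\<^esub> kt 0 (m u) eone \<one>\<^bsub>A\<^esub>) \<oplus>\<^bsub>K 0\<^esub> (v \<ominus>\<^bsub>K 0\<^esub> kt 0 (m v) eone \<one>\<^bsub>A\<^esub>)"
      using add(1,2) by (simp add: m(2) mc kt_add1 eone_W a_minus_def Kg.minus_add kt_closed Kg.a_ac)
    then show ?case using B0(3) add by simp
  qed
  let ?N = "regular_bimodule A" and ?m = "\<lambda>z\<in>carrier (K 0). m z"
  show ?thesis
  proof (rule HK2_transfer[of ?m])
    show "abelian_group ?N"
      by (rule bimod.axioms(1)[OF bimod_ring[OF A.ring_axioms, of "{}" id "{}" id]]) simp_all
    show "?m \<in> bimodule_homs A (K 0) ?N"
      by (rule bimodule_homsI) (simp_all add: mc m(2) act K_lact_closed K_ract_closed)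
    show "?m ` carrier (K 0) = carrier ?N"
    proof (intro equalityI subsetI)
      fix a assume a: "a \<in> carrier ?N"
      have "?m (kt 0 a eone \<one>\<^bsub>A\<^esub>) = a" using a by (simp add: m(3) kt_closed eone_W proj_one)
      then show "a \<in> ?m ` carrier (K 0)" using a kt_closed[of a eone 0 "\<one>\<^bsub>A\<^esub>"] eone_W
        by (intro image_eqI[of _ _ "kt 0 a eone \<one>\<^bsub>A\<^esub>"]) simp_all
    qed (auto simp: mc)
    fix z assume z: "z \<in> carrier (K 0)"
    show "?m z = \<zero>\<^bsub>?N\<^esub> \<longleftrightarrow> z \<in> Bk 0"
    proof
      assume "?m z = \<zero>\<^bsub>?N\<^esub>"
      then have "z \<ominus>\<^bsub>K 0\<^esub> \<zero>\<^bsub>K 0\<^esub> \<in> Bk 0" using ker[OF z] z by (simp add: kt_zero eone_W)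
      moreover have "z \<ominus>\<^bsub>K 0\<^esub> \<zero>\<^bsub>K 0\<^esub> = z" using z by (simp add: a_minus_def Kg.minus_equality)
      ultimately show "z \<in> Bk 0" by simp
    next
      assume "z \<in> Bk 0"
      then show "?m z = \<zero>\<^bsub>?N\<^esub>" using z md unfolding Bk_def by auto
    qed
  qed
qed

end

section \<open>Cycles from the socle\<close>

context koszul_quiver begin

lemma K2_induct [consumes 1, case_names sigma zero add]:
  assumes z: "z \<in> carrier (K 2)"
    and pure: "\<And>a i b. \<lbrakk>a \<in> carrier A; i \<in> verts Q; b \<in> carrier A\<rbrakk> \<Longrightarrow> P (kt 2 a (sg i) b)"
    and zero: "P \<zero>\<^bsub>K 2\<^esub>"
    and add: "\<And>u v. \<lbrakk>u \<in> carrier (K 2); v \<in> carrier (K 2); P u; P v\<rbrakk> \<Longrightarrow> P (u \<oplus>\<^bsub>K 2\<^esub> v)"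
  shows "P z"
  using z
proof (induction rule: K_induct)
  case (pure a w b)
  have w: "w = (\<Sum>i\<in>verts Q. pscale (cs i w) (sg i))" by (rule relations_expand) (use pure(2) in \<open>simp add: W_2\<close>)
  have "P (kt 2 a (\<Sum>i\<in>S. pscale (cs i w) (sg i)) b) \<and> (\<Sum>i\<in>S. pscale (cs i w) (sg i)) \<in> W F Q 2"
    if "finite S" "S \<subseteq> verts Q" for S using that
  proof (induction S rule: finite_induct)
    case empty then show ?case using zero pure by (simp add: kt_zero W_closed)
  next
    case (insert i S)
    have i: "i \<in> verts Q" using insert by simp
    have "kt 2 a (pscale (cs i w) (sg i)) b = kt 2 (phi (cs i w) \<otimes>\<^bsub>A\<^esub> a) (sg i) b"
      using pure i by (simp add: kt_scale1 sg_W)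
    then have "P (kt 2 a (pscale (cs i w) (sg i)) b)" using assms(2) pure i phi_closed by simp
    then show ?case using insert i pure add by (simp add: kt_add2 W_closed sg_W kt_closed)
  qed
  from this[OF finite_verts subset_refl] show ?case using w by simp
qed (rule add)

lemma d2_closed: "z \<in> carrier (K 2) \<Longrightarrow> d 2 z \<in> carrier K1"
  using d_closed[OF reps2, of z] by simp

lemma d1_closed: "z \<in> carrier K1 \<Longrightarrow> d (Suc 0) z \<in> carrier (K 0)"
  using d_closed[OF reps1, of z] by simp

text \<open>On \<open>1 \<otimes> \<sigma>\<^sub>i \<otimes> 1\<close> the first differential gives
  \<open>D(\<sigma>\<^sub>i)\<close>, whose boundary is
  \<open>\<sigma>\<^sub>i \<otimes> 1 - 1 \<otimes> \<sigma>\<^sub>i\<close>, which is zero in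
  \<open>A\<close>. Bilinearity does the rest.\<close>

lemma d1_d2: "z \<in> carrier (K 2) \<Longrightarrow> d (Suc 0) (d 2 z) = \<zero>\<^bsub>K 0\<^esub>"
proof (induction rule: K2_induct)
  case (sigma a i b)
  let ?z = "kt 2 \<one>\<^bsub>A\<^esub> (sg i) \<one>\<^bsub>A\<^esub>"
  have z: "?z \<in> carrier (K 2)" using sigma by (simp add: kt_closed sg_W)
  have "pr (sg i) = \<zero>\<^bsub>A\<^esub>" using proj_zero_iff[OF sg_TC] sg_I sigma by simp
  then have 1: "d (Suc 0) (d 2 ?z) = \<zero>\<^bsub>K 0\<^esub>"
    unfolding D_sg[OF sigma(2), symmetric] d1_D[OF sg_TC] by (simp add: kt_zero eone_W a_minus_def Kg.r_neg)
  have e: "kt 2 a (sg i) b = a \<odot>\<^bsub>K 2\<^esub> ract (K 2) ?z b" using sigma by (simp add: K_lact K_ract sg_W)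
  have "d 2 (kt 2 a (sg i) b) = a \<odot>\<^bsub>K1\<^esub> ract K1 (d 2 ?z) b"
    unfolding e using d_lact[OF reps2 _ sigma(1) K_ract_closed[OF sigma(3) z]] d_ract[OF reps2 _ sigma(3) z] by simp
  then have "d (Suc 0) (d 2 (kt 2 a (sg i) b)) = a \<odot>\<^bsub>K 0\<^esub> ract (K 0) (d (Suc 0) (d 2 ?z)) b"
    using d_lact[OF reps1 _ sigma(1) K_ract_closed[OF sigma(3) d2_closed[OF z]]] d_ract[OF reps1 _ sigma(3) d2_closed[OF z]] by simp
  then show ?case unfolding 1 using sigma by (simp add: K_act_zero)
next
  case zero
  then show ?case using d_zero[OF reps2] d_zero[OF reps1] by simp
next
  case (add u v)
  then show ?case using d_add[OF reps2 _ add(1,2)] d_add[OF reps1 _ d2_closed[OF add(1)] d2_closed[OF add(2)]] by simp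
qed

text \<open>The coefficient of \<open>\<sigma>\<^sub>j\<close>, with the augmentation applied to the right factor.\<close>

lemma theta_ex:
  assumes j: "j \<in> verts Q"
  obtains \<theta> where "\<theta> \<in> carrier (K 2) \<rightarrow> carrier A"
    "\<And>u v. \<lbrakk>u \<in> carrier (K 2); v \<in> carrier (K 2)\<rbrakk> \<Longrightarrow> \<theta> (u \<oplus>\<^bsub>K 2\<^esub> v) = \<theta> u \<oplus>\<^bsub>A\<^esub> \<theta> v"
    "\<And>a w b. \<lbrakk>a \<in> carrier A; w \<in> W F Q 2; b \<in> carrier A\<rbrakk> \<Longrightarrow>
      \<theta> (kt 2 a w b) = phi (cs j w * aug j b) \<otimes>\<^bsub>A\<^esub> (a \<otimes>\<^bsub>A\<^esub> pr (ei j))"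
proof (rule K_lift[of A 2 "\<lambda>a w b. phi (cs j w * aug j b) \<otimes>\<^bsub>A\<^esub> (a \<otimes>\<^bsub>A\<^esub> pr (ei j))"])
  show "abelian_group A" by (rule A.abelian_group_axioms)
  fix a w b assume h: "a \<in> carrier A" "w \<in> W F Q 2" "b \<in> carrier A"
  let ?f = "\<lambda>a w b. phi (cs j w * aug j b) \<otimes>\<^bsub>A\<^esub> (a \<otimes>\<^bsub>A\<^esub> pr (ei j))"
  note S = phi_closed ei_A[OF j]
  show "?f a w b \<in> carrier A" using h by (simp add: S)
  show "?f (a \<oplus>\<^bsub>A\<^esub> a') w b = ?f a w b \<oplus>\<^bsub>A\<^esub> ?f a' w b" if "a' \<in> carrier A" for a'
    using h that by (simp add: S A.l_distr A.r_distr)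
  show "?f a (w + w') b = ?f a w b \<oplus>\<^bsub>A\<^esub> ?f a w' b" for w'
    using h by (simp add: S cs_lin distrib_right phi_add A.l_distr)
  show "?f a w (b \<oplus>\<^bsub>A\<^esub> b') = ?f a w b \<oplus>\<^bsub>A\<^esub> ?f a w b'" if "b' \<in> carrier A" for b'
    using h that by (simp add: S aug_add distrib_left phi_add A.l_distr)
  show "?f (phi c \<otimes>\<^bsub>A\<^esub> a) w b = ?f a (pscale c w) b" for c
  proof -
    have "?f (phi c \<otimes>\<^bsub>A\<^esub> a) w b = phi (cs j w * aug j b) \<otimes>\<^bsub>A\<^esub> phi c \<otimes>\<^bsub>A\<^esub> (a \<otimes>\<^bsub>A\<^esub> pr (ei j))"
      using h by (simp add: S A.m_assoc)
    then show ?thesis by (simp add: phi_mult[symmetric] cs_lin mult_ac)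
  qed
  show "?f a w (phi c \<otimes>\<^bsub>A\<^esub> b) = ?f a (pscale c w) b" for c
    using h by (simp add: aug_scale cs_lin mult_ac)
  fix i assume i: "i \<in> verts Q"
  show "?f (a \<otimes>\<^bsub>A\<^esub> pr (ei i)) w b = ?f a (pmul (ei i) w) b"
  proof -
    have "pr (ei i) \<otimes>\<^bsub>A\<^esub> pr (ei j) = (if i = j then pr (ei j) else \<zero>\<^bsub>A\<^esub>)"
      using i j phi_zero by (simp add: proj_mult[symmetric] ei_TC field_map_def)
    then show ?thesis using h i by (simp add: A.m_assoc ei_A j cs_idem phi_closed phi_zero)
  qed
  show "?f a (pmul w (ei i)) b = ?f a w (pr (ei i) \<otimes>\<^bsub>A\<^esub> b)"
    using h i by (simp add: cs_idem aug_idem)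
qed (rule that)

lemma socle_cycle:
  assumes t: "t \<in> TC" "t \<notin> RI" and j: "j \<in> verts Q" "pmul t (ei j) = t"
    and soc: "\<And>x. x \<in> QA \<Longrightarrow> tgt x = j \<Longrightarrow> pmul t (ar x) \<in> RI"
  shows "\<exists>z\<in>Zk 2. z \<noteq> \<zero>\<^bsub>K 2\<^esub>"
proof -
  define a where "a = pr t"
  have a: "a \<in> carrier A" "a \<noteq> \<zero>\<^bsub>A\<^esub>" "a \<otimes>\<^bsub>A\<^esub> pr (ei j) = a"
    unfolding a_def using t j by (simp_all add: proj_closed proj_zero_iff proj_mult[symmetric] ei_TC)
  have ax: "a \<otimes>\<^bsub>A\<^esub> pa x = \<zero>\<^bsub>A\<^esub>" if "x \<in> QA" "tgt x = j" for x
    unfolding a_def using soc[OF that] t that by (simp add: proj_mult[symmetric] ar_TC proj_zero_iff pmul_TC)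
  define z0 where "z0 = kt 2 a (sg j) \<one>\<^bsub>A\<^esub>"
  have z0: "z0 \<in> carrier (K 2)" unfolding z0_def using a j by (simp add: kt_closed sg_W)
  define y where "y x = \<ominus>\<^bsub>K1\<^esub> kt (Suc 0) a (xs x) \<one>\<^bsub>A\<^esub>" for x
  have y: "y x \<in> carrier K1" if "x \<in> QA" for x using a that by (simp add: y_def kt_closed xs_W)
  \<comment> \<open>All values of \<open>G\<close> are boundaries, \<open>G\<close> fixes cycles,
    and it is additive and right linear. Applied to the cycle
    \<open>d z0 = \<Sum> y\<^sub>x x\<close>, it writes this as a sum of boundaries times arrows,
    although the single \<open>y\<^sub>x\<close> need not be cycles.\<close>
  define G where "G z = z \<ominus>\<^bsub>K1\<^esub> h0 (d (Suc 0) z)" for z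
  have Gc: "G z \<in> carrier K1" if "z \<in> carrier K1" for z using that by (simp add: G_def h0 d1_closed)
  have Ga: "G (u \<oplus>\<^bsub>K1\<^esub> v) = G u \<oplus>\<^bsub>K1\<^esub> G v" if "u \<in> carrier K1" "v \<in> carrier K1" for u v
    using that d_add[OF reps1 _ that] h0(1)[OF d1_closed[OF that(1)]] h0(1)[OF d1_closed[OF that(2)]]
    by (simp add: G_def h0(2) d1_closed a_minus_def Kg.minus_add Kg.a_ac)
  have Gr: "G (ract K1 z c) = ract K1 (G z) c" if "z \<in> carrier K1" "c \<in> carrier A" for z c
    using that d_ract[OF reps1 _ that(2,1)]
    by (simp add: G_def h0_ract d1_closed h0 a_minus_def K_ract_add K_ract_minus)
  have "\<exists>q. q \<in> carrier (K 2) \<and> d 2 q = G (y x)" if "x \<in> QA" for x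
    using homotopy[OF y[OF that]] unfolding Bk_def G_def by (auto simp: numeral_2_eq_2)
  then have "\<forall>x\<in>QA. \<exists>q. q \<in> carrier (K 2) \<and> d 2 q = G (y x)" by blast
  from bchoice[OF this] obtain q where q: "\<And>x. x \<in> QA \<Longrightarrow> q x \<in> carrier (K 2)" "\<And>x. x \<in> QA \<Longrightarrow> d 2 (q x) = G (y x)" by blast
  let ?r = "\<lambda>x. if src x = j then ract K1 (y x) (pa x) else \<zero>\<^bsub>K1\<^esub>"
  let ?Z = "\<lambda>x. if src x = j then ract (K 2) (q x) (pa x) else \<zero>\<^bsub>K 2\<^esub>"
  have r: "?r x \<in> carrier K1" if "x \<in> QA" for x using y that by (simp add: K_ract_closed ar_A)
  have Zc: "?Z x \<in> carrier (K 2)" if "x \<in> QA" for x using q that by (simp add: K_ract_closed ar_A)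
  \<comment> \<open>The left half of the differential vanishes because \<open>a\<close> is
    annihilated by all arrows ending at \<open>j\<close>.\<close>
  have dz0: "d 2 z0 = (\<Oplus>\<^bsub>K1\<^esub>x\<in>QA. ?r x)"
    unfolding z0_def d2_kt[OF j(1) a(1) A.one_closed]
  proof (rule Kg.finsum_cong')
    fix x assume x: "x \<in> QA"
    show "(if tgt x = j then kt (Suc 0) (a \<otimes>\<^bsub>A\<^esub> pa x) (xs x) \<one>\<^bsub>A\<^esub> else \<zero>\<^bsub>K1\<^esub>) \<oplus>\<^bsub>K1\<^esub>
      (if src x = j then \<ominus>\<^bsub>K1\<^esub> kt (Suc 0) a (xs x) (pa x \<otimes>\<^bsub>A\<^esub> \<one>\<^bsub>A\<^esub>) else \<zero>\<^bsub>K1\<^esub>) = ?r x"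
      using x a ax[OF x] by (simp add: y_def K_ract_minus K_ract kt_zero kt_closed xs_W ar_A)
  qed (use r in \<open>simp_all add: Pi_iff\<close>)
  \<comment> \<open>The correction: same boundary as \<open>z0\<close>, but contained in the right
    multiples by arrows.\<close>
  define Z where "Z = (\<Oplus>\<^bsub>K 2\<^esub>x\<in>QA. ?Z x)"
  have Z: "Z \<in> carrier (K 2)" unfolding Z_def using Zc by (simp add: Kg.finsum_closed Pi_iff)
  have dZ: "d 2 Z = d 2 z0"
  proof -
    have dZx: "d 2 (?Z x) = G (?r x)" if x: "x \<in> QA" for x
    proof (cases "src x = j")
      case True
      then show ?thesis using q x Gr[OF y[OF x] ar_A[OF x]] d_ract[OF reps2 _ ar_A[OF x] q(1)[OF x]] by simp
    next
      case False
      then show ?thesis using d_zero[OF reps2] additive_zero[OF K_group K_group, of G "Suc 0" "Suc 0"] Gc Ga by (simp add: Pi_iff)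
    qed
    have "d 2 Z = (\<Oplus>\<^bsub>K1\<^esub>x\<in>QA. d 2 (?Z x))"
      unfolding Z_def by (rule additive_finsum[OF K_group K_group]) (use Zc d2_closed d_add[OF reps2] in \<open>simp_all add: Pi_iff\<close>)
    also have "\<dots> = (\<Oplus>\<^bsub>K1\<^esub>x\<in>QA. G (?r x))"
      by (rule Kg.finsum_cong') (use dZx Gc r in \<open>simp_all add: Pi_iff\<close>)
    also have "\<dots> = G (\<Oplus>\<^bsub>K1\<^esub>x\<in>QA. ?r x)"
      by (rule additive_finsum[OF K_group K_group, symmetric]) (use r Gc Ga in \<open>simp_all add: Pi_iff\<close>)
    also have "\<dots> = d 2 z0" unfolding dz0[symmetric] G_def d1_d2[OF z0] h0_zero
      using d2_closed[OF z0] by (simp add: a_minus_def Kg.minus_equality)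
    finally show ?thesis .
  qed
  obtain \<theta> where \<theta>: "\<theta> \<in> carrier (K 2) \<rightarrow> carrier A"
    "\<And>u v. \<lbrakk>u \<in> carrier (K 2); v \<in> carrier (K 2)\<rbrakk> \<Longrightarrow> \<theta> (u \<oplus>\<^bsub>K 2\<^esub> v) = \<theta> u \<oplus>\<^bsub>A\<^esub> \<theta> v"
    "\<And>a w b. \<lbrakk>a \<in> carrier A; w \<in> W F Q 2; b \<in> carrier A\<rbrakk> \<Longrightarrow>
      \<theta> (kt 2 a w b) = phi (cs j w * aug j b) \<otimes>\<^bsub>A\<^esub> (a \<otimes>\<^bsub>A\<^esub> pr (ei j))" using theta_ex[OF j(1)] by metis
  have \<theta>0: "\<theta> \<zero>\<^bsub>K 2\<^esub> = \<zero>\<^bsub>A\<^esub>" by (rule additive_zero[OF K_group A.abelian_group_axioms \<theta>(1,2)])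
  \<comment> \<open>A right multiple by an arrow has last factors without constant term, so
    \<open>\<theta>\<close> does not see the correction, while it returns \<open>a\<close> on
    \<open>z0\<close>.\<close>
  have \<theta>r: "\<theta> (ract (K 2) z (pa x)) = \<zero>\<^bsub>A\<^esub>" if "z \<in> carrier (K 2)" "x \<in> QA" for z x using that(1)
  proof (induction rule: K_induct)
    case (pure a w b) then show ?case using that(2) by (simp add: K_ract ar_A \<theta>(3) aug_arrow phi_zero ei_A j)
  next
    case (add u v) then show ?case using that(2) by (simp add: K_ract_add ar_A \<theta>(2) K_ract_closed)
  qed
  have "\<theta> Z = (\<Oplus>\<^bsub>A\<^esub>x\<in>QA. \<theta> (?Z x))"
    unfolding Z_def by (rule additive_finsum[OF K_group A.abelian_group_axioms \<theta>(1,2)]) (use Zc in simp_all)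
  also have "\<dots> = (\<Oplus>\<^bsub>A\<^esub>x\<in>QA. \<zero>\<^bsub>A\<^esub>)"
    by (rule A.finsum_cong') (use \<theta>r \<theta>0 q in simp_all)
  finally have \<theta>Z: "\<theta> Z = \<zero>\<^bsub>A\<^esub>" by simp
  have \<theta>z0: "\<theta> z0 = a" unfolding z0_def using a j by (simp add: \<theta>(3) sg_W cs_sg aug_one phi_one)
  have "z0 \<ominus>\<^bsub>K 2\<^esub> Z \<in> Zk 2"
    unfolding Zk_def using z0 Z dZ d_add[OF reps2 _ z0, of "\<ominus>\<^bsub>K 2\<^esub> Z"] d_minus[OF reps2 _ Z] d2_closed[OF z0]
    by (simp add: a_minus_def Kg.r_neg)
  moreover have "z0 \<ominus>\<^bsub>K 2\<^esub> Z \<noteq> \<zero>\<^bsub>K 2\<^esub>"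
  proof
    assume "z0 \<ominus>\<^bsub>K 2\<^esub> Z = \<zero>\<^bsub>K 2\<^esub>"
    moreover have "\<theta> (z0 \<ominus>\<^bsub>K 2\<^esub> Z) = a"
      using z0 Z \<theta>z0 \<theta>Z a additive_minus[OF K_group A.abelian_group_axioms \<theta>(1,2) Z] by (simp add: a_minus_def \<theta>(2))
    ultimately show False using \<theta>0 a(2) by simp
  qed
  ultimately show ?thesis by blast
qed

end

section \<open>Dimension estimates\<close>

text \<open>Rank and nullity, stated with independent sets so that only the finite set
  \<open>S\<close> matters and the ambient spaces may have infinite dimension. Independent kernel
  vectors together with preimages of independent image vectors are independent in the span of
  \<open>S\<close>.\<close>

lemma (in vector_space_pair) rank_bound:
  assumes lin: "Vector_Spaces.linear s1 s2 f" and S: "finite S" "U \<subseteq> vs1.span S"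
    and K: "vs1.independent K" "K \<subseteq> U" "\<And>k. k \<in> K \<Longrightarrow> f k = 0"
    and M: "vs2.independent M" "M \<subseteq> f ` U"
  shows "card K + card M \<le> card S"
proof -
  interpret f: Vector_Spaces.linear s1 s2 f by (rule lin)
  have fK: "finite K" using vs1.independent_span_bound[OF S(1) K(1)] K(2) S(2) by blast
  have "M \<subseteq> vs2.span (f ` S)" using M(2) S(2) unfolding f.span_image by blast
  then have fM: "finite M" using vs2.independent_span_bound[OF finite_imageI[OF S(1)] M(1)] by blast
  have "\<forall>m\<in>M. \<exists>u. u \<in> U \<and> f u = m" using M(2) by blast
  from bchoice[OF this] obtain g where g: "\<And>m. m \<in> M \<Longrightarrow> g m \<in> U" "\<And>m. m \<in> M \<Longrightarrow> f (g m) = m" by blast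
  have inj: "inj_on g M" using g(2) by (metis inj_onI)
  have "0 \<notin> M" using M(1) vs2.dependent_zero by blast
  then have disj: "K \<inter> g ` M = {}" using K(3) g(2) by fastforce
  have "vs1.independent (K \<union> g ` M)"
  proof (subst vs1.dependent_finite)
    show "finite (K \<union> g ` M)" using fK fM by simp
    show "\<not> (\<exists>u. (\<exists>v\<in>K \<union> g ` M. u v \<noteq> 0) \<and> (\<Sum>v\<in>K \<union> g ` M. s1 (u v) v) = 0)"
    proof (intro notI, elim exE conjE bexE)
      fix u v assume v: "v \<in> K \<union> g ` M" "u v \<noteq> 0" and "(\<Sum>v\<in>K \<union> g ` M. s1 (u v) v) = 0"
      then have s: "(\<Sum>v\<in>K. s1 (u v) v) + (\<Sum>v\<in>g ` M. s1 (u v) v) = 0"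
        using fK fM disj by (simp add: sum.union_disjoint)
      then have "f ((\<Sum>v\<in>K. s1 (u v) v) + (\<Sum>v\<in>g ` M. s1 (u v) v)) = 0" by (simp add: f.zero)
      then have "(\<Sum>m\<in>M. s2 (u (g m)) m) = 0"
        using K(3) g(2) by (simp add: f.add f.sum f.scale sum.reindex[OF inj])
      then have 0: "u (g m) = 0" if "m \<in> M" for m
        using vs2.independentD[OF M(1) fM subset_refl, of "\<lambda>m. u (g m)"] that by blast
      then have "(\<Sum>v\<in>g ` M. s1 (u v) v) = 0" by (intro sum.neutral) auto
      then have "u k = 0" if "k \<in> K" for k
        using vs1.independentD[OF K(1) fK subset_refl, of u] that s by simp
      then show False using v 0 by blast
    qed
  qed
  moreover have "K \<union> g ` M \<subseteq> vs1.span S" using K(2) g(1) S(2) by blast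
  ultimately have "card (K \<union> g ` M) \<le> card S" using vs1.independent_span_bound[OF S(1)] by blast
  then show ?thesis using fK fM disj by (simp add: card_Un_disjoint card_image[OF inj])
qed

lemma sum_fun_apply: "(\<Sum>i\<in>I. f i) x = (\<Sum>i\<in>I. f i x)"
  by (induction I rule: infinite_finite_induct) simp_all

text \<open>Families of path algebra elements with pointwise scalars; finite direct sums of graded
  pieces will be realised inside this space.\<close>

interpretation pf: vector_space "\<lambda>(c :: 'f::field) (f :: 'i \<Rightarrow> ('v, 'e, 'f) pelt) i. pscale c (f i)"
  by unfold_locales (simp_all add: fun_eq_iff pv.scale_right_distrib pv.scale_left_distrib)

context fin_quiver begin

section \<open>The graded pieces of \<open>A e\<^sub>j\<close> and their dimensions\<close>

primrec G :: "nat \<Rightarrow> 'v \<Rightarrow> ('v, 'e, 'f) pelt set" where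
  "G 0 = (\<lambda>j. {ei j})"
| "G (Suc n) = (\<lambda>j. \<Union>y\<in>{y \<in> QA. src y = j}. (\<lambda>t. pmul t (ar y)) ` G n (tgt y))"

text \<open>The dimension of \<open>A\<^sub>n e\<^sub>j\<close>, where \<open>G n j\<close> consists of the paths of length \<open>n\<close> from \<open>j\<close>.\<close>

definition hdim :: "nat \<Rightarrow> 'v \<Rightarrow> nat" where "hdim n j = pv.dim (rho ` G n j)"

text \<open>On the path algebra \<open>rho\<close> vanishes exactly on the ideal, so this span is a
  copy of \<open>A\<^sub>n e\<^sub>j\<close> inside the path algebra.\<close>

abbreviation "HS n j \<equiv> pv.span (rho ` G n j)"

lemma finite_G: "finite (G n j)" by (induction n arbitrary: j) simp_all

lemma G_TC: "j \<in> verts Q \<Longrightarrow> t \<in> G n j \<Longrightarrow> t \<in> TC \<and> pmul t (ei j) = t"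
proof (induction n arbitrary: j t)
  case (Suc n)
  then obtain y u where y: "y \<in> QA" "src y = j" "u \<in> G n (tgt y)" "t = pmul u (ar y)" by auto
  then have "u \<in> TC" using Suc.IH[of "tgt y" u] by simp
  then show ?case using y by (simp add: pmul_TC ar_TC pmul_assoc)
qed (simp add: ei_TC)

lemma linear_rho: "Vector_Spaces.linear pscale pscale (rho :: ('v, 'e, 'f) pelt \<Rightarrow> _)"
  by unfold_locales (simp_all add: rho)

lemma rho_rho: "t \<in> TC \<Longrightarrow> rho (rho t) = rho t"
  using rho(4)[OF rho(3)[of t]] by (simp add: rho_diff)

lemma rho_mult: "t \<in> TC \<Longrightarrow> u \<in> TC \<Longrightarrow> rho (pmul (rho t) u) = rho (pmul t u)"
  using rho(4)[OF I_right[OF _ rho(3)[of t]], of u] by (simp add: pmul_diff_left rho_diff)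

lemma HS_props:
  assumes j: "j \<in> verts Q" and b: "b \<in> HS n j"
  shows "b \<in> TC" "pmul b (ei j) = b" "rho b = b" "x \<in> QA \<Longrightarrow> tgt x = j \<Longrightarrow> rho (pmul b (ar x)) \<in> HS (Suc n) (src x)"
proof -
  have "b \<in> TC \<and> pmul b (ei j) = b \<and> rho b = b \<and> (\<forall>x\<in>QA. tgt x = j \<longrightarrow> rho (pmul b (ar x)) \<in> HS (Suc n) (src x))"
    using b
  proof (induction rule: pv.span_induct_alt)
    case base
    have "rho 0 = 0" using rho(2)[of 0 0] by simp
    then show ?case by (simp add: TC_closed pv.span_zero)
  next
    case (step c z y)
    then obtain t where t: "t \<in> G n j" "z = rho t" by blast
    note tT = G_TC[OF j t(1)]
    have "rho (pmul z (ar x)) \<in> HS (Suc n) (src x)" if x: "x \<in> QA" "tgt x = j" for x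
      unfolding t(2) using tT x t(1) rho_mult[of t "ar x"] by (auto simp: ar_TC intro!: pv.span_base)
    moreover have "pmul z (ei j) = z" using rho(5)[OF j, of t] tT t(2) by simp
    ultimately show ?case using step(2) tT t(2)
      by (simp add: TC_closed rho_TC rho_rho rho pmul_add_left pmul_pscale_left pv.span_add pv.span_scale)
  qed
  then show "b \<in> TC" "pmul b (ei j) = b" "rho b = b" "x \<in> QA \<Longrightarrow> tgt x = j \<Longrightarrow> rho (pmul b (ar x)) \<in> HS (Suc n) (src x)"
    by blast+
qed

lemma HS_basis: obtains B where "B \<subseteq> HS n j" "pv.independent B" "HS n j = pv.span B" "card B = hdim n j" "finite B"
proof -
  obtain B where B: "B \<subseteq> rho ` G n j" "pv.independent B" "rho ` G n j \<subseteq> pv.span B" "card B = pv.dim (rho ` G n j)"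
    by (rule pv.basis_exists)
  have "HS n j = pv.span B" using pv.span_mono[OF B(1)] pv.span_mono[OF B(3)] by (simp add: pv.span_span)
  moreover have "finite B" using B(1) finite_G finite_subset by blast
  ultimately show ?thesis using B that[of B] pv.span_superset[of "rho ` G n j"] by (auto simp: hdim_def)
qed

text \<open>Right multiplication by the arrows ending at \<open>j\<close> maps \<open>A\<^sub>n e\<^sub>j\<close> into the kernel of the
  surjection from the sum of the \<open>A\<^sub>n\<^sub>+\<^sub>1 e\<^sub>i\<close> to \<open>A\<^sub>n\<^sub>+\<^sub>2 e\<^sub>j\<close>, because \<open>\<sigma>\<^sub>j\<close> is a relation.\<close>

lemma hdim_ineq:
  assumes j: "j \<in> verts Q"
    and soc: "\<And>t. \<lbrakk>t \<in> TC; pmul t (ei j) = t; \<And>x. \<lbrakk>x \<in> QA; tgt x = j\<rbrakk> \<Longrightarrow> pmul t (ar x) \<in> RI\<rbrakk> \<Longrightarrow> t \<in> RI"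
  shows "hdim n j + hdim (Suc (Suc n)) j \<le> (\<Sum>y | y \<in> QA \<and> src y = j. hdim (Suc n) (tgt y))"
proof -
  interpret vp: vector_space_pair "\<lambda>c (f :: 'e + 'e \<Rightarrow> ('v, 'e, 'f) pelt) i. pscale c (f i)" "pscale :: 'f \<Rightarrow> ('v, 'e, 'f) pelt \<Rightarrow> _"
    by unfold_locales
  interpret vq: vector_space_pair "pscale :: 'f \<Rightarrow> ('v, 'e, 'f) pelt \<Rightarrow> _" "\<lambda>c (f :: 'e + 'e \<Rightarrow> ('v, 'e, 'f) pelt) i. pscale c (f i)"
    by unfold_locales
  let ?Y = "{y \<in> QA. src y = j}"
  have fY: "finite ?Y" by simp
  have Yv: "tgt y \<in> verts Q" if "y \<in> ?Y" for y using that by simp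
  have "\<exists>C. C \<subseteq> HS (Suc n) (tgt y) \<and> HS (Suc n) (tgt y) = pv.span C \<and> card C = hdim (Suc n) (tgt y) \<and> finite C" for y
    by (rule HS_basis[of "Suc n" "tgt y"]) blast
  then obtain C where C: "\<And>y. HS (Suc n) (tgt y) = pv.span (C y)" "\<And>y. card (C y) = hdim (Suc n) (tgt y)" "\<And>y. finite (C y)"
    by metis
  \<comment> \<open>The inclusion of the summand of index \<open>y\<close>.\<close>
  define \<delta> :: "'e + 'e \<Rightarrow> ('v, 'e, 'f) pelt \<Rightarrow> 'e + 'e \<Rightarrow> ('v, 'e, 'f) pelt" where "\<delta> y b = (\<lambda>z. if z = y then b else 0)" for y b
  have lin\<delta>: "Vector_Spaces.linear pscale (\<lambda>c f i. pscale c (f i)) (\<delta> y)" for y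
    by unfold_locales (auto simp: \<delta>_def fun_eq_iff)
  define W where "W = (\<Union>y\<in>?Y. \<delta> y ` C y)"
  have W: "finite W" unfolding W_def using C(3) by simp
  \<comment> \<open>The direct sum of the \<open>A\<^sub>n\<^sub>+\<^sub>1 e\<^sub>i\<close>, with
    one summand for each arrow \<open>y\<close> from \<open>j\<close> to \<open>i\<close>; multiple
    edges thus count with multiplicity.\<close>
  define U where "U = {f. \<forall>y. if y \<in> ?Y then f y \<in> HS (Suc n) (tgt y) else f y = 0}"
  have UW: "U \<subseteq> pf.span W"
  proof
    fix f assume f: "f \<in> U"
    have e: "(\<Sum>y\<in>?Y. \<delta> y (f y)) = f"
    proof
      fix z
      have "(\<Sum>y\<in>?Y. \<delta> y (f y)) z = (\<Sum>y\<in>?Y. if z = y then f y else 0)"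
        unfolding sum_fun_apply by (simp add: \<delta>_def)
      then show "(\<Sum>y\<in>?Y. \<delta> y (f y)) z = f z" using f fY by (auto simp: U_def split: if_splits)
    qed
    have "\<delta> y (f y) \<in> pf.span W" if y: "y \<in> ?Y" for y
    proof -
      have "\<delta> y (f y) \<in> pf.span (\<delta> y ` C y)"
      proof -
        have "if y \<in> ?Y then f y \<in> HS (Suc n) (tgt y) else f y = 0" using f unfolding U_def by blast
        then have "f y \<in> pv.span (C y)" using y C(1)[of y] by (simp del: G.simps)
        then show ?thesis using vq.linear_span_image[OF lin\<delta>, of y "C y"] by blast
      qed
      then show ?thesis using pf.span_mono[of "\<delta> y ` C y" W] y unfolding W_def by blast
    qed
    then have "(\<Sum>y\<in>?Y. \<delta> y (f y)) \<in> pf.span W" by (rule pf.span_sum)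
    then show "f \<in> pf.span W" unfolding e .
  qed
  \<comment> \<open>Multiplication of each component by its arrow \<open>y\<close>, giving an
    element of \<open>A\<^sub>n\<^sub>+\<^sub>2 e\<^sub>j\<close>. All of it is reached, because
    every path of positive length from \<open>j\<close> begins with such an arrow.\<close>
  define \<Psi> where "\<Psi> f = rho (\<Sum>y\<in>?Y. pmul (f y) (ar y))" for f
  have lin\<Psi>: "Vector_Spaces.linear (\<lambda>c f i. pscale c (f i)) pscale \<Psi>"
    by unfold_locales (simp_all add: \<Psi>_def rho(1,2)[symmetric] pmul_add_left pmul_pscale_left sum.distrib pv.scale_sum_right)
  \<comment> \<open>The sign is chosen so that \<open>\<Psi> (\<kappa> b)\<close> is the class of
    \<open>b \<sigma>\<^sub>j\<close>, which is zero in \<open>A\<close>.\<close>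
  define \<kappa> where "\<kappa> b = (\<lambda>y. if y \<in> ?Y then rho (pscale (eps (star y)) (pmul b (ar (star y)))) else 0)" for b
  have lin\<kappa>: "Vector_Spaces.linear pscale (\<lambda>c f i. pscale c (f i)) \<kappa>"
    by unfold_locales (auto simp: \<kappa>_def fun_eq_iff rho(1,2)[symmetric] pmul_add_left pmul_pscale_left pv.scale_right_distrib mult.commute)
  obtain B where B: "B \<subseteq> HS n j" "pv.independent B" "HS n j = pv.span B" "card B = hdim n j" "finite B"
    by (rule HS_basis)
  \<comment> \<open>An element of the kernel is annihilated by all arrows ending at
    \<open>j\<close>, hence lies in the ideal by the assumption, and an element of the ideal fixed
    by \<open>rho\<close> is zero.\<close>
  have inj: "inj_on \<kappa> (pv.span B)"
  proof (subst vq.linear_inj_on_iff_eq_0[OF lin\<kappa> pv.subspace_span], safe)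
    fix b assume b: "b \<in> pv.span B" and 0: "\<kappa> b = 0"
    have bH: "b \<in> HS n j" using b B(3) by simp
    have "pmul b (ar x) \<in> RI" if x: "x \<in> QA" "tgt x = j" for x
    proof -
      have "rho (pscale (eps x) (pmul b (ar x))) = 0" using fun_cong[OF 0, of "star x"] x by (simp add: \<kappa>_def)
      then have "rho (pmul b (ar x)) = 0" by (simp add: rho)
      then show ?thesis using rho_iff pmul_TC ar_TC x HS_props(1)[OF j bH] by blast
    qed
    then have "b \<in> RI" using soc HS_props(1,2)[OF j bH] by blast
    then show "b = 0" using rho(4) HS_props(3)[OF j bH] by metis
  qed
  have K: "pf.independent (\<kappa> ` B)" by (rule vq.linear_independent_injective_image[OF lin\<kappa> B(2) inj])
  have KU: "\<kappa> ` B \<subseteq> U"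
  proof
    fix f assume "f \<in> \<kappa> ` B"
    then obtain b where b: "b \<in> HS n j" "f = \<kappa> b" using B(1) by blast
    have "rho (pmul b (ar (star y))) \<in> HS (Suc n) (tgt y)" if "y \<in> ?Y" for y
      using HS_props(4)[OF j b(1), of "star y"] that by (simp del: G.simps)
    then show "f \<in> U" by (simp add: U_def b(2) \<kappa>_def rho pv.span_scale del: G.simps eps_star)
  qed
  have K0: "\<Psi> k = 0" if k: "k \<in> \<kappa> ` B" for k
  proof -
    obtain b where b: "b \<in> HS n j" "k = \<kappa> b" using k B(1) by blast
    note bT = HS_props(1)[OF j b(1)]
    have e: "rho (pmul (\<kappa> b y) (ar y)) = rho (pscale (eps (star y)) (pmul b (pmul (ar (star y)) (ar y))))" if "y \<in> ?Y" for y
      using that bT by (simp add: \<kappa>_def rho_mult TC_closed pmul_TC ar_TC pmul_pscale_left pmul_assoc del: eps_star)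
    have "\<Psi> k = (\<Sum>y\<in>?Y. rho (pmul (\<kappa> b y) (ar y)))"
      unfolding \<Psi>_def b(2) by (rule vector_space_pair.linear_sum[OF _ linear_rho]) unfold_locales
    also have "\<dots> = (\<Sum>y\<in>?Y. rho (pscale (eps (star y)) (pmul b (pmul (ar (star y)) (ar y)))))"
      by (rule sum.cong[OF refl e])
    also have "\<dots> = (\<Sum>x | x \<in> QA \<and> tgt x = j. rho (pscale (eps x) (pmul b (pmul (ar x) (ar (star x))))))"
      by (rule sum.reindex_bij_witness[of _ star star]) auto
    also have "\<dots> = rho (\<Sum>x | x \<in> QA \<and> tgt x = j. pscale (eps x) (pmul b (pmul (ar x) (ar (star x)))))"
      by (rule vector_space_pair.linear_sum[OF _ linear_rho, symmetric]) unfold_locales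
    also have "\<dots> = rho (pmul b (sg j))" by (simp add: sg_eq pmul_sum_right pmul_pscale_right)
    also have "\<dots> = 0" using rho(4) I_left[OF bT sg_I[OF j]] by blast
    finally show ?thesis .
  qed
  obtain M where M: "M \<subseteq> rho ` G (Suc (Suc n)) j" "pv.independent M" "card M = hdim (Suc (Suc n)) j"
    unfolding hdim_def by (rule pv.basis_exists)
  have MU: "M \<subseteq> \<Psi> ` U"
  proof
    fix m assume "m \<in> M"
    then obtain t y where t: "y \<in> ?Y" "t \<in> G (Suc n) (tgt y)" "m = rho (pmul t (ar y))"
      using M(1) unfolding G.simps(2)[of "Suc n"] by blast
    have tT: "t \<in> TC" using G_TC[OF Yv[OF t(1)] t(2)] by blast
    have "\<Psi> (\<delta> y (rho t)) = rho (\<Sum>z\<in>?Y. if z = y then pmul (rho t) (ar y) else 0)"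
      unfolding \<Psi>_def \<delta>_def by (rule arg_cong[of _ _ rho], rule sum.cong) simp_all
    also have "\<dots> = m" using t tT fY by (simp add: rho_mult ar_TC)
    finally have "m = \<Psi> (\<delta> y (rho t))" by simp
    moreover have "\<delta> y (rho t) \<in> U" using t by (auto simp: U_def \<delta>_def simp del: G.simps intro: pv.span_base pv.span_zero)
    ultimately show "m \<in> \<Psi> ` U" by blast
  qed
  have "card (\<kappa> ` B) + card M \<le> card W"
    by (rule vp.rank_bound[OF lin\<Psi> W UW K KU K0 M(2) MU])
  moreover have "card (\<kappa> ` B) = hdim n j"
    using B(4) card_image[OF inj_on_subset[OF inj pv.span_superset]] by simp
  moreover have "card W \<le> (\<Sum>y\<in>?Y. hdim (Suc n) (tgt y))"
  proof -
    have "card W \<le> (\<Sum>y\<in>?Y. card (\<delta> y ` C y))" unfolding W_def by (rule card_UN_le[OF fY])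
    also have "\<dots> \<le> (\<Sum>y\<in>?Y. hdim (Suc n) (tgt y))"
      by (rule sum_mono) (metis C(2,3) card_image_le)
    finally show ?thesis .
  qed
  ultimately show ?thesis using M(3) by simp
qed

end

section \<open>Dynkin graphs\<close>

context fin_quiver begin

lemma hdim_eq_0: assumes j: "j \<in> verts Q" shows "hdim n j = 0 \<longleftrightarrow> G n j \<subseteq> RI"
proof
  assume 0: "hdim n j = 0"
  obtain B where "HS n j = pv.span B" "card B = hdim n j" "finite B" by (rule HS_basis)
  then have "HS n j = {0}" using 0 by simp
  then have "rho t = 0" if "t \<in> G n j" for t using that pv.span_base[of "rho t" "rho ` G n j"] by blast
  then show "G n j \<subseteq> RI" using G_TC[OF j] rho_iff by blast
next
  assume "G n j \<subseteq> RI"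
  then have "rho ` G n j \<subseteq> pv.span {}" using rho(4) by auto
  then show "hdim n j = 0" using pv.dim_le_card[of "rho ` G n j" "{}"] by (simp add: hdim_def)
qed

lemma ei_notin_I: "ei j \<notin> RI"
  using lookup_Nil_I[of "ei j" j j] by (auto simp: idem_def)

end

text \<open>If \<open>s\<close> never vanished, every step would lower the increments of
  \<open>u\<close> by at least 1, and \<open>u\<close> would eventually become negative. The
  argument runs over the integers, because increments of \<open>u\<close> may be negative.\<close>

lemma concave_nonneg:
  fixes u s :: "nat \<Rightarrow> nat"
  assumes "\<And>n. u n + u (Suc (Suc n)) + s (Suc n) \<le> 2 * u (Suc n)"
  shows "\<exists>n. s n = 0"
proof (rule ccontr)
  assume "\<not> ?thesis"
  then have s: "s n \<ge> 1" for n by (simp add: Suc_leI)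
  have D: "int (u (Suc n)) - int (u n) \<le> int (u (Suc 0)) - int (u 0) - int n" for n
  proof (induction n)
    case (Suc n)
    then show ?case using assms[of n] s[of "Suc n"] by linarith
  qed simp
  \<comment> \<open>From this index on all increments are at most \<open>-1\<close>, since the
    initial increment is at most \<open>u 1\<close>.\<close>
  define N where "N = u (Suc 0) + 1"
  have "int (u (N + k)) \<le> int (u N) - int k" for k
  proof (induction k)
    case (Suc k)
    then show ?case using D[of "N + k"] unfolding N_def by simp
  qed simp
  from this[of "u N + 1"] show False by simp
qed

context koszul_quiver begin

lemma weight_cycle:
  fixes v :: "'v \<Rightarrow> nat"
  assumes ne: "verts Q \<noteq> {}"
    and v: "\<And>l. l \<in> verts Q \<Longrightarrow> (\<Sum>y | y \<in> QA \<and> tgt y = l. v (src y)) + 1 \<le> 2 * v l"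
  shows "\<exists>z\<in>Zk 2. z \<noteq> \<zero>\<^bsub>K 2\<^esub>"
proof (rule ccontr)
  assume no: "\<not> ?thesis"
  have soc: "t \<in> RI" if "j \<in> verts Q" "t \<in> TC" "pmul t (ei j) = t" "\<And>x. \<lbrakk>x \<in> QA; tgt x = j\<rbrakk> \<Longrightarrow> pmul t (ar x) \<in> RI" for j t
    using no socle_cycle[OF that(2) _ that(1,3,4)] by blast
  define u where "u n = (\<Sum>j\<in>verts Q. v j * hdim n j)" for n
  \<comment> \<open>The total dimension of \<open>A\<^sub>n\<close>. The slack 1 in the assumption
    on \<open>v\<close>, multiplied by the dimensions and summed, contributes exactly this
    term.\<close>
  define s where "s n = (\<Sum>j\<in>verts Q. hdim n j)" for n
  have "u n + u (Suc (Suc n)) + s (Suc n) \<le> 2 * u (Suc n)" for n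
  proof -
    have "u n + u (Suc (Suc n)) = (\<Sum>j\<in>verts Q. v j * (hdim n j + hdim (Suc (Suc n)) j))"
      by (simp add: u_def sum.distrib distrib_left)
    also have "\<dots> \<le> (\<Sum>j\<in>verts Q. v j * (\<Sum>y | y \<in> QA \<and> src y = j. hdim (Suc n) (tgt y)))"
      by (intro sum_mono mult_le_mono2 hdim_ineq) (use soc in blast)+
    also have "\<dots> = (\<Sum>j\<in>verts Q. \<Sum>y | y \<in> QA \<and> src y = j. v (src y) * hdim (Suc n) (tgt y))"
      by (simp add: sum_distrib_left)
    \<comment> \<open>The sum over arrows is grouped first by source and then by target, which
      shifts the weights from a vertex to its neighbours.\<close>
    also have "\<dots> = (\<Sum>y\<in>QA. v (src y) * hdim (Suc n) (tgt y))"
      by (rule sum.group) (auto simp: finite_verts)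
    also have "\<dots> = (\<Sum>l\<in>verts Q. \<Sum>y | y \<in> QA \<and> tgt y = l. v (src y) * hdim (Suc n) (tgt y))"
      by (rule sum.group[symmetric]) (auto simp: finite_verts)
    also have "\<dots> = (\<Sum>l\<in>verts Q. (\<Sum>y | y \<in> QA \<and> tgt y = l. v (src y)) * hdim (Suc n) l)"
      by (simp add: sum_distrib_right)
    finally have "u n + u (Suc (Suc n)) + s (Suc n) \<le>
      (\<Sum>l\<in>verts Q. ((\<Sum>y | y \<in> QA \<and> tgt y = l. v (src y)) + 1) * hdim (Suc n) l)"
      by (simp add: s_def sum.distrib)
    also have "\<dots> \<le> (\<Sum>l\<in>verts Q. 2 * v l * hdim (Suc n) l)"
      by (intro sum_mono mult_le_mono1 v)
    finally show ?thesis by (simp add: u_def sum_distrib_left mult.assoc)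
  qed
  then have "\<exists>n. s n = 0" by (rule concave_nonneg)
  \<comment> \<open>Minimality makes the piece of degree \<open>N - 1\<close> nonzero. This degree
    exists: \<open>N = 0\<close> would put some \<open>e\<^sub>j\<close> into the ideal, whose
    elements have no constant terms.\<close>
  define N where "N = (LEAST n. s n = 0)"
  have sN: "s N = 0" unfolding N_def by (rule LeastI_ex) fact
  obtain j0 where j0: "j0 \<in> verts Q" using ne by blast
  have s0: "hdim n l = 0" if "s n = 0" "l \<in> verts Q" for n l using that finite_verts by (simp add: s_def)
  have "N \<noteq> 0"
  proof
    assume "N = 0"
    then have "ei j0 \<in> RI" using s0[OF sN j0] hdim_eq_0[OF j0, of 0] by simp
    then show False using ei_notin_I by blast
  qed
  then obtain m where m: "N = Suc m" using not0_implies_Suc by blast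
  have "s m \<noteq> 0" using not_less_Least[of m "\<lambda>n. s n = 0"] m unfolding N_def by auto
  then obtain j where j: "j \<in> verts Q" "hdim m j \<noteq> 0" using finite_verts by (auto simp: s_def)
  then obtain t where t: "t \<in> G m j" "t \<notin> RI" using hdim_eq_0[OF j(1), of m] by auto
  have "pmul t (ar x) \<in> RI" if x: "x \<in> QA" "tgt x = j" for x
  proof -
    have "G N (src x) \<subseteq> RI" using hdim_eq_0 s0[OF sN] x by simp
    moreover have "pmul t (ar x) \<in> G N (src x)" using x t(1) unfolding m by auto
    ultimately show ?thesis by blast
  qed
  then have "t \<in> RI" using soc[OF j(1)] G_TC[OF j(1) t(1)] by blast
  then show False using t(2) by blast
qed

end

section \<open>Weights on Dynkin graphs\<close>

text \<open>A loop at \<open>l\<close> contributes \<open>0\<close> to the sum; below, loops are excluded.\<close>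

definition neighbour_sum :: "('v, 'e) mgraph \<Rightarrow> ('v \<Rightarrow> nat) \<Rightarrow> 'v \<Rightarrow> nat" where
  "neighbour_sum \<Gamma> v l = (\<Sum>e | e \<in> edges \<Gamma> \<and> l \<in> ends \<Gamma> e. \<Sum>i\<in>ends \<Gamma> e - {l}. v i)"

text \<open>The graph has no loops, and its Cartan matrix sends \<open>v\<close> to a vector with
  all entries at least 1; over the integers this is strict positivity.\<close>

definition superharmonic :: "('v, 'e) mgraph \<Rightarrow> ('v \<Rightarrow> nat) \<Rightarrow> bool" where
  "superharmonic \<Gamma> v \<longleftrightarrow> (\<forall>e\<in>edges \<Gamma>. card (ends \<Gamma> e) = 2) \<and>
     (\<forall>l\<in>vertices \<Gamma>. neighbour_sum \<Gamma> v l + 1 \<le> 2 * v l)"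

lemma superharmonic_iso:
  assumes "graph_iso \<Delta> \<Gamma>" "finite_graph \<Delta>" "superharmonic \<Gamma> v"
  shows "\<exists>v. superharmonic \<Delta> v"
proof -
  obtain f g where f: "bij_betw f (vertices \<Delta>) (vertices \<Gamma>)" and g: "bij_betw g (edges \<Delta>) (edges \<Gamma>)"
    and e: "\<And>e. e \<in> edges \<Delta> \<Longrightarrow> ends \<Gamma> (g e) = f ` ends \<Delta> e"
    using assms(1) unfolding graph_iso_def by blast
  have sub: "ends \<Delta> e \<subseteq> vertices \<Delta>" if "e \<in> edges \<Delta>" for e using assms(2) that unfolding finite_graph_def by blast
  have inj: "inj_on f (vertices \<Delta>)" using f bij_betw_imp_inj_on by blast
  have ge: "g e \<in> edges \<Gamma>" if "e \<in> edges \<Delta>" for e using g that bij_betwE by blast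
  have "card (ends \<Delta> e) = 2" if "e \<in> edges \<Delta>" for e
  proof -
    have "card (ends \<Gamma> (g e)) = 2" using assms(3) ge[OF that] unfolding superharmonic_def by blast
    then show ?thesis using card_image[OF inj_on_subset[OF inj sub[OF that]]] e[OF that] by simp
  qed
  moreover have "neighbour_sum \<Delta> (v \<circ> f) l = neighbour_sum \<Gamma> v (f l)" if l: "l \<in> vertices \<Delta>" for l
  proof -
    have iff: "f l \<in> ends \<Gamma> (g e) \<longleftrightarrow> l \<in> ends \<Delta> e" if "e \<in> edges \<Delta>" for e
      using inj_on_image_mem_iff[OF inj l sub[OF that]] e[OF that] by simp
    have "bij_betw g {e. e \<in> edges \<Delta> \<and> l \<in> ends \<Delta> e} {e. e \<in> edges \<Gamma> \<and> f l \<in> ends \<Gamma> e}"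
    proof (rule bij_betw_imageI)
      show "inj_on g {e. e \<in> edges \<Delta> \<and> l \<in> ends \<Delta> e}" using g unfolding bij_betw_def by (auto intro: inj_on_subset)
      show "g ` {e. e \<in> edges \<Delta> \<and> l \<in> ends \<Delta> e} = {e. e \<in> edges \<Gamma> \<and> f l \<in> ends \<Gamma> e}"
      proof -
        have "edges \<Gamma> = g ` edges \<Delta>" using g unfolding bij_betw_def by simp
        then show ?thesis using iff by auto
      qed
    qed
    then have "neighbour_sum \<Gamma> v (f l) = (\<Sum>e | e \<in> edges \<Delta> \<and> l \<in> ends \<Delta> e. \<Sum>i\<in>ends \<Gamma> (g e) - {f l}. v i)"
      unfolding neighbour_sum_def by (rule sum.reindex_bij_betw[symmetric])
    also have "\<dots> = (\<Sum>e | e \<in> edges \<Delta> \<and> l \<in> ends \<Delta> e. \<Sum>i\<in>ends \<Delta> e - {l}. v (f i))"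
    proof (rule sum.cong[OF refl])
      fix x assume "x \<in> {e. e \<in> edges \<Delta> \<and> l \<in> ends \<Delta> e}"
      then have x: "x \<in> edges \<Delta>" by blast
      have "ends \<Gamma> (g x) - {f l} = f ` (ends \<Delta> x - {l})"
        unfolding e[OF x] using inj_on_image_set_diff[OF inj, of "ends \<Delta> x" "{l}"] sub[OF x] l by (simp add: Diff_subset[THEN subset_trans])
      moreover have "inj_on f (ends \<Delta> x - {l})" using inj sub[OF x] by (auto intro: inj_on_subset)
      ultimately show "(\<Sum>i\<in>ends \<Gamma> (g x) - {f l}. v i) = (\<Sum>i\<in>ends \<Delta> x - {l}. v (f i))"
        by (simp add: sum.reindex)
    qed
    finally show ?thesis by (simp add: neighbour_sum_def)
  qed
  ultimately have "superharmonic \<Delta> (v \<circ> f)"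
    using assms(3) f unfolding superharmonic_def by (simp add: bij_betwE)
  then show ?thesis by blast
qed

lemma finite_chain: "finite (chain n)"
proof -
  have "chain n \<subseteq> (\<lambda>i. {i, Suc i}) ` {..<n}" unfolding chain_def by auto
  then show ?thesis using finite_surj[of "{..<n}"] by blast
qed

definition edge_sum :: "nat set set \<Rightarrow> (nat \<Rightarrow> nat) \<Rightarrow> nat \<Rightarrow> nat" where
  "edge_sum E v l = (\<Sum>e | e \<in> E \<and> l \<in> e. \<Sum>i\<in>e - {l}. v i)"

text \<open>An edge of the chain at \<open>l\<close> leads to \<open>l - 1\<close> or to
  \<open>l + 1\<close>. An upper bound is what superharmonicity asks for, so the sum may be enlarged
  to these two candidate edges.\<close>

lemma edge_sum_chain:
  "edge_sum (chain n) v l \<le> (if 0 < l \<and> l < n then v (l - 1) else 0) + (if Suc l < n then v (Suc l) else 0)"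
proof -
  let ?S = "if 0 < l \<and> l < n then {{l - 1, l}} else {}" and ?T = "if Suc l < n then {{l, Suc l}} else {}"
  let ?g = "\<lambda>e. \<Sum>i\<in>e - {l}. v i"
  have "{e. e \<in> chain n \<and> l \<in> e} \<subseteq> ?S \<union> ?T" unfolding chain_def by auto
  then have "edge_sum (chain n) v l \<le> sum ?g (?S \<union> ?T)"
    unfolding edge_sum_def by (intro sum_mono2) (simp_all split: if_splits)
  also have "\<dots> \<le> sum ?g ?S + sum ?g ?T" by (subst sum_Un_nat) simp_all
  also have "sum ?g ?S = (if 0 < l \<and> l < n then v (l - 1) else 0)"
  proof -
    have "{l - 1, l} - {l} = {l - 1}" if "0 < l" using that by auto
    then show ?thesis by simp
  qed
  also have "sum ?g ?T = (if Suc l < n then v (Suc l) else 0)"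
  proof -
    have "{l, Suc l} - {l} = {Suc l}" by auto
    then show ?thesis by simp
  qed
  finally show ?thesis .
qed

lemma edge_sum_insert:
  assumes "finite E" shows "edge_sum (insert {b, c} E) v l \<le> edge_sum E v l + (if l = b \<or> l = c then \<Sum>i\<in>{b, c} - {l}. v i else 0)"
proof -
  have "{e. e \<in> insert {b, c} E \<and> l \<in> e} = (if l \<in> {b, c} then insert {b, c} {e. e \<in> E \<and> l \<in> e} else {e. e \<in> E \<and> l \<in> e})" by auto
  then show ?thesis using assms by (auto simp: edge_sum_def sum.insert_if)
qed

lemma superharmonic_simple:
  assumes "\<And>e. e \<in> E \<Longrightarrow> card e = 2" "\<And>l. l < n \<Longrightarrow> edge_sum E v l + 1 \<le> 2 * v l"
  shows "superharmonic (simple_graph n E) v"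
  using assms by (simp add: superharmonic_def simple_graph_def neighbour_sum_def edge_sum_def)

lemma card_chain: "e \<in> chain n \<Longrightarrow> card e = 2" unfolding chain_def by auto

text \<open>For the Dynkin graphs, take the coefficients of the sum of the positive roots in terms of the
  simple roots (doubled in type D): the Cartan matrix sends this vector to the constant \<open>2\<close>.\<close>

lemma superharmonic_A: "superharmonic (type_A n) (\<lambda>i. (i + 1) * (n - i))"
  unfolding type_A_def
proof (rule superharmonic_simple[OF card_chain])
  let ?v = "\<lambda>i. (i + 1) * (n - i)"
  fix l assume l: "l < n"
  then obtain d where d: "n = Suc (l + d)" using less_natE by blast
  show "edge_sum (chain n) ?v l + 1 \<le> 2 * ?v l"
    using edge_sum_chain[of n ?v l] unfolding d by (cases l; cases d) (simp_all add: algebra_simps)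
qed

lemma superharmonic_D:
  assumes "n \<ge> 4"
  shows "superharmonic (type_D n) (\<lambda>i. if i \<le> n - 3 then 2 * (i + 1) * (2 * n - 2 - i) else n * (n - 1))"
  unfolding type_D_def
proof (rule superharmonic_simple)
  let ?v = "\<lambda>i. if i \<le> n - 3 then 2 * (i + 1) * (2 * n - 2 - i) else n * (n - 1)"
  let ?E = "insert {n - 3, n - 1} (chain (n - 1))"
  obtain m where m: "n = m + 4" using assms le_Suc_ex by (metis add.commute)
  fix l assume l: "l < n"
  have "edge_sum ?E ?v l \<le> edge_sum (chain (n - 1)) ?v l + (if l = n - 3 \<or> l = n - 1 then \<Sum>i\<in>{n - 3, n - 1} - {l}. ?v i else 0)"
    by (rule edge_sum_insert[OF finite_chain])
  then have *: "edge_sum ?E ?v l \<le> (if 0 < l \<and> l < n - 1 then ?v (l - 1) else 0) + (if Suc l < n - 1 then ?v (Suc l) else 0) +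
    (if l = n - 3 \<or> l = n - 1 then \<Sum>i\<in>{n - 3, n - 1} - {l}. ?v i else 0)"
    using edge_sum_chain[of "n - 1" ?v l] by linarith
  \<comment> \<open>The four cases are the vertices before the branching vertex
    \<open>n - 3\<close>, the branching vertex itself, the end \<open>n - 2\<close> of the chain,
    and the extra vertex \<open>n - 1\<close>.\<close>
  consider "l \<le> m" | "l = m + 1" | "l = m + 2" | "l = m + 3" using l m by linarith
  then show "edge_sum ?E ?v l + 1 \<le> 2 * ?v l"
  proof cases
    case 1
    then obtain d where d: "m = l + d" using le_Suc_ex by blast
    show ?thesis using * unfolding m d by (cases l) (simp_all add: algebra_simps)
  next
    case 2
    have "{n - 3, n - 1} - {l} = {n - 1}" using 2 m by auto
    then show ?thesis using * unfolding 2 m by (simp add: algebra_simps)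
  next
    case 3
    then show ?thesis using * unfolding m by (simp add: algebra_simps)
  next
    case 4
    have "{n - 3, n - 1} - {l} = {n - 3}" using 4 m by auto
    then show ?thesis using * unfolding 4 m by (simp add: algebra_simps)
  qed
qed (use assms card_chain in auto)

lemma superharmonic_E:
  assumes "n \<ge> 6" "\<And>l. l < n \<Longrightarrow> (if 0 < l \<and> l < n - 1 then v (l - 1) else 0) + (if Suc l < n - 1 then v (Suc l) else 0) +
    (if l = 2 then v (n - 1) else 0) + (if l = n - 1 then v 2 else 0) + 1 \<le> 2 * v l"
  shows "superharmonic (type_E n) v"
  unfolding type_E_def
proof (rule superharmonic_simple)
  let ?E = "insert {2, n - 1} (chain (n - 1))"
  fix l assume l: "l < n"
  have "edge_sum ?E v l \<le> edge_sum (chain (n - 1)) v l + (if l = 2 \<or> l = n - 1 then \<Sum>i\<in>{2, n - 1} - {l}. v i else 0)"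
    by (rule edge_sum_insert[OF finite_chain])
  moreover have "{2, n - 1} - {2} = {n - 1}" "{2, n - 1} - {n - 1} = {2}" using assms(1) by auto
  ultimately show "edge_sum ?E v l + 1 \<le> 2 * v l"
    using assms(2)[OF l] edge_sum_chain[of "n - 1" v l] assms(1) by (auto split: if_splits)
qed (use assms(1) card_chain in auto)

lemma dynkin_superharmonic:
  assumes "dynkin_ADE \<Delta>" "finite_graph \<Delta>"
  shows "\<exists>v. superharmonic \<Delta> v"
proof -
  \<comment> \<open>In these lists the chain comes first, with the branching vertex at position 2;
    the last entry belongs to the vertex attached there.\<close>
  have E6: "superharmonic (type_E 6) ((!) [16, 30, 42, 30, 16, 22])"
    by (rule superharmonic_E) (auto simp: less_Suc_eq numeral_eq_Suc)
  have E7: "superharmonic (type_E 7) ((!) [34, 66, 96, 75, 52, 27, 49])"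
    by (rule superharmonic_E) (auto simp: less_Suc_eq numeral_eq_Suc)
  have E8: "superharmonic (type_E 8) ((!) [92, 182, 270, 220, 168, 114, 58, 136])"
    by (rule superharmonic_E) (auto simp: less_Suc_eq numeral_eq_Suc)
  show ?thesis using assms(1) superharmonic_iso[OF _ assms(2)] superharmonic_A superharmonic_D E6 E7 E8
    unfolding dynkin_ADE_def by blast
qed

section \<open>From the graph to the double quiver\<close>

lemma adjacency_iff:
  assumes "has_underlying_graph Q \<Delta>"
  shows "(u, w) \<in> adjacency \<Delta> \<longleftrightarrow>
    (\<exists>x\<in>arcs (double_quiver Q). tail (double_quiver Q) x = u \<and> head (double_quiver Q) x = w)"
proof -
  have "(\<exists>x\<in>arcs (double_quiver Q). tail (double_quiver Q) x = u \<and> head (double_quiver Q) x = w) \<longleftrightarrow>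
    (\<exists>e\<in>arcs Q. tail Q e = u \<and> head Q e = w \<or> head Q e = u \<and> tail Q e = w)"
    unfolding double_quiver_def Plus_def by (auto simp: bex_Un)
  also have "\<dots> \<longleftrightarrow> (\<exists>e\<in>edges \<Delta>. ends \<Delta> e = {u, w})"
    using assms unfolding has_underlying_graph_def by (metis doubleton_eq_iff)
  finally show ?thesis by (simp add: adjacency_def)
qed

text \<open>If no arrow ends at \<open>i\<close>, connectedness leaves \<open>i\<close> as the only
  vertex, without edges: type A1. If the second condition fails at \<open>x\<close>, then
  \<open>star x\<close> is the only arrow into the source of \<open>x\<close> and \<open>x\<close>
  the only one into its target, so a walk arriving at these two vertices has never been elsewhere.
  This leaves two vertices and one edge: type A2.\<close>

lemma koszul_quiver_connected:
  fixes Q :: "('v, 'e) pre_digraph"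
  assumes fin: "finite_graph \<Delta>" and con: "connected_graph \<Delta>"
    and A1: "\<not> graph_iso \<Delta> (type_A 1)" and A2: "\<not> graph_iso \<Delta> (type_A 2)"
    and und: "has_underlying_graph Q \<Delta>"
  shows "koszul_quiver Q"
proof -
  let ?D = "double_quiver Q"
  have V: "verts Q = vertices \<Delta>" and E: "arcs Q = edges \<Delta>" and wf: "wf_digraph Q"
    and ends: "\<And>e. e \<in> edges \<Delta> \<Longrightarrow> ends \<Delta> e = {tail Q e, head Q e}"
    using und unfolding has_underlying_graph_def by simp_all
  have conn: "(u, w) \<in> (adjacency \<Delta>)\<^sup>*" if "u \<in> vertices \<Delta>" "w \<in> vertices \<Delta>" for u w
    using con that unfolding connected_graph_def by blast
  have Inl: "Inl e \<in> arcs ?D" "head ?D (Inl e) = head Q e" "tail ?D (Inl e) = tail Q e" if "e \<in> edges \<Delta>" for e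
    using that by (simp_all add: double_quiver_def E InlI)
  have hv: "head Q e \<in> vertices \<Delta>" if "e \<in> edges \<Delta>" for e
    using wf that E V unfolding wf_digraph_def by metis
  interpret fin_quiver F Q
    by (rule fin_quiver.intro) (use wf fin V E in \<open>simp_all add: finite_graph_def\<close>)
  show ?thesis
  proof unfold_locales
    fix i assume i: "i \<in> verts Q"
    show "\<exists>x\<in>arcs ?D. head ?D x = i"
    proof (rule ccontr)
      assume no: "\<not> ?thesis"
      have "u = i" if "u \<in> vertices \<Delta>" for u
        using conn[OF that] i unfolding V
        by (metis adjacency_iff[OF und] no rtranclE)
      then have v: "vertices \<Delta> = {i}" using i V by blast
      have "edges \<Delta> = {}" using Inl(1,2) hv no v by fastforce
      then have "graph_iso \<Delta> (type_A 1)"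
        unfolding graph_iso_def using v by (intro exI[of _ "\<lambda>_. 0"]) (auto simp: type_A_def simple_graph_def chain_def bij_betw_def)
      then show False using A1 by blast
    qed
  next
    fix x assume x: "x \<in> arcs ?D"
    show "\<exists>y\<in>arcs ?D. head ?D y = tail ?D x \<and> y \<noteq> star x \<or> head ?D y = head ?D x \<and> y \<noteq> x"
    proof (rule ccontr)
      assume no: "\<not> ?thesis"
      define a b where "a = tail ?D x" and "b = head ?D x"
      have ya: "y = star x" if "y \<in> arcs ?D" "head ?D y = a" for y using no that a_def by blast
      have yb: "y = x" if "y \<in> arcs ?D" "head ?D y = b" for y using no that b_def by blast
      \<comment> \<open>If \<open>x\<close> were a loop, it would itself be an arrow ending at its
        source, and so equal to \<open>star x\<close>.\<close>
      have ab: "a \<noteq> b" using ya[OF x] unfolding a_def b_def by (metis star_neq(2))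
      have bV: "b \<in> vertices \<Delta>" "a \<in> vertices \<Delta>" using x tgt_src_verts V unfolding a_def b_def by simp_all
      have "u \<in> {a, b}" if "u \<in> vertices \<Delta>" for u
        using conn[OF that bV(1)]
      proof (induction rule: converse_rtrancl_induct)
        case (step p q)
        then obtain y where y: "y \<in> arcs ?D" "tail ?D y = p" "head ?D y = q" using adjacency_iff[OF und] by blast
        then have "y = x \<or> y = star x" using step(3) ya yb by blast
        then show ?case using y(2) unfolding a_def b_def by auto
      qed simp
      then have v: "vertices \<Delta> = {a, b}" using bV by blast
      obtain e where e: "x = Inl e \<or> x = Inr e" by (cases x) auto
      have eE: "e \<in> edges \<Delta>" using x e E by (auto simp: double_quiver_def)
      have "f = e" if "f \<in> edges \<Delta>" for f
      proof -
        have "Inl f = x \<or> Inl f = star x" using Inl[OF that] hv[OF that] ya yb v by fastforce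
        then show ?thesis using e by auto
      qed
      then have ed: "edges \<Delta> = {e}" using eE by blast
      have en: "ends \<Delta> e = {a, b}" using e unfolding a_def b_def ends[OF eE] by (elim disjE) (simp_all add: double_quiver_def insert_commute)
      have ch: "chain 2 = {{0, 1}}" unfolding chain_def by auto
      have "bij_betw (\<lambda>v. if v = a then 0 else 1 :: nat) {a, b} {..<2}"
        unfolding bij_betw_def using ab by (auto simp: inj_on_def lessThan_nat_numeral lessThan_Suc)
      moreover have "bij_betw (\<lambda>_. {0, 1 :: nat}) {e} {{0, 1}}" by (simp add: bij_betw_def)
      ultimately have "graph_iso \<Delta> (type_A 2)"
        unfolding graph_iso_def type_A_def simple_graph_def ch
        using v ed en ab by (intro exI[of _ "\<lambda>v. if v = a then 0 else 1 :: nat"] exI[of _ "\<lambda>_. {0, 1 :: nat}"]) auto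
      then show False using A2 by blast
    qed
  qed
qed

text \<open>As there are no loops, for each edge at \<open>l\<close> exactly one of the arrow and
  its reverse ends at \<open>l\<close>, and it starts at the other end of the edge.\<close>

lemma neighbour_sum_quiver:
  assumes und: "has_underlying_graph Q \<Delta>" and c: "\<And>e. e \<in> edges \<Delta> \<Longrightarrow> card (ends \<Delta> e) = 2"
  shows "(\<Sum>y | y \<in> arcs (double_quiver Q) \<and> head (double_quiver Q) y = l. v (tail (double_quiver Q) y)) = neighbour_sum \<Delta> v l"
proof -
  have E: "arcs Q = edges \<Delta>" and ends: "\<And>e. e \<in> edges \<Delta> \<Longrightarrow> ends \<Delta> e = {tail Q e, head Q e}"
    using und unfolding has_underlying_graph_def by simp_all
  have ne: "tail Q e \<noteq> head Q e" "head Q e \<noteq> tail Q e" if "e \<in> edges \<Delta>" for e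
    using c[OF that] ends[OF that] by auto
  show ?thesis unfolding neighbour_sum_def
  proof (rule sum.reindex_bij_witness[of _ "\<lambda>e. if head Q e = l then Inl e else Inr e" "case_sum id id"])
    fix y assume "y \<in> {y \<in> arcs (double_quiver Q). head (double_quiver Q) y = l}"
    then have y: "y \<in> arcs (double_quiver Q)" "head (double_quiver Q) y = l" by simp_all
    define e where "e = case_sum id id y"
    have e: "e \<in> edges \<Delta>" using y(1) unfolding e_def E[symmetric] by (cases y) (auto simp: double_quiver_def)
    show "(if head Q (case_sum id id y) = l then Inl (case_sum id id y) else Inr (case_sum id id y)) = y"
      using y ne E by (cases y) (auto simp: double_quiver_def)
    show "case_sum id id y \<in> {e \<in> edges \<Delta>. l \<in> ends \<Delta> e}"
      using y E ends by (cases y) (auto simp: double_quiver_def)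
    have "ends \<Delta> e - {l} = {tail (double_quiver Q) y}"
      using y ends[OF e] ne[OF e] unfolding e_def by (cases y) (auto simp: double_quiver_def)
    then show "(\<Sum>i\<in>ends \<Delta> (case_sum id id y) - {l}. v i) = v (tail (double_quiver Q) y)" unfolding e_def by simp
  next
    fix e assume "e \<in> {e \<in> edges \<Delta>. l \<in> ends \<Delta> e}"
    then have e: "e \<in> edges \<Delta>" "l \<in> {tail Q e, head Q e}" using ends by auto
    show "case_sum id id (if head Q e = l then Inl e else Inr e) = e" by simp
    show "(if head Q e = l then Inl e else Inr e) \<in> {y \<in> arcs (double_quiver Q). head (double_quiver Q) y = l}"
      using e E by (auto simp: double_quiver_def)
  qed
qed

theorem theorem1p3:
  fixes F :: "'f::field itself"
    and \<Delta> :: "('v, 'e) mgraph"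
    and Q :: "('v, 'e) pre_digraph"
  assumes "finite_graph \<Delta>" and "connected_graph \<Delta>"
    and "\<not> graph_iso \<Delta> (type_A 1)" and "\<not> graph_iso \<Delta> (type_A 2)"
    and "has_underlying_graph Q \<Delta>"
  shows "(\<forall>p\<le>2. bimodule_iso (preprojective F Q) (HK F Q p) (koszul_homology F Q (2 - p))) \<and>
    bimodule_iso (preprojective F Q) (HK F Q 2) (regular_bimodule (preprojective F Q)) \<and>
    carrier (HK F Q 1) = {\<zero>\<^bsub>HK F Q 1\<^esub>} \<and>
    bimodule_iso (preprojective F Q) (HK F Q 0) (koszul_homology F Q 2) \<and>
    (dynkin_ADE \<Delta> \<longrightarrow> carrier (koszul_homology F Q 2) \<noteq> {\<zero>\<^bsub>koszul_homology F Q 2\<^esub>})"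
proof -
  interpret koszul_quiver F Q by (rule koszul_quiver_connected[OF assms])
  have "bimodule_iso A (HK F Q p) (koszul_homology F Q (2 - p))" if "p \<le> 2" for p
  proof -
    have "p = 0 \<or> p = Suc 0 \<or> p = 2" using that by linarith
    then show ?thesis using HK_iso by (auto simp: numeral_2_eq_2)
  qed
  moreover have "carrier (HK F Q 1) = {\<zero>\<^bsub>HK F Q 1\<^esub>}" using HK1_trivial[OF Zk_Bk1] by simp
  moreover have "carrier (koszul_homology F Q 2) \<noteq> {\<zero>\<^bsub>koszul_homology F Q 2\<^esub>}" if dy: "dynkin_ADE \<Delta>"
  proof -
    obtain v where v: "superharmonic \<Delta> v" using dynkin_superharmonic[OF dy assms(1)] by blast
    have c: "card (ends \<Delta> e) = 2" if "e \<in> edges \<Delta>" for e using v that unfolding superharmonic_def by blast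
    have V: "verts Q = vertices \<Delta>" using assms(5) unfolding has_underlying_graph_def by simp
    have "\<exists>z\<in>Zk 2. z \<noteq> \<zero>\<^bsub>K 2\<^esub>"
    proof (rule weight_cycle)
      show "verts Q \<noteq> {}" using assms(2) V unfolding connected_graph_def by simp
      show "(\<Sum>y | y \<in> QA \<and> tgt y = l. v (src y)) + 1 \<le> 2 * v l" if "l \<in> verts Q" for l
        using neighbour_sum_quiver[OF assms(5) c, of v l] v that V unfolding superharmonic_def by simp
    qed
    then show ?thesis using homology2_nontrivial by blast
  qed
  ultimately show ?thesis using HK2_iso HK_iso(1) by simp
qed

end
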